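(* Let $Q$ be a commutative ring, let $B$ be an $A_\infty$-algebra over $Q$, and let $\epsilon_1\colon A\to B$ be a quasi-isomorphism of complexes of $Q$-modules (where $B$ has differential $\mu^B_1$) with $A$ a bounded below complex of projective $Q$-modules. (1) There exist an $A_\infty$-algebra structure $(\mu^A_k)_{k\geq 1}$ on $A$ (with $\mu^A_1=\partial^A$) and a quasi-isomorphism of $A_\infty$-algebras $\epsilon=(\epsilon_k)_{k\ge 1}\colon A\to B$ extending $\epsilon_1$. (2) Suppose furthermore that $B$ is strictly unital with strict unit $1_B$, and that $A$ splits as $A=Q\oplus\bar A$ as graded modules, with $\epsilon_1(1_A)=1_B$ and $\partial^A(1_A)=0$, where $1_A$ is a free generator of the summand $Q$ of $A$. Then the $A_\infty$-algebra structure on $A$ in (1) can be chosen to be strictly unital with strict unit $1_A$. (3) The $A_\infty$-algebra structure is unique up to $A_\infty$-homotopy. That is: if $(\hat\mu_k)_{k\ge1}$ and $(\tilde\mu_k)_{k\ge1}$ are two $A_\infty$-algebra structures on $A$ with $\hat\mu_1=\tilde\mu_1=\partial^A$, each admitting a quasi-isomorphism of $A_\infty$-algebras to $B$ extending $\epsilon_1$, then there is a homotopy equivalence of $A_\infty$-algebras $(A,\hat\mu)\to(A,\tilde\mu)$. Likewise, in the situation of (2), if both structures are strictly unital with strict unit $1_A$ and both quasi-isomorphisms to $B$ are morphisms of strictly unital $A_\infty$-algebras, then there is a homotopy equivalence of strictly unital $A_\infty$-algebras $(A,\hat\mu)\to(A,\tilde\mu)$.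
   Context: All modules, complexes, maps, tensor products and Hom are over $Q$. Graded means $\mathbb Z$-graded with lower indices; differentials have degree $-1$. Tensor products of maps follow the Koszul sign rule $(f\otimes g)(m\otimes n)=(-1)^{|g||m|}f(m)\otimes g(n)$. $\mathbb N$ denotes the positive integers; for $\alpha=(\alpha_1,\dots,\alpha_p)\in\mathbb N^p$ put $|\alpha|=\alpha_1+\dots+\alpha_p$, and for a family of maps $f_k$ defined on $k$-fold tensor powers put $f^{\otimes\alpha}=f_{\alpha_1}\otimes\cdots\otimes f_{\alpha_p}$; $\mathbb N^0=\{()\}$ and $f^{\otimes()}=\mathrm{id}_Q$. Put $t_1(\alpha)=\sum_{\ell=1}^p(p-\ell)(\alpha_\ell-1)$. An $A_\infty$-algebra is a graded module $A$ with maps $\mu^A_k\colon A^{\otimes k}\to A$ of degree $k-2$, $k\ge1$, such that for all $k\ge1$ $$\sum_{u+v+w=k,\ u,w\ge0,\ v\ge1}(-1)^{u+vw}\mu^A_{u+1+w}(\mathrm{id}^{\otimes u}\otimes\mu^A_v\otimes\mathrm{id}^{\otimes w})=0.$$ In particular $(A,\mu^A_1)$ is a complex, and we write $\partial^A=\mu^A_1$; an $A_\infty$-structure on a complex is required to have $\mu_1$ equal to the given differential. A morphism of $A_\infty$-algebras $\phi\colon A\to B$ consists of maps $\phi_k\colon A^{\otimes k}\to B$ of degree $k-1$, $k\ge1$, with $$\sum_{u+v+w=k,\ u,w\ge0,\ v\ge1}(-1)^{u+vw}\phi_{u+1+w}(\mathrm{id}^{\otimes u}\otimes\mu^A_v\otimes\mathrm{id}^{\otimes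 w})=\sum_{p=1}^k\sum_{\alpha\in\mathbb N^p,\,|\alpha|=k}(-1)^{t_1(\alpha)}\mu^B_p\,\phi^{\otimes\alpha}.$$ It is a quasi-isomorphism if $\phi_1$ is a quasi-isomorphism of complexes. Composition: $(\psi\circ\phi)_k=\sum_{p=1}^k\sum_{\alpha\in\mathbb N^p,|\alpha|=k}(-1)^{t_1(\alpha)}\psi_p\phi^{\otimes\alpha}$. The identity morphism has $(\mathrm{id}_A)_1=\mathrm{id}_A$ and $(\mathrm{id}_A)_k=0$ for $k\ge2$. Morphisms $\phi,\psi\colon A\to B$ are homotopy equivalent, $\phi\simeq\psi$, if there is an $A_\infty$-homotopy, i.e. maps $\sigma_k\colon A^{\otimes k}\to B$ of degree $k$, $k\ge1$, with $$\phi_k-\psi_k=\sum_{u+v+w=k}(-1)^{u+vw}\sigma_{u+1+w}(\mathrm{id}^{\otimes u}\otimes\mu^A_v\otimes\mathrm{id}^{\otimes w})+\sum_{u+v+w=k}\ \sum_{p=0}^u\sum_{\alpha\in\mathbb N^p,|\alpha|=u}\ \sum_{q=0}^w\sum_{\beta\in\mathbb N^q,|\beta|=w}(-1)^{u+vq+t_2(\alpha,\beta)}\mu^B_{p+1+q}(\phi^{\otimes\alpha}\otimes\sigma_v\otimes\psi^{\otimes\beta}),$$ where $u,w\ge0$, $v\ge1$ and $t_2(\alpha,\beta)=t_1(\alpha)+t_1(\beta)+(u-p)(q+1)$. A morphism $\phi\colon A\to B$ is a homotopy equivalence if there is a morphism $\psi\colon B\to A$ with $\psi\phi\simeq\mathrm{id}_A$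 and $\phi\psi\simeq\mathrm{id}_B$. An $A_\infty$-algebra $A$ is strictly unital with strict unit $1_A=\eta^A(1_Q)$ if there is a degree $0$ map $\eta^A\colon Q\to A$ with $\mu^A_2(\mathrm{id}\otimes\eta^A)=\mathrm{id}_A=\mu^A_2(\eta^A\otimes\mathrm{id})$ and $\mu^A_k(\mathrm{id}^{\otimes u}\otimes\eta^A\otimes\mathrm{id}^{\otimes w})=0$ for $k\ne2$, $u+w=k-1$. A morphism $\phi$ of strictly unital $A_\infty$-algebras must also satisfy $\phi_1\eta^A=\eta^B$ and $\phi_k(\mathrm{id}^{\otimes u}\otimes\eta^A\otimes\mathrm{id}^{\otimes w})=0$ for $k\ne1$, $u+w=k-1$; a homotopy of such morphisms must also satisfy $\sigma_k(\mathrm{id}^{\otimes u}\otimes\eta^A\otimes\mathrm{id}^{\otimes w})=0$ for all $k\ge 1$, $u+w=k-1$. A homotopy equivalence of strictly unital $A_\infty$-algebras is a homotopy equivalence in which all morphisms and homotopies are strictly unital in this sense. *)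

theory Defs
  imports Main "HOL-Library.Function_Algebras"
begin

section \<open>Modules\<close>

text \<open>
  The library's locale \<open>module\<close> works over the class \<open>comm_ring_1\<close>, which demands \<open>0 \<noteq> 1\<close>.
  The sort \<open>{comm_ring, monoid_mult}\<close> is that of arbitrary commutative rings with one, the zero
  ring included, so the few notions needed are stated for it.
\<close>

definition qmodule :: "('q::{comm_ring,monoid_mult} \<Rightarrow> 'a::ab_group_add \<Rightarrow> 'a) \<Rightarrow> bool" where
  "qmodule s \<longleftrightarrow>
     (\<forall>a x y. s a (x + y) = s a x + s a y) \<and>
     (\<forall>a b x. s (a + b) x = s a x + s b x) \<and>
     (\<forall>a b x. s a (s b x) = s (a * b) x) \<and>
     (\<forall>x. s 1 x = x)"

definition submodule :: "('q::{comm_ring,monoid_mult} \<Rightarrow> 'a::ab_group_add \<Rightarrow> 'a) \<Rightarrow> 'a set \<Rightarrow> bool" where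
  "submodule s M \<longleftrightarrow>
     0 \<in> M \<and> (\<forall>x\<in>M. \<forall>y\<in>M. x + y \<in> M) \<and> (\<forall>a. \<forall>x\<in>M. s a x \<in> M)"

definition linear_on ::
  "('q::{comm_ring,monoid_mult} \<Rightarrow> 'a::ab_group_add \<Rightarrow> 'a) \<Rightarrow> 'a set \<Rightarrow>
   ('q \<Rightarrow> 'b::ab_group_add \<Rightarrow> 'b) \<Rightarrow> 'b set \<Rightarrow> ('a \<Rightarrow> 'b) \<Rightarrow> bool" where
  "linear_on s M t N f \<longleftrightarrow>
     (\<forall>x\<in>M. f x \<in> N) \<and>
     (\<forall>x\<in>M. \<forall>y\<in>M. f (x + y) = f x + f y) \<and>
     (\<forall>a. \<forall>x\<in>M. f (s a x) = t a (f x))"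

definition free_smul :: "'q::{comm_ring,monoid_mult} \<Rightarrow> ('i \<Rightarrow> 'q) \<Rightarrow> 'i \<Rightarrow> 'q" where
  "free_smul a c = (\<lambda>i. a * c i)"

definition free_module :: "'i set \<Rightarrow> ('i \<Rightarrow> 'q::{comm_ring,monoid_mult}) set" where
  "free_module I = {c. finite {i. c i \<noteq> 0} \<and> {i. c i \<noteq> 0} \<subseteq> I}"

text \<open>
  Projective modules are the direct summands of free modules.  Bases of free modules can be taken
  in the type of the module itself, because every module is a quotient of the free module on its
  underlying set, and a projective module is a direct summand of any module it is a quotient of.
\<close>

definition projective :: "('q::{comm_ring,monoid_mult} \<Rightarrow> 'a::ab_group_add \<Rightarrow> 'a) \<Rightarrow> 'a set \<Rightarrow> bool" where
  "projective s M \<longleftrightarrow>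
     (\<exists>(I::'a set) i r.
        linear_on s M free_smul (free_module I) i \<and>
        linear_on free_smul (free_module I) s M r \<and>
        (\<forall>x\<in>M. r (i x) = x))"


section \<open>Graded modules and complexes\<close>

text \<open>
  A graded module is a family of modules indexed by the integers.  The modules are given as
  submodules of one ambient module (for a family of abstract modules, take their direct sum); the
  ambient module only provides the operations, and the pieces may overlap.  A homogeneous element
  is accordingly a pair \<open>(n, x)\<close> of a degree \<open>n\<close> and an element \<open>x\<close> of the \<open>n\<close>-th piece.
\<close>

record ('q, 'a) graded =
  smul :: "'q \<Rightarrow> 'a \<Rightarrow> 'a"
  piece :: "int \<Rightarrow> 'a set"

definition graded_module :: "('q::{comm_ring,monoid_mult}, 'a::ab_group_add) graded \<Rightarrow> bool" where
  "graded_module A \<longleftrightarrow> qmodule (smul A) \<and> (\<forall>n. submodule (smul A) (piece A n))"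

definition bounded_below :: "('q, 'a::ab_group_add) graded \<Rightarrow> bool" where
  "bounded_below A \<longleftrightarrow> (\<exists>m. \<forall>n<m. piece A n = {0})"

definition graded_linear ::
  "('q::{comm_ring,monoid_mult}, 'a::ab_group_add) graded \<Rightarrow> ('q, 'b::ab_group_add) graded \<Rightarrow>
   int \<Rightarrow> (int \<Rightarrow> 'a \<Rightarrow> 'b) \<Rightarrow> bool" where
  "graded_linear A B e f \<longleftrightarrow>
     (\<forall>n. linear_on (smul A) (piece A n) (smul B) (piece B (n + e)) (f n))"

definition chain_complex ::
  "('q::{comm_ring,monoid_mult}, 'a::ab_group_add) graded \<Rightarrow> (int \<Rightarrow> 'a \<Rightarrow> 'a) \<Rightarrow> bool" where
  "chain_complex A d \<longleftrightarrow>
     graded_module A \<and> graded_linear A A (-1) d \<and> (\<forall>n. \<forall>x\<in>piece A n. d (n - 1) (d n x) = 0)"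

definition cycles :: "('q, 'a::ab_group_add) graded \<Rightarrow> (int \<Rightarrow> 'a \<Rightarrow> 'a) \<Rightarrow> int \<Rightarrow> 'a set" where
  "cycles A d n = {x \<in> piece A n. d n x = 0}"

definition boundaries :: "('q, 'a) graded \<Rightarrow> (int \<Rightarrow> 'a \<Rightarrow> 'a) \<Rightarrow> int \<Rightarrow> 'a set" where
  "boundaries A d n = d (n + 1) ` piece A (n + 1)"

definition homologous ::
  "('q, 'a::ab_group_add) graded \<Rightarrow> (int \<Rightarrow> 'a \<Rightarrow> 'a) \<Rightarrow> int \<Rightarrow> ('a \<times> 'a) set" where
  "homologous A d n =
     {(x, y). x \<in> cycles A d n \<and> y \<in> cycles A d n \<and> x - y \<in> boundaries A d n}"

definition homology ::
  "('q, 'a::ab_group_add) graded \<Rightarrow> (int \<Rightarrow> 'a \<Rightarrow> 'a) \<Rightarrow> int \<Rightarrow> 'a set set" where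
  "homology A d n = cycles A d n // homologous A d n"

definition homology_map ::
  "('q, 'b::ab_group_add) graded \<Rightarrow> (int \<Rightarrow> 'b \<Rightarrow> 'b) \<Rightarrow> (int \<Rightarrow> 'a \<Rightarrow> 'b) \<Rightarrow> int \<Rightarrow>
   'a set \<Rightarrow> 'b set" where
  "homology_map B d f n C = (\<Union>x\<in>C. homologous B d n `` {f n x})"

definition chain_map ::
  "('q::{comm_ring,monoid_mult}, 'a::ab_group_add) graded \<Rightarrow> (int \<Rightarrow> 'a \<Rightarrow> 'a) \<Rightarrow>
   ('q, 'b::ab_group_add) graded \<Rightarrow> (int \<Rightarrow> 'b \<Rightarrow> 'b) \<Rightarrow> (int \<Rightarrow> 'a \<Rightarrow> 'b) \<Rightarrow> bool" where
  "chain_map A dA B dB f \<longleftrightarrow>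
     graded_linear A B 0 f \<and> (\<forall>n. \<forall>x\<in>piece A n. f (n - 1) (dA n x) = dB n (f n x))"

definition quasi_iso ::
  "('q::{comm_ring,monoid_mult}, 'a::ab_group_add) graded \<Rightarrow> (int \<Rightarrow> 'a \<Rightarrow> 'a) \<Rightarrow>
   ('q, 'b::ab_group_add) graded \<Rightarrow> (int \<Rightarrow> 'b \<Rightarrow> 'b) \<Rightarrow> (int \<Rightarrow> 'a \<Rightarrow> 'b) \<Rightarrow> bool" where
  "quasi_iso A dA B dB f \<longleftrightarrow>
     chain_map A dA B dB f \<and>
     (\<forall>n. bij_betw (homology_map B dB f n) (homology A dA n) (homology B dB n))"


section \<open>Maps on tensor powers\<close>

text \<open>
  By the universal property of the tensor product, a map of degree \<open>e\<close> from the \<open>k\<close>-th tensor power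
  of \<open>A\<close> to \<open>B\<close> is a family of multilinear maps
  \<open>A n\<^sub>1 \<times> \<dots> \<times> A n\<^sub>k \<rightarrow> B (n\<^sub>1 + \<dots> + n\<^sub>k + e)\<close>.  It is represented by a function on lists of
  homogeneous elements, the list \<open>[(n\<^sub>1, x\<^sub>1), \<dots>, (n\<^sub>k, x\<^sub>k)]\<close> standing for the elementary tensor
  \<open>x\<^sub>1 \<otimes> \<dots> \<otimes> x\<^sub>k\<close>; its values on other lists are irrelevant.
\<close>

definition tensors :: "('q, 'a) graded \<Rightarrow> nat \<Rightarrow> (int \<times> 'a) list set" where
  "tensors A k = {xs. length xs = k \<and> (\<forall>(n, x)\<in>set xs. x \<in> piece A n)}"

definition degree :: "(int \<times> 'a) list \<Rightarrow> int" where
  "degree xs = sum_list (map fst xs)"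

definition tensor_map ::
  "('q::{comm_ring,monoid_mult}, 'a::ab_group_add) graded \<Rightarrow> ('q, 'b::ab_group_add) graded \<Rightarrow>
   nat \<Rightarrow> int \<Rightarrow> ((int \<times> 'a) list \<Rightarrow> 'b) \<Rightarrow> bool" where
  "tensor_map A B k e f \<longleftrightarrow>
     (\<forall>xs\<in>tensors A k. f xs \<in> piece B (degree xs + e)) \<and>
     (\<forall>us n x y ws. us @ (n, x) # ws \<in> tensors A k \<longrightarrow> y \<in> piece A n \<longrightarrow>
        f (us @ (n, x + y) # ws) = f (us @ (n, x) # ws) + f (us @ (n, y) # ws)) \<and>
     (\<forall>us n a x ws. us @ (n, x) # ws \<in> tensors A k \<longrightarrow>
        f (us @ (n, smul A a x) # ws) = smul B a (f (us @ (n, x) # ws)))"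

definition sg :: "int \<Rightarrow> 'a::ab_group_add \<Rightarrow> 'a" where
  "sg n x = (if even n then x else - x)"

text \<open>
  A triple \<open>(k, e, f)\<close> is a map \<open>f\<close> of degree \<open>e\<close> on the \<open>k\<close>-th tensor power, and a list of such
  triples is the tensor product of its entries.  The exponent is the Koszul rule
  \<open>(f \<otimes> g) (m \<otimes> n) = (-1)^(|g||m|) f m \<otimes> g n\<close>, with \<open>g\<close> the tensor product of all later factors.
\<close>

type_synonym ('a, 'b) factor = "nat \<times> int \<times> ((int \<times> 'a) list \<Rightarrow> 'b)"

fun koszul_exponent :: "('a, 'b) factor list \<Rightarrow> (int \<times> 'a) list \<Rightarrow> int" where
  "koszul_exponent [] xs = 0"
| "koszul_exponent ((k, e, f) # fs) xs =
     sum_list (map (\<lambda>(k', e', f'). e') fs) * degree (take k xs) + koszul_exponent fs (drop k xs)"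

fun tensor_values :: "('a, 'b) factor list \<Rightarrow> (int \<times> 'a) list \<Rightarrow> (int \<times> 'b) list" where
  "tensor_values [] xs = []"
| "tensor_values ((k, e, f) # fs) xs =
     (degree (take k xs) + e, f (take k xs)) # tensor_values fs (drop k xs)"

definition comp_tensor ::
  "((int \<times> 'b) list \<Rightarrow> 'c::ab_group_add) \<Rightarrow> ('a, 'b) factor list \<Rightarrow> (int \<times> 'a) list \<Rightarrow> 'c" where
  "comp_tensor g fs xs = sg (koszul_exponent fs xs) (g (tensor_values fs xs))"

definition ids :: "nat \<Rightarrow> ('a, 'a) factor list" where
  "ids u = replicate u (1, 0, \<lambda>xs. snd (hd xs))"

text \<open>Here \<open>f\<close> is a family with \<open>f k\<close> of degree \<open>k - 1\<close>, as for morphisms.\<close>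

definition tensor_family :: "(nat \<Rightarrow> (int \<times> 'a) list \<Rightarrow> 'b) \<Rightarrow> nat list \<Rightarrow> ('a, 'b) factor list" where
  "tensor_family f \<alpha> = map (\<lambda>k. (k, int k - 1, f k)) \<alpha>"

definition compositions :: "nat \<Rightarrow> nat \<Rightarrow> nat list set" where
  "compositions p k = {\<alpha>. length \<alpha> = p \<and> (\<forall>a\<in>set \<alpha>. 1 \<le> a) \<and> sum_list \<alpha> = k}"

definition splits :: "nat \<Rightarrow> (nat \<times> nat \<times> nat) set" where
  "splits k = {(u, v, w). u + v + w = k \<and> 1 \<le> v}"

text \<open>List positions start at \<open>0\<close>, so that \<open>i = l - 1\<close>.\<close>

definition t1 :: "nat list \<Rightarrow> int" where
  "t1 \<alpha> = (\<Sum>i<length \<alpha>. (int (length \<alpha>) - int (i + 1)) * (int (\<alpha> ! i) - 1))"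

definition t2 :: "nat list \<Rightarrow> nat list \<Rightarrow> int" where
  "t2 \<alpha> \<beta> =
     t1 \<alpha> + t1 \<beta> + (int (sum_list \<alpha>) - int (length \<alpha>)) * (int (length \<beta>) + 1)"


section \<open>\<open>A\<^sub>\<infinity>\<close>-algebras, morphisms and homotopies\<close>

type_synonym ('a, 'b) family = "nat \<Rightarrow> (int \<times> 'a) list \<Rightarrow> 'b"

definition linear_part :: "('a, 'b) family \<Rightarrow> int \<Rightarrow> 'a \<Rightarrow> 'b" where
  "linear_part f n x = f 1 [(n, x)]"

definition extends :: "('q, 'a) graded \<Rightarrow> ('a, 'b) family \<Rightarrow> (int \<Rightarrow> 'a \<Rightarrow> 'b) \<Rightarrow> bool" where
  "extends A f g \<longleftrightarrow> (\<forall>n. \<forall>x\<in>piece A n. linear_part f n x = g n x)"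

definition ainf_algebra ::
  "('q::{comm_ring,monoid_mult}, 'a::ab_group_add) graded \<Rightarrow> ('a, 'a) family \<Rightarrow> bool" where
  "ainf_algebra A \<mu> \<longleftrightarrow>
     graded_module A \<and>
     (\<forall>k\<ge>1. tensor_map A A k (int k - 2) (\<mu> k)) \<and>
     (\<forall>k\<ge>1. \<forall>xs\<in>tensors A k.
        (\<Sum>(u, v, w)\<in>splits k. sg (int (u + v * w))
           (comp_tensor (\<mu> (u + 1 + w)) (ids u @ [(v, int v - 2, \<mu> v)] @ ids w) xs)) = 0)"

definition ainf_morphism ::
  "('q::{comm_ring,monoid_mult}, 'a::ab_group_add) graded \<Rightarrow> ('a, 'a) family \<Rightarrow>
   ('q, 'b::ab_group_add) graded \<Rightarrow> ('b, 'b) family \<Rightarrow> ('a, 'b) family \<Rightarrow> bool" where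
  "ainf_morphism A \<mu> B \<nu> \<phi> \<longleftrightarrow>
     (\<forall>k\<ge>1. tensor_map A B k (int k - 1) (\<phi> k)) \<and>
     (\<forall>k\<ge>1. \<forall>xs\<in>tensors A k.
        (\<Sum>(u, v, w)\<in>splits k. sg (int (u + v * w))
           (comp_tensor (\<phi> (u + 1 + w)) (ids u @ [(v, int v - 2, \<mu> v)] @ ids w) xs)) =
        (\<Sum>p=1..k. \<Sum>\<alpha>\<in>compositions p k. sg (t1 \<alpha>)
           (comp_tensor (\<nu> p) (tensor_family \<phi> \<alpha>) xs)))"

definition ainf_quasi_iso ::
  "('q::{comm_ring,monoid_mult}, 'a::ab_group_add) graded \<Rightarrow> ('a, 'a) family \<Rightarrow>
   ('q, 'b::ab_group_add) graded \<Rightarrow> ('b, 'b) family \<Rightarrow> ('a, 'b) family \<Rightarrow> bool" where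
  "ainf_quasi_iso A \<mu> B \<nu> \<phi> \<longleftrightarrow>
     ainf_morphism A \<mu> B \<nu> \<phi> \<and> quasi_iso A (linear_part \<mu>) B (linear_part \<nu>) (linear_part \<phi>)"

definition ainf_comp ::
  "('b, 'c::ab_group_add) family \<Rightarrow> ('a, 'b) family \<Rightarrow> ('a, 'c) family" where
  "ainf_comp \<psi> \<phi> k xs =
     (\<Sum>p=1..k. \<Sum>\<alpha>\<in>compositions p k. sg (t1 \<alpha>) (comp_tensor (\<psi> p) (tensor_family \<phi> \<alpha>) xs))"

definition ainf_id :: "('a, 'a::ab_group_add) family" where
  "ainf_id k xs = (if k = 1 then snd (hd xs) else 0)"

definition ainf_homotopy ::
  "('q::{comm_ring,monoid_mult}, 'a::ab_group_add) graded \<Rightarrow> ('a, 'a) family \<Rightarrow>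
   ('q, 'b::ab_group_add) graded \<Rightarrow> ('b, 'b) family \<Rightarrow>
   ('a, 'b) family \<Rightarrow> ('a, 'b) family \<Rightarrow> ('a, 'b) family \<Rightarrow> bool" where
  "ainf_homotopy A \<mu> B \<nu> \<phi> \<psi> \<sigma> \<longleftrightarrow>
     (\<forall>k\<ge>1. tensor_map A B k (int k) (\<sigma> k)) \<and>
     (\<forall>k\<ge>1. \<forall>xs\<in>tensors A k.
        \<phi> k xs - \<psi> k xs =
        (\<Sum>(u, v, w)\<in>splits k. sg (int (u + v * w))
           (comp_tensor (\<sigma> (u + 1 + w)) (ids u @ [(v, int v - 2, \<mu> v)] @ ids w) xs)) +
        (\<Sum>(u, v, w)\<in>splits k.
           \<Sum>p=0..u. \<Sum>\<alpha>\<in>compositions p u. \<Sum>q=0..w. \<Sum>\<beta>\<in>compositions q w.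
             sg (int (u + v * q) + t2 \<alpha> \<beta>)
               (comp_tensor (\<nu> (p + 1 + q))
                  (tensor_family \<phi> \<alpha> @ [(v, int v, \<sigma> v)] @ tensor_family \<psi> \<beta>) xs)))"

definition ainf_homotopy_equivalence ::
  "('q::{comm_ring,monoid_mult}, 'a::ab_group_add) graded \<Rightarrow> ('a, 'a) family \<Rightarrow>
   ('q, 'b::ab_group_add) graded \<Rightarrow> ('b, 'b) family \<Rightarrow> ('a, 'b) family \<Rightarrow> bool" where
  "ainf_homotopy_equivalence A \<mu> B \<nu> \<phi> \<longleftrightarrow>
     ainf_morphism A \<mu> B \<nu> \<phi> \<and>
     (\<exists>\<psi>. ainf_morphism B \<nu> A \<mu> \<psi> \<and>
        (\<exists>\<sigma>. ainf_homotopy A \<mu> A \<mu> (ainf_comp \<psi> \<phi>) ainf_id \<sigma>) \<and>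
        (\<exists>\<tau>. ainf_homotopy B \<nu> B \<nu> (ainf_comp \<phi> \<psi>) ainf_id \<tau>))"


section \<open>Strict units\<close>

text \<open>
  A degree \<open>0\<close> map from the ground ring to \<open>A\<close> is given by the image \<open>e\<close> of \<open>1\<close> in degree \<open>0\<close>.
  Since it has degree \<open>0\<close>, inserting it creates no Koszul sign.
\<close>

definition vanishes_on_unit ::
  "('q, 'a) graded \<Rightarrow> 'a \<Rightarrow> nat \<Rightarrow> ((int \<times> 'a) list \<Rightarrow> 'b::ab_group_add) \<Rightarrow> bool" where
  "vanishes_on_unit A e k f \<longleftrightarrow>
     (\<forall>u w. u + w + 1 = k \<longrightarrow>
        (\<forall>us\<in>tensors A u. \<forall>ws\<in>tensors A w. f (us @ (0, e) # ws) = 0))"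

definition strict_unit ::
  "('q, 'a::ab_group_add) graded \<Rightarrow> ('a, 'a) family \<Rightarrow> 'a \<Rightarrow> bool" where
  "strict_unit A \<mu> e \<longleftrightarrow>
     e \<in> piece A 0 \<and>
     (\<forall>n. \<forall>x\<in>piece A n. \<mu> 2 [(n, x), (0, e)] = x \<and> \<mu> 2 [(0, e), (n, x)] = x) \<and>
     (\<forall>k\<ge>1. k \<noteq> 2 \<longrightarrow> vanishes_on_unit A e k (\<mu> k))"

definition unital_morphism ::
  "('q::{comm_ring,monoid_mult}, 'a::ab_group_add) graded \<Rightarrow> ('a, 'a) family \<Rightarrow> 'a \<Rightarrow>
   ('q, 'b::ab_group_add) graded \<Rightarrow> ('b, 'b) family \<Rightarrow> 'b \<Rightarrow> ('a, 'b) family \<Rightarrow> bool" where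
  "unital_morphism A \<mu> eA B \<nu> eB \<phi> \<longleftrightarrow>
     ainf_morphism A \<mu> B \<nu> \<phi> \<and>
     \<phi> 1 [(0, eA)] = eB \<and>
     (\<forall>k\<ge>2. vanishes_on_unit A eA k (\<phi> k))"

definition unital_homotopy ::
  "('q::{comm_ring,monoid_mult}, 'a::ab_group_add) graded \<Rightarrow> ('a, 'a) family \<Rightarrow> 'a \<Rightarrow>
   ('q, 'b::ab_group_add) graded \<Rightarrow> ('b, 'b) family \<Rightarrow>
   ('a, 'b) family \<Rightarrow> ('a, 'b) family \<Rightarrow> ('a, 'b) family \<Rightarrow> bool" where
  "unital_homotopy A \<mu> eA B \<nu> \<phi> \<psi> \<sigma> \<longleftrightarrow>
     ainf_homotopy A \<mu> B \<nu> \<phi> \<psi> \<sigma> \<and> (\<forall>k\<ge>1. vanishes_on_unit A eA k (\<sigma> k))"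

definition unital_homotopy_equivalence ::
  "('q::{comm_ring,monoid_mult}, 'a::ab_group_add) graded \<Rightarrow> ('a, 'a) family \<Rightarrow> 'a \<Rightarrow>
   ('q, 'b::ab_group_add) graded \<Rightarrow> ('b, 'b) family \<Rightarrow> 'b \<Rightarrow> ('a, 'b) family \<Rightarrow> bool" where
  "unital_homotopy_equivalence A \<mu> eA B \<nu> eB \<phi> \<longleftrightarrow>
     unital_morphism A \<mu> eA B \<nu> eB \<phi> \<and>
     (\<exists>\<psi>. unital_morphism B \<nu> eB A \<mu> eA \<psi> \<and>
        (\<exists>\<sigma>. unital_homotopy A \<mu> eA A \<mu> (ainf_comp \<psi> \<phi>) ainf_id \<sigma>) \<and>
        (\<exists>\<tau>. unital_homotopy B \<nu> eB B \<nu> (ainf_comp \<phi> \<psi>) ainf_id \<tau>))"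

text \<open>
  \<open>A = Q \<oplus> C\<close> as graded modules, with \<open>Q\<close> in degree \<open>0\<close> freely generated by \<open>e\<close>.
\<close>

definition splits_off ::
  "('q::{comm_ring,monoid_mult}, 'a::ab_group_add) graded \<Rightarrow> 'a \<Rightarrow> bool" where
  "splits_off A e \<longleftrightarrow>
     (\<exists>C. (\<forall>n. submodule (smul A) (C n)) \<and>
          (\<forall>n. n \<noteq> 0 \<longrightarrow> C n = piece A n) \<and>
          bij_betw (\<lambda>(a, c). smul A a e + c) (UNIV \<times> C 0) (piece A 0))"

end

theory Submission imports Defs "HOL-Library.Product_Plus" begin

text \<open>
  After suspension, an \<open>A\<^sub>\<infinity>\<close>-structure is a square-zero coderivation of the tensor coalgebra.  Both the
  structure on \<open>A\<close> and the morphism to \<open>B\<close> are built by induction on the arity \<open>k\<close>: the obstruction to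
  the next step is a cycle in the complex of \<open>k\<close>-linear maps from \<open>A\<close> to the cone of \<open>\<epsilon>\<^sub>1\<close>, and that
  complex is acyclic because \<open>A\<close> is projective and bounded below.  In the unital case all obstructions
  vanish on the unit and are lifted among maps out of \<open>A / Q\<close>.

  Uniqueness follows from existence.  Two structures with morphisms \<open>\<epsilon>\<close>, \<open>\<epsilon>'\<close> to \<open>B\<close> give an
  \<open>A\<^sub>\<infinity>\<close>-algebra \<open>N = A \<oplus> B[1] \<oplus> A\<close>, the homotopy fibre product, with strict projections to both, and
  \<open>x \<mapsto> (x, 0, x)\<close> is a quasi-isomorphism \<open>A \<rightarrow> N\<close>.  Transferring along it yields a third structure with
  morphisms to the two given ones whose linear parts are the identity.  Such morphisms are strictly
  invertible, so that the homotopies can be taken to be zero.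
\<close>

section \<open>Signs, modules and additive maps\<close>

text \<open>Curvature and defect are treated as one cycle because they are not independent: a
  correction of \<open>b\<close> also changes the defect of \<open>F\<close>. Acyclicity of the cone
  is what the quasi-isomorphism \<open>\<epsilon>\<^sub>1\<close> provides for such pairs. The
  induction starts with arity 2 already filled in: later corrections vanish on the unit, so the unit
  law, which lives in arity 2, has to be put in by hand before the first of them. For uniqueness the
  obstacle is that B need be neither projective nor bounded below, so that a morphism to B cannot be
  inverted in general, even up to homotopy. The fibre product turns the comparison of two structures
  into one more existence problem with the same source A; this is why existence is proved for an
  arbitrary target. No tensor product is formed: maps of tensor coalgebras are represented by their
  action on functionals on lists. This reverses the order of composition, so that
  \<open>cf F (cf G f)\<close> is \<open>f\<close> after \<open>G\<close> after
  \<open>F\<close>.\<close>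

lemma sg_simps [simp]:
  "sg 0 x = x" "sg n 0 = 0" "sg n (sg n x) = x" "sg n (- x) = - sg n x"
  "sg (n - 1) x = - sg n x" "sg (n + 1) x = - sg n x" "sg (1 + n) x = - sg n x" "sg 1 x = - x" "sg (- 1) x = - x"
  by (auto simp: sg_def)

lemma sg_add: "sg n (x + y) = sg n x + sg n y"
  and sg_diff: "sg n (x - y) = sg n x - sg n y"
  and sg_plus_exp: "sg (i + j) x = sg i (sg j x)"
  and sg_commute: "sg i (sg j x) = sg j (sg i x)"
  by (auto simp: sg_def)

lemma degree_simps [simp]:
  "degree [] = 0" "degree (x # xs) = fst x + degree xs" "degree (xs @ ys) = degree xs + degree ys"
  by (simp_all add: degree_def)

lemma qmodule_simps:
  assumes "qmodule s"
  shows "s a (x + y) = s a x + s a y" "s (a + b) x = s a x + s b x" "s a (s b x) = s (a * b) x"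
    "s 1 x = x" "s a 0 = 0" "s 0 x = 0" "s a (- x) = - s a x" "s (- a) x = - s a x" "s a (x - y) = s a x - s a y"
    "s a (sg n x) = sg n (s a x)"
proof -
  have d: "s a (x + y) = s a x + s a y" "s (a + b) x = s a x + s b x"
      "s a (s b x) = s (a * b) x" "s 1 x = x" for a b x y
    using assms by (auto simp: qmodule_def)
  have z: "s a 0 = 0" for a using d(1)[of a 0 0] by simp
  have z': "s 0 x = 0" for x using d(2)[of 0 0 x] by simp
  have m: "s a (- x) = - s a x" for a x
    using d(1)[of a x "- x"] z by (simp add: eq_neg_iff_add_eq_0 add.commute)
  have m': "s (- a) x = - s a x" for a x
    using d(2)[of a "- a" x] z' by (simp add: eq_neg_iff_add_eq_0 add.commute)
  show "s a (x + y) = s a x + s a y" "s (a + b) x = s a x + s b x" "s a (s b x) = s (a * b) x"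
    "s 1 x = x" "s a 0 = 0" "s 0 x = 0" "s a (- x) = - s a x" "s (- a) x = - s a x"
    by (fact d z z' m m')+
  show "s a (x - y) = s a x - s a y" using d(1)[of a x "- y"] m by simp
  show "s a (sg n x) = sg n (s a x)" using m by (simp add: sg_def)
qed

lemma graded_moduleD:
  assumes "graded_module A"
  shows graded_zero: "0 \<in> piece A n"
    and graded_add: "x \<in> piece A n \<Longrightarrow> y \<in> piece A n \<Longrightarrow> x + y \<in> piece A n"
    and graded_smul: "x \<in> piece A n \<Longrightarrow> smul A a x \<in> piece A n"
    and graded_qmodule: "qmodule (smul A)"
    and graded_uminus: "x \<in> piece A n \<Longrightarrow> - x \<in> piece A n"
    and graded_diff: "x \<in> piece A n \<Longrightarrow> y \<in> piece A n \<Longrightarrow> x - y \<in> piece A n"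
    and graded_sg: "x \<in> piece A n \<Longrightarrow> sg i x \<in> piece A n"
proof -
  show z: "0 \<in> piece A n" and a: "x \<in> piece A n \<Longrightarrow> y \<in> piece A n \<Longrightarrow> x + y \<in> piece A n" 
    and sm: "x \<in> piece A n \<Longrightarrow> smul A a x \<in> piece A n" and q: "qmodule (smul A)" for x y a
    using assms by (auto simp: graded_module_def submodule_def)
  show m: "x \<in> piece A n \<Longrightarrow> - x \<in> piece A n" for x
    using sm[of x "- 1"] qmodule_simps[OF q] by simp
  show "x \<in> piece A n \<Longrightarrow> y \<in> piece A n \<Longrightarrow> x - y \<in> piece A n"
    using a[of x "- y"] m[of y] by simp
  show "x \<in> piece A n \<Longrightarrow> sg i x \<in> piece A n" by (simp add: sg_def m)
qed

lemma sum_list_lin: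
  assumes "\<And>i. i \<in> set is \<Longrightarrow> f i = s (g i) + h i" and "s 0 = 0" and "\<And>x y. s (x + y) = s x + s y"
  shows "(\<Sum>i\<leftarrow>is. f i) = s (\<Sum>i\<leftarrow>is. g i) + (\<Sum>i\<leftarrow>is. h i :: 'c::ab_group_add)"
  using assms(1) by (induction "is") (simp_all add: assms(2,3) ac_simps)

text \<open>Maps are additive only on a graded piece, so the subgroup on which the homomorphism law
  holds is carried along. It is what allows a map to be pulled through the sums \<open>dec\<close>,
  \<open>cd\<close> and \<open>cf\<close>.\<close>

definition additive_on :: "'a::ab_group_add set \<Rightarrow> ('a \<Rightarrow> 'b::ab_group_add) \<Rightarrow> bool" where
  "additive_on M L \<longleftrightarrow> 0 \<in> M \<and> (\<forall>x\<in>M. - x \<in> M) \<and> (\<forall>x\<in>M. \<forall>y\<in>M. x + y \<in> M \<and> L (x + y) = L x + L y)"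

lemma additive_on_simps:
  assumes "additive_on M L"
  shows "L 0 = 0" "x \<in> M \<Longrightarrow> L (- x) = - L x" "x \<in> M \<Longrightarrow> L (sg n x) = sg n (L x)" "x \<in> M \<Longrightarrow> sg n x \<in> M"
proof -
  have "L (0 + 0) = L 0 + L 0" using assms unfolding additive_on_def by blast
  then show z: "L 0 = 0" by simp
  show m: "L (- x) = - L x" if "x \<in> M" for x
  proof -
    have "L (x + - x) = L x + L (- x)" using assms that unfolding additive_on_def by blast
    then show ?thesis using z by (simp add: eq_neg_iff_add_eq_0 add.commute)
  qed
  show "x \<in> M \<Longrightarrow> L (sg n x) = sg n (L x)" by (simp add: sg_def m)
  show "x \<in> M \<Longrightarrow> sg n x \<in> M" using assms by (simp add: sg_def additive_on_def)
qed

lemma additive_on_diff: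
  assumes "additive_on M L" "x \<in> M" "y \<in> M"
  shows "L (x - y) = L x - L y"
proof -
  have "- y \<in> M" using assms by (simp add: additive_on_def)
  then have "L (x + - y) = L x + L (- y)" using assms unfolding additive_on_def by blast
  then show ?thesis using additive_on_simps(2)[OF assms(1,3)] by simp
qed

lemma sum_list_hom:
  assumes "additive_on M L" "\<And>i. i \<in> set is \<Longrightarrow> f i \<in> M"
  shows "L (\<Sum>i\<leftarrow>is. f i) = (\<Sum>i\<leftarrow>is. L (f i)) \<and> (\<Sum>i\<leftarrow>is. f i) \<in> M"
  using assms(2) by (induction "is")
    (use assms(1) additive_on_simps[OF assms(1)] in \<open>auto simp: additive_on_def\<close>)


section \<open>Deconcatenation\<close>

primrec decs :: "'x list \<Rightarrow> ('x list \<times> 'x list) list" where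
  "decs [] = [([], [])]"
| "decs (x # xs) = ([], x # xs) # map (\<lambda>(u, w). (x # u, w)) (decs xs)"

text \<open>The pairing \<open>g\<close> after the deconcatenation coproduct of the tensor
  coalgebra, the two end cuts included.\<close>

definition dec :: "('x list \<Rightarrow> 'x list \<Rightarrow> 'c::ab_group_add) \<Rightarrow> 'x list \<Rightarrow> 'c" where
  "dec g xs = (\<Sum>(u, w)\<leftarrow>decs xs. g u w)"

lemma set_decs: "set (decs xs) = {(u, w). u @ w = xs}"
  by (induction xs) (auto simp: append_eq_Cons_conv)

lemma dec_simps [simp]:
  "dec g [] = g [] []" "dec g (x # xs) = g [] (x # xs) + dec (\<lambda>u w. g (x # u) w) xs"
  by (simp_all add: dec_def o_def split_def)

lemma dec_cong:
  "xs = ys \<Longrightarrow> (\<And>u w. u @ w = ys \<Longrightarrow> g u w = h u w) \<Longrightarrow> dec g xs = dec h ys"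
  unfolding dec_def by (rule arg_cong[where f = sum_list], rule map_cong) (auto simp: set_decs)

lemma dec_add: "dec (\<lambda>u w. g u w + h u w) xs = dec g xs + dec h xs"
  by (simp add: dec_def split_def sum_list_addf)

lemma dec_sg: "dec (\<lambda>u w. sg n (g u w)) xs = sg n (dec g xs)"
  by (induction xs arbitrary: g) (simp_all add: sg_add)

lemma dec_uminus: "dec (\<lambda>u w. - g u w) xs = - dec g xs"
  using dec_sg[of 1] by simp

lemma dec_diff: "dec (\<lambda>u w. g u w - h u w) xs = dec g xs - dec h xs"
  using dec_add[of g "\<lambda>u w. - h u w"] by (simp add: dec_uminus)

lemma dec_0: "(\<And>u w. u @ w = xs \<Longrightarrow> g u w = 0) \<Longrightarrow> dec g xs = 0"
  by (induction xs arbitrary: g) auto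

lemma dec_lin:
  assumes "qmodule s" "\<And>u w. u @ w = xs \<Longrightarrow> f u w = s a (g u w) + h u w"
  shows "dec f xs = s a (dec g xs) + dec h xs"
  unfolding dec_def split_def
  by (rule sum_list_lin) (use assms qmodule_simps[OF assms(1)] in \<open>auto simp: set_decs\<close>)

lemma dec_hom:
  assumes "additive_on M L" "\<And>u w. u @ w = xs \<Longrightarrow> g u w \<in> M"
  shows "L (dec g xs) = dec (\<lambda>u w. L (g u w)) xs" "dec g xs \<in> M"
  using sum_list_hom[OF assms(1), of "decs xs" "\<lambda>i. g (fst i) (snd i)"] assms(2)
  by (auto simp: dec_def set_decs split_def)

lemma dec_last:
  "(\<And>u w. u @ w = xs \<Longrightarrow> w \<noteq> [] \<Longrightarrow> g u w = 0) \<Longrightarrow> dec g xs = g xs []"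
  by (induction xs arbitrary: g) auto

lemma dec_first:
  "(\<And>u w. u @ w = xs \<Longrightarrow> u \<noteq> [] \<Longrightarrow> g u w = 0) \<Longrightarrow> dec g xs = g [] xs"
  by (cases xs) (auto intro: dec_0)

text \<open>Coassociativity of deconcatenation. All regroupings of blocks within blocks go through
  this identity.\<close>

lemma dec_assoc:
  "dec (\<lambda>u w. dec (\<lambda>v t. g u v t) w) xs = dec (\<lambda>v t. dec (\<lambda>u w. g u w t) v) xs"
  by (induction xs arbitrary: g) (simp_all add: dec_add add.assoc)

text \<open>The cut lies before or after the marked letter \<open>x\<close>. In this form the place
  of a variable, or of an inserted unit, can be followed through the sums.\<close>

lemma dec_append_Cons:
  "dec g (us @ x # ws) = dec (\<lambda>u w. g u (w @ x # ws)) us + dec (\<lambda>u w. g (us @ x # u) w) ws"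
  by (induction us arbitrary: g) (simp_all add: add.assoc)

lemma dec_map: "dec g (map h xs) = dec (\<lambda>u w. g (map h u) (map h w)) xs"
  by (induction xs arbitrary: g) simp_all


section \<open>The operators of the bar construction\<close>

definition tlists :: "('q, 'a) graded \<Rightarrow> (int \<times> 'a) list set" where
  "tlists A = {xs. \<forall>(n, x)\<in>set xs. x \<in> piece A n}"

lemma tlists_simps [simp]:
  "[] \<in> tlists A" "x # xs \<in> tlists A \<longleftrightarrow> snd x \<in> piece A (fst x) \<and> xs \<in> tlists A"
  "us @ ws \<in> tlists A \<longleftrightarrow> us \<in> tlists A \<and> ws \<in> tlists A"
  by (auto simp: tlists_def)

lemma tensors_tlists: "tensors A k = {xs \<in> tlists A. length xs = k}"
  by (auto simp: tensors_def tlists_def)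

text \<open>A functional on the tensor coalgebra with values in a plain module: all tensor powers at
  once, and no degree condition. Additivity and homogeneity are merged into one law to halve the
  later inductions.\<close>

definition mlin ::
  "('q::{comm_ring,monoid_mult}, 'a::ab_group_add) graded \<Rightarrow> ('q \<Rightarrow> 'c::ab_group_add \<Rightarrow> 'c) \<Rightarrow>
   ((int \<times> 'a) list \<Rightarrow> 'c) \<Rightarrow> bool" where
  "mlin A s f \<longleftrightarrow> graded_module A \<and> qmodule s \<and>
     (\<forall>us\<in>tlists A. \<forall>ws\<in>tlists A. \<forall>n a. \<forall>x\<in>piece A n. \<forall>y\<in>piece A n.
        f (us @ (n, smul A a x + y) # ws) = s a (f (us @ (n, x) # ws)) + f (us @ (n, y) # ws))"

text \<open>The empty list is exempt from the degree condition: coderivations and coalgebra maps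
  apply their corestriction to nonempty blocks only.\<close>

definition gfam ::
  "('q::{comm_ring,monoid_mult}, 'a::ab_group_add) graded \<Rightarrow> ('q, 'b::ab_group_add) graded \<Rightarrow> int \<Rightarrow>
   ((int \<times> 'a) list \<Rightarrow> 'b) \<Rightarrow> bool" where
  "gfam A B e f \<longleftrightarrow> graded_module B \<and> mlin A (smul B) f \<and>
     (\<forall>xs\<in>tlists A. xs \<noteq> [] \<longrightarrow> f xs \<in> piece B (degree xs + e))"

lemma mlinD:
  assumes "mlin A s f"
  shows "graded_module A" "qmodule s"
    "us \<in> tlists A \<Longrightarrow> ws \<in> tlists A \<Longrightarrow> x \<in> piece A n \<Longrightarrow> y \<in> piece A n \<Longrightarrow>
       f (us @ (n, smul A a x + y) # ws) = s a (f (us @ (n, x) # ws)) + f (us @ (n, y) # ws)"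
  using assms by (auto simp: mlin_def)

lemma mlin_additive:
  assumes "mlin A s f" "us \<in> tlists A" "ws \<in> tlists A"
  shows "additive_on (piece A n) (\<lambda>x. f (us @ (n, x) # ws))"
  using mlinD(3)[OF assms, of _ n _ 1] graded_moduleD[OF mlinD(1)[OF assms(1)]]
    qmodule_simps(4)[OF mlinD(2)[OF assms(1)]]
    qmodule_simps(4)[OF graded_qmodule[OF mlinD(1)[OF assms(1)]]]
  by (simp add: additive_on_def)

lemma mlin_additive_hd:
  "mlin A s f \<Longrightarrow> ws \<in> tlists A \<Longrightarrow> additive_on (piece A n) (\<lambda>x. f ((n, x) # ws))"
  using mlin_additive[of A s f "[]"] by simp

lemma mlin_smul:
  assumes "mlin A s f" "us \<in> tlists A" "ws \<in> tlists A" "x \<in> piece A n"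
  shows "f (us @ (n, smul A a x) # ws) = s a (f (us @ (n, x) # ws))"
  using mlinD(3)[OF assms, of 0 a] graded_zero[OF mlinD(1)[OF assms(1)]]
    additive_on_simps(1)[OF mlin_additive[OF assms(1-3)]] by simp

lemma mlin_0: "mlin A s f \<Longrightarrow> us \<in> tlists A \<Longrightarrow> ws \<in> tlists A \<Longrightarrow> f (us @ (n, 0) # ws) = 0"
  by (rule additive_on_simps(1)[OF mlin_additive])

lemma mlin_0_hd: "mlin A s f \<Longrightarrow> ws \<in> tlists A \<Longrightarrow> f ((n, 0) # ws) = 0"
  using mlin_0[of A s f "[]"] by simp

lemma mlin_sg:
  "mlin A s f \<Longrightarrow> us \<in> tlists A \<Longrightarrow> ws \<in> tlists A \<Longrightarrow> x \<in> piece A n \<Longrightarrow>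
   f (us @ (n, sg i x) # ws) = sg i (f (us @ (n, x) # ws))"
  by (rule additive_on_simps(3)[OF mlin_additive])

lemma mlin_Cons:
  assumes "mlin A s f" "snd z \<in> piece A (fst z)"
  shows "mlin A s (\<lambda>ys. f (z # ys))"
  using assms mlinD(3)[OF assms(1), of "z # _"] unfolding mlin_def by auto

lemma mlin_lin:
  assumes "mlin A s f" "mlin A s g"
  shows "mlin A s (\<lambda>xs. f xs + g xs)" "mlin A s (\<lambda>xs. f xs - g xs)" "mlin A s (\<lambda>xs. - f xs)"
     "mlin A s (\<lambda>xs. 0)"
  using assms by (auto simp: mlin_def qmodule_simps)

lemma gfamD:
  assumes "gfam A B e f"
  shows "graded_module A" "graded_module B" "qmodule (smul B)" "mlin A (smul B) f"
    "xs \<in> tlists A \<Longrightarrow> xs \<noteq> [] \<Longrightarrow> f xs \<in> piece B (degree xs + e)"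
  using assms by (auto simp: gfam_def mlin_def)

text \<open>
  A function on lists plays the role of a map out of the tensor coalgebra.  The functional
  \<open>cd b f\<close> is \<open>f\<close> after the coderivation of degree \<open>-1\<close> with corestriction \<open>b\<close>, and \<open>cf F f\<close> is \<open>f\<close>
  after the coalgebra map of degree \<open>0\<close> with corestriction \<open>F\<close>.  Both are given by explicit lists
  of summands, \<open>cds\<close> recording the exponents of the signs.
\<close>

primrec cds :: "((int \<times> 'a) list \<Rightarrow> 'a) \<Rightarrow> (int \<times> 'a) list \<Rightarrow> (int \<times> (int \<times> 'a) list) list" where
  "cds b [] = []"
| "cds b (x # xs) = map (\<lambda>(i, ys). (fst x + i, x # ys)) (cds b xs) @
     map (\<lambda>(u, w). (0, (degree (x # u) - 1, b (x # u)) # w)) (decs xs)"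

definition cd ::
  "((int \<times> 'a) list \<Rightarrow> 'a) \<Rightarrow> ((int \<times> 'a) list \<Rightarrow> 'c::ab_group_add) \<Rightarrow> (int \<times> 'a) list \<Rightarrow> 'c" where
  "cd b f xs = (\<Sum>(i, ys)\<leftarrow>cds b xs. sg i (f ys))"

function cfs :: "((int \<times> 'a) list \<Rightarrow> 'b) \<Rightarrow> (int \<times> 'a) list \<Rightarrow> (int \<times> 'b) list list" where
  "cfs F [] = [[]]"
| "cfs F (x # xs) = concat (map (\<lambda>(u, w). map (\<lambda>ys. (degree (x # u), F (x # u)) # ys) (cfs F w)) (decs xs))"
  by pat_completeness auto
termination by (relation "measure (length \<circ> snd)") (auto simp: set_decs)

definition cf ::
  "((int \<times> 'a) list \<Rightarrow> 'b) \<Rightarrow> ((int \<times> 'b) list \<Rightarrow> 'c::ab_group_add) \<Rightarrow> (int \<times> 'a) list \<Rightarrow> 'c" where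
  "cf F f xs = (\<Sum>ys\<leftarrow>cfs F xs. f ys)"

section \<open>Recursion on the first letter, and linearity in the functional\<close>

lemma sum_list_sg: "(\<Sum>i\<leftarrow>is. sg n (f i)) = sg n (\<Sum>i\<leftarrow>is. f i)"
  by (induction "is") (simp_all add: sg_add)

lemma cd_Nil [simp]: "cd b f [] = 0"
  by (simp add: cd_def)

text \<open>Either the odd coderivation moves past \<open>x\<close>, at the price of the sign of its
  degree, or it acts on a block that starts with \<open>x\<close> and has nothing to move
  past.\<close>

lemma cd_Cons:
  "cd b f (x # xs) = sg (fst x) (cd b (\<lambda>ys. f (x # ys)) xs) +
     dec (\<lambda>u w. f ((degree (x # u) - 1, b (x # u)) # w)) xs"
  by (simp add: cd_def dec_def o_def split_def sg_plus_exp sum_list_sg)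

lemma sum_list_concat_map: "(\<Sum>y\<leftarrow>concat (map g is). f y) = (\<Sum>i\<leftarrow>is. \<Sum>y\<leftarrow>g i. (f y :: 'c::comm_monoid_add))"
  by (induction "is") simp_all

lemma cf_Nil [simp]: "cf F f [] = f []"
  by (simp add: cf_def)

lemma cf_Cons:
  "cf F f (x # xs) = dec (\<lambda>u w. cf F (\<lambda>ys. f ((degree (x # u), F (x # u)) # ys)) w) xs"
  by (simp add: cf_def dec_def o_def split_def sum_list_concat_map)

definition maps_to ::
  "('q, 'a) graded \<Rightarrow> ('q, 'b) graded \<Rightarrow> int \<Rightarrow> ((int \<times> 'a) list \<Rightarrow> 'b) \<Rightarrow> bool" where
  "maps_to A B e F \<longleftrightarrow> (\<forall>xs\<in>tlists A. xs \<noteq> [] \<longrightarrow> F xs \<in> piece B (degree xs + e))"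

lemma gfam_maps_to: "gfam A B e F \<Longrightarrow> maps_to A B e F"
  by (simp add: gfam_def maps_to_def)

lemma maps_toD: "maps_to A B e F \<Longrightarrow> xs \<in> tlists A \<Longrightarrow> xs \<noteq> [] \<Longrightarrow> F xs \<in> piece B (degree xs + e)"
  by (simp add: maps_to_def)

text \<open>Basis of every later argument by arity: the value of \<open>cd b f\<close> on a list
  depends only on \<open>f\<close> in lengths between one and the length of that list.\<close>

lemma cds_props:
  assumes "maps_to A A (-1) b"
  shows "(i, ys) \<in> set (cds b xs) \<Longrightarrow> xs \<in> tlists A \<Longrightarrow>
     ys \<in> tlists A \<and> degree ys = degree xs - 1 \<and> length ys \<le> length xs \<and> ys \<noteq> []"
proof (induction xs arbitrary: i ys)
  case (Cons x xs)
  from Cons.prems(1) consider i' zs where "ys = x # zs" "(i', zs) \<in> set (cds b xs)"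
    | u w where "u @ w = xs" "ys = (degree (x # u) - 1, b (x # u)) # w"
    by (auto simp: set_decs)
  then show ?case
  proof cases
    case 1
    then show ?thesis using Cons.IH[of i' zs] Cons.prems(2) by auto
  next
    case 2
    then show ?thesis using maps_toD[OF assms, of "x # u"] Cons.prems(2) by auto
  qed
qed simp

lemma cfs_props:
  assumes "maps_to A B 0 F"
  shows "ys \<in> set (cfs F xs) \<Longrightarrow> xs \<in> tlists A \<Longrightarrow>
     ys \<in> tlists B \<and> degree ys = degree xs \<and> length ys \<le> length xs \<and> (ys = [] \<longleftrightarrow> xs = [])"
proof (induction xs arbitrary: ys rule: length_induct)
  case (1 xs)
  show ?case
  proof (cases xs)
    case Nil
    then show ?thesis using 1(2) by simp
  next
    case (Cons x xs')
    with 1(2) obtain u w zs where u: "u @ w = xs'" "ys = (degree (x # u), F (x # u)) # zs" "zs \<in> set (cfs F w)"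
      by (auto simp: set_decs)
    then show ?thesis using 1(1)[rule_format, of w zs] 1(3) maps_toD[OF assms, of "x # u"] Cons by auto
  qed
qed

lemma cd_cong:
  assumes "maps_to A A (-1) b" "xs \<in> tlists A"
    and "\<And>ys. ys \<in> tlists A \<Longrightarrow> degree ys = degree xs - 1 \<Longrightarrow> length ys \<le> length xs \<Longrightarrow> ys \<noteq> [] \<Longrightarrow> f ys = g ys"
  shows "cd b f xs = cd b g xs"
  unfolding cd_def split_def
  by (rule arg_cong[where f = sum_list], rule map_cong)
    (auto dest!: cds_props[OF assms(1) _ assms(2)] simp: assms(3))

lemma cf_cong:
  assumes "maps_to A B 0 F" "xs \<in> tlists A"
    and "\<And>ys. ys \<in> tlists B \<Longrightarrow> degree ys = degree xs \<Longrightarrow> length ys \<le> length xs \<Longrightarrow> (ys = [] \<longleftrightarrow> xs = []) \<Longrightarrow> f ys = g ys"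
  shows "cf F f xs = cf F g xs"
  unfolding cf_def
  by (rule arg_cong[where f = sum_list], rule map_cong)
    (auto dest!: cfs_props[OF assms(1) _ assms(2)] simp: assms(3))

lemma cd_lin:
  assumes "qmodule s" "maps_to A A (-1) b" "xs \<in> tlists A"
    and "\<And>ys. ys \<in> tlists A \<Longrightarrow> f ys = s a (g ys) + h ys"
  shows "cd b f xs = s a (cd b g xs) + cd b h xs"
proof -
  have "f ys = s a (g ys) + h ys" if "(i, ys) \<in> set (cds b xs)" for i ys
    using cds_props[OF assms(2) that assms(3)] assms(4) by blast
  then show ?thesis unfolding cd_def split_def
    by (intro sum_list_lin) (auto simp: sg_add qmodule_simps[OF assms(1)])
qed

lemma cf_lin:
  assumes "qmodule s" "maps_to A B 0 F" "xs \<in> tlists A"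
    and "\<And>ys. ys \<in> tlists B \<Longrightarrow> f ys = s a (g ys) + h ys"
  shows "cf F f xs = s a (cf F g xs) + cf F h xs"
proof -
  have "f ys = s a (g ys) + h ys" if "ys \<in> set (cfs F xs)" for ys
    using cfs_props[OF assms(2) that assms(3)] assms(4) by blast
  then show ?thesis unfolding cf_def
    by (intro sum_list_lin) (auto simp: qmodule_simps[OF assms(1)])
qed

lemma cd_add: "cd b (\<lambda>ys. f ys + g ys) xs = cd b f xs + cd b g xs"
  by (simp add: cd_def split_def sum_list_addf sg_add)

lemma cd_sg: "cd b (\<lambda>ys. sg n (f ys)) xs = sg n (cd b f xs)"
  by (simp add: cd_def split_def sg_commute[of _ n] sum_list_sg)

lemma cd_uminus: "cd b (\<lambda>ys. - f ys) xs = - cd b f xs"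
  using cd_sg[of b 1] by simp

lemma cd_diff: "cd b (\<lambda>ys. f ys - g ys) xs = cd b f xs - cd b g xs"
  using cd_add[of b f "\<lambda>ys. - g ys"] by (simp add: cd_uminus)

lemma cf_add: "cf F (\<lambda>ys. f ys + g ys) xs = cf F f xs + cf F g xs"
  by (simp add: cf_def sum_list_addf)

lemma cf_sg: "cf F (\<lambda>ys. sg n (f ys)) xs = sg n (cf F f xs)"
  by (simp add: cf_def sum_list_sg)

lemma cf_uminus: "cf F (\<lambda>ys. - f ys) xs = - cf F f xs"
  using cf_sg[of F 1] by simp

lemma cf_diff: "cf F (\<lambda>ys. f ys - g ys) xs = cf F f xs - cf F g xs"
  using cf_add[of F f "\<lambda>ys. - g ys"] by (simp add: cf_uminus)

lemma cd_hom:
  assumes "maps_to A A (-1) b" "xs \<in> tlists A" "additive_on M L"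
    and "\<And>ys. ys \<in> tlists A \<Longrightarrow> degree ys = degree xs - 1 \<Longrightarrow> length ys \<le> length xs \<Longrightarrow> ys \<noteq> [] \<Longrightarrow> f ys \<in> M"
  shows "L (cd b f xs) = cd b (\<lambda>ys. L (f ys)) xs" "cd b f xs \<in> M"
proof -
  have *: "f ys \<in> M" if "(i, ys) \<in> set (cds b xs)" for i ys
    using cds_props[OF assms(1) that assms(2)] assms(4) by blast
  show "L (cd b f xs) = cd b (\<lambda>ys. L (f ys)) xs" "cd b f xs \<in> M"
    using sum_list_hom[OF assms(3), of "cds b xs" "\<lambda>p. sg (fst p) (f (snd p))"] *
    additive_on_simps[OF assms(3)]
    by (auto simp: cd_def split_def intro!: arg_cong[where f = sum_list] map_cong)
qed

lemma cf_hom: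
  assumes "maps_to A B 0 F" "xs \<in> tlists A" "additive_on M L"
    and "\<And>ys. ys \<in> tlists B \<Longrightarrow> degree ys = degree xs \<Longrightarrow> length ys \<le> length xs \<Longrightarrow> (ys = [] \<longleftrightarrow> xs = []) \<Longrightarrow> f ys \<in> M"
  shows "L (cf F f xs) = cf F (\<lambda>ys. L (f ys)) xs" "cf F f xs \<in> M"
proof -
  have *: "f ys \<in> M" if "ys \<in> set (cfs F xs)" for ys
    using cfs_props[OF assms(1) that assms(2)] assms(4) by blast
  show "L (cf F f xs) = cf F (\<lambda>ys. L (f ys)) xs" "cf F f xs \<in> M"
    using sum_list_hom[OF assms(3), of "cfs F xs" f] * by (auto simp: cf_def)
qed

text \<open>The co-Leibniz rule of a coderivation: it acts on the left or on the right part of a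
  cut, and in the second case it has to pass the left part.\<close>

lemma cd_dec:
  "cd b (dec g) xs = dec (\<lambda>u w. cd b (\<lambda>v. g v w) u + sg (degree u) (cd b (g u) w)) xs"
proof (induction xs arbitrary: g)
  case (Cons x xs)
  have "cd b (dec g) (x # xs) =
      sg (fst x) (cd b (g []\<circ> (#) x) xs + cd b (dec (\<lambda>u. g (x # u))) xs)
      + (dec (\<lambda>u w. g [] ((degree (x # u) - 1, b (x # u)) # w)) xs
      + dec (\<lambda>u w. dec (\<lambda>v t. g ((degree (x # u) - 1, b (x # u)) # v) t) w) xs)"
    by (simp add: cd_Cons cd_add dec_add o_def)
  also have "\<dots> = dec (\<lambda>u w. cd b (\<lambda>v. g v w) u + sg (degree u) (cd b (g u) w)) (x # xs)"
    unfolding Cons.IH dec_assoc[where g = "\<lambda>u v t. g ((degree (x # u) - 1, b (x # u)) # v) t"]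
    by (simp add: cd_Cons sg_add dec_add dec_sg[symmetric] o_def sg_plus_exp sg_commute[of "fst x"] ac_simps)
  finally show ?case .
qed simp

text \<open>A coalgebra map commutes with deconcatenation, since a cut of the list of images is a
  cut of the source between two blocks.\<close>

lemma cf_dec:
  "cf F (dec g) xs = dec (\<lambda>u w. cf F (\<lambda>v. cf F (g v) w) u) xs"
proof (induction xs arbitrary: g rule: length_induct)
  case (1 xs)
  show ?case
  proof (cases xs)
    case (Cons x xs')
    have "cf F (dec g) xs = dec (\<lambda>u w. cf F (\<lambda>ys. g [] ((degree (x # u), F (x # u)) # ys)) w) xs' +
       dec (\<lambda>u w. cf F (dec (\<lambda>a c. g ((degree (x # u), F (x # u)) # a) c)) w) xs'"
      by (simp add: Cons cf_Cons cf_add dec_add)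
    also have "dec (\<lambda>u w. cf F (dec (\<lambda>a c. g ((degree (x # u), F (x # u)) # a) c)) w) xs' =
       dec (\<lambda>u w. dec (\<lambda>w1 w2. cf F (\<lambda>v. cf F (g ((degree (x # u), F (x # u)) # v)) w2) w1) w) xs'"
      using 1 Cons by (intro dec_cong refl) auto
    also have "\<dots> = dec (\<lambda>v t. cf F (\<lambda>v. cf F (g v) t) (x # v)) xs'"
      by (subst dec_assoc) (simp add: cf_Cons)
    finally show ?thesis by (simp add: Cons cf_Cons)
  qed simp
qed

text \<open>Naturality under strict morphisms, that is, under letterwise maps \<open>h\<close>
  intertwining \<open>b\<close> with \<open>c\<close>. It is needed for the projections of the fibre
  product and of the path object.\<close>

lemma cd_map:
  assumes "\<And>u. u \<noteq> [] \<Longrightarrow> set u \<subseteq> set xs \<Longrightarrow> h (degree u - 1, b u) = (degree (map h u) - 1, c (map h u))"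
    and "\<And>x. x \<in> set xs \<Longrightarrow> fst (h x) = fst x"
  shows "cd b (\<lambda>ys. f (map h ys)) xs = cd c f (map h xs)"
  using assms
proof (induction xs arbitrary: f)
  case (Cons x xs)
  have "cd b (\<lambda>ys. f (map h (x # ys))) xs = cd c (\<lambda>ys. f (h x # ys)) (map h xs)"
    using Cons.IH[of "\<lambda>ys. f (h x # ys)"] Cons.prems by (simp add: subset_iff)
  moreover have "dec (\<lambda>u w. f (map h ((degree (x # u) - 1, b (x # u)) # w))) xs =
      dec (\<lambda>u w. f ((degree (map h (x # u)) - 1, c (map h (x # u))) # map h w)) xs"
  proof (rule dec_cong[OF refl])
    fix u w assume "u @ w = xs"
    then have "set (x # u) \<subseteq> set (x # xs)" by auto
    from Cons.prems(1)[OF _ this] show "f (map h ((degree (x # u) - 1, b (x # u)) # w)) =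
      f ((degree (map h (x # u)) - 1, c (map h (x # u))) # map h w)" by simp
  qed
  ultimately show ?case using Cons.prems(2)[of x] by (simp add: cd_Cons dec_map)
qed simp

text \<open>Source and target may be changed by different letterwise maps \<open>h\<close> and
  \<open>k\<close>. With \<open>h\<close> the identity this describes a coalgebra map followed by a
  strict projection.\<close>

lemma cf_map:
  assumes "\<And>u. u \<noteq> [] \<Longrightarrow> set u \<subseteq> set xs \<Longrightarrow> k (degree u, F u) = (degree (map h u), G (map h u))"
  shows "cf F (\<lambda>ys. f (map k ys)) xs = cf G f (map h xs)"
  using assms
proof (induction xs arbitrary: f rule: measure_induct_rule[where f = length])
  case (less xs)
  show ?case
  proof (cases xs)
    case (Cons x xs')
    have "cf F (\<lambda>ys. f (map k ys)) (x # xs') = 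
      dec (\<lambda>u w. cf F (\<lambda>ys. f (k (degree (x # u), F (x # u)) # map k ys)) w) xs'"
      by (simp add: cf_Cons)
    also have "\<dots> = dec (\<lambda>u w. cf G (\<lambda>ys. f ((degree (map h (x # u)), G (map h (x # u))) # ys)) (map h w)) xs'"
    proof (rule dec_cong[OF refl])
      fix u w assume u: "u @ w = xs'"
      then have "set (x # u) \<subseteq> set xs" using Cons by auto
      then have k: "k (degree (x # u), F (x # u)) = (degree (map h (x # u)), G (map h (x # u)))"
        using less(2)[of "x # u"] by simp
      have "set w \<subseteq> set xs" using u Cons by auto
      then show "cf F (\<lambda>ys. f (k (degree (x # u), F (x # u)) # map k ys)) w =
        cf G (\<lambda>ys. f ((degree (map h (x # u)), G (map h (x # u))) # ys)) (map h w)"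
        unfolding k
        by (intro less(1)[where f = "\<lambda>ys. f ((degree (map h (x # u)), G (map h (x # u))) # ys)"])
          (use less(2) u Cons in auto)
    qed
    finally show ?thesis by (simp add: Cons cf_Cons dec_map)
  qed simp
qed

section \<open>Multilinearity and degrees of the two operators\<close>

lemma cf_additive_hd:
  assumes "mlin B s f" "maps_to A B 0 F" "w \<in> tlists A"
  shows "additive_on (piece B n) (\<lambda>x. cf F (\<lambda>ys. f ((n, x) # ys)) w)"
proof -
  note g = graded_moduleD[OF mlinD(1)[OF assms(1)]]
  have "cf F (\<lambda>ys. f ((n, x + y) # ys)) w = cf F (\<lambda>ys. f ((n, x) # ys) + f ((n, y) # ys)) w"
    if "x \<in> piece B n" "y \<in> piece B n" for x y
    using that mlin_additive_hd[OF assms(1)]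
    by (intro cf_cong[OF assms(2,3)]) (auto simp: additive_on_def)
  then show ?thesis by (auto simp: additive_on_def cf_add g)
qed

lemma gfam_mem: "gfam A B e f \<Longrightarrow> xs \<in> tlists A \<Longrightarrow> xs \<noteq> [] \<Longrightarrow> n = degree xs + e \<Longrightarrow> f xs \<in> piece B n"
  by (simp add: gfamD)

lemma cd_mem:
  assumes "maps_to A A (-1) b" "gfam A B e f" "xs \<in> tlists A" "n = degree xs - 1 + e"
  shows "cd b f xs \<in> piece B n"
proof -
  have "additive_on (piece B n) id"
    using graded_moduleD[OF gfamD(2)[OF assms(2)]] by (auto simp: additive_on_def)
  from cd_hom(2)[OF assms(1,3) this, of f] show ?thesis
    using gfam_mem[OF assms(2)] assms(4) by simp
qed

lemma cf_mem:
  assumes "maps_to A B 0 F" "gfam B C e f" "xs \<in> tlists A" "xs \<noteq> []" "n = degree xs + e"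
  shows "cf F f xs \<in> piece C n"
proof -
  have "additive_on (piece C n) id"
    using graded_moduleD[OF gfamD(2)[OF assms(2)]] by (auto simp: additive_on_def)
  from cf_hom(2)[OF assms(1,3) this, of f] show ?thesis
    using gfam_mem[OF assms(2)] assms(4,5) by simp
qed

text \<open>Induction on the letters before the varied one. A block that misses this letter leaves
  it to the multilinearity of \<open>f\<close>; for a block that contains it, \<open>b\<close> is
  linear in the letter and \<open>f\<close> in the value of the block.\<close>

lemma cd_mlin:
  assumes "gfam A A (-1) b" "mlin A s f"
  shows "mlin A s (cd b f)"
proof -
  note mt = gfam_maps_to[OF assms(1)]
  note q = qmodule_simps[OF mlinD(2)[OF assms(2)]]
  note gA = graded_moduleD[OF gfamD(1)[OF assms(1)]]
  have "cd b f (us @ (n, smul A a x + y) # ws) = s a (cd b f (us @ (n, x) # ws)) + cd b f (us @ (n, y) # ws)"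
    if "us \<in> tlists A" "ws \<in> tlists A" "x \<in> piece A n" "y \<in> piece A n" "mlin A s f" for us ws x y a n f
    using that
  proof (induction us arbitrary: f)
    case Nil
    have 1: "cd b (\<lambda>ys. f ((n, smul A a x + y) # ys)) ws = s a (cd b (\<lambda>ys. f ((n, x) # ys)) ws) + cd b (\<lambda>ys. f ((n, y) # ys)) ws"
      by (rule cd_lin[OF mlinD(2)[OF Nil(5)] mt Nil(2)]) (use mlinD(3)[OF Nil(5), of "[]"] Nil in auto)
    have 2: "dec (\<lambda>u w. f ((degree ((n, smul A a x + y) # u) - 1, b ((n, smul A a x + y) # u)) # w)) ws =
       s a (dec (\<lambda>u w. f ((degree ((n, x) # u) - 1, b ((n, x) # u)) # w)) ws) +
        dec (\<lambda>u w. f ((degree ((n, y) # u) - 1, b ((n, y) # u)) # w)) ws"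
    proof (rule dec_lin[OF mlinD(2)[OF Nil(5)]])
      fix u w assume uw: "u @ w = ws"
      then have T: "u \<in> tlists A" "w \<in> tlists A" using Nil by auto
      have "b ((n, smul A a x + y) # u) = smul A a (b ((n, x) # u)) + b ((n, y) # u)"
        using mlinD(3)[OF gfamD(4)[OF assms(1)], of "[]" u x n y a] T Nil by simp
      then show "f ((degree ((n, smul A a x + y) # u) - 1, b ((n, smul A a x + y) # u)) # w) =
        s a (f ((degree ((n, x) # u) - 1, b ((n, x) # u)) # w)) + f ((degree ((n, y) # u) - 1, b ((n, y) # u)) # w)"
        using mlinD(3)[OF Nil(5), of "[]" w "b ((n, x) # u)" _ "b ((n, y) # u)" a] T Nil
          gfam_mem[OF assms(1), of "(n, _) # u"] by simp
    qed
    show ?case unfolding append_Nil cd_Cons 1 2 by (simp add: q sg_add ac_simps)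
  next
    case (Cons z us)
    have z: "snd z \<in> piece A (fst z)" "us \<in> tlists A" using Cons.prems by auto
    note fz = mlin_Cons[OF Cons.prems(5) z(1)]
    have 1: "dec (\<lambda>u w. f ((degree (z # u) - 1, b (z # u)) # w)) (us @ (n, smul A a x + y) # ws) =
      s a (dec (\<lambda>u w. f ((degree (z # u) - 1, b (z # u)) # w)) (us @ (n, x) # ws)) +
       dec (\<lambda>u w. f ((degree (z # u) - 1, b (z # u)) # w)) (us @ (n, y) # ws)"
    proof -
      have A: "dec (\<lambda>u w. f ((degree (z # u) - 1, b (z # u)) # w @ (n, smul A a x + y) # ws)) us =
        s a (dec (\<lambda>u w. f ((degree (z # u) - 1, b (z # u)) # w @ (n, x) # ws)) us) + 
         dec (\<lambda>u w. f ((degree (z # u) - 1, b (z # u)) # w @ (n, y) # ws)) us"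
      proof (rule dec_lin[OF mlinD(2)[OF Cons.prems(5)]])
        fix u w assume "u @ w = us"
        then show "f ((degree (z # u) - 1, b (z # u)) # w @ (n, smul A a x + y) # ws) =
          s a (f ((degree (z # u) - 1, b (z # u)) # w @ (n, x) # ws)) + f ((degree (z # u) - 1, b (z # u)) # w @ (n, y) # ws)"
          using mlinD(3)[OF Cons.prems(5), of "(degree (z # u) - 1, b (z # u)) # w" ws x n y a] z Cons.prems
            gfam_mem[OF assms(1), of "z # u"] by auto
      qed
      have B: "dec (\<lambda>u w. f ((degree (z # us @ (n, smul A a x + y) # u) - 1, b (z # us @ (n, smul A a x + y) # u)) # w)) ws =
        s a (dec (\<lambda>u w. f ((degree (z # us @ (n, x) # u) - 1, b (z # us @ (n, x) # u)) # w)) ws) +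
         dec (\<lambda>u w. f ((degree (z # us @ (n, y) # u) - 1, b (z # us @ (n, y) # u)) # w)) ws"
      proof (rule dec_lin[OF mlinD(2)[OF Cons.prems(5)]])
        fix u w assume "u @ w = ws"
        then have T: "u \<in> tlists A" "w \<in> tlists A" using Cons.prems by auto
        have "b (z # us @ (n, smul A a x + y) # u) = smul A a (b (z # us @ (n, x) # u)) + b (z # us @ (n, y) # u)"
          using mlinD(3)[OF gfamD(4)[OF assms(1)], of "z # us" u x n y a] T z Cons.prems by simp
        then show "f ((degree (z # us @ (n, smul A a x + y) # u) - 1, b (z # us @ (n, smul A a x + y) # u)) # w) =
            s a (f ((degree (z # us @ (n, x) # u) - 1, b (z # us @ (n, x) # u)) # w)) + f ((degree (z # us @ (n, y) # u) - 1, b (z # us @ (n, y) # u)) # w)"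
          using mlinD(3)[OF Cons.prems(5), of "[]" w "b (z # us @ (n, x) # u)" _ "b (z # us @ (n, y) # u)" a] T z Cons.prems
            gfam_mem[OF assms(1), of "z # us @ (n, _) # u"] by simp
      qed
      show ?thesis unfolding dec_append_Cons A B by (simp add: q ac_simps)
    qed
    show ?case
      unfolding append_Cons cd_Cons 1 Cons.IH[OF z(2) Cons.prems(2-4) fz] by (simp add: q sg_add ac_simps)
  qed
  then show ?thesis using assms(2) gfamD(1)[OF assms(1)] by (simp add: mlin_def)
qed

text \<open>The same case distinction as for coderivations, but by induction on the length of the
  prefix, because the first block removes several letters at once.\<close>

lemma cf_mlin:
  assumes "gfam A B 0 F" "mlin B s f"
  shows "mlin A s (cf F f)"
proof -
  note mt = gfam_maps_to[OF assms(1)]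
  note q = qmodule_simps[OF mlinD(2)[OF assms(2)]]
  have "cf F f (us @ (n, smul A a x + y) # ws) = s a (cf F f (us @ (n, x) # ws)) + cf F f (us @ (n, y) # ws)"
    if "us \<in> tlists A" "ws \<in> tlists A" "x \<in> piece A n" "y \<in> piece A n" "mlin B s f" for us ws x y a n f
    using that
  proof (induction us arbitrary: f rule: measure_induct_rule[where f = length])
    case (less us)
    note ml = mlinD(2)[OF less(6)]
    have hd: "cf F (\<lambda>ys. f ((m, smul B a X + Y) # ys)) w = s a (cf F (\<lambda>ys. f ((m, X) # ys)) w) + cf F (\<lambda>ys. f ((m, Y) # ys)) w"
      if "w \<in> tlists A" "X \<in> piece B m" "Y \<in> piece B m" for X Y m w
      by (rule cf_lin[OF ml mt that(1)]) (use mlinD(3)[OF less(6), of "[]"] that in auto)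
    have blk: "cf F (\<lambda>ys. f ((degree (vs @ (n, smul A a x + y) # u), F (vs @ (n, smul A a x + y) # u)) # ys)) w =
        s a (cf F (\<lambda>ys. f ((degree (vs @ (n, x) # u), F (vs @ (n, x) # u)) # ys)) w) +
        cf F (\<lambda>ys. f ((degree (vs @ (n, y) # u), F (vs @ (n, y) # u)) # ys)) w"
      if "vs \<in> tlists A" "u \<in> tlists A" "w \<in> tlists A" for vs u w
    proof -
      have "F (vs @ (n, smul A a x + y) # u) = smul B a (F (vs @ (n, x) # u)) + F (vs @ (n, y) # u)"
        using mlinD(3)[OF gfamD(4)[OF assms(1)]] that less.prems by blast
      then show ?thesis using hd[OF that(3), of "F (vs @ (n, x) # u)" _ "F (vs @ (n, y) # u)"]
        gfam_mem[OF assms(1), of "vs @ (n, _) # u"] that less.prems by simp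
    qed
    show ?case
    proof (cases us)
      case Nil
      have "dec (\<lambda>u w. cf F (\<lambda>ys. f ((degree ([] @ (n, smul A a x + y) # u), F ([] @ (n, smul A a x + y) # u)) # ys)) w) ws =
        s a (dec (\<lambda>u w. cf F (\<lambda>ys. f ((degree ([] @ (n, x) # u), F ([] @ (n, x) # u)) # ys)) w) ws) +
         dec (\<lambda>u w. cf F (\<lambda>ys. f ((degree ([] @ (n, y) # u), F ([] @ (n, y) # u)) # ys)) w) ws"
        by (rule dec_lin[OF ml], rule blk) (use less.prems in auto)
      then show ?thesis by (simp add: Nil cf_Cons)
    next
      case (Cons z us')
      have z: "snd z \<in> piece A (fst z)" "us' \<in> tlists A" using less.prems Cons by auto
      have A: "dec (\<lambda>u w. cf F (\<lambda>ys. f ((degree (z # u), F (z # u)) # ys)) (w @ (n, smul A a x + y) # ws)) us' =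
          s a (dec (\<lambda>u w. cf F (\<lambda>ys. f ((degree (z # u), F (z # u)) # ys)) (w @ (n, x) # ws)) us') +
           dec (\<lambda>u w. cf F (\<lambda>ys. f ((degree (z # u), F (z # u)) # ys)) (w @ (n, y) # ws)) us'"
      proof (rule dec_lin[OF ml])
        fix u w assume u: "u @ w = us'"
        have "mlin B s (\<lambda>ys. f ((degree (z # u), F (z # u)) # ys))"
          using gfam_mem[OF assms(1), of "z # u"] z u by (intro mlin_Cons[OF less.prems(5)]) auto
        then show "cf F (\<lambda>ys. f ((degree (z # u), F (z # u)) # ys)) (w @ (n, smul A a x + y) # ws) =
          s a (cf F (\<lambda>ys. f ((degree (z # u), F (z # u)) # ys)) (w @ (n, x) # ws)) +
           cf F (\<lambda>ys. f ((degree (z # u), F (z # u)) # ys)) (w @ (n, y) # ws)"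
          by (intro less.IH) (use u z Cons less.prems in auto)
      qed
      have B: "dec (\<lambda>u w. cf F (\<lambda>ys. f ((degree ((z # us') @ (n, smul A a x + y) # u), F ((z # us') @ (n, smul A a x + y) # u)) # ys)) w) ws =
        s a (dec (\<lambda>u w. cf F (\<lambda>ys. f ((degree ((z # us') @ (n, x) # u), F ((z # us') @ (n, x) # u)) # ys)) w) ws) +
         dec (\<lambda>u w. cf F (\<lambda>ys. f ((degree ((z # us') @ (n, y) # u), F ((z # us') @ (n, y) # u)) # ys)) w) ws"
        by (rule dec_lin[OF ml], rule blk) (use less.prems z in auto)
      show ?thesis using A B by (simp add: Cons cf_Cons dec_append_Cons q ac_simps)
    qed
  qed
  then show ?thesis using assms(2) gfamD(1)[OF assms(1)] by (simp add: mlin_def)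
qed

lemma cd_gfam:
  assumes "gfam A A (-1) b" "gfam A B e f" "e' = e - 1"
  shows "gfam A B e' (cd b f)"
  using cd_mlin[OF assms(1) gfamD(4)[OF assms(2)]] cd_mem[OF gfam_maps_to[OF assms(1)] assms(2)]
    gfamD(2)[OF assms(2)] assms(3) by (auto simp: gfam_def algebra_simps)

lemma cf_gfam:
  assumes "gfam A B 0 F" "gfam B C e f"
  shows "gfam A C e (cf F f)"
  using cf_mlin[OF assms(1) gfamD(4)[OF assms(2)]] cf_mem[OF gfam_maps_to[OF assms(1)] assms(2)]
    gfamD(2)[OF assms(2)] by (auto simp: gfam_def)

text \<open>Coalgebra maps compose, and \<open>cf F G\<close> is the corestriction of the composite:
  the blocks of \<open>F\<close> that enter the first block of \<open>G\<close> are collected, and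
  the value of that block is pulled out by additivity.\<close>

lemma cf_cf:
  assumes "gfam A B 0 F" "gfam B C 0 G"
  shows "mlin C s f \<Longrightarrow> xs \<in> tlists A \<Longrightarrow> cf F (cf G f) xs = cf (cf F G) f xs"
proof (induction xs arbitrary: f rule: measure_induct_rule[where f = length])
  case (less xs)
  note mF = gfam_maps_to[OF assms(1)]
  have GF: "gfam A C 0 (cf F G)" by (rule cf_gfam[OF assms])
  show ?case
  proof (cases xs)
    case (Cons x xs')
    have x: "snd x \<in> piece A (fst x)" "xs' \<in> tlists A" using less.prems Cons by auto
    define y where "y u = (degree (x # u), F (x # u))" for u
    \<comment> \<open>\<open>L v t X\<close> is the contribution in which the letters
      \<open>x # v\<close> end up in a single first letter \<open>X\<close> while \<open>t\<close>
      is still to be mapped. It is additive in \<open>X\<close>.\<close>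
    define L where "L v t X = cf (cf F G) (\<lambda>zs. f ((degree (x # v), X) # zs)) t" for v t X
    have "cf F (cf G f) (x # xs') =
      dec (\<lambda>u w. cf F (dec (\<lambda>a c. cf G (\<lambda>zs. f ((degree (y u # a), G (y u # a)) # zs)) c)) w) xs'"
      by (simp add: cf_Cons y_def)
    also have "\<dots> = dec (\<lambda>u w. dec (\<lambda>w1 w2. cf F (\<lambda>a. L (u @ w1) w2 (G (y u # a))) w1) w) xs'"
    proof (intro dec_cong refl)
      fix u w assume u: "u @ w = xs'"
      have yu: "snd (y u) \<in> piece B (fst (y u))" "fst (y u) = degree (x # u)"
        using gfam_mem[OF assms(1), of "x # u"] x u by (auto simp: y_def)
      have "cf F (\<lambda>a. cf F (\<lambda>c. cf G (\<lambda>zs. f ((degree (y u # a), G (y u # a)) # zs)) c) w2) w1 =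
        cf F (\<lambda>a. L (u @ w1) w2 (G (y u # a))) w1" if w: "w1 @ w2 = w" for w1 w2
      proof (rule cf_cong[OF mF])
        show "w1 \<in> tlists A" using u w x by auto
        fix a assume a: "a \<in> tlists B" "degree a = degree w1"
        have "mlin C s (\<lambda>zs. f ((degree (y u # a), G (y u # a)) # zs))"
          using gfam_mem[OF assms(2), of "y u # a"] yu a by (intro mlin_Cons less.prems) auto
        then show "cf F (cf G (\<lambda>zs. f ((degree (y u # a), G (y u # a)) # zs))) w2 = L (u @ w1) w2 (G (y u # a))"
          using u w x a yu by (subst less.IH) (auto simp: Cons L_def add.assoc)
      qed
      then show "cf F (dec (\<lambda>a c. cf G (\<lambda>zs. f ((degree (y u # a), G (y u # a)) # zs)) c)) w =
         dec (\<lambda>w1 w2. cf F (\<lambda>a. L (u @ w1) w2 (G (y u # a))) w1) w"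
        by (subst cf_dec) (intro dec_cong refl)
    qed
    \<comment> \<open>Regrouping: \<open>v\<close> now collects all letters that enter the first
      block of \<open>G\<close>, beyond those of its first inner block.\<close>
    also have "\<dots> = dec (\<lambda>v t. dec (\<lambda>u w1. cf F (\<lambda>a. L (u @ w1) t (G (y u # a))) w1) v) xs'"
      by (rule dec_assoc)
    also have "\<dots> = dec (\<lambda>v t. L v t (cf F G (x # v))) xs'"
    proof (intro dec_cong refl)
      fix v t assume v: "v @ t = xs'"
      then have T: "v \<in> tlists A" "t \<in> tlists A" using x by auto
      have L: "additive_on (piece C (degree (x # v))) (L v t)"
        unfolding L_def using less.prems(1) gfam_maps_to[OF GF] T(2) by (rule cf_additive_hd)
      have in1: "cf F (\<lambda>a. L (u @ w1) t (G (y u # a))) w1 = L v t (cf F (\<lambda>a. G (y u # a)) w1)"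
          "cf F (\<lambda>a. G (y u # a)) w1 \<in> piece C (degree (x # v))"
        if "u @ w1 = v" for u w1
      proof -
        have yu: "snd (y u) \<in> piece B (fst (y u))" "fst (y u) = degree (x # u)"
          using gfam_mem[OF assms(1), of "x # u"] x T that by (auto simp: y_def)
        have w1: "w1 \<in> tlists A" using T that by auto
        have "G (y u # a) \<in> piece C (degree (x # v))" if "a \<in> tlists B" "degree a = degree w1" for a
          by (intro gfam_mem[OF assms(2)]) (use that yu \<open>u @ w1 = v\<close> in auto)
        then show "cf F (\<lambda>a. L (u @ w1) t (G (y u # a))) w1 = L v t (cf F (\<lambda>a. G (y u # a)) w1)"
          "cf F (\<lambda>a. G (y u # a)) w1 \<in> piece C (degree (x # v))"
          using cf_hom[OF mF w1 L] that by auto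
      qed
      have "dec (\<lambda>u w1. cf F (\<lambda>a. L (u @ w1) t (G (y u # a))) w1) v =
        dec (\<lambda>u w1. L v t (cf F (\<lambda>a. G (y u # a)) w1)) v"
        by (intro dec_cong refl in1)
      also have "\<dots> = L v t (dec (\<lambda>u w1. cf F (\<lambda>a. G (y u # a)) w1) v)"
        by (rule dec_hom(1)[OF L, symmetric]) (rule in1)
      finally show "dec (\<lambda>u w1. cf F (\<lambda>a. L (u @ w1) t (G (y u # a))) w1) v = L v t (cf F G (x # v))"
        by (simp add: cf_Cons y_def)
    qed
    finally show ?thesis by (simp add: Cons cf_Cons L_def)
  qed simp
qed

text \<open>
  Bianchi identities: the first nonvanishing component of the curvature \<open>cd b b\<close> is a cycle, and up
  to sign its image under \<open>F\<close> is the boundary of that of the defect \<open>mdef b \<beta> F\<close>.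
\<close>

lemma cd_cd:
  assumes "gfam A A (-1) b"
  shows "mlin A s f \<Longrightarrow> xs \<in> tlists A \<Longrightarrow> xs \<noteq> [] \<Longrightarrow>
    (\<And>ys. ys \<in> tlists A \<Longrightarrow> length ys < length xs \<Longrightarrow> cd b b ys = 0) \<Longrightarrow>
    cd b (cd b f) xs = f [(degree xs - 2, cd b b xs)]"
proof (induction xs arbitrary: f)
  case (Cons x xs)
  note m = gfam_maps_to[OF assms]
  have x: "snd x \<in> piece A (fst x)" "xs \<in> tlists A" using Cons.prems by auto
  note fx = mlin_Cons[OF Cons.prems(1) x(1)]
  define y where "y u = (degree (x # u) - 1, b (x # u))" for u
  define L where "L v t X = f ((degree (x # v) - 2, X) # t)" for v t X
  have tail: "cd b (cd b (\<lambda>ys. f (x # ys))) xs = 0"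
  proof (cases "xs = []")
    case False
    then have "cd b (cd b (\<lambda>ys. f (x # ys))) xs = f (x # [(degree xs - 2, cd b b xs)])"
      using Cons.prems by (intro Cons.IH[OF fx]) auto
    also have "cd b b xs = 0" using Cons.prems x by simp
    also have "f (x # [(degree xs - 2, 0)]) = 0"
      using mlin_0[OF Cons.prems(1), of "[x]" "[]"] x by simp
    finally show ?thesis .
  qed simp
  have "cd b (cd b f) (x # xs) = cd b (cd b (\<lambda>ys. f (x # ys))) xs +
     sg (fst x) (dec (\<lambda>u w. cd b (\<lambda>v. f (y v # w)) u + sg (degree u) (cd b (\<lambda>w. f (y u # w)) w)) xs) +
     dec (\<lambda>u w. - sg (degree (x # u)) (cd b (\<lambda>ys. f (y u # ys)) w) +
        dec (\<lambda>s t. f ((degree (y u # s) - 1, b (y u # s)) # t)) w) xs"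
    by (simp add: cd_Cons cd_add cd_sg cd_dec y_def sg_add)
  \<comment> \<open>The two orders of acting on disjoint blocks differ in sign, because the
    coderivation is odd, and cancel. Left are the nested terms, in which the second block swallows
    the value of the first.\<close>
  also have "\<dots> = dec (\<lambda>v t. sg (fst x) (cd b (\<lambda>a. f (y a # t)) v)) xs
     + dec (\<lambda>v t. dec (\<lambda>u s. f ((degree (y u # s) - 1, b (y u # s)) # t)) v) xs"
    by (subst dec_assoc[symmetric]) (simp add: tail dec_add dec_diff dec_sg sg_add dec_uminus sg_plus_exp)
  also have "\<dots> = dec (\<lambda>v t. L v t (cd b b (x # v))) xs"
    unfolding dec_add[symmetric]
  proof (intro dec_cong refl)
    fix v t assume v: "v @ t = xs"
    then have T: "v \<in> tlists A" "t \<in> tlists A" using x by auto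
    have L: "additive_on (piece A (degree (x # v) - 2)) (L v t)"
      unfolding L_def using Cons.prems(1) T(2) by (rule mlin_additive_hd)
    have mem: "b (x # a) \<in> piece A (degree (x # v) - 2)" if "a \<in> tlists A" "degree a = degree v - 1" for a
      by (intro gfam_mem[OF assms]) (use x that in auto)
    have "cd b (\<lambda>a. f (y a # t)) v = cd b (\<lambda>a. L v t (b (x # a))) v"
      by (rule cd_cong[OF m T(1)]) (simp add: y_def L_def)
    also have "\<dots> = L v t (cd b (\<lambda>a. b (x # a)) v)"
      by (rule cd_hom(1)[OF m T(1) L, symmetric]) (rule mem)
    finally have 1: "cd b (\<lambda>a. f (y a # t)) v = L v t (cd b (\<lambda>a. b (x # a)) v)" .
    have mem1: "cd b (\<lambda>a. b (x # a)) v \<in> piece A (degree (x # v) - 2)"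
      by (rule cd_hom(2)[OF m T(1) L]) (rule mem)
    have mem2: "b (y u # s) \<in> piece A (degree (x # v) - 2)" if "u @ s = v" for u s
      using gfam_mem[OF assms, of "y u # s"] gfam_mem[OF assms, of "x # u"] that x T by (auto simp: y_def)
    have "dec (\<lambda>u s. f ((degree (y u # s) - 1, b (y u # s)) # t)) v = dec (\<lambda>u s. L v t (b (y u # s))) v"
      by (intro dec_cong refl) (auto simp: L_def y_def algebra_simps)
    also have "\<dots> = L v t (dec (\<lambda>u s. b (y u # s)) v)"
      by (rule dec_hom(1)[OF L, symmetric]) (rule mem2)
    finally have 2: "dec (\<lambda>u s. f ((degree (y u # s) - 1, b (y u # s)) # t)) v = L v t (dec (\<lambda>u s. b (y u # s)) v)" .
    have mem3: "dec (\<lambda>u s. b (y u # s)) v \<in> piece A (degree (x # v) - 2)"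
      by (rule dec_hom(2)[OF L]) (rule mem2)
    show "sg (fst x) (cd b (\<lambda>a. f (y a # t)) v) + dec (\<lambda>u s. f ((degree (y u # s) - 1, b (y u # s)) # t)) v
      = L v t (cd b b (x # v))"
      using L mem1 mem3 additive_on_simps(3,4)[OF L mem1] unfolding 1 2 cd_Cons y_def[symmetric]
      by (simp add: additive_on_def)
  qed
  \<comment> \<open>The curvature of a proper prefix vanishes by hypothesis, so only the block that
    takes the whole list survives.\<close>
  also have "\<dots> = L xs [] (cd b b (x # xs))"
  proof (rule dec_last)
    fix v t assume v: "v @ t = xs" "t \<noteq> []"
    then have "cd b b (x # v) = 0" using Cons.prems by auto
    then show "L v t (cd b b (x # v)) = 0"
      using v x by (auto simp: L_def intro: mlin_0_hd[OF Cons.prems(1)])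
  qed
  finally show ?case by (simp add: L_def)
qed simp

text \<open>Later conditions ask for its vanishing on nonempty lists only, since
  \<open>cf F \<beta> []\<close> is the unconstrained value \<open>\<beta> []\<close>.\<close>

definition mdef ::
  "((int \<times> 'a) list \<Rightarrow> 'a) \<Rightarrow> ((int \<times> 'b) list \<Rightarrow> 'b::ab_group_add) \<Rightarrow> ((int \<times> 'a) list \<Rightarrow> 'b) \<Rightarrow> (int \<times> 'a) list \<Rightarrow> 'b" where
  "mdef b \<beta> F xs = cf F \<beta> xs - cd b F xs"

text \<open>The commutator of the coalgebra map with the coderivations is determined by its
  corestriction, the defect: it applies the defect to one block and \<open>F\<close> to the blocks
  around it. As the defect vanishes in lower arity, only the block that takes all of
  \<open>xs\<close> is left.\<close>

lemma cf_cd: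
  assumes "gfam A A (-1) b" "gfam B B (-1) \<beta>" "gfam A B 0 F"
  shows "mlin B s f \<Longrightarrow> xs \<in> tlists A \<Longrightarrow> xs \<noteq> [] \<Longrightarrow>
    (\<And>ys. ys \<in> tlists A \<Longrightarrow> length ys < length xs \<Longrightarrow> ys \<noteq> [] \<Longrightarrow> mdef b \<beta> F ys = 0) \<Longrightarrow>
    cf F (cd \<beta> f) xs - cd b (cf F f) xs = f [(degree xs - 1, mdef b \<beta> F xs)]"
proof (induction xs arbitrary: f rule: measure_induct_rule[where f = length])
  case (less xs0)
  then obtain x xs where Cons: "xs0 = x # xs" by (cases xs0) auto
  note mb = gfam_maps_to[OF assms(1)] and mF = gfam_maps_to[OF assms(3)]
  have x: "snd x \<in> piece A (fst x)" "xs \<in> tlists A" using less.prems Cons by auto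
  define y where "y u = (degree (x # u), F (x # u))" for u
  define z where "z u = (degree (x # u) - 1, b (x # u))" for u
  define L where "L v t X = cf F (\<lambda>ys. f ((degree (x # v) - 1, X) # ys)) t" for v t X
  have yu: "snd (y u) \<in> piece B (fst (y u))" "fst (y u) = degree (x # u)" if "u \<in> tlists A" for u
    using gfam_mem[OF assms(3), of "x # u"] x that by (auto simp: y_def)
  have zu: "snd (z u) \<in> piece A (fst (z u))" "fst (z u) = degree (x # u) - 1" if "u \<in> tlists A" for u
    using gfam_mem[OF assms(1), of "x # u"] x that by (auto simp: z_def)
  \<comment> \<open>Behind the first block the list is shorter, so the induction hypothesis gives a
    value of the defect, and that value vanishes.\<close>
  have tail: "cf F (cd \<beta> (\<lambda>ys. f (y u # ys))) w = cd b (cf F (\<lambda>ys. f (y u # ys))) w" if u: "u @ w = xs" for u w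
  proof (cases "w = []")
    case False
    have T: "u \<in> tlists A" "w \<in> tlists A" using u x by auto
    have fy: "mlin B s (\<lambda>ys. f (y u # ys))" by (rule mlin_Cons[OF less.prems(1) yu(1)[OF T(1)]])
    have "cf F (cd \<beta> (\<lambda>ys. f (y u # ys))) w - cd b (cf F (\<lambda>ys. f (y u # ys))) w =
       f (y u # [(degree w - 1, mdef b \<beta> F w)])"
      using u by (intro less.IH fy T False less.prems(4)) (auto simp: Cons)
    also have "mdef b \<beta> F w = 0" using u T False by (intro less.prems(4)) (auto simp: Cons)
    also have "f (y u # [(degree w - 1, 0)]) = 0"
      using mlin_0[OF less.prems(1), of "[y u]" "[]"] yu[OF T(1)] by simp
    finally show ?thesis by simp
  qed simp
  have L: "additive_on (piece B (degree (x # v) - 1)) (L v t)" if "t \<in> tlists A" for v t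
    unfolding L_def by (rule cf_additive_hd[OF less.prems(1) mF that])
  have "cf F (cd \<beta> f) xs0 = dec (\<lambda>u w. sg (degree (x # u)) (cf F (cd \<beta> (\<lambda>ys. f (y u # ys))) w)) xs +
      dec (\<lambda>u w. dec (\<lambda>w1 w2. cf F (\<lambda>s. cf F (\<lambda>t. f ((degree (y u # s) - 1, \<beta> (y u # s)) # t)) w2) w1) w) xs"
    unfolding Cons cf_Cons y_def[symmetric] cd_Cons cf_add cf_sg cf_dec dec_add by (simp add: y_def)
  also have "dec (\<lambda>u w. dec (\<lambda>w1 w2. cf F (\<lambda>s. cf F (\<lambda>t. f ((degree (y u # s) - 1, \<beta> (y u # s)) # t)) w2) w1) w) xs
     = dec (\<lambda>v t. L v t (cf F \<beta> (x # v))) xs"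
    unfolding dec_assoc
  proof (intro dec_cong refl)
    fix v t assume v: "v @ t = xs"
    then have T: "v \<in> tlists A" "t \<in> tlists A" using x by auto
    have mem: "\<beta> (y u # s) \<in> piece B (degree (x # v) - 1)" if "u @ w = v" "s \<in> tlists B" "degree s = degree w" for u w s
    proof -
      have "u \<in> tlists A" using that T by auto
      from yu[OF this] show ?thesis using that by (intro gfam_mem[OF assms(2)]) auto
    qed
    have in1: "cf F (\<lambda>s. cf F (\<lambda>t. f ((degree (y u # s) - 1, \<beta> (y u # s)) # t)) t) w = L v t (cf F (\<lambda>s. \<beta> (y u # s)) w)"
      "cf F (\<lambda>s. \<beta> (y u # s)) w \<in> piece B (degree (x # v) - 1)" if uw: "u @ w = v" for u w
    proof -
      have w: "w \<in> tlists A" "u \<in> tlists A" using uw T by auto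
      have "cf F (\<lambda>s. cf F (\<lambda>t. f ((degree (y u # s) - 1, \<beta> (y u # s)) # t)) t) w = cf F (\<lambda>s. L v t (\<beta> (y u # s))) w"
        by (rule cf_cong[OF mF w(1)]) (use uw yu(2)[OF w(2)] in \<open>auto simp: L_def add.assoc\<close>)
      also have "\<dots> = L v t (cf F (\<lambda>s. \<beta> (y u # s)) w)"
        by (rule cf_hom(1)[OF mF w(1) L[OF T(2)], symmetric]) (use mem[OF uw] in auto)
      finally show "cf F (\<lambda>s. cf F (\<lambda>t. f ((degree (y u # s) - 1, \<beta> (y u # s)) # t)) t) w = L v t (cf F (\<lambda>s. \<beta> (y u # s)) w)" .
      show "cf F (\<lambda>s. \<beta> (y u # s)) w \<in> piece B (degree (x # v) - 1)"
        by (rule cf_hom(2)[OF mF w(1) L[OF T(2)]]) (use mem[OF uw] in auto)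
    qed
    have "dec (\<lambda>u w. cf F (\<lambda>s. cf F (\<lambda>t. f ((degree (y u # s) - 1, \<beta> (y u # s)) # t)) t) w) v =
       dec (\<lambda>u w. L v t (cf F (\<lambda>s. \<beta> (y u # s)) w)) v"
      by (intro dec_cong refl in1)
    also have "\<dots> = L v t (dec (\<lambda>u w. cf F (\<lambda>s. \<beta> (y u # s)) w) v)"
      by (rule dec_hom(1)[OF L[OF T(2)], symmetric]) (rule in1)
    finally show "dec (\<lambda>u w. cf F (\<lambda>s. cf F (\<lambda>t. f ((degree (y u # s) - 1, \<beta> (y u # s)) # t)) t) w) v = L v t (cf F \<beta> (x # v))"
      by (simp add: cf_Cons y_def)
  qed
  finally have 1: "cf F (cd \<beta> f) xs0 = dec (\<lambda>u w. sg (degree (x # u)) (cf F (cd \<beta> (\<lambda>ys. f (y u # ys))) w)) xs +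
    dec (\<lambda>v t. L v t (cf F \<beta> (x # v))) xs" .
  have "cd b (cf F f) xs0 = sg (fst x) (dec (\<lambda>u w. cd b (\<lambda>a. cf F (\<lambda>ys. f (y a # ys)) w) u +
       sg (degree u) (cd b (cf F (\<lambda>ys. f (y u # ys))) w)) xs) +
     dec (\<lambda>u w. dec (\<lambda>s t. cf F (\<lambda>ys. f ((degree (z u # s), F (z u # s)) # ys)) t) w) xs"
    unfolding Cons cd_Cons cf_Cons y_def[symmetric] z_def[symmetric] cd_dec by simp
  also have "\<dots> = dec (\<lambda>u w. sg (degree (x # u)) (cd b (cf F (\<lambda>ys. f (y u # ys))) w)) xs +
     dec (\<lambda>v t. sg (fst x) (cd b (\<lambda>a. cf F (\<lambda>ys. f (y a # ys)) t) v) +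
       dec (\<lambda>u s. cf F (\<lambda>ys. f ((degree (z u # s), F (z u # s)) # ys)) t) v) xs"
    unfolding dec_assoc dec_add by (simp add: dec_add sg_add dec_sg sg_plus_exp)
  also have "dec (\<lambda>v t. sg (fst x) (cd b (\<lambda>a. cf F (\<lambda>ys. f (y a # ys)) t) v) +
       dec (\<lambda>u s. cf F (\<lambda>ys. f ((degree (z u # s), F (z u # s)) # ys)) t) v) xs =
    dec (\<lambda>v t. L v t (cd b F (x # v))) xs"
  proof (intro dec_cong refl)
    fix v t assume v: "v @ t = xs"
    then have T: "v \<in> tlists A" "t \<in> tlists A" using x by auto
    have mem: "F (x # a) \<in> piece B (degree (x # v) - 1)" if "a \<in> tlists A" "degree a = degree v - 1" for a
      by (intro gfam_mem[OF assms(3)]) (use x that in auto)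
    have "cd b (\<lambda>a. cf F (\<lambda>ys. f (y a # ys)) t) v = cd b (\<lambda>a. L v t (F (x # a))) v"
      by (rule cd_cong[OF mb T(1)]) (simp add: y_def L_def add_diff_eq)
    also have "\<dots> = L v t (cd b (\<lambda>a. F (x # a)) v)"
      by (rule cd_hom(1)[OF mb T(1) L[OF T(2)], symmetric]) (rule mem)
    finally have 1: "cd b (\<lambda>a. cf F (\<lambda>ys. f (y a # ys)) t) v = L v t (cd b (\<lambda>a. F (x # a)) v)" .
    have mem1: "cd b (\<lambda>a. F (x # a)) v \<in> piece B (degree (x # v) - 1)"
      by (rule cd_hom(2)[OF mb T(1) L[OF T(2)]]) (rule mem)
    have mem2: "F (z u # s) \<in> piece B (degree (x # v) - 1)" if "u @ s = v" for u s
      by (intro gfam_mem[OF assms(3)]) (use zu[of u] that T in auto)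
    have "dec (\<lambda>u s. cf F (\<lambda>ys. f ((degree (z u # s), F (z u # s)) # ys)) t) v = dec (\<lambda>u s. L v t (F (z u # s))) v"
      by (intro dec_cong refl) (auto simp: L_def z_def algebra_simps)
    also have "\<dots> = L v t (dec (\<lambda>u s. F (z u # s)) v)"
      by (rule dec_hom(1)[OF L[OF T(2)], symmetric]) (rule mem2)
    finally have 2: "dec (\<lambda>u s. cf F (\<lambda>ys. f ((degree (z u # s), F (z u # s)) # ys)) t) v = L v t (dec (\<lambda>u s. F (z u # s)) v)" .
    have mem3: "dec (\<lambda>u s. F (z u # s)) v \<in> piece B (degree (x # v) - 1)"
      by (rule dec_hom(2)[OF L[OF T(2)]]) (rule mem2)
    show "sg (fst x) (cd b (\<lambda>a. cf F (\<lambda>ys. f (y a # ys)) t) v) +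
       dec (\<lambda>u s. cf F (\<lambda>ys. f ((degree (z u # s), F (z u # s)) # ys)) t) v = L v t (cd b F (x # v))"
      using L[OF T(2), of v] mem1 mem3 additive_on_simps(3,4)[OF L[OF T(2), of v] mem1] unfolding 1 2 cd_Cons z_def[symmetric]
      by (simp add: additive_on_def)
  qed
  finally have 2: "cd b (cf F f) xs0 = dec (\<lambda>u w. sg (degree (x # u)) (cd b (cf F (\<lambda>ys. f (y u # ys))) w)) xs +
    dec (\<lambda>v t. L v t (cd b F (x # v))) xs" .
  have 3: "dec (\<lambda>u w. sg (degree (x # u)) (cf F (cd \<beta> (\<lambda>ys. f (y u # ys))) w)) xs =
    dec (\<lambda>u w. sg (degree (x # u)) (cd b (cf F (\<lambda>ys. f (y u # ys))) w)) xs"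
    by (intro dec_cong refl) (simp add: tail)
  have "cf F (cd \<beta> f) xs0 - cd b (cf F f) xs0 = dec (\<lambda>v t. L v t (mdef b \<beta> F (x # v))) xs"
    unfolding 1 2 3 add_diff_cancel_left dec_diff[symmetric]
  proof (intro dec_cong refl)
    fix v t assume v: "v @ t = xs"
    then have T: "v \<in> tlists A" "t \<in> tlists A" using x by auto
    note LL = L[OF T(2), of v]
    have m: "cf F \<beta> (x # v) \<in> piece B (degree (x # v) - 1)" "cd b F (x # v) \<in> piece B (degree (x # v) - 1)"
      by (rule cf_mem[OF mF assms(2)] cd_mem[OF mb assms(3)]; use x T in simp)+
    then have m': "- cd b F (x # v) \<in> piece B (degree (x # v) - 1)" using LL by (auto simp: additive_on_def)
    have "L v t (cf F \<beta> (x # v) + - cd b F (x # v)) = L v t (cf F \<beta> (x # v)) + - L v t (cd b F (x # v))"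
      using LL m(1) m' additive_on_simps(2)[OF LL m(2)] unfolding additive_on_def by metis
    then show "L v t (cf F \<beta> (x # v)) - L v t (cd b F (x # v)) = L v t (mdef b \<beta> F (x # v))"
      by (simp add: mdef_def)
  qed
  also have "\<dots> = L xs [] (mdef b \<beta> F (x # xs))"
  proof (rule dec_last)
    fix v t assume v: "v @ t = xs" "t \<noteq> []"
    then have T: "v \<in> tlists A" "t \<in> tlists A" using x by auto
    have "mdef b \<beta> F (x # v) = 0" using x v T by (intro less.prems(4)) (auto simp: Cons)
    then show "L v t (mdef b \<beta> F (x # v)) = 0"
      using additive_on_simps(1)[OF L[OF T(2)]] by simp
  qed
  finally show ?case by (simp add: L_def Cons)
qed

text \<open>Corestriction of the identity of the tensor coalgebra. Used as a functional it projects
  to arity one, so that \<open>cd b idn\<close> and \<open>cf F idn\<close> give back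
  \<open>b\<close> and \<open>F\<close> on nonempty lists.\<close>

definition idn :: "(int \<times> 'a::zero) list \<Rightarrow> 'a" where
  "idn xs = (if length xs = 1 then snd (hd xs) else 0)"

lemma idn_simps [simp]:
  "idn [z] = snd z" "idn [] = 0" "idn (x # y # zs) = 0" "xs \<noteq> [] \<Longrightarrow> idn (x # xs) = 0"
  by (simp_all add: idn_def)

lemma gfam_idn:
  assumes "graded_module A"
  shows "gfam A A 0 idn"
  unfolding gfam_def mlin_def
proof (intro conjI ballI allI impI)
  show "idn (us @ (n, smul A a x + y) # ws) = smul A a (idn (us @ (n, x) # ws)) + idn (us @ (n, y) # ws)" for us ws n a x y
    using qmodule_simps[OF graded_qmodule[OF assms]] by (cases us; cases ws) (simp_all add: idn_def)
  show "idn xs \<in> piece A (degree xs + 0)" if "xs \<in> tlists A" "xs \<noteq> []" for xs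
    using that graded_zero[OF assms] by (cases xs; cases "tl xs") auto
qed (use assms graded_qmodule in auto)

lemma cd_0: "maps_to A A (-1) b \<Longrightarrow> xs \<in> tlists A \<Longrightarrow> (\<And>ys. ys \<in> tlists A \<Longrightarrow> ys \<noteq> [] \<Longrightarrow> f ys = 0) \<Longrightarrow> cd b f xs = 0"
  using cd_cong[of A b xs f "\<lambda>_. 0"] by (simp add: cd_def split_def)

lemma cf_0: "maps_to A B 0 F \<Longrightarrow> xs \<in> tlists A \<Longrightarrow>
   (\<And>ys. ys \<in> tlists B \<Longrightarrow> (ys = [] \<longleftrightarrow> xs = []) \<Longrightarrow> f ys = 0) \<Longrightarrow> cf F f xs = 0"
  using cf_cong[of A B F xs f "\<lambda>_. 0"] by (simp add: cf_def)

lemma cd_idn: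
  assumes "maps_to A A (-1) b" "xs \<in> tlists A" "xs \<noteq> []"
  shows "cd b idn xs = b xs"
proof -
  obtain x xs' where x: "xs = x # xs'" using assms(3) by (cases xs) auto
  have "cd b (\<lambda>ys. idn (x # ys)) xs' = 0" using assms by (intro cd_0[OF assms(1)]) (auto simp: x)
  moreover have "dec (\<lambda>u w. idn ((degree (x # u) - 1, b (x # u)) # w)) xs' = b (x # xs')"
    by (subst dec_last) auto
  ultimately show ?thesis unfolding x cd_Cons by simp
qed

lemma cf_to_idn:
  assumes "maps_to A B 0 F" "xs \<in> tlists A" "xs \<noteq> []"
  shows "cf F idn xs = F xs"
proof -
  obtain x xs' where x: "xs = x # xs'" using assms(3) by (cases xs) auto
  have "dec (\<lambda>u w. cf F (\<lambda>ys. idn ((degree (x # u), F (x # u)) # ys)) w) xs' = F (x # xs')"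
  proof (subst dec_last)
    show "cf F (\<lambda>ys. idn ((degree (x # u), F (x # u)) # ys)) w = 0" if "u @ w = xs'" "w \<noteq> []" for u w
      using assms that by (intro cf_0[OF assms(1)]) (auto simp: x)
  qed simp
  then show ?thesis unfolding x cf_Cons .
qed

lemma cf_idn: "mlin A s f \<Longrightarrow> xs \<in> tlists A \<Longrightarrow> cf idn f xs = f xs"
proof (induction xs arbitrary: f)
  case (Cons x xs)
  have x: "snd x \<in> piece A (fst x)" "xs \<in> tlists A" using Cons.prems by auto
  note idn_mt = gfam_maps_to[OF gfam_idn[OF mlinD(1)[OF Cons.prems(1)]]]
  have "dec (\<lambda>u w. cf idn (\<lambda>ys. f ((degree (x # u), idn (x # u)) # ys)) w) xs = cf idn (\<lambda>ys. f (x # ys)) xs"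
  proof (subst dec_first)
    fix u w assume "u @ w = xs" "u \<noteq> []"
    then show "cf idn (\<lambda>ys. f ((degree (x # u), idn (x # u)) # ys)) w = 0"
      using x by (intro cf_0[OF idn_mt]) (auto intro: mlin_0_hd[OF Cons.prems(1)])
  qed (simp_all add: degree_def)
  then show ?case using Cons.IH[OF mlin_Cons[OF Cons.prems(1) x(1)] x(2)] by (simp add: cf_Cons)
qed simp

section \<open>Dependence on the corestriction, and the arity one part\<close>

lemma cds_eq:
  "xs \<in> tlists A \<Longrightarrow> (\<And>ys. ys \<in> tlists A \<Longrightarrow> length ys \<le> length xs \<Longrightarrow> ys \<noteq> [] \<Longrightarrow> b ys = c ys) \<Longrightarrow> cds b xs = cds c xs"
proof (induction xs)
  case (Cons x xs)
  have "map (\<lambda>(u, w). (0 :: int, (degree (x # u) - 1, b (x # u)) # w)) (decs xs) =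
    map (\<lambda>(u, w). (0, (degree (x # u) - 1, c (x # u)) # w)) (decs xs)"
    using Cons.prems by (intro map_cong) (auto simp: set_decs)
  then show ?case using Cons by simp
qed simp

lemma cfs_eq:
  "xs \<in> tlists A \<Longrightarrow> (\<And>ys. ys \<in> tlists A \<Longrightarrow> length ys \<le> length xs \<Longrightarrow> ys \<noteq> [] \<Longrightarrow> F ys = G ys) \<Longrightarrow> cfs F xs = cfs G xs"
proof (induction xs rule: measure_induct_rule[where f = length])
  case (less xs)
  show ?case
  proof (cases xs)
    case (Cons x xs')
    have "map (\<lambda>(u, w). map (\<lambda>ys. (degree (x # u), F (x # u)) # ys) (cfs F w)) (decs xs') =
      map (\<lambda>(u, w). map (\<lambda>ys. (degree (x # u), G (x # u)) # ys) (cfs G w)) (decs xs')"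
    proof (intro map_cong refl, clarify)
      fix u w assume "(u, w) \<in> set (decs xs')"
      then have u: "u @ w = xs'" by (simp add: set_decs)
      have "cfs F w = cfs G w" using u less.prems by (intro less.IH) (auto simp: Cons)
      moreover have "F (x # u) = G (x # u)" using u less.prems by (auto simp: Cons)
      ultimately show "map (\<lambda>ys. (degree (x # u), F (x # u)) # ys) (cfs F w) =
        map (\<lambda>ys. (degree (x # u), G (x # u)) # ys) (cfs G w)" by simp
    qed
    then show ?thesis unfolding Cons cfs.simps by (rule arg_cong[where f = concat])
  qed simp
qed

lemma cd_eq: "xs \<in> tlists A \<Longrightarrow> (\<And>ys. ys \<in> tlists A \<Longrightarrow> length ys \<le> length xs \<Longrightarrow> ys \<noteq> [] \<Longrightarrow> b ys = c ys) \<Longrightarrow> cd b f xs = cd c f xs"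
  using cds_eq[of xs A b c] by (simp add: cd_def)

lemma cf_eq: "xs \<in> tlists A \<Longrightarrow> (\<And>ys. ys \<in> tlists A \<Longrightarrow> length ys \<le> length xs \<Longrightarrow> ys \<noteq> [] \<Longrightarrow> F ys = G ys) \<Longrightarrow> cf F f xs = cf G f xs"
  using cfs_eq[of xs A F G] by (simp add: cf_def)

text \<open>Only the summand whose block is the whole list sees the component of top arity. A change
  of that component is therefore felt only through the arity one part of \<open>f\<close>.\<close>

lemma cd_change:
  assumes "xs \<in> tlists A" "xs \<noteq> []" "\<And>ys. length ys < length xs \<Longrightarrow> b ys = c ys"
  shows "cd b f xs = cd c f xs + f [(degree xs - 1, b xs)] - f [(degree xs - 1, c xs)]"
proof -
  obtain x xs' where x: "xs = x # xs'" using assms(2) by (cases xs) auto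
  have 1: "cd b (\<lambda>ys. f (x # ys)) xs' = cd c (\<lambda>ys. f (x # ys)) xs'"
    using assms by (intro cd_eq) (auto simp: x)
  have "dec (\<lambda>u w. f ((degree (x # u) - 1, b (x # u)) # w) - f ((degree (x # u) - 1, c (x # u)) # w)) xs'
     = f [(degree xs - 1, b xs)] - f [(degree xs - 1, c xs)]"
    by (subst dec_last) (use assms(3) in \<open>auto simp: x\<close>)
  then show ?thesis unfolding x cd_Cons 1 dec_diff by (simp add: algebra_simps)
qed

lemma cf_change:
  assumes "xs \<in> tlists A" "xs \<noteq> []" "\<And>ys. length ys < length xs \<Longrightarrow> F ys = G ys"
  shows "cf F f xs = cf G f xs + f [(degree xs, F xs)] - f [(degree xs, G xs)]"
proof -
  obtain x xs' where x: "xs = x # xs'" using assms(2) by (cases xs) auto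
  have "dec (\<lambda>u w. cf F (\<lambda>ys. f ((degree (x # u), F (x # u)) # ys)) w - cf G (\<lambda>ys. f ((degree (x # u), G (x # u)) # ys)) w) xs'
     = f [(degree xs, F xs)] - f [(degree xs, G xs)]"
  proof (subst dec_last)
    fix u w assume u: "u @ w = xs'" "w \<noteq> []"
    have "F (x # u) = G (x # u)" using u assms by (auto simp: x)
    moreover have "cf F (\<lambda>ys. f ((degree (x # u), G (x # u)) # ys)) w = cf G (\<lambda>ys. f ((degree (x # u), G (x # u)) # ys)) w"
      using u assms by (intro cf_eq) (auto simp: x)
    ultimately show "cf F (\<lambda>ys. f ((degree (x # u), F (x # u)) # ys)) w - cf G (\<lambda>ys. f ((degree (x # u), G (x # u)) # ys)) w = 0"
      by simp
  qed (simp_all add: x)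
  then show ?thesis unfolding x cf_Cons dec_diff by (simp add: algebra_simps)
qed

text \<open>\<open>f\<close> after the Koszul differential of the tensor powers of the complex with
  differential \<open>d\<close>.\<close>

primrec dd :: "(int \<Rightarrow> 'a \<Rightarrow> 'a) \<Rightarrow> ((int \<times> 'a) list \<Rightarrow> 'c::ab_group_add) \<Rightarrow> (int \<times> 'a) list \<Rightarrow> 'c" where
  "dd d f [] = 0"
| "dd d f (x # xs) = sg (fst x) (dd d (\<lambda>ys. f (x # ys)) xs) + f ((fst x - 1, d (fst x) (snd x)) # xs)"

text \<open>A block of two or more letters shortens the list, and there \<open>f\<close> vanishes.
  What remains of the coderivation is its arity one part.\<close>

lemma cd_dd:
  assumes "maps_to A A (-1) b" "\<And>n x. x \<in> piece A n \<Longrightarrow> b [(n, x)] = d n x"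
  shows "xs \<in> tlists A \<Longrightarrow> (\<And>ys. ys \<in> tlists A \<Longrightarrow> ys \<noteq> [] \<Longrightarrow> length ys < length xs \<Longrightarrow> f ys = 0) \<Longrightarrow> cd b f xs = dd d f xs"
proof (induction xs arbitrary: f)
  case (Cons x xs)
  have x: "snd x \<in> piece A (fst x)" "xs \<in> tlists A" using Cons.prems by auto
  have 1: "cd b (\<lambda>ys. f (x # ys)) xs = dd d (\<lambda>ys. f (x # ys)) xs" 
    using x by (intro Cons.IH Cons.prems(2)) auto
  have "dec (\<lambda>u w. f ((degree (x # u) - 1, b (x # u)) # w)) xs = f ((fst x - 1, d (fst x) (snd x)) # xs)"
  proof (subst dec_first)
    fix u w assume u: "u @ w = xs" "u \<noteq> []"
    then show "f ((degree (x # u) - 1, b (x # u)) # w) = 0"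
      using x maps_toD[OF assms(1), of "x # u"] by (intro Cons.prems(2)) (auto simp: neq_Nil_conv)
  qed (use assms(2)[OF x(1)] in simp)
  then show ?case unfolding cd_Cons 1 by simp
qed simp


section \<open>Strict units\<close>

text \<open>
  Degrees are those of the suspension, so units have degree \<open>1\<close>.  The set \<open>U\<close> is a singleton
  in the strictly unital case and empty otherwise, which treats both cases at once.
\<close>

definition unital ::
  "('q, 'a::ab_group_add) graded \<Rightarrow> 'a set \<Rightarrow> ((int \<times> 'a) list \<Rightarrow> 'a) \<Rightarrow> bool" where
  "unital A U b \<longleftrightarrow> (\<forall>e\<in>U. e \<in> piece A 1 \<and> b [(1, e)] = 0 \<and>
     (\<forall>n. \<forall>x\<in>piece A n. b [(1, e), (n, x)] = x \<and> b [(n, x), (1, e)] = sg (n - 1) x) \<and>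
     (\<forall>us\<in>tlists A. \<forall>ws\<in>tlists A. 2 \<le> length us + length ws \<longrightarrow> b (us @ (1, e) # ws) = 0))"

definition unital_map ::
  "('q, 'a::ab_group_add) graded \<Rightarrow> 'a set \<Rightarrow> 'b set \<Rightarrow> ((int \<times> 'a) list \<Rightarrow> 'b::ab_group_add) \<Rightarrow> bool" where
  "unital_map A U V F \<longleftrightarrow> (\<forall>e\<in>U. F [(1, e)] \<in> V \<and>
     (\<forall>us\<in>tlists A. \<forall>ws\<in>tlists A. us @ ws \<noteq> [] \<longrightarrow> F (us @ (1, e) # ws) = 0))"

lemma unitalD:
  assumes "unital A U b" "e \<in> U"
  shows "e \<in> piece A 1" "b [(1, e)] = 0" "x \<in> piece A n \<Longrightarrow> b [(1, e), (n, x)] = x"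
    "x \<in> piece A n \<Longrightarrow> b [(n, x), (1, e)] = sg (n - 1) x"
    "us \<in> tlists A \<Longrightarrow> ws \<in> tlists A \<Longrightarrow> 2 \<le> length us + length ws \<Longrightarrow> b (us @ (1, e) # ws) = 0"
    "ws \<in> tlists A \<Longrightarrow> 2 \<le> length ws \<Longrightarrow> b ((1, e) # ws) = 0"
    "us \<in> tlists A \<Longrightarrow> ws \<in> tlists A \<Longrightarrow> snd z \<in> piece A (fst z) \<Longrightarrow> us @ ws \<noteq> [] \<Longrightarrow> b (z # us @ (1, e) # ws) = 0"
    "ws \<in> tlists A \<Longrightarrow> snd z \<in> piece A (fst z) \<Longrightarrow> ws \<noteq> [] \<Longrightarrow> b (z # (1, e) # ws) = 0"
proof -
  show *: "us \<in> tlists A \<Longrightarrow> ws \<in> tlists A \<Longrightarrow> 2 \<le> length us + length ws \<Longrightarrow> b (us @ (1, e) # ws) = 0" for us ws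
    using assms by (auto simp: unital_def)
  have len: "2 \<le> Suc (length us) + length ws" if "us @ ws \<noteq> []" for us ws :: "'x list"
    using that by (cases us; cases ws) auto
  show "us \<in> tlists A \<Longrightarrow> ws \<in> tlists A \<Longrightarrow> snd z \<in> piece A (fst z) \<Longrightarrow> us @ ws \<noteq> [] \<Longrightarrow> b (z # us @ (1, e) # ws) = 0"
    using *[of "z # us" ws] len[of us ws] by simp
  show "ws \<in> tlists A \<Longrightarrow> snd z \<in> piece A (fst z) \<Longrightarrow> ws \<noteq> [] \<Longrightarrow> b (z # (1, e) # ws) = 0"
    using *[of "[z]" ws] len[of "[]" ws] by simp
  show "ws \<in> tlists A \<Longrightarrow> 2 \<le> length ws \<Longrightarrow> b ((1, e) # ws) = 0"
    using *[of "[]" ws] by simp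
qed (use assms in \<open>auto simp: unital_def\<close>)

text \<open>As \<open>f\<close> kills units in arity above one, only products of the unit with a
  neighbouring letter can contribute. An inner unit has two neighbours and the two products cancel,
  by the sign in the right unit law; only a unit at an end of the list leaves a term.\<close>

lemma cd_unit:
  assumes b: "maps_to A A (-1) b" "unital A U b" "e \<in> U"
  shows "mlin A s f \<Longrightarrow>
    (\<And>us ws. us \<in> tlists A \<Longrightarrow> ws \<in> tlists A \<Longrightarrow> us @ ws \<noteq> [] \<Longrightarrow> f (us @ (1, e) # ws) = 0) \<Longrightarrow>
    us \<in> tlists A \<Longrightarrow> ws \<in> tlists A \<Longrightarrow>
    cd b f (us @ (1, e) # ws) =
      (if us = [] \<and> ws \<noteq> [] then f ws else 0) - (if us \<noteq> [] \<and> ws = [] then sg (degree us) (f us) else 0)"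
proof (induction us arbitrary: f)
  case Nil
  note e = unitalD[OF b(2,3)]
  have 1: "cd b (\<lambda>ys. f ((1, e) # ys)) ws = 0"
    using Nil.prems(2)[of "[]"] Nil.prems(4) by (intro cd_0[OF b(1)]) auto
  have "dec (\<lambda>u w. f ((degree ((1, e) # u) - 1, b ((1, e) # u)) # w)) ws = (if ws = [] then 0 else f ws)"
  proof (cases ws)
    case Nil
    then show ?thesis using e(2) mlin_0_hd[OF Nil.prems(1), of "[]"] by simp
  next
    case (Cons y ws')
    have y: "snd y \<in> piece A (fst y)" "ws' \<in> tlists A" using Cons Nil.prems by auto
    have "dec (\<lambda>u w. f ((degree ((1, e) # y # u) - 1, b ((1, e) # y # u)) # w)) ws' = f (y # ws')"
    proof (subst dec_first)
      fix u w assume u: "u @ w = ws'" "u \<noteq> []"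
      then have "b ((1, e) # y # u) = 0" using y by (intro e(6)) (auto simp: Suc_le_eq)
      then show "f ((degree ((1, e) # y # u) - 1, b ((1, e) # y # u)) # w) = 0"
        using u y mlin_0_hd[OF Nil.prems(1), of w] by auto
    qed (use e(3)[of "snd y" "fst y"] y in simp)
    then show ?thesis using e(2) mlin_0_hd[OF Nil.prems(1), of ws] Nil.prems by (simp add: Cons)
  qed
  then show ?case unfolding append_Nil cd_Cons 1 by simp
next
  case (Cons z us)
  note e = unitalD[OF b(2,3)]
  have z: "snd z \<in> piece A (fst z)" "us \<in> tlists A" using Cons.prems by auto
  have v: "f (z # us' @ (1, e) # ws') = 0" if "us' \<in> tlists A" "ws' \<in> tlists A" for us' ws'
    using Cons.prems(2)[of "z # us'" ws'] that z by simp
  have IH: "cd b (\<lambda>ys. f (z # ys)) (us @ (1, e) # ws) =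
    (if us = [] \<and> ws \<noteq> [] then f (z # ws) else 0) - (if us \<noteq> [] \<and> ws = [] then sg (degree us) (f (z # us)) else 0)"
    by (rule Cons.IH[OF mlin_Cons[OF Cons.prems(1) z(1)] v z(2) Cons.prems(4)])
  have 1: "dec (\<lambda>u w. f ((degree (z # u) - 1, b (z # u)) # w @ (1, e) # ws)) us = 0"
  proof (rule dec_0)
    fix u w assume u: "u @ w = us"
    then show "f ((degree (z # u) - 1, b (z # u)) # w @ (1, e) # ws) = 0"
      using Cons.prems(2)[of "(degree (z # u) - 1, b (z # u)) # w" ws] z Cons.prems(4) maps_toD[OF b(1), of "z # u"] by auto
  qed
  \<comment> \<open>Of the blocks from \<open>z\<close> through the unit only the product of
    \<open>z\<close> with the unit survives, which presupposes that \<open>us\<close> is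
    empty.\<close>
  have 2: "dec (\<lambda>u w. f ((degree (z # us @ (1, e) # u) - 1, b (z # us @ (1, e) # u)) # w)) ws =
    (if us = [] then - sg (fst z) (f (z # ws)) else 0)"
  proof (cases "us = []")
    case True
    have "dec (\<lambda>u w. f ((degree (z # (1, e) # u) - 1, b (z # (1, e) # u)) # w)) ws = f ((fst z, sg (fst z - 1) (snd z)) # ws)"
    proof (subst dec_first)
      fix u w assume u: "u @ w = ws" "u \<noteq> []"
      then have "b (z # (1, e) # u) = 0" using z Cons.prems by (intro e(8)) auto
      then show "f ((degree (z # (1, e) # u) - 1, b (z # (1, e) # u)) # w) = 0"
        using u z Cons.prems mlin_0_hd[OF Cons.prems(1), of w] by auto
    qed (use e(4)[OF z(1)] in simp)
    also have "\<dots> = sg (fst z - 1) (f (z # ws))"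
      using mlin_sg[OF Cons.prems(1), of "[]" ws "snd z" "fst z" "fst z - 1"] z Cons.prems by simp
    finally show ?thesis using True by simp
  next
    case False
    have "dec (\<lambda>u w. f ((degree (z # us @ (1, e) # u) - 1, b (z # us @ (1, e) # u)) # w)) ws = 0"
    proof (rule dec_0)
      fix u w assume u: "u @ w = ws"
      then have "b (z # us @ (1, e) # u) = 0" using z Cons.prems False by (intro e(7)) auto
      then show "f ((degree (z # us @ (1, e) # u) - 1, b (z # us @ (1, e) # u)) # w) = 0"
        using u z Cons.prems mlin_0_hd[OF Cons.prems(1), of w] by auto
    qed
    then show ?thesis using False by simp
  qed
  show ?case unfolding append_Cons cd_Cons dec_append_Cons IH 1 2 by (auto simp: sg_plus_exp)
qed

text \<open>\<open>cd_unit\<close> does not apply to \<open>b\<close> itself, whose arity two values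
  on a unit are not zero. It does apply once a letter \<open>z\<close> is fixed in front; a unit in
  first position is treated by hand.\<close>

lemma cd_unit_b:
  assumes g: "gfam A A (-1) b" and u: "unital A U b" "e \<in> U" and T: "us \<in> tlists A" "ws \<in> tlists A"
  shows "cd b b (us @ (1, e) # ws) = 0"
proof -
  note e = unitalD[OF u]
  note m = gfam_maps_to[OF g] and l = gfamD(4)[OF g]
  show ?thesis
  proof (cases us)
    case Nil
    show ?thesis
    proof (cases ws)
      case Nil
      then show ?thesis using \<open>us = []\<close> e(2) mlin_0_hd[OF l, of "[]"] by (simp add: cd_Cons)
    next
      case (Cons y ws')
      have y: "snd y \<in> piece A (fst y)" "ws' \<in> tlists A" using Cons T by auto
      \<comment> \<open>A unit in front turns \<open>b\<close> into the identity corestriction, so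
        this term is \<open>b ws\<close> up to sign. It cancels against the block formed by the unit
        and the next letter.\<close>
      have "cd b (\<lambda>ys. b ((1, e) # ys)) ws = cd b idn ws"
      proof (rule cd_cong[OF m T(2)])
        fix ys assume ys: "ys \<in> tlists A" "ys \<noteq> []"
        then obtain n x ys' where y': "ys = (n, x) # ys'" by (cases ys) auto
        show "b ((1, e) # ys) = idn ys"
          using ys e(3)[of x n] e(6)[of ys] by (cases ys') (auto simp: y')
      qed
      also have "\<dots> = b ws" using cd_idn[OF m T(2)] Cons by simp
      finally have 1: "cd b (\<lambda>ys. b ((1, e) # ys)) ws = b ws" .
      have "dec (\<lambda>u w. b ((degree ((1, e) # y # u) - 1, b ((1, e) # y # u)) # w)) ws' = b (y # ws')"
      proof (subst dec_first)
        fix u w assume u: "u @ w = ws'" "u \<noteq> []"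
        then have "b ((1, e) # y # u) = 0" using y by (intro e(6)) (auto simp: Suc_le_eq)
        then show "b ((degree ((1, e) # y # u) - 1, b ((1, e) # y # u)) # w) = 0"
          using u y mlin_0_hd[OF l, of w] by auto
      qed (use e(3)[of "snd y" "fst y"] y in simp)
      moreover have "b ((0, 0) # ws) = 0" using mlin_0_hd[OF l T(2)] by simp
      ultimately show ?thesis using 1 e(2) by (simp add: \<open>us = []\<close> cd_Cons Cons)
    qed
  next
    case (Cons z us')
    have z: "snd z \<in> piece A (fst z)" "us' \<in> tlists A" using Cons T by auto
    have 0: "cd b (\<lambda>ys. b (z # ys)) (us' @ (1, e) # ws) =
      (if us' = [] \<and> ws \<noteq> [] then b (z # ws) else 0) - (if us' \<noteq> [] \<and> ws = [] then sg (degree us') (b (z # us')) else 0)"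
      by (rule cd_unit[OF m u mlin_Cons[OF l z(1)] e(7) z(2) T(2)]) (use z in auto)
    have 1: "dec (\<lambda>u w. b ((degree (z # u) - 1, b (z # u)) # w @ (1, e) # ws)) us' =
      (if ws = [] then sg (degree (z # us')) (b (z # us')) else 0)"
    proof -
      have bm: "b (z # u) \<in> piece A (degree (z # u) - 1)" if "u \<in> tlists A" for u
        using maps_toD[OF m, of "z # u"] that z by auto
      have "dec (\<lambda>u w. b ((degree (z # u) - 1, b (z # u)) # w @ (1, e) # ws)) us' = b ((degree (z # us') - 1, b (z # us')) # (1, e) # ws)"
      proof (subst dec_last)
        fix u w assume u: "u @ w = us'" "w \<noteq> []"
        then show "b ((degree (z # u) - 1, b (z # u)) # w @ (1, e) # ws) = 0"
          using z T bm[of u] by (intro e(7)) auto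
      qed simp
      also have "\<dots> = (if ws = [] then sg (degree (z # us')) (b (z # us')) else 0)"
        using e(4)[OF bm[OF z(2)]] e(8)[OF T(2), of "(degree (z # us') - 1, b (z # us'))"] bm[OF z(2)]
        by (auto simp: sg_def)
      finally show ?thesis .
    qed
    have 2: "dec (\<lambda>u w. b ((degree (z # us' @ (1, e) # u) - 1, b (z # us' @ (1, e) # u)) # w)) ws =
      (if us' = [] then - sg (fst z) (b (z # ws)) else 0)"
    proof (cases "us' = []")
      case True
      have "dec (\<lambda>u w. b ((degree (z # (1, e) # u) - 1, b (z # (1, e) # u)) # w)) ws = b ((fst z, sg (fst z - 1) (snd z)) # ws)"
      proof (subst dec_first)
        fix u w assume u: "u @ w = ws" "u \<noteq> []"
        then have "b (z # (1, e) # u) = 0" using z T by (intro e(8)) auto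
        then show "b ((degree (z # (1, e) # u) - 1, b (z # (1, e) # u)) # w) = 0"
          using u z T mlin_0_hd[OF l, of w] by auto
      qed (use e(4)[OF z(1)] in simp)
      also have "\<dots> = sg (fst z - 1) (b (z # ws))"
        using mlin_sg[OF l, of "[]" ws "snd z" "fst z" "fst z - 1"] z T by simp
      finally show ?thesis using True by simp
    next
      case False
      have "dec (\<lambda>u w. b ((degree (z # us' @ (1, e) # u) - 1, b (z # us' @ (1, e) # u)) # w)) ws = 0"
      proof (rule dec_0)
        fix u w assume u: "u @ w = ws"
        then have "b (z # us' @ (1, e) # u) = 0" using z T False by (intro e(7)) auto
        then show "b ((degree (z # us' @ (1, e) # u) - 1, b (z # us' @ (1, e) # u)) # w) = 0"
          using u z T mlin_0_hd[OF l, of w] by auto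
      qed
      then show ?thesis using False by simp
    qed
    show ?thesis unfolding Cons append_Cons cd_Cons dec_append_Cons 0 1 2
      by (auto simp: sg_plus_exp sg_diff)
  qed
qed

lemma unital_mapD:
  assumes "unital_map A U V F" "e \<in> U"
  shows "F [(1, e)] \<in> V"
    "us \<in> tlists A \<Longrightarrow> ws \<in> tlists A \<Longrightarrow> us @ ws \<noteq> [] \<Longrightarrow> F (us @ (1, e) # ws) = 0"
  using assms by (auto simp: unital_map_def)

text \<open>\<open>F\<close> kills every longer block through the unit, so the unit is a block of
  its own and the blocks on its two sides are chosen independently.\<close>

lemma cf_unit:
  assumes F: "maps_to A B 0 F" "unital_map A U V F" "e \<in> U"
  shows "mlin B s f \<Longrightarrow> us \<in> tlists A \<Longrightarrow> ws \<in> tlists A \<Longrightarrow>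
    cf F f (us @ (1, e) # ws) = cf F (\<lambda>ys. cf F (\<lambda>zs. f (ys @ (1, F [(1, e)]) # zs)) ws) us"
proof (induction us arbitrary: f rule: measure_induct_rule[where f = length])
  case (less us)
  note e = unital_mapD[OF F(2,3)]
  have zero: "cf F (\<lambda>ys. f ((n, 0) # ys)) w = 0" if "w \<in> tlists A" for n w
    using that by (intro cf_0[OF F(1)] mlin_0_hd[OF less.prems(1)]) auto
  show ?case
  proof (cases us)
    case Nil
    have "dec (\<lambda>u w. cf F (\<lambda>ys. f ((degree ((1, e) # u), F ((1, e) # u)) # ys)) w) ws =
      cf F (\<lambda>ys. f ((1, F [(1, e)]) # ys)) ws"
    proof (subst dec_first)
      fix u w assume u: "u @ w = ws" "u \<noteq> []"
      then have "F ((1, e) # u) = 0" using less.prems e(2)[of "[]" u] by auto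
      then show "cf F (\<lambda>ys. f ((degree ((1, e) # u), F ((1, e) # u)) # ys)) w = 0"
        using zero u less.prems by auto
    qed simp
    then show ?thesis by (simp add: Nil cf_Cons)
  next
    case (Cons z us')
    have z: "snd z \<in> piece A (fst z)" "us' \<in> tlists A" using less.prems Cons by auto
    have 1: "dec (\<lambda>u w. cf F (\<lambda>ys. f ((degree (z # us' @ (1, e) # u), F (z # us' @ (1, e) # u)) # ys)) w) ws = 0"
    proof (rule dec_0)
      fix u w assume u: "u @ w = ws"
      then have "F (z # us' @ (1, e) # u) = 0" using less.prems z e(2)[of "z # us'" u] by auto
      then show "cf F (\<lambda>ys. f ((degree (z # us' @ (1, e) # u), F (z # us' @ (1, e) # u)) # ys)) w = 0"
        using zero u less.prems by auto
    qed
    have "dec (\<lambda>u w. cf F (\<lambda>ys. f ((degree (z # u), F (z # u)) # ys)) (w @ (1, e) # ws)) us' =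
      dec (\<lambda>u w. cf F (\<lambda>ys. cf F (\<lambda>zs. f ((degree (z # u), F (z # u)) # ys @ (1, F [(1, e)]) # zs)) ws) w) us'"
    proof (intro dec_cong refl)
      fix u w assume u: "u @ w = us'"
      have "mlin B s (\<lambda>ys. f ((degree (z # u), F (z # u)) # ys))"
        using maps_toD[OF F(1), of "z # u"] u z by (intro mlin_Cons less.prems) auto
      then show "cf F (\<lambda>ys. f ((degree (z # u), F (z # u)) # ys)) (w @ (1, e) # ws) =
        cf F (\<lambda>ys. cf F (\<lambda>zs. f ((degree (z # u), F (z # u)) # ys @ (1, F [(1, e)]) # zs)) ws) w"
        by (intro less.IH) (use u z less.prems Cons in auto)
    qed
    then show ?thesis by (simp add: Cons cf_Cons dec_append_Cons 1[simplified])
  qed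
qed

text \<open>As \<open>F\<close> sends the unit to a unit again, the unit law of \<beta> reduces
  \<open>cf F \<beta>\<close> to the same end terms that \<open>cd_unit\<close> gives for
  \<open>cd b F\<close>.\<close>

lemma mdef_unit:
  assumes "gfam A A (-1) b" "gfam B B (-1) \<beta>" "gfam A B 0 F"
    and u: "unital A U b" "unital B V \<beta>" "unital_map A U V F" "e \<in> U"
    and T: "us \<in> tlists A" "ws \<in> tlists A"
  shows "mdef b \<beta> F (us @ (1, e) # ws) = 0"
proof -
  note m = gfam_maps_to[OF assms(1)] and mF = gfam_maps_to[OF assms(3)]
  note e' = unitalD[OF u(2) unital_mapD(1)[OF u(3,4)]]
  have D: "cd b F (us @ (1, e) # ws) =
      (if us = [] \<and> ws \<noteq> [] then F ws else 0) - (if us \<noteq> [] \<and> ws = [] then sg (degree us) (F us) else 0)"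
    by (rule cd_unit[OF m u(1,4) gfamD(4)[OF assms(3)] unital_mapD(2)[OF u(3,4)] T])
  have C: "cf F \<beta> (us @ (1, e) # ws) = cf F (\<lambda>ys. cf F (\<lambda>zs. \<beta> (ys @ (1, F [(1, e)]) # zs)) ws) us"
    by (rule cf_unit[OF mF u(3,4) gfamD(4)[OF assms(2)] T])
  consider "us = []" "ws = []" | "us = []" "ws \<noteq> []" | "us \<noteq> []" "ws = []" | "us \<noteq> []" "ws \<noteq> []" by blast
  then show ?thesis
  proof cases
    case 1
    then show ?thesis using C D e'(2) by (simp add: mdef_def)
  next
    case 2
    have "cf F (\<lambda>zs. \<beta> ((1, F [(1, e)]) # zs)) ws = cf F idn ws"
    proof (rule cf_cong[OF mF T(2)])
      fix ys assume ys: "ys \<in> tlists B" "(ys = []) = (ws = [])"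
      then obtain n x ys' where y': "ys = (n, x) # ys'" using 2 by (cases ys) auto
      show "\<beta> ((1, F [(1, e)]) # ys) = idn ys"
        using ys e'(3)[of x n] e'(6)[of ys] by (cases ys') (auto simp: y')
    qed
    then show ?thesis using C D 2 cf_to_idn[OF mF T(2)] by (simp add: mdef_def)
  next
    case 3
    have "cf F (\<lambda>ys. \<beta> (ys @ [(1, F [(1, e)])])) us = cf F (\<lambda>ys. sg (degree us - 1) (idn ys)) us"
    proof (rule cf_cong[OF mF T(1)])
      fix ys assume ys: "ys \<in> tlists B" "(ys = []) = (us = [])" "degree ys = degree us"
      then obtain n x ys' where y': "ys = (n, x) # ys'" using 3 by (cases ys) auto
      show "\<beta> (ys @ [(1, F [(1, e)])]) = sg (degree us - 1) (idn ys)"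
        using ys e'(4)[of x n] e'(5)[of ys "[]"] by (cases ys') (auto simp: y')
    qed
    also have "\<dots> = - sg (degree us) (F us)"
      using cf_to_idn[OF mF T(1)] 3 unfolding cf_sg by simp
    finally show ?thesis using C D 3 by (simp add: mdef_def)
  next
    case 4
    have "cf F (\<lambda>ys. cf F (\<lambda>zs. \<beta> (ys @ (1, F [(1, e)]) # zs)) ws) us = 0"
    proof (intro cf_0[OF mF T(1)] cf_0[OF mF T(2)] e'(5))
      fix ys zs assume "(ys = []) = (us = [])" "(zs = []) = (ws = [])"
      then show "2 \<le> length ys + length zs" using 4 by (cases ys; cases zs) auto
    qed
    then show ?thesis using C D 4 by (simp add: mdef_def)
  qed
qed

section \<open>Complexes of multilinear maps\<close>

lemma linear_onD:
  assumes "linear_on s M t N f" 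
  shows "x \<in> M \<Longrightarrow> f x \<in> N" "x \<in> M \<Longrightarrow> y \<in> M \<Longrightarrow> f (x + y) = f x + f y" "x \<in> M \<Longrightarrow> f (s a x) = t a (f x)"
  using assms by (auto simp: linear_on_def)

lemma linear_on_0: "linear_on s M t N f \<Longrightarrow> 0 \<in> M \<Longrightarrow> f 0 = 0"
  using linear_onD(2)[of s M t N f 0 0] by simp

text \<open>Values on a basis of the free module are lifted one by one and extended linearly; the
  lift on \<open>M\<close> is the restriction along \<open>i\<close>. Surjectivity of
  \<open>q\<close> is asked for only over the values of \<open>h\<close>, because in use
  \<open>q\<close> is a differential, which reaches only cycles.\<close>

lemma projective_lift:
  fixes s :: "'q::{comm_ring,monoid_mult} \<Rightarrow> 'a::ab_group_add \<Rightarrow> 'a"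
  assumes "projective s M" and h: "linear_on s M t N h" and q: "linear_on u C t N q"
    and C: "submodule u C" "qmodule u" and M: "submodule s M" and t: "qmodule t"
    and sur: "\<forall>x\<in>M. h x \<in> q ` C"
  shows "\<exists>g. linear_on s M u C g \<and> (\<forall>x\<in>M. q (g x) = h x)"
proof -
  from assms(1) obtain I :: "'a set" and i r where i: "linear_on s M free_smul (free_module I) i"
    and r: "linear_on free_smul (free_module I) s M r" and ri: "\<forall>x\<in>M. r (i x) = x"
    unfolding projective_def by blast
  define \<delta> :: "'a \<Rightarrow> 'a \<Rightarrow> 'q" where "\<delta> j = (\<lambda>k. if k = j then 1 else 0)" for j
  have \<delta>: "\<delta> j \<in> free_module I" if "j \<in> I" for j
  proof -
    have "{k. \<delta> j k \<noteq> 0} \<subseteq> {j}" by (auto simp: \<delta>_def)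
    then show ?thesis using that finite_subset[of _ "{j}"] unfolding free_module_def by blast
  qed
  have "\<forall>j\<in>I. \<exists>c\<in>C. q c = h (r (\<delta> j))"
    using sur linear_onD(1)[OF r] \<delta> by (metis (no_types, opaque_lifting) image_iff)
  then obtain c where c: "\<And>j. j \<in> I \<Longrightarrow> c j \<in> C \<and> q (c j) = h (r (\<delta> j))" by metis
  define L where "L x = (\<Sum>k\<in>{k. x k \<noteq> 0}. u (x k) (c k))" for x
  note qu = qmodule_simps[OF C(2)] and qt = qmodule_simps[OF t]
  have L_sup: "L x = (\<Sum>k\<in>S. u (x k) (c k))" if "finite S" "{k. x k \<noteq> 0} \<subseteq> S" for x S
    unfolding L_def by (rule sum.mono_neutral_left) (use that qu in auto)
  have zero: "(\<lambda>_. 0 :: 'q) \<in> free_module I" by (simp add: free_module_def)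
  have M0: "0 \<in> M" and C0: "0 \<in> C" and Ca: "x \<in> C \<Longrightarrow> y \<in> C \<Longrightarrow> x + y \<in> C" "x \<in> C \<Longrightarrow> u a x \<in> C" for x y a
    using M C by (auto simp: submodule_def)
  have r0: "r (\<lambda>_. 0) = 0"
    using linear_onD(2)[OF r zero zero] by (simp add: plus_fun_def)
  \<comment> \<open>Induction on a finite set that contains the support: splitting off one basis
    element at a time reduces the claim to the chosen lifts \<open>c j\<close>.\<close>
  have main: "L x \<in> C \<and> q (L x) = h (r x)" if "finite S" "{k. x k \<noteq> 0} \<subseteq> S" "S \<subseteq> I" for S x
    using that
  proof (induction S arbitrary: x rule: finite_induct)
    case empty
    then have "x = (\<lambda>_. 0)" by auto
    then show ?case using r0 linear_on_0[OF h M0] linear_on_0[OF q C0] C0 by (simp add: L_def)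
  next
    case (insert j S)
    define y where "y = x(j := 0)"
    have y: "{k. y k \<noteq> 0} \<subseteq> S" using insert.prems by (auto simp: y_def)
    have yI: "y \<in> free_module I" using y insert finite_subset[of _ S] by (auto simp: free_module_def)
    have j: "j \<in> I" using insert by simp
    have IH: "L y \<in> C" "q (L y) = h (r y)" using insert.IH[OF y] insert.prems by auto
    have "L x = (\<Sum>k\<in>insert j S. u (x k) (c k))" by (rule L_sup) (use insert in auto)
    also have "\<dots> = u (x j) (c j) + (\<Sum>k\<in>S. u (y k) (c k))"
      using insert by (auto simp: y_def intro!: sum.cong)
    also have "(\<Sum>k\<in>S. u (y k) (c k)) = L y" by (rule L_sup[symmetric]) (use insert y in auto)
    finally have Lx: "L x = u (x j) (c j) + L y" .
    have sm: "free_smul (x j) (\<delta> j) \<in> free_module I"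
    proof -
      have "{k. free_smul (x j) (\<delta> j) k \<noteq> 0} \<subseteq> {j}" by (auto simp: free_smul_def \<delta>_def)
      then show ?thesis using j finite_subset[of _ "{j}"] unfolding free_module_def by blast
    qed
    have "x = free_smul (x j) (\<delta> j) + y"
      by (rule ext) (auto simp: free_smul_def \<delta>_def y_def)
    then have "r x = s (x j) (r (\<delta> j)) + r y"
      using linear_onD(2)[OF r sm yI] linear_onD(3)[OF r \<delta>[OF j]] by metis
    then have "h (r x) = t (x j) (h (r (\<delta> j))) + h (r y)"
      using linear_onD(2,3)[OF h] linear_onD(1)[OF r] M yI \<delta>[OF j] by (simp add: submodule_def)
    moreover have "q (L x) = t (x j) (q (c j)) + q (L y)"
      using Lx linear_onD(2,3)[OF q] IH(1) c[OF j] Ca by simp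
    ultimately show ?case using Lx IH Ca c[OF j] by simp
  qed
  have main': "L x \<in> C" "q (L x) = h (r x)" if "x \<in> free_module I" for x
    using main[of "{k. x k \<noteq> 0}" x] that by (auto simp: free_module_def)
  have ladd: "L (x + y) = L x + L y" if "x \<in> free_module I" "y \<in> free_module I" for x y
  proof -
    let ?S = "{k. x k \<noteq> 0} \<union> {k. y k \<noteq> 0}"
    have f: "finite ?S" using that by (auto simp: free_module_def)
    have "L (x + y) = (\<Sum>k\<in>?S. u ((x + y) k) (c k))" by (rule L_sup[OF f]) auto
    also have "\<dots> = (\<Sum>k\<in>?S. u (x k) (c k)) + (\<Sum>k\<in>?S. u (y k) (c k))"
      by (simp add: qu sum.distrib)
    also have "\<dots> = L x + L y" by (simp add: L_sup[OF f])
    finally show ?thesis .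
  qed
  have lsm: "L (free_smul a x) = u a (L x)" if "x \<in> free_module I" for x a
  proof -
    let ?S = "{k. x k \<noteq> 0}"
    have f: "finite ?S" using that by (auto simp: free_module_def)
    have "L (free_smul a x) = (\<Sum>k\<in>?S. u a (u (x k) (c k)))"
      by (subst L_sup[OF f]) (auto simp: free_smul_def qu)
    also have "\<dots> = u a (\<Sum>k\<in>?S. u (x k) (c k))"
      using f by induction (simp_all add: qu)
    finally show ?thesis by (simp add: L_def)
  qed
  show ?thesis
  proof (intro exI[of _ "\<lambda>x. L (i x)"] conjI ballI)
    show "linear_on s M u C (\<lambda>x. L (i x))"
      using linear_onD[OF i] by (auto simp: linear_on_def main' ladd lsm)
    show "q (L (i x)) = h x" if "x \<in> M" for x
      using main'(2)[OF linear_onD(1)[OF i that]] ri that by simp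
  qed
qed

section \<open>Null homotopies of maps out of bounded below projective complexes\<close>

lemma graded_linearD:
  assumes "graded_linear A B e f" "x \<in> piece A n"
  shows "m = n + e \<Longrightarrow> f n x \<in> piece B m" "y \<in> piece A n \<Longrightarrow> f n (x + y) = f n x + f n y"
    "f n (smul A a x) = smul B a (f n x)"
  using assms unfolding graded_linear_def linear_on_def by auto

lemma graded_linear_0: "graded_linear A B e f \<Longrightarrow> graded_module A \<Longrightarrow> f n 0 = 0"
  using graded_linearD(2)[of A B e f 0 n 0] graded_zero[of A n] by simp

lemma graded_linear_additive:
  "graded_linear A B e f \<Longrightarrow> graded_module A \<Longrightarrow> additive_on (piece A n) (f n)"
  by (auto simp: additive_on_def graded_moduleD graded_linearD)

lemma chain_complexD:
  assumes "chain_complex A d"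
  shows "graded_module A" "graded_linear A A (-1) d" "x \<in> piece A n \<Longrightarrow> d (n - 1) (d n x) = 0"
    "x \<in> piece A n \<Longrightarrow> d n x \<in> piece A (n - 1)"
  using assms graded_linearD(1)[of A A "-1" d x n "n - 1"] by (auto simp: chain_complex_def)

definition acyclic_complex :: "('q, 'a::ab_group_add) graded \<Rightarrow> (int \<Rightarrow> 'a \<Rightarrow> 'a) \<Rightarrow> bool" where
  "acyclic_complex C d \<longleftrightarrow> (\<forall>n. \<forall>x\<in>piece C n. d n x = 0 \<longrightarrow> (\<exists>y\<in>piece C (n + 1). d (n + 1) y = x))"

text \<open>Bounded below complexes of projectives, the standard examples of semiprojective
  complexes.\<close>

definition sproj :: "('q::{comm_ring,monoid_mult}, 'a::ab_group_add) graded \<Rightarrow> (int \<Rightarrow> 'a \<Rightarrow> 'a) \<Rightarrow> bool" where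
  "sproj P d \<longleftrightarrow> chain_complex P d \<and> bounded_below P \<and> (\<forall>n. projective (smul P) (piece P n))"

text \<open>The homotopy is built upwards from the lowest degree, by lifting in each degree through
  the differential of the acyclic complex.\<close>

lemma sproj_null_homotopic:
  assumes P: "sproj P d" and C: "chain_complex C dC" "acyclic_complex C dC"
    and f: "graded_linear P C e f" "\<And>n x. x \<in> piece P n \<Longrightarrow> dC (n + e) (f n x) = sg e (f (n - 1) (d n x))"
  shows "\<exists>g. graded_linear P C (e + 1) g \<and>
    (\<forall>n. \<forall>x\<in>piece P n. f n x = dC (n + e + 1) (g n x) + sg e (g (n - 1) (d n x)))"
proof -
  have Pc: "chain_complex P d" and Pp: "projective (smul P) (piece P n)" for n using P by (auto simp: sproj_def)
  note dP = chain_complexD[OF Pc] and dC = chain_complexD[OF C(1)]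
  note gP = graded_moduleD[OF dP(1)] and gC = graded_moduleD[OF dC(1)]
  from P obtain m where m: "\<And>n. n < m \<Longrightarrow> piece P n = {0}" unfolding sproj_def bounded_below_def by blast
  \<comment> \<open>Counting starts one degree below the bottom, where the piece is zero, so that
    the zero map is a base case.\<close>
  define N where "N k = m - 1 + int k" for k :: nat
  \<comment> \<open>The clause on cycles of \<open>P\<close> is what makes the map \<open>h\<close>
    of the next degree take values in cycles of \<open>C\<close>. On cycles the second term of the
    homotopy formula is absent.\<close>
  define Q where "Q k G \<longleftrightarrow> linear_on (smul P) (piece P (N k)) (smul C) (piece C (N k + e + 1)) G \<and>
     (\<forall>y\<in>piece P (N k). d (N k) y = 0 \<longrightarrow> dC (N k + e + 1) (G y) = f (N k) y)" for k G
  have "\<exists>G. \<forall>k. Q k (G k) \<and> (\<forall>x\<in>piece P (N (Suc k)).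
      f (N (Suc k)) x = dC (N (Suc k) + e + 1) (G (Suc k) x) + sg e (G k (d (N (Suc k)) x)))"
  proof (rule dependent_nat_choice)
    have "piece P (N 0) = {0}" by (simp add: N_def m)
    then have "Q 0 (\<lambda>_. 0)"
      by (auto simp: Q_def linear_on_def gC qmodule_simps[OF gC(4)] graded_linear_0[OF dC(2,1)] graded_linear_0[OF f(1) dP(1)])
    then show "\<exists>G. Q 0 G" by blast
  next
    fix G k
    assume Q: "Q k G"
    then have G: "linear_on (smul P) (piece P (N k)) (smul C) (piece C (N k + e + 1)) G"
      and Gd: "\<And>y. y \<in> piece P (N k) \<Longrightarrow> d (N k) y = 0 \<Longrightarrow> dC (N k + e + 1) (G y) = f (N k) y" by (auto simp: Q_def)
    define n where "n = N (Suc k)"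
    have Nk: "N k = n - 1" by (simp add: n_def N_def)
    note Gl = linear_onD[OF G, unfolded Nk]
    define h where "h x = f n x - sg e (G (d n x))" for x
    have hm: "h x \<in> piece C (n + e)" if "x \<in> piece P n" for x
      using Gl(1)[OF dP(4)[OF that]] graded_linearD(1)[OF f(1) that, of "n + e"]
      by (auto simp: h_def intro!: gC)
    have hlin: "linear_on (smul P) (piece P n) (smul C) (piece C (n + e)) h"
      unfolding linear_on_def
    proof (intro conjI ballI allI)
      show "h (x + y) = h x + h y" if "x \<in> piece P n" "y \<in> piece P n" for x y
        using that Gl(2)[OF dP(4) dP(4)] by (simp add: h_def graded_linearD[OF f(1)] graded_linearD[OF dP(2)] sg_add)
      show "h (smul P a x) = smul C a (h x)" if "x \<in> piece P n" for x a
        using that Gl(3)[OF dP(4)] by (simp add: h_def graded_linearD[OF f(1)] graded_linearD[OF dP(2)] qmodule_simps[OF gC(4)])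
    qed (rule hm)
    have hsur: "\<forall>x\<in>piece P n. h x \<in> dC (n + e + 1) ` piece C (n + e + 1)"
    proof
      fix x assume x: "x \<in> piece P n"
      note dx = dP(4)[OF x]
      have Gdx: "G (d n x) \<in> piece C (n + e)" using Gl(1)[OF dx] by simp
      have fx: "f n x \<in> piece C (n + e)" using graded_linearD(1)[OF f(1) x] by simp
      have "dC (n + e) (h x) = dC (n + e) (f n x) + dC (n + e) (- sg e (G (d n x)))"
        using graded_linearD(2)[OF dC(2) fx, of "- sg e (G (d n x))"] Gdx gC by (simp add: h_def)
      also have "dC (n + e) (- sg e (G (d n x))) = - sg e (dC (n + e) (G (d n x)))"
        using additive_on_simps[OF graded_linear_additive[OF dC(2,1)]] Gdx gC by simp
      also have "dC (n + e) (G (d n x)) = f (n - 1) (d n x)"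
        using Gd[unfolded Nk, OF dx dP(3)[OF x]] by simp
      finally have "dC (n + e) (h x) = 0" using f(2)[OF x] by simp
      then show "h x \<in> dC (n + e + 1) ` piece C (n + e + 1)"
        using C(2) hm[OF x] unfolding acyclic_complex_def by force
    qed
    have dlin: "linear_on (smul C) (piece C (n + e + 1)) (smul C) (piece C (n + e)) (dC (n + e + 1))"
      using dC(2) unfolding graded_linear_def by (metis add_diff_cancel_right' diff_conv_add_uminus)
    have sub: "submodule (smul C) (piece C n)" "submodule (smul P) (piece P n)" for n
      using gP gC by (auto simp: submodule_def)
    from projective_lift[OF Pp hlin dlin sub(1) gC(4) sub(2) gC(4) hsur]
    obtain G' where G': "linear_on (smul P) (piece P n) (smul C) (piece C (n + e + 1)) G'"
      "\<And>x. x \<in> piece P n \<Longrightarrow> dC (n + e + 1) (G' x) = h x" by blast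
    have "Q (Suc k) G'"
      unfolding Q_def n_def[symmetric] using G' linear_on_0[OF G] gP(1) by (simp add: h_def)
    then show "\<exists>G'. Q (Suc k) G' \<and> (\<forall>x\<in>piece P (N (Suc k)).
      f (N (Suc k)) x = dC (N (Suc k) + e + 1) (G' x) + sg e (G (d (N (Suc k)) x)))"
      using G'(2) unfolding n_def[symmetric] by (intro exI[of _ G']) (simp add: h_def)
  qed
  then obtain G where G: "\<And>k. Q k (G k)" "\<And>k x. x \<in> piece P (N (Suc k)) \<Longrightarrow>
      f (N (Suc k)) x = dC (N (Suc k) + e + 1) (G (Suc k) x) + sg e (G k (d (N (Suc k)) x))" by blast
  define g where "g n = (if n < m - 1 then (\<lambda>_. 0) else G (nat (n - (m - 1))))" for n
  have gN: "g (N k) = G k" for k by (simp add: g_def N_def)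
  have N_ex: "\<exists>k. n = N k" if "\<not> n < m - 1" for n
    using that by (intro exI[of _ "nat (n - (m - 1))"]) (simp add: N_def)
  show ?thesis
  proof (intro exI[of _ g] conjI allI ballI)
    have "linear_on (smul P) (piece P n) (smul C) (piece C (n + (e + 1))) (g n)" for n
    proof (cases "n < m - 1")
      case True
      then show ?thesis by (auto simp: g_def linear_on_def gC qmodule_simps[OF gC(4)])
    next
      case False
      then obtain k where "n = N k" using N_ex by blast
      then show ?thesis using G(1)[of k] gN by (simp add: Q_def add.assoc)
    qed
    then show gl: "graded_linear P C (e + 1) g" by (simp add: graded_linear_def)
    fix n x assume x: "x \<in> piece P n"
    show "f n x = dC (n + e + 1) (g n x) + sg e (g (n - 1) (d n x))"
    proof (cases "n < m")
      case True
      then have "x = 0" using x m by auto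
      then show ?thesis using graded_linear_0[OF f(1) dP(1)] graded_linear_0[OF gl dP(1)] graded_linear_0[OF dC(2,1)]
        graded_linear_0[OF dP(2,1)] by simp
    next
      case False
      define k where "k = nat (n - m)"
      have k: "n = N (Suc k)" "n - 1 = N k" using False by (simp_all add: k_def N_def)
      show ?thesis using G(2)[of x k] x unfolding k(2) gN unfolding k(1) gN by simp
    qed
  qed
qed

section \<open>Hom complexes of tensor powers\<close>

lemma dd_cong:
  assumes "graded_linear P P (-1) d"
  shows "xs \<in> tlists P \<Longrightarrow>
   (\<And>ys. ys \<in> tlists P \<Longrightarrow> degree ys = degree xs - 1 \<Longrightarrow> length ys = length xs \<Longrightarrow> f ys = g ys) \<Longrightarrow> dd d f xs = dd d g xs"
proof (induction xs arbitrary: f g)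
  case (Cons x xs)
  have x: "snd x \<in> piece P (fst x)" "xs \<in> tlists P" using Cons.prems by auto
  have "dd d (\<lambda>ys. f (x # ys)) xs = dd d (\<lambda>ys. g (x # ys)) xs"
    using x by (intro Cons.IH Cons.prems(2)) auto
  then show ?case using x graded_linearD(1)[OF assms x(1)] by (auto intro!: Cons.prems(2))
qed simp

lemma dd_sum:
  "dd d (\<lambda>ys. f ys + g ys) xs = dd d f xs + dd d g xs"
  "dd d (\<lambda>ys. sg n (f ys)) xs = sg n (dd d f xs)"
  "dd d (\<lambda>ys. 0) xs = (0 :: 'c::ab_group_add)"
proof -
  show "dd d (\<lambda>ys. f ys + g ys) xs = dd d f xs + dd d g xs"
    by (induction xs arbitrary: f g) (simp_all add: sg_add)
  show "dd d (\<lambda>ys. sg n (f ys)) xs = sg n (dd d f xs)"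
    by (induction xs arbitrary: f) (simp_all add: sg_add sg_commute)
  show "dd d (\<lambda>ys. 0) xs = (0 :: 'c::ab_group_add)"
    by (induction xs) simp_all
qed

lemma dd_smul: "qmodule s \<Longrightarrow> dd d (\<lambda>ys. s a (f ys)) xs = s a (dd d f xs)"
  by (induction xs arbitrary: f) (simp_all add: qmodule_simps)

lemma dd_hom:
  assumes "graded_linear P P (-1) d" "additive_on M L"
  shows "xs \<in> tlists P \<Longrightarrow>
   (\<And>ys. ys \<in> tlists P \<Longrightarrow> degree ys = degree xs - 1 \<Longrightarrow> length ys = length xs \<Longrightarrow> f ys \<in> M) \<Longrightarrow>
     L (dd d f xs) = dd d (\<lambda>ys. L (f ys)) xs \<and> dd d f xs \<in> M"
proof (induction xs arbitrary: f)
  case (Cons x xs)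
  have x: "snd x \<in> piece P (fst x)" "xs \<in> tlists P" using Cons.prems by auto
  have "L (dd d (\<lambda>ys. f (x # ys)) xs) = dd d (\<lambda>ys. L (f (x # ys))) xs \<and> dd d (\<lambda>ys. f (x # ys)) xs \<in> M"
    using x by (intro Cons.IH Cons.prems(2)) auto
  moreover have "f ((fst x - 1, d (fst x) (snd x)) # xs) \<in> M"
    using x graded_linearD(1)[OF assms(1) x(1)] by (intro Cons.prems(2)) auto
  ultimately show ?case using assms(2) additive_on_simps[OF assms(2)] by (simp add: additive_on_def)
qed (use assms additive_on_simps in \<open>auto simp: additive_on_def\<close>)

lemma dd_mlin:
  assumes "graded_linear P P (-1) d" "mlin P s f"
  shows "mlin P s (dd d f)"
proof -
  note q = qmodule_simps[OF mlinD(2)[OF assms(2)]]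
  have "dd d f (us @ (n, smul P a x + y) # ws) = s a (dd d f (us @ (n, x) # ws)) + dd d f (us @ (n, y) # ws)"
    if "us \<in> tlists P" "ws \<in> tlists P" "x \<in> piece P n" "y \<in> piece P n" "mlin P s f" for us ws x y a n f
    using that
  proof (induction us arbitrary: f)
    case Nil
    note f = mlinD(3)[OF Nil(5), of "[]"]
    note gA = graded_moduleD[OF mlinD(1)[OF Nil(5)]]
    have "dd d (\<lambda>ys. f ((n, smul P a x + y) # ys)) ws = dd d (\<lambda>ys. s a (f ((n, x) # ys)) + f ((n, y) # ys)) ws"
      by (rule dd_cong[OF assms(1) Nil(2)]) (use f Nil in auto)
    moreover have "d n (smul P a x + y) = smul P a (d n x) + d n y"
      using Nil gA by (simp add: graded_linearD[OF assms(1)])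
    ultimately show ?case
      using f[of ws "d n x" "n - 1" "d n y"] Nil graded_linearD(1)[OF assms(1), of _ n "n - 1"]
      by (simp add: dd_sum dd_smul[OF mlinD(2)[OF assms(2)]] q sg_add ac_simps)
  next
    case (Cons z us)
    have z: "snd z \<in> piece P (fst z)" "us \<in> tlists P" using Cons.prems by auto
    note IH = Cons.IH[OF z(2) Cons.prems(2-4) mlin_Cons[OF Cons.prems(5) z(1)]]
    have "f (((fst z - 1, d (fst z) (snd z)) # us) @ (n, smul P a x + y) # ws) =
       s a (f (((fst z - 1, d (fst z) (snd z)) # us) @ (n, x) # ws)) + f (((fst z - 1, d (fst z) (snd z)) # us) @ (n, y) # ws)"
      using z graded_linearD(1)[OF assms(1) z(1)] Cons.prems by (intro mlinD(3)[OF Cons.prems(5)]) auto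
    then show ?case using IH by (simp add: q sg_add ac_simps)
  qed
  then show ?thesis using assms(2) by (simp add: mlin_def)
qed

lemma dd_dd:
  assumes "chain_complex P d"
  shows "mlin P s f \<Longrightarrow> xs \<in> tlists P \<Longrightarrow> dd d (dd d f) xs = 0"
proof (induction xs arbitrary: f)
  case (Cons x xs)
  have x: "snd x \<in> piece P (fst x)" "xs \<in> tlists P" using Cons.prems by auto
  have "dd d (dd d (\<lambda>ys. f (x # ys))) xs = 0" by (rule Cons.IH[OF mlin_Cons[OF Cons.prems(1) x(1)] x(2)])
  then show ?case using chain_complexD(3)[OF assms x(1)] mlin_0_hd[OF Cons.prems(1) x(2)]
    by (simp add: dd_sum)
qed simp

text \<open>The maps are normalised to zero outside the \<open>k\<close>-th tensor power. Equal maps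
  are then equal functions, so that the Hom modules can themselves serve as the target complex of a
  null homotopy.\<close>

definition Hom ::
  "('q::{comm_ring,monoid_mult}, 'a::ab_group_add) graded \<Rightarrow> ('q, 'c::ab_group_add) graded \<Rightarrow> nat \<Rightarrow>
   ('q, (int \<times> 'a) list \<Rightarrow> 'c) graded" where
  "Hom P C k = \<lparr>smul = (\<lambda>a f xs. smul C a (f xs)),
     piece = (\<lambda>n. {f. mlin P (smul C) f \<and> (\<forall>xs\<in>tlists P. length xs = k \<longrightarrow> f xs \<in> piece C (degree xs + n)) \<and>
       (\<forall>xs. \<not> (xs \<in> tlists P \<and> length xs = k) \<longrightarrow> f xs = 0)})\<rparr>"

definition dHom ::
  "('q, 'a) graded \<Rightarrow> (int \<Rightarrow> 'a \<Rightarrow> 'a) \<Rightarrow> (int \<Rightarrow> 'c \<Rightarrow> 'c) \<Rightarrow> nat \<Rightarrow>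
   int \<Rightarrow> ((int \<times> 'a) list \<Rightarrow> 'c::ab_group_add) \<Rightarrow> (int \<times> 'a) list \<Rightarrow> 'c" where
  "dHom P d dC k n f xs =
     (if xs \<in> tlists P \<and> length xs = k then dC (degree xs + n) (f xs) - sg n (dd d f xs) else 0)"

lemma HomD:
  assumes "f \<in> piece (Hom P C k) n"
  shows "mlin P (smul C) f" "xs \<in> tlists P \<Longrightarrow> length xs = k \<Longrightarrow> m = degree xs + n \<Longrightarrow> f xs \<in> piece C m"
    "\<not> (xs \<in> tlists P \<and> length xs = k) \<Longrightarrow> f xs = 0"
  using assms by (auto simp: Hom_def)

lemma HomI:
  assumes "mlin P (smul C) f" "\<And>xs. xs \<in> tlists P \<Longrightarrow> length xs = k \<Longrightarrow> f xs \<in> piece C (degree xs + n)"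
    "\<And>xs. xs \<notin> tlists P \<or> length xs \<noteq> k \<Longrightarrow> f xs = 0"
  shows "f \<in> piece (Hom P C k) n"
  using assms by (auto simp: Hom_def)

lemma smul_Hom [simp]: "smul (Hom P C k) a f xs = smul C a (f xs)"
  by (simp add: Hom_def)

lemma mlin_trunc:
  assumes "mlin P s f"
  shows "mlin P s (\<lambda>xs. if xs \<in> tlists P \<and> length xs = k then f xs else 0)"
  using assms graded_moduleD[OF mlinD(1)[OF assms]] by (auto simp: mlin_def qmodule_simps)

lemma Hom_complex:
  assumes P: "chain_complex P d" and C: "chain_complex C dC"
  shows "chain_complex (Hom P C k) (dHom P d dC k)"
proof -
  note dP = chain_complexD[OF P] and dC = chain_complexD[OF C]
  note gP = graded_moduleD[OF dP(1)] and gC = graded_moduleD[OF dC(1)]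
  note q = qmodule_simps[OF gC(4)]
  have dadd: "additive_on (piece C n) (dC n)" for n by (rule graded_linear_additive[OF dC(2,1)])
  have add: "f + g \<in> piece (Hom P C k) n" if "f \<in> piece (Hom P C k) n" "g \<in> piece (Hom P C k) n" for f g n
    using HomD[OF that(1)] HomD[OF that(2)] mlin_lin(1)[of P "smul C" f g]
    by (intro HomI) (auto simp: plus_fun_def gC)
  have sml: "smul (Hom P C k) a f \<in> piece (Hom P C k) n" if "f \<in> piece (Hom P C k) n" for f a n
  proof (intro HomI)
    show "mlin P (smul C) (smul (Hom P C k) a f)"
      using HomD(1)[OF that] by (auto simp: mlin_def q mult.commute)
  qed (use HomD[OF that] gC q in auto)
  have gm: "graded_module (Hom P C k)"
    unfolding graded_module_def submodule_def
  proof (intro conjI allI ballI add sml)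
    show "qmodule (smul (Hom P C k))" by (auto simp: qmodule_def fun_eq_iff q)
    show "0 \<in> piece (Hom P C k) n" for n
      using dP(1) gC(4) by (intro HomI) (auto simp: gC mlin_def q)
  qed
  have mem: "dHom P d dC k n f \<in> piece (Hom P C k) (n + - 1)" if f: "f \<in> piece (Hom P C k) n" for f n
  proof (intro HomI)
    note fm = HomD[OF f]
    have ddm: "dd d f xs \<in> piece C (degree xs + n - 1)" if "xs \<in> tlists P" "length xs = k" for xs
      by (rule conjunct2[OF dd_hom[OF dP(2) dadd]]) (use that in \<open>auto intro!: fm(2)\<close>)
    show "dHom P d dC k n f xs \<in> piece C (degree xs + (n + - 1))" if "xs \<in> tlists P" "length xs = k" for xs
      using ddm[OF that] dC(4)[OF fm(2)[OF that refl]] that by (auto simp: dHom_def add_diff_eq intro!: gC)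
    show "dHom P d dC k n f xs = 0" if "xs \<notin> tlists P \<or> length xs \<noteq> k" for xs using that by (auto simp: dHom_def)
    have "mlin P (smul C) (\<lambda>xs. sg n (dd d f xs))"
      using dd_mlin[OF dP(2) fm(1)] by (auto simp: mlin_def q sg_add)
    moreover have "mlin P (smul C) (\<lambda>xs. if xs \<in> tlists P \<and> length xs = k then dC (degree xs + n) (f xs) else 0)"
      unfolding mlin_def
    proof (intro conjI ballI allI)
      fix us ws m a x y assume *: "us \<in> tlists P" "ws \<in> tlists P" "x \<in> piece P m" "y \<in> piece P m"
      have "dC N (f (us @ (m, smul P a x + y) # ws)) = smul C a (dC N (f (us @ (m, x) # ws))) + dC N (f (us @ (m, y) # ws))"
        if "Suc (length us + length ws) = k" "N = degree us + (m + degree ws) + n" for N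
      proof -
        have "f (us @ (m, x) # ws) \<in> piece C N" "f (us @ (m, y) # ws) \<in> piece C N"
          by (rule fm(2); use * that in simp)+
        then show ?thesis using mlinD(3)[OF fm(1) *] gC by (simp add: graded_linearD[OF dC(2)])
      qed
      then show "(if us @ (m, smul P a x + y) # ws \<in> tlists P \<and> length (us @ (m, smul P a x + y) # ws) = k
                  then dC (degree (us @ (m, smul P a x + y) # ws) + n) (f (us @ (m, smul P a x + y) # ws)) else 0) =
          smul C a (if us @ (m, x) # ws \<in> tlists P \<and> length (us @ (m, x) # ws) = k
               then dC (degree (us @ (m, x) # ws) + n) (f (us @ (m, x) # ws)) else 0) +
          (if us @ (m, y) # ws \<in> tlists P \<and> length (us @ (m, y) # ws) = k
           then dC (degree (us @ (m, y) # ws) + n) (f (us @ (m, y) # ws)) else 0)"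
        using * gP q by simp
    qed (use dP(1) gC(4) in auto)
    ultimately have "mlin P (smul C) (\<lambda>xs. (if xs \<in> tlists P \<and> length xs = k then dC (degree xs + n) (f xs) else 0) - sg n (dd d f xs))"
      by (intro mlin_lin)
    from mlin_trunc[OF this, of k] show "mlin P (smul C) (dHom P d dC k n f)"
      by (rule subst[where P = "mlin P (smul C)", rotated]) (auto simp: dHom_def)
  qed
  have "dHom P d dC k n (f + g) = dHom P d dC k n f + dHom P d dC k n g"
    if "f \<in> piece (Hom P C k) n" "g \<in> piece (Hom P C k) n" for f g n
    using HomD(2)[OF that(1) _ _ refl] HomD(2)[OF that(2) _ _ refl]
    by (auto simp: fun_eq_iff dHom_def graded_linearD[OF dC(2)] plus_fun_def dd_sum sg_add)
  moreover have "dHom P d dC k n (smul (Hom P C k) a f) = smul (Hom P C k) a (dHom P d dC k n f)"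
    if "f \<in> piece (Hom P C k) n" for f n a
  proof -
    have "dd d (smul (Hom P C k) a f) xs = smul C a (dd d f xs)" for xs
      using dd_smul[OF gC(4), of d a f xs] by (simp add: Hom_def)
    then show ?thesis
      using HomD(2)[OF that _ _ refl] by (auto simp: fun_eq_iff dHom_def graded_linearD[OF dC(2)] q)
  qed
  ultimately have gl: "graded_linear (Hom P C k) (Hom P C k) (-1) (dHom P d dC k)"
    using mem by (auto simp: graded_linear_def linear_on_def)
  have "dHom P d dC k (n - 1) (dHom P d dC k n f) xs = 0" if f: "f \<in> piece (Hom P C k) n" for f n xs
  proof (cases "xs \<in> tlists P \<and> length xs = k")
    case True
    note fm = HomD[OF f]
    define N where "N = degree xs + n - 1"
    have ddm: "dC N (dd d f xs) = dd d (\<lambda>ys. dC N (f ys)) xs \<and> dd d f xs \<in> piece C N"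
      by (rule dd_hom[OF dP(2) dadd]) (use True in \<open>auto simp: N_def intro!: fm(2)\<close>)
    have m1: "dC (degree xs + n) (f xs) \<in> piece C N" using dC(4)[OF fm(2)] True by (simp add: N_def)
    have "dd d (dHom P d dC k n f) xs = dd d (\<lambda>ys. dC N (f ys) + - sg n (dd d f ys)) xs"
      by (rule dd_cong[OF dP(2)]) (use True in \<open>auto simp: dHom_def N_def diff_add_eq\<close>)
    also have "\<dots> = dC N (dd d f xs)"
      using dd_sum(2)[of d 1 "\<lambda>ys. sg n (dd d f ys)" xs] dd_dd[OF P fm(1), of xs] True ddm
      unfolding dd_sum(1) by (simp add: dd_sum(2))
    finally have 1: "dd d (dHom P d dC k n f) xs = dC N (dd d f xs)" .
    have "dHom P d dC k n f xs = dC (degree xs + n) (f xs) + - sg n (dd d f xs)" using True by (simp add: dHom_def)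
    then have "dC N (dHom P d dC k n f xs) = dC N (dC (degree xs + n) (f xs)) + - sg n (dC N (dd d f xs))"
      using graded_linearD(2)[OF dC(2) m1, of "- sg n (dd d f xs)"] ddm additive_on_simps[OF dadd[of N]] gC by simp
    also have "dC N (dC (degree xs + n) (f xs)) = 0" using dC(3)[OF fm(2)[OF _ _ refl]] True by (simp add: N_def)
    finally show ?thesis using True 1 by (simp add: dHom_def N_def add_diff_eq)
  qed (auto simp: dHom_def)
  then show ?thesis using gm gl by (auto simp: chain_complex_def fun_eq_iff)
qed

text \<open>Induction on \<open>k\<close> by currying: a cycle in the Hom complex of the next tensor
  power is a chain map, up to sign, from \<open>P\<close> to the Hom complex of the
  \<open>k\<close>-th power. The latter is acyclic by induction, and a null homotopy uncurries to a
  primitive.\<close>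

lemma Hom_acyclic:
  assumes P: "sproj P d" and C: "chain_complex C dC" "acyclic_complex C dC"
  shows "acyclic_complex (Hom P C k) (dHom P d dC k)"
proof (induction k)
  case 0
  note dC = chain_complexD[OF C(1)]
  have gP: "graded_module P" using P by (simp add: sproj_def chain_complex_def)
  show ?case unfolding acyclic_complex_def
  proof (intro allI ballI impI)
    fix n f assume f: "f \<in> piece (Hom P C 0) n" "dHom P d dC 0 n f = 0"
    have "dC n (f []) = 0" using fun_cong[OF f(2), of "[]"] by (simp add: dHom_def)
    moreover have "f [] \<in> piece C n" using HomD(2)[OF f(1), of "[]" n] by simp
    ultimately obtain y where y: "y \<in> piece C (n + 1)" "dC (n + 1) y = f []"
      using C(2) unfolding acyclic_complex_def by blast
    show "\<exists>g\<in>piece (Hom P C 0) (n + 1). dHom P d dC 0 (n + 1) g = f"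
    proof
      show "dHom P d dC 0 (n + 1) (\<lambda>xs. if xs = [] then y else 0) = f"
        using y HomD(3)[OF f(1)] by (auto simp: fun_eq_iff dHom_def)
      show "(\<lambda>xs. if xs = [] then y else 0) \<in> piece (Hom P C 0) (n + 1)"
        using y gP graded_qmodule[OF dC(1)] by (intro HomI) (auto simp: mlin_def qmodule_simps)
    qed
  qed
next
  case (Suc k)
  have Pc: "chain_complex P d" using P by (simp add: sproj_def)
  note dP = chain_complexD[OF Pc] and dC = chain_complexD[OF C(1)]
  note gP = graded_moduleD[OF dP(1)] and gC = graded_moduleD[OF dC(1)]
  note q = qmodule_simps[OF gC(4)]
  show ?case unfolding acyclic_complex_def
  proof (intro allI ballI impI)
    fix n f assume f: "f \<in> piece (Hom P C (Suc k)) n" "dHom P d dC (Suc k) n f = 0"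
    note fm = HomD[OF f(1)]
    define F where "F m x = (\<lambda>xs. f ((m, x) # xs))" for m x
    have Fm: "F m x \<in> piece (Hom P C k) (m + n)" if "x \<in> piece P m" for m x
      unfolding F_def
    proof (intro HomI)
      show "mlin P (smul C) (\<lambda>xs. f ((m, x) # xs))" by (rule mlin_Cons[OF fm(1)]) (use that in simp)
      show "f ((m, x) # xs) \<in> piece C (degree xs + (m + n))" if "xs \<in> tlists P" "length xs = k" for xs
        by (rule fm(2)) (use that \<open>x \<in> piece P m\<close> in auto)
      show "f ((m, x) # xs) = 0" if "xs \<notin> tlists P \<or> length xs \<noteq> k" for xs by (rule fm(3)) (use that in auto)
    qed
    have Fl: "graded_linear P (Hom P C k) n F"
      unfolding graded_linear_def linear_on_def
    proof (intro conjI allI ballI Fm)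
      show "F m (x + y) = F m x + F m y" if "x \<in> piece P m" "y \<in> piece P m" for m x y
      proof (rule ext)
        show "F m (x + y) xs = (F m x + F m y) xs" for xs
        proof (cases "xs \<in> tlists P")
          case True
          from mlin_additive_hd[OF fm(1) True, of m] show ?thesis using that by (simp add: F_def additive_on_def)
        qed (use fm(3) in \<open>auto simp: F_def\<close>)
      qed
      show "F m (smul P a x) = smul (Hom P C k) a (F m x)" if "x \<in> piece P m" for m x a
      proof (rule ext)
        show "F m (smul P a x) xs = smul (Hom P C k) a (F m x) xs" for xs
          using mlin_smul[OF fm(1), of "[]" xs x m a] that fm(3) q by (cases "xs \<in> tlists P") (auto simp: F_def)
      qed
    qed
    have Fc: "dHom P d dC k (m + n) (F m x) = sg n (F (m - 1) (d m x))" if x: "x \<in> piece P m" for m x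
    proof (rule ext)
      fix xs
      show "dHom P d dC k (m + n) (F m x) xs = sg n (F (m - 1) (d m x)) xs"
      proof (cases "xs \<in> tlists P \<and> length xs = k")
        case True
        have "dC (m + degree xs + n) (f ((m, x) # xs)) = sg n (sg m (dd d (F m x) xs) + f ((m - 1, d m x) # xs))"
          using fun_cong[OF f(2), of "(m, x) # xs"] True x by (simp add: dHom_def F_def)
        then show ?thesis using True by (simp add: dHom_def F_def sg_add sg_plus_exp sg_commute add_ac sg_def)
      next
        case False
        then have "f ((m - 1, d m x) # xs) = 0" by (intro fm(3)) auto
        then show ?thesis using False by (auto simp: dHom_def F_def sg_def)
      qed
    qed
    from sproj_null_homotopic[OF P Hom_complex[OF Pc C(1)] Suc Fl Fc]
    obtain G where G: "graded_linear P (Hom P C k) (n + 1) G"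
      and GF: "\<And>m x. x \<in> piece P m \<Longrightarrow> F m x = dHom P d dC k (m + n + 1) (G m x) + sg n (G (m - 1) (d m x))"
      by blast
    have Gm: "G m x \<in> piece (Hom P C k) (m + (n + 1))" if "x \<in> piece P m" for m x
      using graded_linearD(1)[OF G that] by simp
    \<comment> \<open>Uncurrying. Heads outside \<open>P\<close> have to give zero to meet the
      normalisation in \<open>Hom\<close>.\<close>
    define g where "g xs = (case xs of [] \<Rightarrow> 0 | (m, x) # ys \<Rightarrow> if x \<in> piece P m then G m x ys else 0)" for xs
    have g_Cons: "g ((m, x) # ys) = G m x ys" if "x \<in> piece P m" for m x ys using that by (simp add: g_def)
    have "dHom P d dC (Suc k) (n + 1) g = f"
    proof (rule ext)
      fix xs
      show "dHom P d dC (Suc k) (n + 1) g xs = f xs"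
      proof (cases "xs \<in> tlists P \<and> length xs = Suc k")
        case True
        then obtain m x ys where xs: "xs = (m, x) # ys" "x \<in> piece P m" "ys \<in> tlists P" "length ys = k"
          by (cases xs) auto
        have "(\<lambda>ys. g ((m, x) # ys)) = G m x" using xs by (auto simp: g_Cons)
        then show ?thesis using fun_cong[OF GF[OF xs(2)], of ys] xs dP(4)[OF xs(2)]
          by (simp add: dHom_def F_def g_Cons sg_add sg_plus_exp sg_commute add_ac sg_def)
      qed (use fm(3) in \<open>auto simp: dHom_def\<close>)
    qed
    moreover have "g \<in> piece (Hom P C (Suc k)) (n + 1)"
    proof (intro HomI)
      show "mlin P (smul C) g" unfolding mlin_def
      proof (intro conjI ballI allI)
        fix us ws m a x y assume *: "us \<in> tlists P" "ws \<in> tlists P" "x \<in> piece P m" "y \<in> piece P m"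
        show "g (us @ (m, smul P a x + y) # ws) = smul C a (g (us @ (m, x) # ws)) + g (us @ (m, y) # ws)"
        proof (cases us)
          case Nil
          then show ?thesis using * gP by (simp add: g_Cons graded_linearD[OF G])
        next
          case (Cons z us')
          obtain k' z' where z: "z = (k', z')" by (cases z)
          then have z': "z' \<in> piece P k'" "us' \<in> tlists P" using Cons * by auto
          show ?thesis using mlinD(3)[OF HomD(1)[OF Gm[OF z'(1)]] z'(2) *(2-4)] z' by (simp add: Cons z g_Cons)
        qed
      qed (use dP(1) gC(4) in auto)
      show "g xs \<in> piece C (degree xs + (n + 1))" if xs0: "xs \<in> tlists P" "length xs = Suc k" for xs
      proof -
        obtain m x ys where xs: "xs = (m, x) # ys" "x \<in> piece P m" "ys \<in> tlists P" "length ys = k"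
          using xs0 by (cases xs) auto
        then show ?thesis using HomD(2)[OF Gm[OF xs(2)] xs(3,4)] by (simp add: g_Cons ac_simps)
      qed
      show "g xs = 0" if xs: "xs \<notin> tlists P \<or> length xs \<noteq> Suc k" for xs
      proof (cases xs)
        case (Cons z ys)
        then show ?thesis using xs HomD(3)[OF Gm, of "snd z" "fst z" ys] by (cases z) (auto simp: g_def)
      qed (simp add: g_def)
    qed
    ultimately show "\<exists>g\<in>piece (Hom P C (Suc k)) (n + 1). dHom P d dC (Suc k) (n + 1) g = f" by blast
  qed
qed

text \<open>
  For \<open>U = {e}\<close> this is a splitting \<open>x = co x \<cdot> e + \<pi> x\<close> of \<open>P\<close>; for \<open>U = {}\<close> it forces \<open>\<pi>\<close> to be the
  identity.
\<close>

definition unit_data ::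
  "('q::{comm_ring,monoid_mult}, 'a::ab_group_add) graded \<Rightarrow> 'a set \<Rightarrow> (int \<Rightarrow> 'a \<Rightarrow> 'a) \<Rightarrow> (int \<Rightarrow> 'a \<Rightarrow> 'q) \<Rightarrow> bool" where
  "unit_data P U \<pi> co \<longleftrightarrow> graded_linear P P 0 \<pi> \<and> (\<forall>n. \<forall>x\<in>piece P n. \<pi> n (\<pi> n x) = \<pi> n x) \<and>
     (\<forall>n. \<forall>x\<in>piece P n. \<forall>y\<in>piece P n. \<forall>a. co n (smul P a x + y) = a * co n x + co n y) \<and>
     (\<forall>n. \<forall>x\<in>piece P n. n \<noteq> 1 \<longrightarrow> co n x = 0) \<and>
     (\<forall>e\<in>U. e \<in> piece P 1 \<and> \<pi> 1 e = 0 \<and> co 1 e = 1 \<and> (\<forall>x\<in>piece P 1. x = smul P (co 1 x) e + \<pi> 1 x)) \<and>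
     (\<forall>n. \<forall>x\<in>piece P n. n \<noteq> 1 \<or> U = {} \<longrightarrow> \<pi> n x = x)"

lemma unit_dataD:
  assumes "unit_data P U \<pi> co"
  shows "graded_linear P P 0 \<pi>" "x \<in> piece P n \<Longrightarrow> \<pi> n (\<pi> n x) = \<pi> n x"
    "x \<in> piece P n \<Longrightarrow> \<pi> n x \<in> piece P n"
    "x \<in> piece P n \<Longrightarrow> y \<in> piece P n \<Longrightarrow> co n (smul P a x + y) = a * co n x + co n y"
    "x \<in> piece P n \<Longrightarrow> n \<noteq> 1 \<Longrightarrow> co n x = 0"
    "e \<in> U \<Longrightarrow> e \<in> piece P 1" "e \<in> U \<Longrightarrow> \<pi> 1 e = 0" "e \<in> U \<Longrightarrow> co 1 e = 1"
    "e \<in> U \<Longrightarrow> x \<in> piece P 1 \<Longrightarrow> x = smul P (co 1 x) e + \<pi> 1 x"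
    "x \<in> piece P n \<Longrightarrow> n \<noteq> 1 \<or> U = {} \<Longrightarrow> \<pi> n x = x"
  using assms graded_linearD(1)[of P P 0 \<pi> x n n] unfolding unit_data_def by auto

section \<open>Maps that vanish on the unit\<close>

definition vanish :: "('q, 'a) graded \<Rightarrow> 'a set \<Rightarrow> ((int \<times> 'a) list \<Rightarrow> 'c::zero) \<Rightarrow> bool" where
  "vanish P U f \<longleftrightarrow> (\<forall>e\<in>U. \<forall>us\<in>tlists P. \<forall>ws\<in>tlists P. f (us @ (1, e) # ws) = 0)"

text \<open>\<open>x\<close> and \<open>\<pi> n x\<close> differ by a multiple of the unit, which
  \<open>f\<close> does not see.\<close>

lemma vanish_proj:
  assumes "unit_data P U \<pi> co" "mlin P s f" "vanish P U f" "us \<in> tlists P" "ws \<in> tlists P" "x \<in> piece P n"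
  shows "f (us @ (n, \<pi> n x) # ws) = f (us @ (n, x) # ws)"
proof (cases "n = 1 \<and> U \<noteq> {}")
  case True
  then obtain e where e: "e \<in> U" "n = 1" by blast
  have "f (us @ (1, smul P (co 1 x) e + \<pi> 1 x) # ws) = s (co 1 x) (f (us @ (1, e) # ws)) + f (us @ (1, \<pi> 1 x) # ws)"
    using assms e unit_dataD(3,6)[OF assms(1)] by (intro mlinD(3)[OF assms(2)]) auto
  moreover have "f (us @ (1, e) # ws) = 0" using assms e by (auto simp: vanish_def)
  ultimately show ?thesis
    using unit_dataD(9)[OF assms(1) e(1), of x] assms(6) e(2) qmodule_simps(5)[OF mlinD(2)[OF assms(2)]] by simp
next
  case False
  then show ?thesis using unit_dataD(10)[OF assms(1,6)] by auto
qed

text \<open>Maps that vanish on the unit are maps out of the quotient of \<open>P\<close> by the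
  unit. The quotient is realised as the image of \<pi>, a direct summand and hence again projective
  in each degree; \<open>Hom_acyclic\<close> is applied there and the primitive is pulled back along
  \<pi>.\<close>

lemma Hom_lift:
  fixes P :: "('q::{comm_ring,monoid_mult}, 'a::ab_group_add) graded"
    and C :: "('q, 'c::ab_group_add) graded"
  assumes P: "sproj P d" and U: "unit_data P U \<pi> co" "\<And>e. e \<in> U \<Longrightarrow> d 1 e = 0"
    and C: "chain_complex C dC" "acyclic_complex C dC"
    and f: "f \<in> piece (Hom P C k) m" "vanish P U f"
      "\<And>xs. xs \<in> tlists P \<Longrightarrow> length xs = k \<Longrightarrow> dC (degree xs + m) (f xs) = sg m (dd d f xs)"
  shows "\<exists>g\<in>piece (Hom P C k) (m + 1). vanish P U g \<and>
    (\<forall>xs\<in>tlists P. length xs = k \<longrightarrow> f xs = dC (degree xs + m + 1) (g xs) + sg m (dd d g xs))"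
proof -
  have Pc: "chain_complex P d" and Pp: "\<And>n. projective (smul P) (piece P n)" and Pb: "bounded_below P"
    using P by (auto simp: sproj_def)
  note dP = chain_complexD[OF Pc] and dC = chain_complexD[OF C(1)] and u = unit_dataD[OF U(1)]
  note gP = graded_moduleD[OF dP(1)] and gC = graded_moduleD[OF dC(1)]
  note fm = HomD[OF f(1)]
  define P' where "P' = \<lparr>smul = smul P, piece = (\<lambda>n. \<pi> n ` piece P n)\<rparr>"
  define d' where "d' n x = \<pi> (n - 1) (d n x)" for n x
  have P's: "smul P' = smul P" by (simp add: P'_def)
  have P'I: "\<pi> n x \<in> piece P' n" if "x \<in> piece P n" for n x using that by (simp add: P'_def)
  have P'D: "x \<in> piece P n" "\<pi> n x = x" if "x \<in> piece P' n" for n x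
    using that u(2,3) by (auto simp: P'_def)
  have tP: "xs \<in> tlists P" if "xs \<in> tlists P'" for xs using that P'D by (auto simp: tlists_def)
  \<comment> \<open>As \<open>d\<close> kills the unit it descends to the quotient: the induced
    differential does not depend on the unit part of \<open>x\<close>.\<close>
  have \<pi>d: "\<pi> (n - 1) (d n (\<pi> n x)) = \<pi> (n - 1) (d n x)" if x: "x \<in> piece P n" for n x
  proof (cases "n = 1 \<and> U \<noteq> {}")
    case True
    then obtain e where e: "e \<in> U" "n = 1" by blast
    have "d 1 (smul P (co 1 x) e + \<pi> 1 x) = d 1 (\<pi> 1 x)"
      using x e u(3,6) U(2) by (simp add: graded_linearD[OF dP(2)] gP qmodule_simps[OF gP(4)])
    then show ?thesis using u(9)[OF e(1), of x] x e by simp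
  next
    case False
    then show ?thesis using u(10)[OF x] by auto
  qed
  have gP': "graded_module P'"
    unfolding graded_module_def submodule_def P's
  proof (intro conjI allI ballI gP(4))
    show "0 \<in> piece P' n" for n using P'I[OF gP(1), of n] graded_linear_0[OF u(1) dP(1)] by simp
    show "x + y \<in> piece P' n" if "x \<in> piece P' n" "y \<in> piece P' n" for n x y
      using P'I[of "x + y" n] P'D[OF that(1)] P'D[OF that(2)] gP by (simp add: graded_linearD[OF u(1)])
    show "smul P a x \<in> piece P' n" if "x \<in> piece P' n" for n x a
      using P'I[of "smul P a x" n] P'D[OF that] gP by (simp add: graded_linearD[OF u(1)])
  qed
  have P'c: "chain_complex P' d'"
    unfolding chain_complex_def
  proof (intro conjI allI ballI gP')
    show "graded_linear P' P' (-1) d'"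
      unfolding graded_linear_def linear_on_def P's
      using P'D(1) P'I dP(4) by (auto simp: d'_def graded_linearD[OF u(1)] graded_linearD[OF dP(2)])
    show "d' (n - 1) (d' n x) = 0" if x: "x \<in> piece P' n" for n x
      using P'D[OF x] dP(3,4) \<pi>d[of "d n x" "n - 1"] graded_linear_0[OF u(1) dP(1)]
      by (simp add: d'_def)
  qed
  have proj: "projective (smul P') (piece P' n)" for n
  proof -
    from Pp[of n] obtain I :: "'a set" and i r where *: "linear_on (smul P) (piece P n) free_smul (free_module I) i"
      "linear_on free_smul (free_module I) (smul P) (piece P n) r" "\<forall>x\<in>piece P n. r (i x) = x"
      unfolding projective_def by blast
    have "linear_on (smul P') (piece P' n) free_smul (free_module I) i"
      using * P'D(1) by (auto simp: linear_on_def P's)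
    moreover have "linear_on free_smul (free_module I) (smul P') (piece P' n) (\<lambda>c. \<pi> n (r c))"
      using linear_onD[OF *(2)] P'I by (simp add: linear_on_def P's graded_linearD[OF u(1)])
    ultimately show ?thesis using * P'D unfolding projective_def by (intro exI conjI) auto
  qed
  have "bounded_below P'"
  proof -
    from Pb obtain l where l: "\<forall>n<l. piece P n = {0}" by (auto simp: bounded_below_def)
    have "\<forall>n<l. piece P' n = {0}" using l graded_linear_0[OF u(1) dP(1)] by (simp add: P'_def)
    then show ?thesis by (auto simp: bounded_below_def)
  qed
  then have P': "sproj P' d'" using P'c proj by (simp add: sproj_def)
  have mP': "mlin P' s h" if "mlin P s h" for s and h :: "_ \<Rightarrow> 'c"
    using that tP P'D gP' by (auto simp: mlin_def P's)
  \<comment> \<open>For maps that vanish on the unit the Koszul differentials of \<open>P\<close>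
    and of the quotient agree, since they differ only by applications of \<pi>.\<close>
  have dd': "dd d' h xs = dd d h xs" if "mlin P s h" "vanish P U h" "xs \<in> tlists P'" for s xs and h :: "_ \<Rightarrow> 'c"
    using that
  proof (induction xs arbitrary: h)
    case (Cons x xs)
    have x: "snd x \<in> piece P' (fst x)" "snd x \<in> piece P (fst x)" "xs \<in> tlists P'" using Cons.prems P'D by auto
    have v: "vanish P U (\<lambda>ys. h (x # ys))"
      unfolding vanish_def
    proof (intro ballI)
      fix e us ws assume "e \<in> U" "us \<in> tlists P" "ws \<in> tlists P"
      then show "h (x # us @ (1, e) # ws) = 0"
        using Cons.prems(2)[unfolded vanish_def, rule_format, of e "x # us" ws] x by simp
    qed
    have "h ((fst x - 1, d' (fst x) (snd x)) # xs) = h ((fst x - 1, d (fst x) (snd x)) # xs)"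
      using vanish_proj[OF U(1) Cons.prems(1,2), of "[]" xs "d (fst x) (snd x)" "fst x - 1"] tP[OF x(3)] dP(4)[OF x(2)]
      by (simp add: d'_def)
    then show ?case using Cons.IH[OF mlin_Cons[OF Cons.prems(1) x(2)] v x(3)] by simp
  qed simp
  define f' where "f' xs = (if xs \<in> tlists P' \<and> length xs = k then f xs else 0)" for xs
  have f': "f' \<in> piece (Hom P' C k) m"
    using mlin_trunc[OF mP'[OF fm(1)], of k] fm(2)[OF tP _ refl]
    by (intro HomI) (auto simp: f'_def[abs_def])
  have "dHom P' d' dC k m f' = 0"
  proof (rule ext)
    fix xs
    show "dHom P' d' dC k m f' xs = 0 xs"
    proof (cases "xs \<in> tlists P' \<and> length xs = k")
      case True
      have "dd d' f' xs = dd d' f xs"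
        by (rule dd_cong[OF chain_complexD(2)[OF P'c]]) (use True in \<open>auto simp: f'_def\<close>)
      then show ?thesis using True f(3)[of xs] tP dd'[OF fm(1) f(2)] by (simp add: dHom_def f'_def)
    qed (auto simp: dHom_def)
  qed
  then obtain g' where g': "g' \<in> piece (Hom P' C k) (m + 1)" "dHom P' d' dC k (m + 1) g' = f'"
    using Hom_acyclic[OF P' C, of k] f' unfolding acyclic_complex_def by blast
  note gm = HomD[OF g'(1)]
  define \<pi>l where "\<pi>l = map (\<lambda>(n, x). (n, \<pi> n x))"
  have \<pi>l: "\<pi>l xs \<in> tlists P'" "degree (\<pi>l xs) = degree xs" "length (\<pi>l xs) = length xs" if "xs \<in> tlists P" for xs
    using that by (induction xs) (auto simp: \<pi>l_def P'I)
  have \<pi>l_simps: "\<pi>l [] = []" "\<pi>l ((n, x) # xs) = (n, \<pi> n x) # \<pi>l xs" "\<pi>l (us @ ws) = \<pi>l us @ \<pi>l ws" for n x xs us ws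
    by (simp_all add: \<pi>l_def)
  \<comment> \<open>Precomposition with \<pi> in every letter vanishes on the unit because
    \<open>\<pi> 1 e = 0\<close>.\<close>
  define g where "g xs = (if xs \<in> tlists P \<and> length xs = k then g' (\<pi>l xs) else 0)" for xs
  have g: "g \<in> piece (Hom P C k) (m + 1)"
  proof (intro HomI)
    have "mlin P (smul C) (\<lambda>xs. g' (\<pi>l xs))"
      unfolding mlin_def
    proof (intro conjI ballI allI)
      fix us ws n a x y assume *: "us \<in> tlists P" "ws \<in> tlists P" "x \<in> piece P n" "y \<in> piece P n"
      show "g' (\<pi>l (us @ (n, smul P a x + y) # ws)) = smul C a (g' (\<pi>l (us @ (n, x) # ws))) + g' (\<pi>l (us @ (n, y) # ws))"
        using mlinD(3)[OF gm(1) \<pi>l(1)[OF *(1)] \<pi>l(1)[OF *(2)] P'I[OF *(3)] P'I[OF *(4)], of a] * gP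
        by (simp add: \<pi>l_simps graded_linearD[OF u(1)] P's)
    qed (use dP(1) gC(4) in auto)
    from mlin_trunc[OF this, of k] show "mlin P (smul C) g"
      by (rule subst[where P = "mlin P (smul C)", rotated]) (auto simp: g_def)
  qed (auto simp: g_def \<pi>l intro!: gm(2))
  have gv: "vanish P U g"
    unfolding vanish_def
  proof (intro ballI)
    fix e us ws assume "e \<in> U" "us \<in> tlists P" "ws \<in> tlists P"
    then show "g (us @ (1, e) # ws) = 0"
      using mlin_0[OF gm(1) \<pi>l(1) \<pi>l(1)] by (simp add: g_def \<pi>l_simps u(7))
  qed
  have ddg: "dd d' h (\<pi>l xs) = dd d (\<lambda>ys. h (\<pi>l ys)) xs" if "xs \<in> tlists P" for xs and h :: "_ \<Rightarrow> 'c"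
    using that
  proof (induction xs arbitrary: h)
    case (Cons x xs)
    obtain n y where x: "x = (n, y)" "y \<in> piece P n" "xs \<in> tlists P" using Cons.prems by (cases x) auto
    then show ?case using Cons.IH[of "\<lambda>ys. h ((n, \<pi> n y) # ys)"] \<pi>d[OF x(2)] by (simp add: \<pi>l_simps d'_def)
  qed (simp add: \<pi>l_simps)
  have f\<pi>: "f (us @ \<pi>l xs) = f (us @ xs)" if "us \<in> tlists P" "xs \<in> tlists P" for us xs
    using that
  proof (induction xs arbitrary: us)
    case (Cons x xs)
    obtain n y where x: "x = (n, y)" "y \<in> piece P n" "xs \<in> tlists P" using Cons.prems by (cases x) auto
    then show ?case using Cons.IH[of "us @ [(n, \<pi> n y)]"] Cons.prems u(3)
      vanish_proj[OF U(1) fm(1) f(2) Cons.prems(1) x(3,2)] by (simp add: \<pi>l_simps)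
  qed (simp add: \<pi>l_simps)
  show ?thesis
  proof (intro bexI[OF _ g] conjI gv ballI impI)
    fix xs assume xs: "xs \<in> tlists P" "length xs = k"
    have "f xs = f' (\<pi>l xs)" using f\<pi>[of "[]" xs] xs \<pi>l[OF xs(1)] by (simp add: f'_def)
    also have "\<dots> = dHom P' d' dC k (m + 1) g' (\<pi>l xs)" by (simp add: g'(2))
    also have "\<dots> = dC (degree xs + m + 1) (g' (\<pi>l xs)) + sg m (dd d (\<lambda>ys. g' (\<pi>l ys)) xs)"
      using xs \<pi>l[OF xs(1)] ddg[OF xs(1), of g'] by (simp add: dHom_def add.assoc)
    also have "dd d (\<lambda>ys. g' (\<pi>l ys)) xs = dd d g xs"
      by (rule dd_cong[OF dP(2) xs(1)]) (use xs in \<open>auto simp: g_def\<close>)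
    finally show "f xs = dC (degree xs + m + 1) (g xs) + sg m (dd d g xs)" using xs by (simp add: g_def)
  qed
qed


section \<open>Transfer along a quasi-isomorphism\<close>

text \<open>The mapping cone shifted down by one. In this grading the curvature, of degree -2 with
  values in \<open>P\<close>, and the defect, of degree -1 with values in \<open>Q\<close>, are the
  two entries of one map of degree -2.\<close>

definition cone ::
  "('q, 'a) graded \<Rightarrow> ('q, 'b) graded \<Rightarrow> ('q, 'a \<times> 'b) graded" where
  "cone P Q = \<lparr>smul = (\<lambda>a z. (smul P a (fst z), smul Q a (snd z))), piece = (\<lambda>n. piece P n \<times> piece Q (n + 1))\<rparr>"

definition dcone ::
  "(int \<Rightarrow> 'a \<Rightarrow> 'a) \<Rightarrow> (int \<Rightarrow> 'a \<Rightarrow> 'b) \<Rightarrow> (int \<Rightarrow> 'b \<Rightarrow> 'b) \<Rightarrow> int \<Rightarrow> 'a \<times> 'b \<Rightarrow> 'a \<times> 'b::ab_group_add" where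
  "dcone d f d' n z = (d n (fst z), f n (fst z) - d' (n + 1) (snd z))"

lemma cone_simps [simp]:
  "smul (cone P Q) a (x, y) = (smul P a x, smul Q a y)" "piece (cone P Q) n = piece P n \<times> piece Q (n + 1)"
  "fst (smul (cone P Q) a z) = smul P a (fst z)" "snd (smul (cone P Q) a z) = smul Q a (snd z)"
  by (simp_all add: cone_def)

lemma cone_graded: "graded_module P \<Longrightarrow> graded_module Q \<Longrightarrow> graded_module (cone P Q)"
  unfolding graded_module_def submodule_def
  by (auto simp: qmodule_def prod_eq_iff zero_prod_def)

lemma cone_complex:
  assumes "chain_complex P d" "chain_complex Q d'" "graded_linear P Q 0 f"
    and "\<And>n x. x \<in> piece P n \<Longrightarrow> f (n - 1) (d n x) = d' n (f n x)"
  shows "chain_complex (cone P Q) (dcone d f d')"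
proof -
  note dP = chain_complexD[OF assms(1)] and dQ = chain_complexD[OF assms(2)]
  note gP = graded_moduleD[OF dP(1)] and gQ = graded_moduleD[OF dQ(1)]
  have fm: "f n x \<in> piece Q n" if "x \<in> piece P n" for n x using graded_linearD(1)[OF assms(3) that] by simp
  have dQ': "d' (n + 1) x \<in> piece Q n" if "x \<in> piece Q (n + 1)" for n x using dQ(4)[OF that] by simp
  have dd0: "d' n (d' (n + 1) x) = 0" if "x \<in> piece Q (n + 1)" for n x using dQ(3)[OF that] by simp
  have dsub: "d' n (x - y) = d' n x - d' n y" if "x \<in> piece Q n" "y \<in> piece Q n" for n x y
    using graded_linearD(2)[OF dQ(2), of x n "- y"] additive_on_simps(2)[OF graded_linear_additive[OF dQ(2,1)], of y n] that gQ
    by simp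
  have "graded_linear (cone P Q) (cone P Q) (-1) (dcone d f d')"
    unfolding graded_linear_def linear_on_def
    using fm dQ' dP(4)
    by (auto simp: dcone_def graded_linearD[OF assms(3)] graded_linearD[OF dP(2)] graded_linearD[OF dQ(2)]
        qmodule_simps[OF gQ(4)] intro!: gQ)
  moreover have "dcone d f d' (n - 1) (dcone d f d' n z) = 0" if "z \<in> piece (cone P Q) n" for n z
    using that dP(3) assms(4) by (auto simp: dcone_def zero_prod_def dsub fm dQ' dd0)
  ultimately show ?thesis using cone_graded[OF dP(1) dQ(1)] by (simp add: chain_complex_def)
qed

lemma dd_pair: "dd d (\<lambda>ys. (f ys, g ys)) xs = (dd d f xs, dd d g xs)"
  by (induction xs arbitrary: f g) (simp_all add: sg_def zero_prod_def)

lemma gfam_diff: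
  assumes "gfam A B e f" "gfam A B e g"
  shows "gfam A B e (\<lambda>xs. f xs - g xs)"
  using assms mlin_lin(2)[OF gfamD(4)[OF assms(1)] gfamD(4)[OF assms(2)]] graded_diff[OF gfamD(2)[OF assms(1)]]
  by (simp add: gfam_def)

text \<open>All data are already suspended. The target is arbitrary because the locale is
  interpreted a second time with the homotopy fibre product in place of \<open>Q\<close>; acyclicity
  of the cone expresses that \<open>f1\<close> is a quasi-isomorphism.\<close>

locale transfer =
  fixes P :: "('q::{comm_ring,monoid_mult}, 'a::ab_group_add) graded" and d :: "int \<Rightarrow> 'a \<Rightarrow> 'a"
    and U :: "'a set" and \<pi> :: "int \<Rightarrow> 'a \<Rightarrow> 'a" and co :: "int \<Rightarrow> 'a \<Rightarrow> 'q"
    and Q :: "('q, 'b::ab_group_add) graded" and \<beta> :: "(int \<times> 'b) list \<Rightarrow> 'b" and V :: "'b set"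
    and f1 :: "int \<Rightarrow> 'a \<Rightarrow> 'b"
  assumes P: "sproj P d" and U: "unit_data P U \<pi> co" and dU: "e \<in> U \<Longrightarrow> d 1 e = 0"
    and \<beta>: "gfam Q Q (-1) \<beta>" and \<beta>\<beta>: "ys \<in> tlists Q \<Longrightarrow> cd \<beta> \<beta> ys = 0" and V: "unital Q V \<beta>"
    and f1: "graded_linear P Q 0 f1" and f1d: "x \<in> piece P n \<Longrightarrow> f1 (n - 1) (d n x) = \<beta> [(n, f1 n x)]"
    and f1U: "e \<in> U \<Longrightarrow> f1 1 e \<in> V"
    and acyclic: "acyclic_complex (cone P Q) (dcone d f1 (\<lambda>n y. \<beta> [(n, y)]))"
begin

abbreviation "d\<beta> \<equiv> (\<lambda>n y. \<beta> [(n, y)])"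

text \<open>Both families are present in all arities from the start, and the unit conditions hold in
  all arities; only the structure and morphism equations are limited to arities below
  \<open>k\<close>.\<close>

definition approx :: "nat \<Rightarrow> ((int \<times> 'a) list \<Rightarrow> 'a) \<times> ((int \<times> 'a) list \<Rightarrow> 'b) \<Rightarrow> bool" where
  "approx k z \<longleftrightarrow> (case z of (b, F) \<Rightarrow> gfam P P (-1) b \<and> gfam P Q 0 F \<and>
     (\<forall>n. \<forall>x\<in>piece P n. b [(n, x)] = d n x \<and> F [(n, x)] = f1 n x) \<and>
     unital P U b \<and> unital_map P U V F \<and>
     (\<forall>xs\<in>tlists P. xs \<noteq> [] \<longrightarrow> length xs < k \<longrightarrow> cd b b xs = 0 \<and> mdef b \<beta> F xs = 0))"

lemma Pc: "chain_complex P d" using P by (simp add: sproj_def)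

lemma d\<beta>_additive: "additive_on (piece Q n) (\<lambda>y. \<beta> [(n, y)])"
  using mlin_additive[OF gfamD(4)[OF \<beta>], of "[]" "[]"] by simp

lemma Qc: "chain_complex Q d\<beta>"
  unfolding chain_complex_def
proof (intro conjI allI ballI gfamD(1)[OF \<beta>])
  show "graded_linear Q Q (-1) d\<beta>"
    unfolding graded_linear_def linear_on_def
    using gfam_mem[OF \<beta>, of "[(_, _)]"] d\<beta>_additive mlin_smul[OF gfamD(4)[OF \<beta>], of "[]" "[]"]
    by (auto simp: additive_on_def)
  show "\<beta> [(n - 1, \<beta> [(n, x)])] = 0" if "x \<in> piece Q n" for n x
    using \<beta>\<beta>[of "[(n, x)]"] that by (simp add: cd_Cons)
qed

lemma cone_c: "chain_complex (cone P Q) (dcone d f1 d\<beta>)"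
  by (rule cone_complex[OF Pc Qc f1 f1d])

text \<open>Arity one is given by \<open>d\<close> and \<open>f1\<close>. Arity two must satisfy the
  unit law already, because every later correction vanishes on the unit.\<close>

lemma approx_base: "\<exists>z. approx 2 z"
proof -
  note dP = chain_complexD[OF Pc] and u = unit_dataD[OF U]
  note gP = graded_moduleD[OF dP(1)] and gQ = graded_moduleD[OF gfamD(1)[OF \<beta>]]
  note q = qmodule_simps[OF gP(4)]
  \<comment> \<open>The product that the unit law prescribes, extended by zero on the complement of
    the unit; \<pi> in the second term keeps the square of the unit from being counted
    twice.\<close>
  define m where "m k x n y = smul P (co k x) y + sg (k - 1) (smul P (co n y) (\<pi> k x))" for k x n y
  define b where "b xs = (case xs of [(n, x)] \<Rightarrow> d n x | [(k, x), (n, y)] \<Rightarrow> m k x n y | _ \<Rightarrow> 0)" for xs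
  define F where "F xs = (case xs of [(n, x)] \<Rightarrow> f1 n x | _ \<Rightarrow> 0)" for xs
  have b_simps: "b [] = 0" "b [(n, x)] = d n x" "b [(k, x), (n, y)] = m k x n y" "b (x1 # x2 # x3 # xs) = 0" for k n x y x1 x2 x3 xs
    by (simp_all add: b_def split_def)
  have F_simps: "F [] = 0" "F [(n, x)] = f1 n x" "F (x1 # x2 # xs) = 0" for n x x1 x2 xs
    by (simp_all add: F_def split_def)
  have b_long: "b xs = 0" if "3 \<le> length xs" for xs
  proof -
    from that obtain x1 x2 x3 ys where "xs = x1 # x2 # x3 # ys"
      by (auto simp: numeral_eq_Suc Suc_le_length_iff)
    then show ?thesis by (simp add: b_simps)
  qed
  have F_long: "F xs = 0" if "2 \<le> length xs" for xs
  proof -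
    from that obtain x1 x2 ys where "xs = x1 # x2 # ys"
      by (auto simp: numeral_eq_Suc Suc_le_length_iff)
    then show ?thesis by (simp add: F_simps)
  qed
  have lens: "(us = [] \<and> ws = []) \<or> (\<exists>k z. us = [] \<and> ws = [(k, z)]) \<or> (\<exists>k z. us = [(k, z)] \<and> ws = []) \<or>
      (2 \<le> length us + length ws)" for us ws :: "(int \<times> 'a) list"
    by (cases us; cases "tl us"; cases ws; cases "tl ws") auto
  have mm: "m k x n y \<in> piece P (k + n - 1)" if "x \<in> piece P k" "y \<in> piece P n" for k x n y
  proof -
    have "smul P (co k x) y \<in> piece P (k + n - 1)"
      using that u(5)[of x k] gP q by (cases "k = 1") auto
    moreover have "smul P (co n y) (\<pi> k x) \<in> piece P (k + n - 1)"
      using that u(5)[of y n] u(3)[of x k] gP q by (cases "n = 1") auto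
    ultimately show ?thesis by (simp add: m_def gP)
  qed
  have "mlin P (smul P) b"
    unfolding mlin_def
  proof (intro conjI ballI allI)
    fix us ws n a x y assume *: "us \<in> tlists P" "ws \<in> tlists P" "x \<in> piece P n" "y \<in> piece P n"
    have co1: "co n (smul P a x + y) = a * co n x + co n y" using u(4) * by blast
    have co: "co n (smul P a x + y) = a * co n x + co n y" "co n (y + smul P a x) = a * co n x + co n y"
      using co1 by (simp_all add: add.commute)
    consider "us = []" "ws = []" | k z where "us = []" "ws = [(k, z)]" | k z where "us = [(k, z)]" "ws = []"
      | "2 \<le> length us + length ws" using lens[of us ws] by blast
    then show "b (us @ (n, smul P a x + y) # ws) = smul P a (b (us @ (n, x) # ws)) + b (us @ (n, y) # ws)"
    proof cases
      case 1
      then show ?thesis using * gP by (simp add: b_simps graded_linearD[OF dP(2)])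
    next
      case 2
      then show ?thesis using * gP by (simp add: b_simps m_def co graded_linearD[OF u(1)] q sg_add algebra_simps)
    next
      case 3
      then show ?thesis using * gP by (simp add: b_simps m_def co q sg_add algebra_simps)
    next
      case 4
      then show ?thesis using q by (simp add: b_long)
    qed
  qed (use dP(1) gP(4) in auto)
  moreover have "b xs \<in> piece P (degree xs + - 1)" if xs0: "xs \<in> tlists P" "xs \<noteq> []" for xs
  proof -
    obtain n x ys where xs: "xs = (n, x) # ys" using xs0(2) by (cases xs) auto
    show ?thesis
    proof (cases ys)
      case Nil
      then show ?thesis using xs0 dP(4)[of x n] by (simp add: xs b_simps)
    next
      case (Cons z zs)
      obtain k y where z: "z = (k, y)" by (cases z)
      show ?thesis
      proof (cases zs)
        case Nil
        then show ?thesis using xs0 mm[of x n y k] by (simp add: xs Cons z b_simps)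
      next
        case (Cons z' zs')
        then show ?thesis using gP by (simp add: xs \<open>ys = z # zs\<close> b_simps)
      qed
    qed
  qed
  ultimately have bg: "gfam P P (-1) b" using dP(1) by (simp add: gfam_def)
  have "mlin P (smul Q) F"
    unfolding mlin_def
  proof (intro conjI ballI allI)
    fix us ws n a x y assume *: "us \<in> tlists P" "ws \<in> tlists P" "x \<in> piece P n" "y \<in> piece P n"
    show "F (us @ (n, smul P a x + y) # ws) = smul Q a (F (us @ (n, x) # ws)) + F (us @ (n, y) # ws)"
    proof (cases "us = [] \<and> ws = []")
      case False
      then have "2 \<le> length (us @ z # ws)" for z by (cases us; cases ws) auto
      then show ?thesis using F_long qmodule_simps[OF gQ(4)] by simp
    qed (use * gP in \<open>simp add: F_simps graded_linearD[OF f1]\<close>)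
  qed (use dP(1) gQ(4) in auto)
  moreover have "F xs \<in> piece Q (degree xs + 0)" if xs0: "xs \<in> tlists P" "xs \<noteq> []" for xs
  proof -
    obtain n x ys where xs: "xs = (n, x) # ys" using xs0(2) by (cases xs) auto
    then show ?thesis using xs0 gQ graded_linearD(1)[OF f1, of x n] by (cases ys) (simp_all add: F_simps)
  qed
  ultimately have Fg: "gfam P Q 0 F" using gfamD(1)[OF \<beta>] by (simp add: gfam_def)
  have "unital P U b"
    unfolding unital_def
  proof (intro ballI conjI allI impI)
    fix e assume e: "e \<in> U"
    show "e \<in> piece P 1" "b [(1, e)] = 0" using u(6)[OF e] dU[OF e] by (simp_all add: b_simps)
    show "b [(1, e), (n, x)] = x" if "x \<in> piece P n" for n x
      using u(7,8)[OF e] that q by (simp add: b_simps m_def)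
    show "b [(n, x), (1, e)] = sg (n - 1) x" if "x \<in> piece P n" for n x
      using u(8)[OF e] u(9)[OF e, of x] u(5,10)[of x n] that q by (cases "n = 1") (simp_all add: b_simps m_def)
    show "b (us @ (1, e) # ws) = 0" if "2 \<le> length us + length ws" for us ws
      using that by (simp add: b_long)
  qed
  moreover have "unital_map P U V F"
    unfolding unital_map_def
  proof (intro ballI conjI impI)
    show "F (us @ (1, e) # ws) = 0" if "us @ ws \<noteq> []" for e us ws
      using that by (intro F_long) (cases us; cases ws; simp)
  qed (use f1U in \<open>simp add: F_simps\<close>)
  moreover have "cd b b xs = 0 \<and> mdef b \<beta> F xs = 0" if xs0: "xs \<in> tlists P" "xs \<noteq> []" "length xs < 2" for xs
  proof -
    obtain n x where x: "xs = [(n, x)]" "x \<in> piece P n"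
      using xs0 by (cases xs) auto
    then show ?thesis using f1d[OF x(2)] dP(3)[OF x(2)] by (simp add: mdef_def cd_Cons cf_Cons b_simps F_simps)
  qed
  ultimately have "approx 2 (b, F)" using bg Fg by (simp add: approx_def b_simps F_simps)
  then show ?thesis by blast
qed

text \<open>
  The curvature and the negative defect in arity \<open>k\<close> form a cycle of multilinear maps into the
  acyclic cone of \<open>f1\<close>; subtracting a primitive from \<open>(b, F)\<close> kills both.
\<close>

lemma approx_step:
  assumes "approx k (b, F)" "2 \<le> k"
  shows "\<exists>b' F'. approx (Suc k) (b', F') \<and> (\<forall>xs. length xs \<noteq> k \<longrightarrow> b' xs = b xs \<and> F' xs = F xs)"
proof -
  have b: "gfam P P (-1) b" and F: "gfam P Q 0 F"
    and lin: "\<And>n x. x \<in> piece P n \<Longrightarrow> b [(n, x)] = d n x" "\<And>n x. x \<in> piece P n \<Longrightarrow> F [(n, x)] = f1 n x"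
    and ub: "unital P U b" and uF: "unital_map P U V F"
    and low: "\<And>xs. xs \<in> tlists P \<Longrightarrow> xs \<noteq> [] \<Longrightarrow> length xs < k \<Longrightarrow> cd b b xs = 0"
      "\<And>xs. xs \<in> tlists P \<Longrightarrow> xs \<noteq> [] \<Longrightarrow> length xs < k \<Longrightarrow> mdef b \<beta> F xs = 0"
    using assms(1) by (auto simp: approx_def)
  note dP = chain_complexD[OF Pc] and u = unit_dataD[OF U]
  note gP = graded_moduleD[OF dP(1)] and gQ = graded_moduleD[OF gfamD(1)[OF \<beta>]]
  note mb = gfam_maps_to[OF b] and mF = gfam_maps_to[OF F]
  define R where "R = cd b b"
  define S where "S = mdef b \<beta> F"
  have Rg: "gfam P P (-2) R" unfolding R_def by (rule cd_gfam[OF b b]) simp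
  have Sg: "gfam P Q (-1) S"
  proof -
    have "gfam P Q (-1) (cf F \<beta>)" "gfam P Q (-1) (cd b F)"
      by (rule cf_gfam[OF F \<beta>]) (rule cd_gfam[OF b F], simp)
    from gfam_diff[OF this] show ?thesis unfolding S_def mdef_def[abs_def] .
  qed
  \<comment> \<open>The minus sign turns the two Bianchi identities into the cycle condition for
    \<open>dcone\<close>.\<close>
  define G where "G xs = (if xs \<in> tlists P \<and> length xs = k then (R xs, - S xs) else 0)" for xs
  have knz: "xs \<noteq> []" if "length xs = k" for xs :: "(int \<times> 'a) list" using that assms(2) by auto
  have Gm: "G \<in> piece (Hom P (cone P Q) k) (-2)"
  proof (intro HomI)
    have "mlin P (smul (cone P Q)) (\<lambda>xs. (R xs, - S xs))"
      using gfamD(4)[OF Rg] gfamD(4)[OF Sg] graded_qmodule[OF cone_graded[OF dP(1) gfamD(1)[OF \<beta>]]] qmodule_simps[OF gQ(4)]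
      by (simp add: mlin_def)
    from mlin_trunc[OF this, of k] show "mlin P (smul (cone P Q)) G"
      by (rule subst[where P = "mlin P (smul (cone P Q))", rotated]) (auto simp: G_def)
    show "G xs \<in> piece (cone P Q) (degree xs + - 2)" if "xs \<in> tlists P" "length xs = k" for xs
      using gfam_mem[OF Rg, of xs] gfam_mem[OF Sg, of xs] that knz[of xs] gQ by (simp add: G_def)
  qed (auto simp: G_def)
  have Gv: "vanish P U G"
    unfolding vanish_def G_def R_def S_def
    by (simp add: cd_unit_b[OF b ub] mdef_unit[OF b \<beta> F ub V uF] zero_prod_def)
  \<comment> \<open>Curvature and defect vanish below arity \<open>k\<close>, so on both of them
    \<open>cd b\<close> reduces to the Koszul differential, and the Bianchi identities evaluate
    it.\<close>
  have cyc: "dcone d f1 d\<beta> (degree xs + - 2) (G xs) = sg (- 2) (dd d G xs)" if xs: "xs \<in> tlists P" "length xs = k" for xs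
  proof -
    have ddG: "dd d G xs = (dd d R xs, - dd d S xs)"
    proof -
      have "dd d G xs = dd d (\<lambda>ys. (R ys, - S ys)) xs"
        by (rule dd_cong[OF dP(2) xs(1)]) (use xs in \<open>auto simp: G_def\<close>)
      then show ?thesis using dd_sum(2)[of d 1 S xs] by (simp add: dd_pair)
    qed
    have R0: "cd b b ys = 0" if "ys \<in> tlists P" "length ys < length xs" for ys
      using low(1)[OF that(1)] that(2) xs(2) by (cases "ys = []") auto
    have S0: "mdef b \<beta> F ys = 0" if "ys \<in> tlists P" "length ys < length xs" "ys \<noteq> []" for ys
      using low(2) that xs(2) by auto
    have Rx: "R xs \<in> piece P (degree xs - 2)" using gfam_mem[OF Rg xs(1) knz[OF xs(2)]] by simp
    have "dd d R xs = cd b R xs"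
      by (rule cd_dd[OF mb lin(1) xs(1), symmetric]) (use R0 in \<open>auto simp: R_def\<close>)
    also have "\<dots> = b [(degree xs - 2, R xs)]"
      unfolding R_def using R0 by (intro cd_cd[OF b gfamD(4)[OF b] xs(1) knz[OF xs(2)]])
    finally have 1: "dd d R xs = d (degree xs - 2) (R xs)" using lin(1)[OF Rx] by simp
    have "dd d S xs = cd b S xs"
      by (rule cd_dd[OF mb lin(1) xs(1), symmetric]) (use S0 in \<open>auto simp: S_def\<close>)
    also have "\<dots> = cd b (cf F \<beta>) xs - cd b (cd b F) xs"
      unfolding S_def mdef_def cd_diff ..
    also have "cd b (cd b F) xs = F [(degree xs - 2, R xs)]"
      unfolding R_def using R0 by (intro cd_cd[OF b gfamD(4)[OF F] xs(1) knz[OF xs(2)]])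
    also have "cd b (cf F \<beta>) xs = - \<beta> [(degree xs - 1, S xs)]"
    proof -
      have "cf F (cd \<beta> \<beta>) xs - cd b (cf F \<beta>) xs = \<beta> [(degree xs - 1, S xs)]"
        unfolding S_def using S0 by (intro cf_cd[OF b \<beta> F gfamD(4)[OF \<beta>] xs(1) knz[OF xs(2)]])
      moreover have "cf F (cd \<beta> \<beta>) xs = 0" by (rule cf_0[OF mF xs(1)]) (rule \<beta>\<beta>)
      ultimately have "- cd b (cf F \<beta>) xs = \<beta> [(degree xs - 1, S xs)]" by simp
      from arg_cong[OF this, of uminus] show ?thesis by simp
    qed
    finally have 2: "dd d S xs = - \<beta> [(degree xs - 1, S xs)] - f1 (degree xs - 2) (R xs)" using lin(2)[OF Rx] by simp
    have Sx: "S xs \<in> piece Q (degree xs - 1)" using gfam_mem[OF Sg xs(1) knz[OF xs(2)]] by simp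
    show ?thesis
      using xs 1 2 additive_on_simps(2)[OF d\<beta>_additive Sx] unfolding ddG
      by (simp add: dcone_def G_def sg_def)
  qed
  obtain H where H: "H \<in> piece (Hom P (cone P Q) k) (- 2 + 1)" "vanish P U H"
    "\<And>xs. xs \<in> tlists P \<Longrightarrow> length xs = k \<Longrightarrow>
      G xs = dcone d f1 d\<beta> (degree xs + - 2 + 1) (H xs) + sg (- 2) (dd d H xs)"
    using Hom_lift[OF P U dU cone_c acyclic Gm Gv cyc] by blast
  note Hm = HomD[OF H(1)]
  define g1 where "g1 xs = fst (H xs)" for xs
  define g2 where "g2 xs = snd (H xs)" for xs
  have g0: "g1 xs = 0 \<and> g2 xs = 0" if "length xs \<noteq> k" for xs using Hm(3)[of xs] that by (simp add: g1_def g2_def)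
  have g1m: "g1 xs \<in> piece P (degree xs - 1)" and g2m: "g2 xs \<in> piece Q (degree xs)" if "xs \<in> tlists P" for xs
    using Hm(2)[OF that _ refl] g0[of xs] gP gQ by (cases "length xs = k"; auto simp: g1_def g2_def)+
  have gl: "mlin P (smul P) g1" "mlin P (smul Q) g2"
    using Hm(1) gP(4) gQ(4) by (auto simp: mlin_def g1_def g2_def)
  have gv: "g1 (us @ (1, e) # ws) = 0" "g2 (us @ (1, e) # ws) = 0" if "e \<in> U" "us \<in> tlists P" "ws \<in> tlists P" for e us ws
    using H(2) that by (auto simp: vanish_def g1_def g2_def)
  have eq: "R xs = d (degree xs - 1) (g1 xs) + dd d g1 xs"
      "- S xs = f1 (degree xs - 1) (g1 xs) - \<beta> [(degree xs, g2 xs)] + dd d g2 xs"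
    if xs: "xs \<in> tlists P" "length xs = k" for xs
  proof -
    have "dd d H xs = (dd d g1 xs, dd d g2 xs)"
      using dd_pair[of d g1 g2 xs] by (simp add: g1_def g2_def)
    with H(3)[OF xs] xs show "R xs = d (degree xs - 1) (g1 xs) + dd d g1 xs"
      "- S xs = f1 (degree xs - 1) (g1 xs) - \<beta> [(degree xs, g2 xs)] + dd d g2 xs"
      by (simp_all add: G_def dcone_def g1_def g2_def sg_def)
  qed
  \<comment> \<open>The correction lives in arity \<open>k\<close> alone and vanishes on the unit,
    so the equations of lower arity and the unit law survive.\<close>
  define b' where "b' xs = b xs - g1 xs" for xs
  define F' where "F' xs = F xs - g2 xs" for xs
  have same: "b' xs = b xs \<and> F' xs = F xs" if "length xs \<noteq> k" for xs using g0[OF that] by (simp add: b'_def F'_def)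
  have b': "gfam P P (-1) b'"
    unfolding b'_def[abs_def] using g1m gl dP(1) by (intro gfam_diff b) (simp add: gfam_def)
  have F': "gfam P Q 0 F'"
    unfolding F'_def[abs_def] using g2m gl gfamD(1)[OF \<beta>] by (intro gfam_diff F) (simp add: gfam_def)
  note mb' = gfam_maps_to[OF b'] and mF' = gfam_maps_to[OF F']
  have lin': "b' [(n, x)] = d n x" "F' [(n, x)] = f1 n x" if "x \<in> piece P n" for n x
    using same[of "[(n, x)]"] assms(2) lin[OF that] by auto
  have ub': "unital P U b'"
    unfolding unital_def
  proof (intro ballI conjI allI impI)
    fix e assume e: "e \<in> U"
    note e' = unitalD[OF ub e]
    show "e \<in> piece P 1" by (rule e')
    show "b' [(1, e)] = 0" using e'(2) gv[OF e, of "[]" "[]"] by (simp add: b'_def)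
    show "b' [(1, e), (n, x)] = x" if "x \<in> piece P n" for n x
      using e'(3)[OF that] gv[OF e, of "[]" "[(n, x)]"] that by (simp add: b'_def)
    show "b' [(n, x), (1, e)] = sg (n - 1) x" if "x \<in> piece P n" for n x
      using e'(4)[OF that] gv[OF e, of "[(n, x)]" "[]"] that by (simp add: b'_def)
    show "b' (us @ (1, e) # ws) = 0" if "us \<in> tlists P" "ws \<in> tlists P" "2 \<le> length us + length ws" for us ws
      using e'(5)[OF that] gv[OF e that(1,2)] by (simp add: b'_def)
  qed
  have uF': "unital_map P U V F'"
    unfolding unital_map_def
  proof (intro ballI conjI impI)
    fix e assume e: "e \<in> U"
    show "F' [(1, e)] \<in> V" using unital_mapD(1)[OF uF e] gv[OF e, of "[]" "[]"] by (simp add: F'_def)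
    show "F' (us @ (1, e) # ws) = 0" if "us \<in> tlists P" "ws \<in> tlists P" "us @ ws \<noteq> []" for us ws
      using unital_mapD(2)[OF uF e that] gv[OF e that(1,2)] by (simp add: F'_def)
  qed
  have "cd b' b' xs = 0 \<and> mdef b' \<beta> F' xs = 0" if xs: "xs \<in> tlists P" "xs \<noteq> []" "length xs < Suc k" for xs
  proof (cases "length xs = k")
    case False
    then have l: "length xs < k" using xs by simp
    have "cd b' b' xs = cd b b' xs" by (rule cd_eq[OF xs(1)]) (use same l in auto)
    also have "\<dots> = cd b b xs" by (rule cd_cong[OF mb xs(1)]) (use same l in auto)
    finally have 1: "cd b' b' xs = cd b b xs" .
    have "cd b' F' xs = cd b F' xs" by (rule cd_eq[OF xs(1)]) (use same l in auto)
    also have "\<dots> = cd b F xs" by (rule cd_cong[OF mb xs(1)]) (use same l in auto)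
    finally have 2: "cd b' F' xs = cd b F xs" .
    have "cf F' \<beta> xs = cf F \<beta> xs" by (rule cf_eq[OF xs(1)]) (use same l in auto)
    then show ?thesis using 1 2 low(1,2)[OF xs(1,2) l] by (simp add: mdef_def)
  next
    case True
    \<comment> \<open>Since \<open>k\<close> is at least 2, two corrections of arity
      \<open>k\<close> do not fit on a list of length \<open>k\<close>. They enter linearly,
      combined with arity one components only, and so change the obstruction exactly by the boundary
      of the primitive.\<close>
    have eqb: "b' ys = b ys" and eqF: "F' ys = F ys" if "length ys < length xs" for ys using same that True by auto
    have bx: "b xs \<in> piece P (degree xs - 1)" "g1 xs \<in> piece P (degree xs - 1)" "b' xs \<in> piece P (degree xs - 1)"
      using gfam_mem[OF b xs(1,2)] gfam_mem[OF b' xs(1,2)] g1m[OF xs(1)] by auto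
    have Fx: "F xs \<in> piece Q (degree xs)" "g2 xs \<in> piece Q (degree xs)"
      using gfam_mem[OF F xs(1,2)] g2m[OF xs(1)] by auto
    have dd1: "cd b' g1 xs = dd d g1 xs" "cd b' g2 xs = dd d g2 xs"
      by (rule cd_dd[OF mb' lin'(1) xs(1)]; use g0 True in simp)+
    have b1: "b [(degree xs - 1, b' xs)] = b [(degree xs - 1, b xs)] - d (degree xs - 1) (g1 xs)"
      using additive_on_diff[OF graded_linear_additive[OF dP(2,1)] bx(1,2)] lin(1)[OF bx(1)] lin(1)[OF bx(3)] by (simp add: b'_def)
    have "cd b' b' xs = cd b' b xs - cd b' g1 xs" unfolding b'_def[abs_def] by (rule cd_diff)
    also have "cd b' b xs = R xs - d (degree xs - 1) (g1 xs)"
      using cd_change[OF xs(1,2) eqb, where f = b] b1 by (simp add: R_def)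
    finally have 1: "cd b' b' xs = 0" using eq(1)[OF xs(1) True] dd1 by simp
    have F1: "F [(degree xs - 1, b' xs)] = F [(degree xs - 1, b xs)] - f1 (degree xs - 1) (g1 xs)"
      using additive_on_diff[OF graded_linear_additive[OF f1 dP(1)] bx(1,2)] lin(2)[OF bx(1)] lin(2)[OF bx(3)] by (simp add: b'_def)
    have "cd b' F' xs = cd b' F xs - cd b' g2 xs" unfolding F'_def[abs_def] by (rule cd_diff)
    also have "cd b' F xs = cd b F xs - f1 (degree xs - 1) (g1 xs)"
      using cd_change[OF xs(1,2) eqb, where f = F] F1 by simp
    finally have 2: "cd b' F' xs = cd b F xs - f1 (degree xs - 1) (g1 xs) - dd d g2 xs" using dd1 by simp
    have "\<beta> [(degree xs, F' xs)] = \<beta> [(degree xs, F xs)] - \<beta> [(degree xs, g2 xs)]"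
      using additive_on_diff[OF d\<beta>_additive Fx] by (simp add: F'_def)
    then have 3: "cf F' \<beta> xs = cf F \<beta> xs - \<beta> [(degree xs, g2 xs)]"
      using cf_change[OF xs(1,2) eqF, where f = \<beta>] by simp
    have "mdef b' \<beta> F' xs = S xs + (f1 (degree xs - 1) (g1 xs) - \<beta> [(degree xs, g2 xs)] + dd d g2 xs)"
      unfolding mdef_def S_def 2 3 by simp
    also have "\<dots> = 0" unfolding eq(2)[OF xs(1) True, symmetric] by simp
    finally show ?thesis using 1 by simp
  qed
  then have "approx (Suc k) (b', F')" using b' F' lin' ub' uF' by (simp add: approx_def)
  then show ?thesis using same by blast
qed

text \<open>The passage from \<open>z j\<close> to its successor alters arity \<open>j + 2\<close>
  only. The component of each arity is eventually constant, and the limit is taken arity by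
  arity.\<close>

theorem transfer_exists:
  "\<exists>b F. \<forall>k. approx k (b, F)"
proof -
  have "\<exists>z. \<forall>j. approx (j + 2) (z j) \<and>
    (\<forall>xs. length xs \<noteq> j + 2 \<longrightarrow> fst (z (Suc j)) xs = fst (z j) xs \<and> snd (z (Suc j)) xs = snd (z j) xs)"
  proof (rule dependent_nat_choice)
    show "\<exists>z. approx (0 + 2) z" using approx_base by (simp only: add_0)
    fix z j assume "approx (j + 2) z"
    then show "\<exists>y. approx (Suc j + 2) y \<and>
      (\<forall>xs. length xs \<noteq> j + 2 \<longrightarrow> fst y xs = fst z xs \<and> snd y xs = snd z xs)"
      using approx_step[of "j + 2" "fst z" "snd z"] by force
  qed
  then obtain z where z: "\<And>j. approx (j + 2) (z j)"
    "\<And>j xs. length xs \<noteq> j + 2 \<Longrightarrow> fst (z (Suc j)) xs = fst (z j) xs \<and> snd (z (Suc j)) xs = snd (z j) xs" by blast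
  define b where "b xs = fst (z (length xs)) xs" for xs
  define F where "F xs = snd (z (length xs)) xs" for xs
  have stable: "fst (z (length xs + i)) xs = b xs \<and> snd (z (length xs + i)) xs = F xs" for xs i
    by (induction i) (simp_all add: b_def F_def z(2))
  have st: "b xs = fst (z j) xs" "F xs = snd (z j) xs" if "length xs \<le> j" for xs j
    using stable[of xs "j - length xs"] that by auto
  have zz: "gfam P P (-1) (fst (z j))" "gfam P Q 0 (snd (z j))"
     "x \<in> piece P n \<Longrightarrow> fst (z j) [(n, x)] = d n x \<and> snd (z j) [(n, x)] = f1 n x"
     "unital P U (fst (z j))" "unital_map P U V (snd (z j))"
     "xs \<in> tlists P \<Longrightarrow> xs \<noteq> [] \<Longrightarrow> length xs < j + 2 \<Longrightarrow> cd (fst (z j)) (fst (z j)) xs = 0 \<and> mdef (fst (z j)) \<beta> (snd (z j)) xs = 0"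
    for j n x xs
    using z(1)[of j] by (auto simp: approx_def split_def)
  have b: "gfam P P (-1) b"
    unfolding gfam_def mlin_def
  proof (intro conjI ballI allI impI)
    show "b (us @ (n, smul P a x + y) # ws) = smul P a (b (us @ (n, x) # ws)) + b (us @ (n, y) # ws)"
      if "us \<in> tlists P" "ws \<in> tlists P" "x \<in> piece P n" "y \<in> piece P n" for us ws n a x y
      using mlinD(3)[OF gfamD(4)[OF zz(1)] that, of "Suc (length us + length ws)"] by (simp add: b_def)
    show "b xs \<in> piece P (degree xs + - 1)" if "xs \<in> tlists P" "xs \<noteq> []" for xs
      using gfamD(5)[OF zz(1) that] by (simp add: b_def)
  qed (use gfamD(1,3)[OF zz(1)] in auto)
  have F: "gfam P Q 0 F"
    unfolding gfam_def mlin_def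
  proof (intro conjI ballI allI impI)
    show "F (us @ (n, smul P a x + y) # ws) = smul Q a (F (us @ (n, x) # ws)) + F (us @ (n, y) # ws)"
      if "us \<in> tlists P" "ws \<in> tlists P" "x \<in> piece P n" "y \<in> piece P n" for us ws n a x y
      using mlinD(3)[OF gfamD(4)[OF zz(2)] that, of "Suc (length us + length ws)"] by (simp add: F_def)
    show "F xs \<in> piece Q (degree xs + 0)" if "xs \<in> tlists P" "xs \<noteq> []" for xs
      using gfamD(5)[OF zz(2) that] by (simp add: F_def)
  qed (use gfamD(1-3)[OF zz(2)] in auto)
  have ub: "unital P U b"
    unfolding unital_def
  proof (intro ballI conjI allI impI)
    fix e assume e: "e \<in> U"
    note e' = unitalD[OF zz(4) e]
    show "e \<in> piece P 1" by (rule e')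
    show "b [(1, e)] = 0" using e'(2) by (simp add: b_def)
    show "b [(1, e), (n, x)] = x" "b [(n, x), (1, e)] = sg (n - 1) x" if "x \<in> piece P n" for n x
      using e'(3,4)[OF that] by (simp_all add: b_def)
    show "b (us @ (1, e) # ws) = 0" if "us \<in> tlists P" "ws \<in> tlists P" "2 \<le> length us + length ws" for us ws
      using e'(5)[OF that] by (simp add: b_def)
  qed
  have uF: "unital_map P U V F"
    using zz(5) unfolding unital_map_def F_def by blast
  have "cd b b xs = 0 \<and> mdef b \<beta> F xs = 0" if xs: "xs \<in> tlists P" "xs \<noteq> []" for xs
  proof -
    define j where "j = length xs"
    note mb = gfam_maps_to[OF zz(1)]
    have 1: "cd b f xs = cd (fst (z j)) f xs" for f :: "_ \<Rightarrow> 'x::ab_group_add"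
      by (rule cd_eq[OF xs(1)]) (simp add: st j_def)
    have "cd (fst (z j)) b xs = cd (fst (z j)) (fst (z j)) xs"
        "cd (fst (z j)) F xs = cd (fst (z j)) (snd (z j)) xs"
      by (rule cd_cong[OF mb xs(1)], simp add: st j_def)+
    moreover have "cf F \<beta> xs = cf (snd (z j)) \<beta> xs"
      by (rule cf_eq[OF xs(1)]) (simp add: st j_def)
    ultimately show ?thesis using zz(6)[OF xs, of j] by (simp add: mdef_def j_def 1)
  qed
  moreover have "b [(n, x)] = d n x \<and> F [(n, x)] = f1 n x" if "x \<in> piece P n" for n x
    using zz(3)[OF that] by (simp add: b_def F_def)
  ultimately show ?thesis using b F ub uF by (intro exI[of _ b] exI[of _ F]) (simp add: approx_def)
qed

end

section \<open>The homotopy fibre product of two morphisms\<close>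

text \<open>The middle entry sits one degree higher because it stands for a homotopy between the
  images in \<open>Q\<close> of the outer two. With \<open>Q\<close> in all three places this is the
  path object of \<open>Q\<close>.\<close>

definition triple ::
  "('q, 'a) graded \<Rightarrow> ('q, 'b) graded \<Rightarrow> ('q, 'c) graded \<Rightarrow> ('q, 'a \<times> 'b \<times> 'c) graded" where
  "triple P Q P' = \<lparr>smul = (\<lambda>a z. (smul P a (fst z), smul Q a (fst (snd z)), smul P' a (snd (snd z)))),
     piece = (\<lambda>n. piece P n \<times> piece Q (n + 1) \<times> piece P' n)\<rparr>"

lemma triple_simps [simp]:
  "smul (triple P Q P') a (x, h, y) = (smul P a x, smul Q a h, smul P' a y)"
  "piece (triple P Q P') n = piece P n \<times> piece Q (n + 1) \<times> piece P' n"
  by (simp_all add: triple_def)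

lemma triple_graded:
  "graded_module P \<Longrightarrow> graded_module Q \<Longrightarrow> graded_module P' \<Longrightarrow> graded_module (triple P Q P')"
  unfolding graded_module_def submodule_def
  by (auto simp: qmodule_def prod_eq_iff zero_prod_def triple_def)

section \<open>Projections to the three entries\<close>

definition p0 :: "int \<times> 'a \<times> 'b \<times> 'c \<Rightarrow> int \<times> 'a" where "p0 z = (fst z, fst (snd z))"
definition p1 :: "int \<times> 'a \<times> 'b \<times> 'c \<Rightarrow> int \<times> 'b" where "p1 z = (fst z + 1, fst (snd (snd z)))"
definition p2 :: "int \<times> 'a \<times> 'b \<times> 'c \<Rightarrow> int \<times> 'c" where "p2 z = (fst z, snd (snd (snd z)))"

lemma p_simps [simp]:
  "p0 (n, x, h, y) = (n, x)" "p1 (n, x, h, y) = (n + 1, h)" "p2 (n, x, h, y) = (n, y)"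
  "fst (p0 z) = fst z" "fst (p1 z) = fst z + 1" "fst (p2 z) = fst z"
  "degree (map p0 zs) = degree zs" "degree (map p2 zs) = degree zs"
  by (simp_all add: p0_def p1_def p2_def degree_def o_def)

lemma p_pair: "p0 (n, z) = (n, fst z)" "p1 (n, z) = (n + 1, fst (snd z))" "p2 (n, z) = (n, snd (snd z))"
  by (simp_all add: p0_def p1_def p2_def)

lemma p_mem:
  assumes "snd z \<in> piece (triple P Q P') (fst z)"
  shows "snd (p0 z) \<in> piece P (fst z)" "snd (p1 z) \<in> piece Q (fst z + 1)" "snd (p2 z) \<in> piece P' (fst z)"
  using assms by (cases z; simp)+

lemma p_tlists: "zs \<in> tlists (triple P Q P') \<Longrightarrow> map p0 zs \<in> tlists P \<and> map p2 zs \<in> tlists P'"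
  by (induction zs) (auto simp: p_mem)

lemma mlin_map0:
  assumes "mlin P s f" "graded_module Q" "graded_module P'"
  shows "mlin (triple P Q P') s (\<lambda>zs. f (map p0 zs))"
  unfolding mlin_def
proof (intro conjI ballI allI)
  show "f (map p0 (us @ (n, smul (triple P Q P') a x + y) # ws)) = s a (f (map p0 (us @ (n, x) # ws))) + f (map p0 (us @ (n, y) # ws))"
    if "us \<in> tlists (triple P Q P')" "ws \<in> tlists (triple P Q P')" "x \<in> piece (triple P Q P') n" "y \<in> piece (triple P Q P') n" for us ws n a x y
    using mlinD(3)[OF assms(1), of "map p0 us" "map p0 ws" "fst x" n "fst y" a] that p_tlists[OF that(1)] p_tlists[OF that(2)]
    by (cases x; cases y) simp
qed (use assms mlinD triple_graded in blast)+

lemma mlin_map2: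
  assumes "mlin P' s f" "graded_module Q" "graded_module P"
  shows "mlin (triple P Q P') s (\<lambda>zs. f (map p2 zs))"
  unfolding mlin_def
proof (intro conjI ballI allI)
  show "f (map p2 (us @ (n, smul (triple P Q P') a x + y) # ws)) = s a (f (map p2 (us @ (n, x) # ws))) + f (map p2 (us @ (n, y) # ws))"
    if "us \<in> tlists (triple P Q P')" "ws \<in> tlists (triple P Q P')" "x \<in> piece (triple P Q P') n" "y \<in> piece (triple P Q P') n" for us ws n a x y
    using mlinD(3)[OF assms(1), of "map p2 us" "map p2 ws" "snd (snd x)" n "snd (snd y)" a] that p_tlists[OF that(1)] p_tlists[OF that(2)]
    by (cases x; cases y) simp
qed (use assms mlinD triple_graded in blast)+

lemma mlin_triple:
  assumes "mlin A (smul P) f" "mlin A (smul Q) g" "mlin A (smul P') h" "graded_module (triple P Q P')"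
  shows "mlin A (smul (triple P Q P')) (\<lambda>xs. (f xs, g xs, h xs))"
  using assms graded_qmodule[OF assms(4)] by (simp add: mlin_def)

lemma mlin_proj:
  assumes "mlin A (smul (triple P Q P')) f" "graded_module P" "graded_module Q" "graded_module P'"
  shows "mlin A (smul P) (\<lambda>xs. fst (f xs))" "mlin A (smul Q) (\<lambda>xs. fst (snd (f xs)))" "mlin A (smul P') (\<lambda>xs. snd (snd (f xs)))"
  using assms graded_qmodule[OF assms(2)] graded_qmodule[OF assms(3)] graded_qmodule[OF assms(4)]
  by (simp_all add: mlin_def triple_def)

lemma cf_pair: "cf F (\<lambda>ys. (f ys, g ys)) xs = (cf F f xs, cf F g xs)"
proof -
  have "(\<Sum>ys\<leftarrow>cs. (f ys, g ys)) = (\<Sum>ys\<leftarrow>cs. f ys, \<Sum>ys\<leftarrow>cs. g ys)" for cs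
    by (induction cs) (auto simp: zero_prod_def)
  then show ?thesis by (simp add: cf_def)
qed

lemma cd_pair: "cd b (\<lambda>ys. (f ys, g ys)) xs = (cd b f xs, cd b g xs)"
proof -
  have "(\<Sum>(i, ys)\<leftarrow>cs. sg i (f ys, g ys)) = (\<Sum>(i, ys)\<leftarrow>cs. sg i (f ys), \<Sum>(i, ys)\<leftarrow>cs. sg i (g ys))" for cs
    by (induction cs) (auto simp: zero_prod_def sg_def)
  then show ?thesis by (simp add: cd_def)
qed

text \<open>
  If \<open>\<Phi> = (F, H, G)\<close>, then \<open>cf \<Phi> (dl f)\<close> is \<open>f\<close> after the \<open>(F, G)\<close>-coderivation of degree \<open>1\<close> with
  corestriction \<open>H\<close>.
\<close>

primrec dl :: "((int \<times> 'b) list \<Rightarrow> 'c::ab_group_add) \<Rightarrow> (int \<times> 'b \<times> 'b \<times> 'b) list \<Rightarrow> 'c" where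
  "dl f [] = 0"
| "dl f (y # ys) = sg (fst y) (dl (\<lambda>zs. f (p0 y # zs)) ys) + f (p1 y # map p2 ys)"

lemma dl_add: "dl (\<lambda>ys. f ys + g ys) ys = dl f ys + dl g ys"
  by (induction ys arbitrary: f g) (simp_all add: sg_add)

lemma dl_sg: "dl (\<lambda>ys. sg n (f ys)) ys = sg n (dl f ys)"
  by (induction ys arbitrary: f) (simp_all add: sg_add sg_commute)

lemma dl_cong:
  "ys \<in> tlists (triple Q Q Q) \<Longrightarrow>
   (\<And>zs. zs \<in> tlists Q \<Longrightarrow> degree zs = degree ys + 1 \<Longrightarrow> length zs = length ys \<Longrightarrow> f zs = g zs) \<Longrightarrow> dl f ys = dl g ys"
proof (induction ys arbitrary: f g)
  case (Cons y ys)
  have y: "snd y \<in> piece (triple Q Q Q) (fst y)" "ys \<in> tlists (triple Q Q Q)" using Cons.prems by auto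
  note pm = p_mem[OF y(1)]
  have "dl (\<lambda>zs. f (p0 y # zs)) ys = dl (\<lambda>zs. g (p0 y # zs)) ys"
    using pm y by (intro Cons.IH Cons.prems(2)) auto
  moreover have "f (p1 y # map p2 ys) = g (p1 y # map p2 ys)"
    using pm p_tlists[OF y(2)] by (intro Cons.prems(2)) auto
  ultimately show ?case by simp
qed simp

lemma dl_hom:
  assumes "additive_on M L"
  shows "ys \<in> tlists (triple Q Q Q) \<Longrightarrow>
   (\<And>zs. zs \<in> tlists Q \<Longrightarrow> degree zs = degree ys + 1 \<Longrightarrow> length zs = length ys \<Longrightarrow> f zs \<in> M) \<Longrightarrow>
     L (dl f ys) = dl (\<lambda>zs. L (f zs)) ys \<and> dl f ys \<in> M"
proof (induction ys arbitrary: f)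
  case (Cons y ys)
  have y: "snd y \<in> piece (triple Q Q Q) (fst y)" "ys \<in> tlists (triple Q Q Q)" using Cons.prems by auto
  note pm = p_mem[OF y(1)]
  have "L (dl (\<lambda>zs. f (p0 y # zs)) ys) = dl (\<lambda>zs. L (f (p0 y # zs))) ys \<and> dl (\<lambda>zs. f (p0 y # zs)) ys \<in> M"
    using pm y by (intro Cons.IH Cons.prems(2)) auto
  moreover have "f (p1 y # map p2 ys) \<in> M"
    using pm p_tlists[OF y(2)] by (intro Cons.prems(2)) auto
  ultimately show ?case using assms additive_on_simps[OF assms] by (simp add: additive_on_def)
qed (use assms additive_on_simps in \<open>auto simp: additive_on_def\<close>)

text \<open>The co-Leibniz rule of a coderivation along two strict maps: letters before the marked
  one go through \<open>p0\<close>, letters after it through \<open>p2\<close>.\<close>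

lemma dl_dec:
  "dl (dec g) ys = dec (\<lambda>u w. dl (\<lambda>a. g a (map p2 w)) u + sg (degree u) (dl (g (map p0 u)) w)) ys"
proof (induction ys arbitrary: g)
  case (Cons y ys)
  show ?case
    by (simp add: dl_add Cons.IH dec_map dec_add sg_add dec_sg[symmetric] sg_plus_exp sg_commute[of "fst y"] ac_simps)
qed simp

lemma dl_mlin:
  assumes "mlin Q s f"
  shows "mlin (triple Q Q Q) s (dl f)"
proof -
  let ?M = "triple Q Q Q"
  note q = qmodule_simps[OF mlinD(2)[OF assms]]
  note gQ = mlinD(1)[OF assms]
  have dl_smul: "dl (\<lambda>zs. s a (f zs)) ys = s a (dl f ys)" for a f ys
    by (induction ys arbitrary: f) (simp_all add: q)
  have key: "dl f (us @ (n, smul ?M a x + y) # ws) = s a (dl f (us @ (n, x) # ws)) + dl f (us @ (n, y) # ws)"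
    if "us \<in> tlists ?M" "ws \<in> tlists ?M" "x \<in> piece ?M n" "y \<in> piece ?M n" "mlin Q s f" for us ws n a x y f
    using that
  proof (induction us arbitrary: f)
    case Nil
    note f = mlinD(3)[OF Nil(5), of "[]"]
    obtain x0 x1 x2 y0 y1 y2 where xy: "x = (x0, x1, x2)" "y = (y0, y1, y2)" by (cases x; cases y)
    have "dl (\<lambda>zs. f ((n, smul Q a x0 + y0) # zs)) ws = dl (\<lambda>zs. s a (f ((n, x0) # zs)) + f ((n, y0) # zs)) ws"
      by (rule dl_cong[OF Nil(2)]) (use f Nil xy in auto)
    then show ?case using f[of "map p2 ws" x1 "n + 1" y1 a] Nil xy p_tlists[OF Nil(2)]
      by (simp add: dl_add dl_smul q sg_add ac_simps)
  next
    case (Cons z us)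
    have z: "snd z \<in> piece ?M (fst z)" "us \<in> tlists ?M" using Cons.prems by auto
    note pm = p_mem[OF z(1)]
    have "mlin Q s (\<lambda>zs. f (p0 z # zs))" using pm by (intro mlin_Cons[OF Cons.prems(5)]) simp
    note IH = Cons.IH[OF z(2) Cons.prems(2-4) this]
    have "f ((p1 z # map p2 us) @ (n, smul Q a (snd (snd x)) + snd (snd y)) # map p2 ws) =
      s a (f ((p1 z # map p2 us) @ (n, snd (snd x)) # map p2 ws)) + f ((p1 z # map p2 us) @ (n, snd (snd y)) # map p2 ws)"
      using pm p_tlists[OF z(2)] p_tlists[OF Cons.prems(2)] Cons.prems by (intro mlinD(3)[OF Cons.prems(5)]) auto
    then show ?case using IH by (cases x; cases y) (simp add: q sg_add ac_simps)
  qed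
  show ?thesis unfolding mlin_def
    by (intro conjI ballI allI mlinD(2)[OF assms] triple_graded[OF gQ gQ gQ] key assms)
qed

text \<open>The \<open>A\<^sub>\<infinity>\<close>-structure on the cochains of the interval with values in \<open>Q\<close>.\<close>

definition mpath :: "((int \<times> 'b) list \<Rightarrow> 'b::ab_group_add) \<Rightarrow> (int \<times> 'b \<times> 'b \<times> 'b) list \<Rightarrow> 'b \<times> 'b \<times> 'b" where
  "mpath \<beta> ys = (\<beta> (map p0 ys), fst (idn ys) - snd (snd (idn ys)) - dl \<beta> ys, \<beta> (map p2 ys))"

lemma dl_mem:
  assumes "gfam Q C e f" "ys \<in> tlists (triple Q Q Q)" "ys \<noteq> []" "m = degree ys + 1 + e"
  shows "dl f ys \<in> piece C m"
proof -
  have "additive_on (piece C m) id"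
    using graded_moduleD[OF gfamD(2)[OF assms(1)]] by (auto simp: additive_on_def)
  from conjunct2[OF dl_hom[OF this assms(2), of f]] show ?thesis
    using assms(3,4) gfam_mem[OF assms(1)] by fastforce
qed

lemma gfam_tripleI:
  assumes "mlin A (smul P) f" "mlin A (smul Q) g" "mlin A (smul P') h"
    "graded_module P" "graded_module Q" "graded_module P'"
    "\<And>xs. xs \<in> tlists A \<Longrightarrow> xs \<noteq> [] \<Longrightarrow> f xs \<in> piece P (degree xs + e) \<and> g xs \<in> piece Q (degree xs + e + 1) \<and> h xs \<in> piece P' (degree xs + e)"
  shows "gfam A (triple P Q P') e (\<lambda>xs. (f xs, g xs, h xs))"
  unfolding gfam_def using assms(7) mlin_triple[OF assms(1-3) triple_graded[OF assms(4-6)]] triple_graded[OF assms(4-6)] by simp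

lemma gfam_mpath:
  assumes "gfam Q Q (-1) \<beta>"
  shows "gfam (triple Q Q Q) (triple Q Q Q) (-1) (mpath \<beta>)"
proof -
  note gm = gfamD(1)[OF assms] and l = gfamD(4)[OF assms]
  note gQ = graded_moduleD[OF gm]
  note idn = gfam_idn[OF triple_graded[OF gm gm gm]]
  note pr = mlin_proj[OF gfamD(4)[OF idn] gm gm gm]
  show ?thesis
    unfolding mpath_def[abs_def]
  proof (rule gfam_tripleI[OF mlin_map0[OF l gm gm] mlin_lin(2)[OF mlin_lin(2)[OF pr(1) pr(3)] dl_mlin[OF l]] mlin_map2[OF l gm gm] gm gm gm])
    fix ys assume ys: "ys \<in> tlists (triple Q Q Q)" "ys \<noteq> []"
    then have "idn ys \<in> piece (triple Q Q Q) (degree ys)" using gfam_mem[OF idn] by simp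
    then have "fst (idn ys) \<in> piece Q (degree ys)" "snd (snd (idn ys)) \<in> piece Q (degree ys)"
      by (auto simp: mem_Times_iff)
    then show "\<beta> (map p0 ys) \<in> piece Q (degree ys + - 1) \<and>
         fst (idn ys) - snd (snd (idn ys)) - dl \<beta> ys \<in> piece Q (degree ys + - 1 + 1) \<and>
         \<beta> (map p2 ys) \<in> piece Q (degree ys + - 1)"
      using gfam_mem[OF assms, of "map p0 ys" "degree ys - 1"] gfam_mem[OF assms, of "map p2 ys" "degree ys - 1"]
        p_tlists[OF ys(1)] ys dl_mem[OF assms ys, of "degree ys"] gQ by simp
  qed
qed

text \<open>\<open>dl\<close> is the universal homotopy between the two end point maps of the path
  object. The middle component of \<open>mpath\<close> is defined so as to make this true for
  \<open>f = idn\<close>; for general \<open>f\<close> the terms telescope letter by letter.\<close>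

lemma dl_cd:
  fixes \<beta> :: "(int \<times> 'b) list \<Rightarrow> 'b::ab_group_add"
  assumes \<beta>: "gfam Q Q (-1) \<beta>"
  shows "mlin Q s f \<Longrightarrow> ys \<in> tlists (triple Q Q Q) \<Longrightarrow>
    dl (cd \<beta> f) ys + cd (mpath \<beta>) (dl f) ys = f (map p0 ys) - f (map p2 ys)"
proof (induction ys arbitrary: f)
  case (Cons y ys)
  have y: "snd y \<in> piece (triple Q Q Q) (fst y)" "ys \<in> tlists (triple Q Q Q)" using Cons.prems by auto
  note pm = p_mem[OF y(1)]
  note gm = gfamD(1)[OF \<beta>] and l = gfamD(4)[OF \<beta>]
  note gQ = graded_moduleD[OF gm]
  note M = gfam_mpath[OF \<beta>]
  let ?m = "mpath \<beta>"
  define D where "D u = degree (y # u)" for u :: "(int \<times> 'b \<times> 'b \<times> 'b) list"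
  define L where "L u w X = f ((D u, X) # map p2 w)" for u w :: "(int \<times> 'b \<times> 'b \<times> 'b) list" and X
  have fy: "mlin Q s (\<lambda>zs. f (p0 y # zs))" using pm by (intro mlin_Cons[OF Cons.prems(1)]) simp
  have nat: "cd ?m (\<lambda>zs. g (map p2 zs)) ys = cd \<beta> g (map p2 ys)" for g
    by (rule cd_map) (simp_all add: p_pair mpath_def)
  have A: "dl (cd \<beta> f) (y # ys) = dl (cd \<beta> (\<lambda>zs. f (p0 y # zs))) ys +
      sg (fst y) (dec (\<lambda>u w. dl (\<lambda>a. f ((degree (p0 y # a) - 1, \<beta> (p0 y # a)) # map p2 w)) u +
         sg (degree u) (dl (\<lambda>c. f ((degree (p0 y # map p0 u) - 1, \<beta> (p0 y # map p0 u)) # c)) w)) ys)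
      - sg (fst y) (cd \<beta> (\<lambda>zs. f (p1 y # zs)) (map p2 ys))
      + dec (\<lambda>u w. f ((degree (p1 y # map p2 u) - 1, \<beta> (p1 y # map p2 u)) # map p2 w)) ys"
    by (simp add: cd_Cons dl_add dl_sg sg_add dl_dec dec_map)
  have B: "cd ?m (dl f) (y # ys) = cd ?m (dl (\<lambda>zs. f (p0 y # zs))) ys + sg (fst y) (cd \<beta> (\<lambda>zs. f (p1 y # zs)) (map p2 ys))
     + dec (\<lambda>u w. - sg (fst y) (sg (degree u) (dl (\<lambda>zs. f ((D u - 1, \<beta> (p0 y # map p0 u)) # zs)) w))
        + L u w (fst (snd (?m (y # u))))) ys"
  proof -
    have "dec (\<lambda>u w. dl f ((degree (y # u) - 1, ?m (y # u)) # w)) ys =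
      dec (\<lambda>u w. - sg (fst y) (sg (degree u) (dl (\<lambda>zs. f ((D u - 1, \<beta> (p0 y # map p0 u)) # zs)) w))
        + L u w (fst (snd (?m (y # u))))) ys"
      by (intro dec_cong refl) (simp add: L_def D_def p0_def p1_def mpath_def sg_plus_exp)
    then show ?thesis by (simp add: cd_Cons cd_add cd_sg sg_add nat[of "\<lambda>zs. f (p1 y # zs)"])
  qed
  \<comment> \<open>Terms in which a block starting with \<open>y\<close> yields a middle entry. By
    the definition of \<open>mpath\<close> they add up to the difference of the end points of that
    block.\<close>
  have C: "sg (fst y) (dl (\<lambda>a. f ((degree (p0 y # a) - 1, \<beta> (p0 y # a)) # map p2 w)) u)
      + f ((degree (p1 y # map p2 u) - 1, \<beta> (p1 y # map p2 u)) # map p2 w) + L u w (fst (snd (?m (y # u))))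
     = L u w (fst (idn (y # u)) - snd (snd (idn (y # u))))" if uw: "u @ w = ys" for u w
  proof -
    have T: "u \<in> tlists (triple Q Q Q)" "w \<in> tlists (triple Q Q Q)" using uw y by auto
    have add: "additive_on (piece Q (D u)) (L u w)"
      unfolding L_def by (rule mlin_additive_hd[OF Cons.prems(1)]) (use p_tlists[OF T(2)] in simp)
    have mem: "\<beta> (p0 y # a) \<in> piece Q (D u)" if "a \<in> tlists Q" "degree a = degree u + 1" for a
      by (rule gfam_mem[OF \<beta>]) (use that pm in \<open>auto simp: D_def\<close>)
    have "dl (\<lambda>a. f ((degree (p0 y # a) - 1, \<beta> (p0 y # a)) # map p2 w)) u = dl (\<lambda>a. L u w (\<beta> (p0 y # a))) u"
      by (rule dl_cong[OF T(1)]) (simp add: L_def D_def)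
    also have "\<dots> = L u w (dl (\<lambda>a. \<beta> (p0 y # a)) u)"
      using dl_hom[OF add T(1), of "\<lambda>a. \<beta> (p0 y # a)"] mem by simp
    finally have 1: "dl (\<lambda>a. f ((degree (p0 y # a) - 1, \<beta> (p0 y # a)) # map p2 w)) u = L u w (dl (\<lambda>a. \<beta> (p0 y # a)) u)" .
    have m1: "dl (\<lambda>a. \<beta> (p0 y # a)) u \<in> piece Q (D u)" using dl_hom[OF add T(1), of "\<lambda>a. \<beta> (p0 y # a)"] mem by simp
    have 2: "f ((degree (p1 y # map p2 u) - 1, \<beta> (p1 y # map p2 u)) # map p2 w) = L u w (\<beta> (p1 y # map p2 u))"
      by (simp add: L_def D_def)
    have m2: "\<beta> (p1 y # map p2 u) \<in> piece Q (D u)"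
      by (rule gfam_mem[OF \<beta>]) (use pm p_tlists[OF T(1)] in \<open>auto simp: D_def\<close>)
    have "?m (y # u) \<in> piece (triple Q Q Q) (D u - 1)"
      by (rule gfam_mem[OF M]) (use y T in \<open>auto simp: D_def\<close>)
    then have m3: "fst (snd (?m (y # u))) \<in> piece Q (D u)" by (auto simp: mem_Times_iff)
    have "sg (fst y) (L u w (dl (\<lambda>a. \<beta> (p0 y # a)) u)) = L u w (sg (fst y) (dl (\<lambda>a. \<beta> (p0 y # a)) u))"
      using additive_on_simps(3)[OF add m1] by simp
    then have "sg (fst y) (L u w (dl (\<lambda>a. \<beta> (p0 y # a)) u)) + L u w (\<beta> (p1 y # map p2 u)) + L u w (fst (snd (?m (y # u))))
      = L u w (sg (fst y) (dl (\<lambda>a. \<beta> (p0 y # a)) u) + \<beta> (p1 y # map p2 u) + fst (snd (?m (y # u))))"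
      using add m1 m2 m3 additive_on_simps(4)[OF add m1, of "fst y"] by (simp add: additive_on_def)
    also have "sg (fst y) (dl (\<lambda>a. \<beta> (p0 y # a)) u) + \<beta> (p1 y # map p2 u) + fst (snd (?m (y # u))) = fst (idn (y # u)) - snd (snd (idn (y # u)))"
      by (simp add: mpath_def)
    finally show ?thesis unfolding 1 2 .
  qed
  \<comment> \<open>\<open>idn\<close> sees only the block consisting of \<open>y\<close> alone, so
    what remains is the change of its first entry into its third: one step of the telescoping
    sum.\<close>
  have E: "dec (\<lambda>u w. L u w (fst (idn (y # u)) - snd (snd (idn (y # u))))) ys = f (p0 y # map p2 ys) - f (p2 y # map p2 ys)"
  proof (subst dec_first)
    show "L u w (fst (idn (y # u)) - snd (snd (idn (y # u)))) = 0" if uw: "u @ w = ys" "u \<noteq> []" for u w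
    proof -
      have T: "w \<in> tlists (triple Q Q Q)" using uw y by auto
      show ?thesis using uw mlin_0_hd[OF Cons.prems(1)] p_tlists[OF T] by (simp add: L_def)
    qed
    have add: "additive_on (piece Q (fst y)) (L [] ys)"
      unfolding L_def D_def using mlin_additive_hd[OF Cons.prems(1), of "map p2 ys" "fst y"] p_tlists[OF y(2)] by simp
    have "L [] ys (snd (p0 y) - snd (p2 y)) = L [] ys (snd (p0 y)) - L [] ys (snd (p2 y))"
      by (rule additive_on_diff[OF add]) (use pm in auto)
    then show "L [] ys (fst (idn [y]) - snd (snd (idn [y]))) = f (p0 y # map p2 ys) - f (p2 y # map p2 ys)"
      by (simp add: L_def D_def p0_def p2_def)
  qed
  have "dl (cd \<beta> f) (y # ys) + cd ?m (dl f) (y # ys) =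
      (dl (cd \<beta> (\<lambda>zs. f (p0 y # zs))) ys + cd ?m (dl (\<lambda>zs. f (p0 y # zs))) ys)
      + dec (\<lambda>u w. sg (fst y) (dl (\<lambda>a. f ((degree (p0 y # a) - 1, \<beta> (p0 y # a)) # map p2 w)) u)
        + f ((degree (p1 y # map p2 u) - 1, \<beta> (p1 y # map p2 u)) # map p2 w) + L u w (fst (snd (?m (y # u))))) ys"
    unfolding A B D_def by (simp add: dec_add dec_sg dec_uminus dec_diff sg_add)
  also have "\<dots> = (f (p0 y # map p0 ys) - f (p0 y # map p2 ys)) +
      dec (\<lambda>u w. L u w (fst (idn (y # u)) - snd (snd (idn (y # u))))) ys"
    unfolding Cons.IH[OF fy y(2)] by (intro arg_cong2[where f = "(+)"] refl dec_cong C)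
  finally show ?case unfolding E by simp
qed simp

text \<open>Every summand contains an outer entry of \<open>v\<close>, which is a unit, unless
  \<open>v\<close> is itself the marked letter, and then its middle entry is zero.\<close>

lemma dl_unit:
  assumes v: "fst v \<in> V" "fst (snd v) = 0" "snd (snd v) \<in> V" and V: "\<And>e. e \<in> V \<Longrightarrow> e \<in> piece Q 1"
  shows "mlin Q s f \<Longrightarrow>
    (\<And>us ws e. us \<in> tlists Q \<Longrightarrow> ws \<in> tlists Q \<Longrightarrow> e \<in> V \<Longrightarrow> f (us @ (1, e) # ws) = 0) \<Longrightarrow>
    ys \<in> tlists (triple Q Q Q) \<Longrightarrow> zs \<in> tlists (triple Q Q Q) \<Longrightarrow> dl f (ys @ (1, v) # zs) = 0"
proof (induction ys arbitrary: f)
  case Nil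
  have "dl (\<lambda>ws. f ((1, fst v) # ws)) zs = dl (\<lambda>ws. sg 0 0) zs"
    by (rule dl_cong[OF Nil(4)]) (use Nil(2)[of "[]"] v in auto)
  also have "\<dots> = 0" using dl_sg[of 1 "\<lambda>_. 0" zs] dl_add[of "\<lambda>_. 0" "\<lambda>_. 0" zs] by simp
  finally have "dl (\<lambda>ws. f (p0 (1, v) # ws)) zs = 0" by (simp add: p0_def)
  moreover have "f (p1 (1, v) # map p2 zs) = 0"
    using mlin_0_hd[OF Nil(1)] p_tlists[OF Nil(4)] v by (simp add: p1_def)
  ultimately show ?case by simp
next
  case (Cons y ys)
  have y: "snd y \<in> piece (triple Q Q Q) (fst y)" "ys \<in> tlists (triple Q Q Q)" using Cons.prems by auto
  note pm = p_mem[OF y(1)]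
  have fy: "mlin Q s (\<lambda>zs. f (p0 y # zs))" using pm by (intro mlin_Cons[OF Cons.prems(1)]) simp
  have "dl (\<lambda>zs. f (p0 y # zs)) (ys @ (1, v) # zs) = 0"
  proof (rule Cons.IH[OF fy _ y(2) Cons.prems(4)])
    show "f (p0 y # us @ (1, e) # ws) = 0" if "us \<in> tlists Q" "ws \<in> tlists Q" "e \<in> V" for us ws e
      using Cons.prems(2)[of "p0 y # us" ws e] that pm by simp
  qed
  moreover have "f (p1 y # map p2 ys @ p2 (1, v) # map p2 zs) = 0"
    using Cons.prems(2)[of "p1 y # map p2 ys" "map p2 zs" "snd (snd v)"] pm v p_tlists[OF y(2)] p_tlists[OF Cons.prems(4)]
    by (simp add: p2_def)
  ultimately show ?case by simp
qed

text \<open>In arity three and more \<beta> kills units, which is the case of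
  \<open>dl_unit\<close>. In arity two the surviving term is the product of a unit with the middle
  entry of a single letter.\<close>

lemma dl_unital:
  assumes \<beta>: "gfam Q Q (-1) \<beta>" "unital Q V \<beta>"
    and v: "fst v \<in> V" "fst (snd v) = 0" "snd (snd v) \<in> V"
    and T: "ys \<in> tlists (triple Q Q Q)" "zs \<in> tlists (triple Q Q Q)"
  shows "dl \<beta> (ys @ (1, v) # zs) =
    (if ys = [] then - fst (snd (idn zs)) else if zs = [] then sg (degree ys) (fst (snd (idn ys))) else 0)"
proof -
  note l = gfamD(4)[OF \<beta>(1)]
  note e = unitalD[OF \<beta>(2) v(1)] and e' = unitalD[OF \<beta>(2) v(3)]
  show ?thesis
  proof (cases "2 \<le> length ys + length zs")
    case True
    \<comment> \<open>Truncation makes \<open>dl_unit\<close> applicable, and it does not change the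
      value because \<open>dl\<close> preserves length.\<close>
    define f where "f xs = (if 3 \<le> length xs then \<beta> xs else 0)" for xs
    have f: "mlin Q (smul Q) f"
      using l graded_moduleD[OF gfamD(1)[OF \<beta>(1)]] by (auto simp: mlin_def f_def qmodule_simps)
    have fv: "f (us @ (1, e) # ws) = 0" if "us \<in> tlists Q" "ws \<in> tlists Q" "e \<in> V" for us ws e
      using unitalD(5)[OF \<beta>(2) that(3,1,2)] by (simp add: f_def)
    have vm: "v \<in> piece (triple Q Q Q) 1"
      using e(1) e'(1) v(2) graded_zero[OF gfamD(1)[OF \<beta>(1)]] by (cases v) simp
    have "dl \<beta> (ys @ (1, v) # zs) = dl f (ys @ (1, v) # zs)"
      by (rule dl_cong) (use T vm True in \<open>auto simp: f_def\<close>)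
    also have "\<dots> = 0"
      by (rule dl_unit[OF v _ f fv T]) (use \<beta>(2) in \<open>auto simp: unital_def\<close>)
    finally show ?thesis using True
      by (cases ys; cases zs; cases "tl ys"; cases "tl zs") (auto simp: zero_prod_def)
  next
    case False
    have 0: "\<beta> [(n, 0)] = 0" "\<beta> ((n, 0) # [z]) = 0" "\<beta> [z, (n, 0)] = 0"
      if "snd z \<in> piece Q (fst z)" for n z
      using mlin_0_hd[OF l, of "[]"] mlin_0_hd[OF l, of "[z]"] mlin_0[OF l, of "[z]" "[]"] that by auto
    consider "ys = []" "zs = []" | z where "ys = []" "zs = [z]" | z where "ys = [z]" "zs = []"
      using False by (cases ys; cases zs; cases "tl ys"; cases "tl zs") auto
    then show ?thesis
    proof cases
      case 1
      then show ?thesis using mlin_0_hd[OF l, of "[]"] v by (simp add: p1_def zero_prod_def)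
    next
      case 2
      then have z: "snd z \<in> piece (triple Q Q Q) (fst z)" using T by simp
      show ?thesis using 2 p_mem[OF z] 0[of "p2 z"] v e(3)[of "snd (p1 z)" "fst z + 1"] by (simp add: p0_def p1_def p2_def)
    next
      case 3
      then have z: "snd z \<in> piece (triple Q Q Q) (fst z)" using T by simp
      show ?thesis using 3 p_mem[OF z] 0[of "p0 z"] v e'(4)[of "snd (p1 z)" "fst z + 1"] by (simp add: p0_def p1_def p2_def)
    qed
  qed
qed

locale fibre =
  fixes P :: "('q::{comm_ring,monoid_mult}, 'a::ab_group_add) graded" and b :: "(int \<times> 'a) list \<Rightarrow> 'a"
    and P' :: "('q, 'c::ab_group_add) graded" and b' :: "(int \<times> 'c) list \<Rightarrow> 'c"
    and Q :: "('q, 'b::ab_group_add) graded" and \<beta> :: "(int \<times> 'b) list \<Rightarrow> 'b"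
    and E :: "(int \<times> 'a) list \<Rightarrow> 'b" and E' :: "(int \<times> 'c) list \<Rightarrow> 'b"
  assumes b: "gfam P P (-1) b" "xs \<in> tlists P \<Longrightarrow> cd b b xs = 0"
    and b': "gfam P' P' (-1) b'" "xs' \<in> tlists P' \<Longrightarrow> cd b' b' xs' = 0"
    and \<beta>: "gfam Q Q (-1) \<beta>" "ys \<in> tlists Q \<Longrightarrow> cd \<beta> \<beta> ys = 0"
    and E: "gfam P Q 0 E" "xs \<in> tlists P \<Longrightarrow> xs \<noteq> [] \<Longrightarrow> mdef b \<beta> E xs = 0"
    and E': "gfam P' Q 0 E'" "xs' \<in> tlists P' \<Longrightarrow> xs' \<noteq> [] \<Longrightarrow> mdef b' \<beta> E' xs' = 0"
begin

abbreviation "N \<equiv> triple P Q P'"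
abbreviation "M \<equiv> triple Q Q Q"

text \<open>The comparison of the fibre product with the path object of \<open>Q\<close>: the given
  morphisms on the outer entries, strict on the middle one. The structure on \<open>N\<close> is
  modelled on the pullback of the path object along \<open>E\<close> and \<open>E'\<close>.\<close>

definition \<Phi> :: "(int \<times> 'a \<times> 'b \<times> 'c) list \<Rightarrow> 'b \<times> 'b \<times> 'b" where
  "\<Phi> zs = (E (map p0 zs), fst (snd (idn zs)), E' (map p2 zs))"

text \<open>
  The middle component is chosen so that the projection to \<open>Q\<close> becomes a homotopy between the two
  composites \<open>N \<rightarrow> Q\<close>.
\<close>

definition bN :: "(int \<times> 'a \<times> 'b \<times> 'c) list \<Rightarrow> 'a \<times> 'b \<times> 'c" where
  "bN zs = (b (map p0 zs), E (map p0 zs) - E' (map p2 zs) - cf \<Phi> (dl \<beta>) zs, b' (map p2 zs))"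

lemma gms: "graded_module P" "graded_module Q" "graded_module P'"
  using gfamD(1)[OF b(1)] gfamD(1)[OF b'(1)] gfamD(1)[OF \<beta>(1)] by auto

lemma gN: "graded_module N" and gM: "graded_module M"
  using gms triple_graded by blast+

lemma \<Phi>: "gfam N M 0 \<Phi>"
  unfolding \<Phi>_def[abs_def]
proof (rule gfam_tripleI[OF mlin_map0[OF gfamD(4)[OF E(1)] gms(2,3)]
      mlin_proj(2)[OF gfamD(4)[OF gfam_idn[OF gN]] gms] mlin_map2[OF gfamD(4)[OF E'(1)] gms(2,1)] gms(2,2,2)])
  fix zs assume zs: "zs \<in> tlists N" "zs \<noteq> []"
  have "idn zs \<in> piece N (degree zs)" using gfam_mem[OF gfam_idn[OF gN] zs] by simp
  then show "E (map p0 zs) \<in> piece Q (degree zs + 0) \<and> fst (snd (idn zs)) \<in> piece Q (degree zs + 0 + 1) \<and>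
     E' (map p2 zs) \<in> piece Q (degree zs + 0)"
    using gfam_mem[OF E(1), of "map p0 zs"] gfam_mem[OF E'(1), of "map p2 zs"] p_tlists[OF zs(1)] zs by (auto simp: mem_Times_iff)
qed

lemma bN: "gfam N N (-1) bN"
  unfolding bN_def[abs_def]
proof (rule gfam_tripleI[OF mlin_map0[OF gfamD(4)[OF b(1)] gms(2,3)] mlin_lin(2)[OF mlin_lin(2)[OF
      mlin_map0[OF gfamD(4)[OF E(1)] gms(2,3)] mlin_map2[OF gfamD(4)[OF E'(1)] gms(2,1)]] cf_mlin[OF \<Phi> dl_mlin[OF gfamD(4)[OF \<beta>(1)]]]]
      mlin_map2[OF gfamD(4)[OF b'(1)] gms(2,1)] gms])
  fix zs assume zs: "zs \<in> tlists N" "zs \<noteq> []"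
  have "cf \<Phi> (dl \<beta>) zs \<in> piece Q (degree zs)"
  proof -
    have "gfam M Q 0 (dl \<beta>)"
      unfolding gfam_def using dl_mem[OF \<beta>(1)] dl_mlin[OF gfamD(4)[OF \<beta>(1)]] gms by simp
    from cf_mem[OF gfam_maps_to[OF \<Phi>] this zs] show ?thesis by simp
  qed
  then show "b (map p0 zs) \<in> piece P (degree zs + - 1) \<and>
    E (map p0 zs) - E' (map p2 zs) - cf \<Phi> (dl \<beta>) zs \<in> piece Q (degree zs + - 1 + 1) \<and>
    b' (map p2 zs) \<in> piece P' (degree zs + - 1)"
    using gfam_mem[OF E(1), of "map p0 zs"] gfam_mem[OF E'(1), of "map p2 zs"]
      gfam_mem[OF b(1), of "map p0 zs" "degree zs - 1"] gfam_mem[OF b'(1), of "map p2 zs" "degree zs - 1"]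
      p_tlists[OF zs(1)] zs graded_moduleD[OF gms(2)] by simp
qed

lemma nat0: "cd bN (\<lambda>zs. f (map p0 zs)) zs = cd b f (map p0 zs)"
  by (rule cd_map) (simp_all add: p_pair bN_def)

lemma nat2: "cd bN (\<lambda>zs. f (map p2 zs)) zs = cd b' f (map p2 zs)"
  by (rule cd_map) (simp_all add: p_pair bN_def)

lemma nat\<Phi>0: "cf \<Phi> (\<lambda>ys. f (map p0 ys)) zs = cf E f (map p0 zs)"
  by (rule cf_map) (simp add: p_pair \<Phi>_def)

lemma nat\<Phi>2: "cf \<Phi> (\<lambda>ys. f (map p2 ys)) zs = cf E' f (map p2 zs)"
  by (rule cf_map) (simp add: p_pair \<Phi>_def)

lemma E_eq: "xs \<in> tlists P \<Longrightarrow> cf E \<beta> xs = cd b E xs" if "xs \<noteq> []" for xs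
  using E(2)[of xs] that by (simp add: mdef_def)

lemma E'_eq: "xs \<in> tlists P' \<Longrightarrow> cf E' \<beta> xs = cd b' E' xs" if "xs \<noteq> []" for xs
  using E'(2)[of xs] that by (simp add: mdef_def)

lemma cf_idn_parts:
  assumes "zs \<in> tlists N" "zs \<noteq> []"
  shows "cf \<Phi> (\<lambda>ys. fst (idn ys)) zs = E (map p0 zs)" "cf \<Phi> (\<lambda>ys. fst (snd (idn ys))) zs = fst (snd (idn zs))"
    "cf \<Phi> (\<lambda>ys. snd (snd (idn ys))) zs = E' (map p2 zs)"
proof -
  have "cf \<Phi> (\<lambda>ys. (fst (idn ys), fst (snd (idn ys)), snd (snd (idn ys)))) zs = \<Phi> zs"
    using cf_to_idn[OF gfam_maps_to[OF \<Phi>] assms] by simp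
  then show "cf \<Phi> (\<lambda>ys. fst (idn ys)) zs = E (map p0 zs)" "cf \<Phi> (\<lambda>ys. fst (snd (idn ys))) zs = fst (snd (idn zs))"
    "cf \<Phi> (\<lambda>ys. snd (snd (idn ys))) zs = E' (map p2 zs)"
    unfolding cf_pair by (simp_all add: \<Phi>_def)
qed

lemma cd_idn_part:
  assumes "zs \<in> tlists N" "zs \<noteq> []"
  shows "cd bN (\<lambda>ys. fst (snd (idn ys))) zs = fst (snd (bN zs))"
proof -
  have "cd bN (\<lambda>ys. (fst (idn ys), fst (snd (idn ys)), snd (snd (idn ys)))) zs = bN zs"
    using cd_idn[OF gfam_maps_to[OF bN] assms] by simp
  from arg_cong[OF this, of "fst \<circ> snd"] show ?thesis
    unfolding cd_pair by simp
qed

text \<open>The outer components are the morphism equations of \<open>E\<close> and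
  \<open>E'\<close>; the middle one holds by the definition of \<open>bN\<close>. This is available
  before the square of \<open>bN\<close> is known, and serves to compute it.\<close>

lemma mdef_\<Phi>:
  assumes "zs \<in> tlists N" "zs \<noteq> []"
  shows "mdef bN (mpath \<beta>) \<Phi> zs = 0"
proof -
  note T = p_tlists[OF assms(1)]
  have "cf \<Phi> (mpath \<beta>) zs = (cf E \<beta> (map p0 zs), E (map p0 zs) - E' (map p2 zs) - cf \<Phi> (dl \<beta>) zs, cf E' \<beta> (map p2 zs))"
    unfolding mpath_def[abs_def] cf_pair cf_diff nat\<Phi>0 nat\<Phi>2 using cf_idn_parts[OF assms] by simp
  moreover have "cd bN \<Phi> zs = (cd b E (map p0 zs), fst (snd (bN zs)), cd b' E' (map p2 zs))"
    unfolding \<Phi>_def[abs_def] cd_pair nat0 nat2 cd_idn_part[OF assms] ..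
  ultimately show ?thesis using E_eq[of "map p0 zs"] E'_eq[of "map p2 zs"] T assms
    by (simp add: mdef_def bN_def zero_prod_def)
qed

text \<open>Only the middle component needs an argument. As \<Phi> has no defect,
  \<open>cd bN\<close> can be moved past \<open>cf \<Phi>\<close>; there \<open>dl_cd\<close> turns
  it into the difference of the end points, which cancels the terms coming from \<open>E\<close> and
  \<open>E'\<close>.\<close>

lemma bN_bN:
  assumes zs: "zs \<in> tlists N"
  shows "cd bN bN zs = 0"
proof (cases "zs = []")
  case False
  note T = p_tlists[OF zs]
  note l = gfamD(4)[OF \<beta>(1)] and M = gfam_mpath[OF \<beta>(1)]
  have "cf \<Phi> (cd (mpath \<beta>) (dl \<beta>)) zs - cd bN (cf \<Phi> (dl \<beta>)) zs = dl \<beta> [(degree zs - 1, mdef bN (mpath \<beta>) \<Phi> zs)]"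
    by (rule cf_cd[OF bN M \<Phi> dl_mlin[OF l] zs False]) (rule mdef_\<Phi>)
  also have "\<dots> = 0" unfolding mdef_\<Phi>[OF zs False] by (rule mlin_0_hd[OF dl_mlin[OF l]]) simp
  finally have "cd bN (cf \<Phi> (dl \<beta>)) zs = cf \<Phi> (cd (mpath \<beta>) (dl \<beta>)) zs" by simp
  also have "\<dots> = cf \<Phi> (\<lambda>ys. \<beta> (map p0 ys) - \<beta> (map p2 ys)) zs"
  proof (rule cf_cong[OF gfam_maps_to[OF \<Phi>] zs])
    fix ys assume ys: "ys \<in> tlists M"
    have "dl (cd \<beta> \<beta>) ys = dl (\<lambda>_. sg 1 0) ys" by (rule dl_cong[OF ys]) (simp add: \<beta>)
    also have "\<dots> = 0" using dl_add[of "\<lambda>_. 0" "\<lambda>_. 0" ys] by simp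
    finally show "cd (mpath \<beta>) (dl \<beta>) ys = \<beta> (map p0 ys) - \<beta> (map p2 ys)" using dl_cd[OF \<beta>(1) l ys] by simp
  qed
  also have "\<dots> = cf E \<beta> (map p0 zs) - cf E' \<beta> (map p2 zs)" unfolding cf_diff nat\<Phi>0 nat\<Phi>2 ..
  finally have "cd bN (cf \<Phi> (dl \<beta>)) zs = cd b E (map p0 zs) - cd b' E' (map p2 zs)"
    using E_eq[of "map p0 zs"] E'_eq[of "map p2 zs"] T False by simp
  moreover have "cd bN bN zs = (cd b b (map p0 zs),
     cd b E (map p0 zs) - cd b' E' (map p2 zs) - cd bN (cf \<Phi> (dl \<beta>)) zs, cd b' b' (map p2 zs))"
    by (subst (2) bN_def[abs_def]) (simp add: cd_pair cd_diff nat0 nat2)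
  ultimately show ?thesis using T b b' by (simp add: zero_prod_def)
qed simp

lemma bN_single: "bN [(n, x, h, y)] = (b [(n, x)], E [(n, x)] - E' [(n, y)] - \<beta> [(n + 1, h)], b' [(n, y)])"
  by (simp add: bN_def cf_Cons \<Phi>_def)

text \<open>A unit of \<open>N\<close> consists of two units with the same image in \<open>Q\<close>
  and zero in between. \<Phi> sends it to a unit of the path object, which reduces the middle
  component to \<open>dl_unital\<close>.\<close>

lemma bN_unital:
  assumes u: "unital P U b" "unital P' U' b'" "unital Q V \<beta>" "unital_map P U V E" "unital_map P' U' V E'"
    and W: "\<And>z. z \<in> W \<Longrightarrow> fst z \<in> U \<and> fst (snd z) = 0 \<and> snd (snd z) \<in> U' \<and> E [(1, fst z)] = E' [(1, snd (snd z))]"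
  shows "unital N W bN"
proof -
  define V3 :: "('b \<times> 'b \<times> 'b) set" where "V3 = {v. fst v \<in> V \<and> fst (snd v) = 0 \<and> snd (snd v) \<in> V}"
  note m\<Phi> = gfam_maps_to[OF \<Phi>]
  have u\<Phi>: "unital_map N W V3 \<Phi>"
    unfolding unital_map_def
  proof (intro ballI conjI impI)
    fix z assume "z \<in> W"
    note z = W[OF this]
    show "\<Phi> [(1, z)] \<in> V3" using z u(4,5) by (auto simp: V3_def \<Phi>_def p0_def p2_def unital_map_def)
    show "\<Phi> (us @ (1, z) # ws) = 0" if "us \<in> tlists N" "ws \<in> tlists N" "us @ ws \<noteq> []" for us ws
    proof -
      have "idn (us @ (1, z) # ws) = 0" using that(3) by (cases us; cases ws) auto
      then show ?thesis using z unital_mapD(2)[OF u(4), of "fst z" "map p0 us" "map p0 ws"]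
          unital_mapD(2)[OF u(5), of "snd (snd z)" "map p2 us" "map p2 ws"]
          p_tlists[OF that(1)] p_tlists[OF that(2)] that(3)
        by (simp add: \<Phi>_def p0_def[of "(1, z)"] p2_def[of "(1, z)"] zero_prod_def)
    qed
  qed
  have C: "cf \<Phi> (dl \<beta>) (us @ (1, z) # ws) =
     (if us = [] then - fst (snd (idn ws)) else if ws = [] then sg (degree us) (fst (snd (idn us))) else 0)"
    if z: "z \<in> W" and T: "us \<in> tlists N" "ws \<in> tlists N" for z us ws
  proof -
    define v where "v = \<Phi> [(1, z)]"
    have v: "fst v \<in> V" "fst (snd v) = 0" "snd (snd v) \<in> V"
      using unital_mapD(1)[OF u\<Phi> z] by (auto simp: V3_def v_def)
    note D = dl_unital[OF \<beta>(1) u(3) v]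
    have 1: "cf \<Phi> (dl \<beta>) (us @ (1, z) # ws) = cf \<Phi> (\<lambda>ys. cf \<Phi> (\<lambda>zs. dl \<beta> (ys @ (1, v) # zs)) ws) us"
      unfolding v_def by (rule cf_unit[OF m\<Phi> u\<Phi> z dl_mlin[OF gfamD(4)[OF \<beta>(1)]] T])
    consider "us = []" "ws = []" | "us = []" "ws \<noteq> []" | "us \<noteq> []" "ws = []" | "us \<noteq> []" "ws \<noteq> []" by blast
    then show ?thesis
    proof cases
      case 1
      then show ?thesis using D[of "[]" "[]"] \<open>cf \<Phi> (dl \<beta>) (us @ (1, z) # ws) = _\<close> by simp
    next
      case 2
      have "cf \<Phi> (\<lambda>zs. dl \<beta> ((1, v) # zs)) ws = cf \<Phi> (\<lambda>zs. - fst (snd (idn zs))) ws"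
        by (rule cf_cong[OF m\<Phi> T(2)]) (use D[of "[]"] in simp)
      then show ?thesis using 1 2 cf_idn_parts[OF T(2)] by (simp add: cf_uminus)
    next
      case 3
      have "cf \<Phi> (\<lambda>ys. dl \<beta> (ys @ [(1, v)])) us = cf \<Phi> (\<lambda>ys. sg (degree us) (fst (snd (idn ys)))) us"
        by (rule cf_cong[OF m\<Phi> T(1)]) (use D[of _ "[]"] 3 in auto)
      then show ?thesis using 1 3 cf_idn_parts[OF T(1)] by (simp add: cf_sg)
    next
      case 4
      have "cf \<Phi> (\<lambda>ys. cf \<Phi> (\<lambda>zs. dl \<beta> (ys @ (1, v) # zs)) ws) us = 0"
        by (intro cf_0[OF m\<Phi> T(1)] cf_0[OF m\<Phi> T(2)]) (use D 4 in auto)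
      then show ?thesis using 1 4 by simp
    qed
  qed
  show ?thesis
    unfolding unital_def
  proof (intro ballI conjI allI impI)
    fix z assume zW: "z \<in> W"
    note z = W[OF zW]
    note e = unitalD[OF u(1), of "fst z"] and e' = unitalD[OF u(2), of "snd (snd z)"]
    have pz: "p0 (1, z) = (1, fst z)" "p2 (1, z) = (1, snd (snd z))" by (simp_all add: p0_def p2_def)
    show zN: "z \<in> piece N 1" using z e(1) e'(1) graded_zero[OF gms(2)] by (cases z) simp
    show "bN [(1, z)] = 0" using z e(2) e'(2) C[OF zW, of "[]" "[]"] by (simp add: bN_def pz zero_prod_def)
    show "bN [(1, z), (n, x)] = x" if x: "x \<in> piece N n" for n x
    proof -
      have "E [(1, fst z), p0 (n, x)] = 0" "E' [(1, snd (snd z)), p2 (n, x)] = 0"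
        using unital_mapD(2)[OF u(4), of "fst z" "[]" "[p0 (n, x)]"] unital_mapD(2)[OF u(5), of "snd (snd z)" "[]" "[p2 (n, x)]"]
          z p_mem[of "(n, x)" P Q P'] x by auto
      then show ?thesis using C[OF zW, of "[]" "[(n, x)]"] z e(3)[of "fst x" n] e'(3)[of "snd (snd x)" n] x
        by (cases x) (simp add: bN_def pz)
    qed
    show "bN [(n, x), (1, z)] = sg (n - 1) x" if x: "x \<in> piece N n" for n x
    proof -
      have "E [p0 (n, x), (1, fst z)] = 0" "E' [p2 (n, x), (1, snd (snd z))] = 0"
        using unital_mapD(2)[OF u(4), of "fst z" "[p0 (n, x)]" "[]"] unital_mapD(2)[OF u(5), of "snd (snd z)" "[p2 (n, x)]" "[]"]
          z p_mem[of "(n, x)" P Q P'] x by auto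
      then show ?thesis using C[OF zW, of "[(n, x)]" "[]"] z e(4)[of "fst x" n] e'(4)[of "snd (snd x)" n] x
        by (cases x) (simp add: bN_def pz sg_def)
    qed
    show "bN (us @ (1, z) # ws) = 0" if T: "us \<in> tlists N" "ws \<in> tlists N" and l: "2 \<le> length us + length ws" for us ws
    proof -
      have ne: "us @ ws \<noteq> []" using l by auto
      have "cf \<Phi> (dl \<beta>) (us @ (1, z) # ws) = 0"
        unfolding C[OF zW T] using l
        by (cases us; cases ws; cases "tl us"; cases "tl ws") (auto simp: zero_prod_def)
      then show ?thesis
        using z e(5)[of "map p0 us" "map p0 ws"] e'(5)[of "map p2 us" "map p2 ws"]
          unital_mapD(2)[OF u(4), of "fst z" "map p0 us" "map p0 ws"]
          unital_mapD(2)[OF u(5), of "snd (snd z)" "map p2 us" "map p2 ws"]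
          p_tlists[OF T(1)] p_tlists[OF T(2)] l ne
        by (simp add: bN_def pz zero_prod_def)
    qed
  qed
qed

end

section \<open>Uniqueness\<close>

text \<open>Inverse for composition, solved arity by arity: when the linear part of \<open>F\<close>
  is the identity, the component of top arity enters \<open>cf F (linv F)\<close> with coefficient
  one. The inner comparison of lengths serves termination.\<close>

function linv :: "((int \<times> 'a) list \<Rightarrow> 'a) \<Rightarrow> (int \<times> 'a) list \<Rightarrow> 'a::ab_group_add" where
  "linv F xs = (if length xs = 1 then idn xs else - cf F (\<lambda>ys. if length ys < length xs then linv F ys else 0) xs)"
  by pat_completeness auto
termination by (relation "measure (length \<circ> snd)") auto

declare linv.simps [simp del]

definition unipotent :: "('q::{comm_ring,monoid_mult}, 'a::ab_group_add) graded \<Rightarrow> ((int \<times> 'a) list \<Rightarrow> 'a) \<Rightarrow> bool" where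
  "unipotent P F \<longleftrightarrow> gfam P P 0 F \<and> (\<forall>n. \<forall>x\<in>piece P n. F [(n, x)] = x)"

text \<open>A partition with a block of two or more letters shortens the list, and there
  \<open>f\<close> vanishes. Left is the partition into single letters, on which \<open>F\<close> is
  the identity.\<close>

lemma cf_top:
  assumes F: "unipotent P F"
  shows "xs \<in> tlists P \<Longrightarrow> (\<And>ys. ys \<in> tlists P \<Longrightarrow> length ys < length xs \<Longrightarrow> f ys = 0) \<Longrightarrow> cf F f xs = f xs"
proof (induction xs arbitrary: f)
  case (Cons x xs)
  have gF: "gfam P P 0 F" using F by (simp add: unipotent_def)
  note mF = gfam_maps_to[OF gF]
  have x: "snd x \<in> piece P (fst x)" "xs \<in> tlists P" using Cons.prems by auto
  have "dec (\<lambda>u w. cf F (\<lambda>ys. f ((degree (x # u), F (x # u)) # ys)) w) xs = cf F (\<lambda>ys. f (x # ys)) xs"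
  proof (subst dec_first)
    fix u w assume u: "u @ w = xs" "u \<noteq> []"
    have "cf F (\<lambda>ys. f ((degree (x # u), F (x # u)) # ys)) w = cf F (\<lambda>_. 0) w"
    proof (rule cf_cong[OF mF])
      fix ys assume ys: "ys \<in> tlists P" "length ys \<le> length w"
      have "0 < length u" "length xs = length u + length w" using u by auto
      then have "length ys < length xs" using ys(2) by linarith
      then show "f ((degree (x # u), F (x # u)) # ys) = 0"
        using u x ys maps_toD[OF mF, of "x # u"] by (intro Cons.prems(2)) auto
    qed (use u x in auto)
    then show "cf F (\<lambda>ys. f ((degree (x # u), F (x # u)) # ys)) w = 0" by (simp add: cf_def)
  next
    have "F [x] = snd x" using F x(1) by (cases x) (simp add: unipotent_def)
    then show "cf F (\<lambda>ys. f ((degree [x], F [x]) # ys)) xs = cf F (\<lambda>ys. f (x # ys)) xs" by simp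
  qed
  then show ?case using Cons.IH[of "\<lambda>ys. f (x # ys)"] Cons.prems x by (simp add: cf_Cons)
qed simp

text \<open>Since \<open>cf F G\<close> is \<open>G\<close> after \<open>F\<close>, the second claim
  makes \<open>linv F\<close> a left inverse only; that it is two-sided takes a further
  argument.\<close>

lemma linv:
  assumes F: "unipotent P F"
  shows "unipotent P (linv F)" "xs \<in> tlists P \<Longrightarrow> xs \<noteq> [] \<Longrightarrow> cf F (linv F) xs = idn xs"
    "unital_map P U U F \<Longrightarrow> U \<subseteq> piece P 1 \<Longrightarrow> unital_map P U U (linv F)"
proof -
  have gF: "gfam P P 0 F" using F by (simp add: unipotent_def)
  note mF = gfam_maps_to[OF gF] and gm = gfamD(1)[OF gF]
  note gP = graded_moduleD[OF gm] and id = gfam_idn[OF gm]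
  \<comment> \<open>The truncation used in the recursion. Its multilinearity is proved by induction
    on \<open>n\<close> and yields that of \<open>linv F\<close> in each arity.\<close>
  define g where "g n = (\<lambda>ys. if length ys < n then linv F ys else 0)" for n
  have linv_eq: "linv F ys = (if length ys = 1 then idn ys else - cf F (g (length ys)) ys)" for ys
    by (simp add: linv.simps[of F ys] g_def)
  have g: "gfam P P 0 (g n)" for n
  proof (induction n)
    case 0
    then show ?case using gm gP by (simp add: g_def gfam_def mlin_def qmodule_simps)
  next
    case (Suc n)
    define h where "h ys = (if n = 1 then idn ys else - cf F (g n) ys)" for ys
    have h: "gfam P P 0 h"
    proof (cases "n = 1")
      case False
      then have "h = (\<lambda>ys. - cf F (g n) ys)" by (auto simp: h_def)
      then show ?thesis using cf_gfam[OF gF Suc] mlin_lin(3)[OF gfamD(4)[OF cf_gfam[OF gF Suc]] gfamD(4)[OF gF]] gP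
        by (simp add: gfam_def)
    qed (simp add: h_def[abs_def] id)
    have gS: "g (Suc n) ys = (if length ys = n then h ys else g n ys)" for ys
      by (auto simp: g_def h_def linv_eq)
    show ?case
      unfolding gfam_def mlin_def
    proof (intro conjI ballI allI impI)
      show "g (Suc n) (us @ (m, smul P a x + y) # ws) = smul P a (g (Suc n) (us @ (m, x) # ws)) + g (Suc n) (us @ (m, y) # ws)"
        if "us \<in> tlists P" "ws \<in> tlists P" "x \<in> piece P m" "y \<in> piece P m" for us ws m a x y
        unfolding gS using mlinD(3)[OF gfamD(4)[OF h] that] mlinD(3)[OF gfamD(4)[OF Suc] that] by simp
      show "g (Suc n) xs \<in> piece P (degree xs + 0)" if "xs \<in> tlists P" "xs \<noteq> []" for xs
        unfolding gS using gfamD(5)[OF h that] gfamD(5)[OF Suc that] by simp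
    qed (use gm gP in auto)
  qed
  have li: "linv F ys = g (Suc (length ys)) ys" for ys by (simp add: g_def)
  have "gfam P P 0 (linv F)"
    unfolding gfam_def mlin_def
  proof (intro conjI ballI allI impI)
    show "linv F (us @ (m, smul P a x + y) # ws) = smul P a (linv F (us @ (m, x) # ws)) + linv F (us @ (m, y) # ws)"
      if "us \<in> tlists P" "ws \<in> tlists P" "x \<in> piece P m" "y \<in> piece P m" for us ws m a x y
      unfolding li using mlinD(3)[OF gfamD(4)[OF g] that] by simp
    show "linv F xs \<in> piece P (degree xs + 0)" if "xs \<in> tlists P" "xs \<noteq> []" for xs
      unfolding li using gfamD(5)[OF g that] by simp
  qed (use gm gP in auto)
  then show uni: "unipotent P (linv F)" by (simp add: unipotent_def linv.simps)
  show "cf F (linv F) xs = idn xs" if xs: "xs \<in> tlists P" "xs \<noteq> []" for xs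
  proof (cases "length xs = 1")
    case True
    then obtain n x where x: "xs = [(n, x)]" by (cases xs) auto
    then show ?thesis using xs F by (simp add: cf_Cons linv.simps unipotent_def)
  next
    case False
    have "cf F (linv F) xs = cf F (\<lambda>ys. g (length xs) ys + (if length ys = length xs then linv F ys else 0)) xs"
      by (rule cf_cong[OF mF xs(1)]) (auto simp: g_def)
    also have "\<dots> = cf F (g (length xs)) xs + linv F xs"
      unfolding cf_add by (subst cf_top[OF F xs(1), of "\<lambda>ys. if length ys = length xs then linv F ys else 0"]) auto
    also have "\<dots> = 0" using False by (simp add: linv_eq)
    finally show ?thesis using False by (simp add: idn_def)
  qed
  show "unital_map P U U (linv F)" if u: "unital_map P U U F" "U \<subseteq> piece P 1"
    unfolding unital_map_def
  proof (intro ballI conjI impI)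
    fix e assume e: "e \<in> U"
    have Fe: "F [(1, e)] = e" using F e u(2) by (auto simp: unipotent_def)
    show "linv F [(1, e)] \<in> U" using e by (simp add: linv.simps)
    show "linv F (us @ (1, e) # ws) = 0" if "us \<in> tlists P" "ws \<in> tlists P" "us @ ws \<noteq> []" for us ws
      using that
    proof (induction "length (us @ ws)" arbitrary: us ws rule: less_induct)
      case less
      let ?xs = "us @ (1, e) # ws"
      have "cf F (g (length ?xs)) ?xs = cf F (\<lambda>ys. cf F (\<lambda>zs. g (length ?xs) (ys @ (1, e) # zs)) ws) us"
        using cf_unit[OF mF u(1) e gfamD(4)[OF g] less.prems(1,2), of "length ?xs"] Fe by simp
      also have "\<dots> = 0"
      proof (intro cf_0[OF mF less.prems(1)] cf_0[OF mF less.prems(2)])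
        fix ys zs assume "ys \<in> tlists P" "(ys = []) = (us = [])" "zs \<in> tlists P" "(zs = []) = (ws = [])"
        then show "g (length ?xs) (ys @ (1, e) # zs) = 0"
          using less.hyps[of ys zs] less.prems(3) by (auto simp: g_def)
      qed
      finally show ?case using less.prems(3) by (auto simp: linv_eq)
    qed
  qed
qed

section \<open>Isotopies: morphisms whose linear part is the identity\<close>

definition isotopy ::
  "('q::{comm_ring,monoid_mult}, 'a::ab_group_add) graded \<Rightarrow> 'a set \<Rightarrow> ((int \<times> 'a) list \<Rightarrow> 'a) \<Rightarrow>
   ((int \<times> 'a) list \<Rightarrow> 'a) \<Rightarrow> ((int \<times> 'a) list \<Rightarrow> 'a) \<Rightarrow> bool" where
  "isotopy P U b b' F \<longleftrightarrow> unipotent P F \<and> unital_map P U U F \<and>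
     (\<forall>xs\<in>tlists P. xs \<noteq> [] \<longrightarrow> mdef b b' F xs = 0)"

lemma cf_cd_morphism:
  assumes "gfam A A (-1) b" "gfam B B (-1) \<beta>" "gfam A B 0 F" "mlin B s f"
    and "\<And>ys. ys \<in> tlists A \<Longrightarrow> ys \<noteq> [] \<Longrightarrow> mdef b \<beta> F ys = 0" "xs \<in> tlists A"
  shows "cf F (cd \<beta> f) xs = cd b (cf F f) xs"
proof (cases "xs = []")
  case False
  have "cf F (cd \<beta> f) xs - cd b (cf F f) xs = f [(degree xs - 1, mdef b \<beta> F xs)]"
    by (rule cf_cd[OF assms(1-4) assms(6) False]) (rule assms(5))
  also have "\<dots> = 0" using mlin_0_hd[OF assms(4), of "[]"] assms(5)[OF assms(6) False] by simp
  finally show ?thesis by simp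
qed simp

lemma isotopy_comp:
  assumes b: "gfam P P (-1) b" "gfam P P (-1) b'" and F: "isotopy P U b b' F" and G: "isotopy P U b' b'' G"
    and b'': "gfam P P (-1) b''" and U: "U \<subseteq> piece P 1"
  shows "isotopy P U b b'' (cf F G)"
proof -
  have gF: "gfam P P 0 F" "gfam P P 0 G" using F G by (auto simp: isotopy_def unipotent_def)
  have lin: "F [(n, x)] = x" "G [(n, x)] = x" if "x \<in> piece P n" for n x
    using F G that by (auto simp: isotopy_def unipotent_def)
  have uF: "unital_map P U U F" "unital_map P U U G" using F G by (auto simp: isotopy_def)
  note mF = gfam_maps_to[OF gF(1)]
  have 1: "unipotent P (cf F G)" using cf_gfam[OF gF] lin by (simp add: unipotent_def cf_Cons)
  have "mdef b b'' (cf F G) xs = 0" if xs: "xs \<in> tlists P" "xs \<noteq> []" for xs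
  proof -
    have "cf (cf F G) b'' xs = cf F (cf G b'') xs" using cf_cf[OF gF gfamD(4)[OF b''] xs(1)] by simp
    also have "\<dots> = cf F (cd b' G) xs"
      by (rule cf_cong[OF mF xs(1)]) (use G xs in \<open>auto simp: isotopy_def mdef_def\<close>)
    also have "\<dots> = cd b (cf F G) xs"
      by (rule cf_cd_morphism[OF b gF(1) gfamD(4)[OF gF(2)] _ xs(1)]) (use F in \<open>auto simp: isotopy_def\<close>)
    finally show ?thesis by (simp add: mdef_def)
  qed
  moreover have "unital_map P U U (cf F G)"
    unfolding unital_map_def
  proof (intro ballI conjI impI)
    fix e assume e: "e \<in> U"
    then have e1: "e \<in> piece P 1" using U by blast
    show "cf F G [(1, e)] \<in> U" using lin[OF e1] e by (simp add: cf_Cons)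
    show "cf F G (us @ (1, e) # ws) = 0" if T: "us \<in> tlists P" "ws \<in> tlists P" "us @ ws \<noteq> []" for us ws
    proof -
      have "cf F (\<lambda>ys. cf F (\<lambda>zs. G (ys @ (1, F [(1, e)]) # zs)) ws) us = 0"
      proof (intro cf_0[OF mF T(1)] cf_0[OF mF T(2)])
        fix ys zs assume "ys \<in> tlists P" "(ys = []) = (us = [])" "zs \<in> tlists P" "(zs = []) = (ws = [])"
        then show "G (ys @ (1, F [(1, e)]) # zs) = 0"
          using unital_mapD(2)[OF uF(2) e, of ys zs] T(3) lin[OF e1] by auto
      qed
      then show ?thesis using cf_unit[OF mF uF(1) e gfamD(4)[OF gF(2)] T(1,2)] by simp
    qed
  qed
  ultimately show ?thesis using 1 by (simp add: isotopy_def)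
qed

text \<open>The left inverse \<open>G\<close> of \<open>F\<close> has a left inverse of its own, and
  this must be \<open>F\<close>; so \<open>G\<close> is two-sided. It is a morphism because
  \<open>F\<close> is one, by conjugating the coderivations.\<close>

lemma isotopy_inverse:
  assumes b: "gfam P P (-1) b" "gfam P P (-1) b'" and F: "isotopy P U b b' F" and U: "U \<subseteq> piece P 1"
  shows "\<exists>G. isotopy P U b' b G \<and>
    (\<forall>xs\<in>tlists P. xs \<noteq> [] \<longrightarrow> cf F G xs = idn xs \<and> cf G F xs = idn xs)"
proof -
  have uF: "unipotent P F" and nF: "unital_map P U U F"
    and mF: "\<And>xs. xs \<in> tlists P \<Longrightarrow> xs \<noteq> [] \<Longrightarrow> mdef b b' F xs = 0" using F by (auto simp: isotopy_def)
  define G where "G = linv F"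
  note G = linv[OF uF, folded G_def]
  note K = linv[OF G(1)]
  have gF: "gfam P P 0 F" "gfam P P 0 G" "gfam P P 0 (linv G)" using uF G(1) K(1) by (auto simp: unipotent_def)
  note gm = gfamD(1)[OF gF(1)]
  note mtF = gfam_maps_to[OF gF(1)] and mtG = gfam_maps_to[OF gF(2)]
  have FK: "F xs = linv G xs" if xs: "xs \<in> tlists P" "xs \<noteq> []" for xs
  proof -
    have "F xs = cf F idn xs" by (rule cf_to_idn[OF mtF xs, symmetric])
    also have "\<dots> = cf F (cf G (linv G)) xs" by (rule cf_cong[OF mtF xs(1)]) (use K(2) xs in auto)
    also have "\<dots> = cf (cf F G) (linv G) xs" by (rule cf_cf[OF gF(1,2) gfamD(4)[OF gF(3)] xs(1)])
    also have "\<dots> = cf idn (linv G) xs" by (rule cf_eq[OF xs(1)]) (rule G(2))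
    also have "\<dots> = linv G xs" by (rule cf_idn[OF gfamD(4)[OF gF(3)] xs(1)])
    finally show ?thesis .
  qed
  have GF: "cf G F xs = idn xs" if xs: "xs \<in> tlists P" "xs \<noteq> []" for xs
  proof -
    have "cf G F xs = cf G (linv G) xs" by (rule cf_cong[OF mtG xs(1)]) (use FK xs in auto)
    then show ?thesis using K(2)[OF xs] by simp
  qed
  have "mdef b' b G xs = 0" if xs: "xs \<in> tlists P" "xs \<noteq> []" for xs
  proof -
    have l: "mlin P (smul P) (cd b' G)" by (rule cd_mlin[OF b(2) gfamD(4)[OF gF(2)]])
    have "cf G b xs = cf G (cf F (cd b' G)) xs"
    proof (rule cf_cong[OF mtG xs(1)])
      fix ys assume ys: "ys \<in> tlists P" "(ys = []) = (xs = [])"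
      then have "b ys = cd b idn ys" using cd_idn[OF gfam_maps_to[OF b(1)] ys(1)] xs by simp
      also have "\<dots> = cd b (cf F G) ys"
        by (rule cd_cong[OF gfam_maps_to[OF b(1)] ys(1)]) (simp add: G(2))
      also have "\<dots> = cf F (cd b' G) ys"
        by (rule cf_cd_morphism[OF b gF(1) gfamD(4)[OF gF(2)] mF ys(1), symmetric])
      finally show "b ys = cf F (cd b' G) ys" .
    qed
    also have "\<dots> = cf (cf G F) (cd b' G) xs" by (rule cf_cf[OF gF(2,1) l xs(1)])
    also have "\<dots> = cf idn (cd b' G) xs" by (rule cf_eq[OF xs(1)]) (rule GF)
    also have "\<dots> = cd b' G xs" by (rule cf_idn[OF l xs(1)])
    finally show ?thesis by (simp add: mdef_def)
  qed
  then have "isotopy P U b' b G" using G(1) G(3)[OF nF U] by (simp add: isotopy_def)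
  then show ?thesis using G(2) GF by blast
qed

section \<open>Uniqueness of the transferred structure\<close>

context transfer
begin

lemma approxD:
  assumes "\<And>k. approx k (b, F)"
  shows "gfam P P (-1) b" "gfam P Q 0 F" "x \<in> piece P n \<Longrightarrow> b [(n, x)] = d n x" "x \<in> piece P n \<Longrightarrow> F [(n, x)] = f1 n x"
    "unital P U b" "unital_map P U V F" "xs \<in> tlists P \<Longrightarrow> cd b b xs = 0"
    "xs \<in> tlists P \<Longrightarrow> xs \<noteq> [] \<Longrightarrow> mdef b \<beta> F xs = 0"
proof -
  show "cd b b xs = 0" if "xs \<in> tlists P" for xs
    using assms[of "Suc (length xs)"] that by (cases "xs = []") (auto simp: approx_def)
  show "mdef b \<beta> F xs = 0" if "xs \<in> tlists P" "xs \<noteq> []" for xs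
    using assms[of "Suc (length xs)"] that by (auto simp: approx_def)
qed (use assms[of 0] in \<open>auto simp: approx_def\<close>)

theorem transfer_unique:
  assumes "\<And>k. approx k (b, E)" "\<And>k. approx k (b', E')"
  shows "\<exists>F. isotopy P U b b' F"
proof -
  note A = approxD[OF assms(1)] and A' = approxD[OF assms(2)]
  note dP = chain_complexD[OF Pc] and u = unit_dataD[OF U]
  note gP = graded_moduleD[OF dP(1)] and gQ = graded_moduleD[OF gfamD(1)[OF \<beta>]]
  interpret fibre P b P b' Q \<beta> E E'
    by unfold_locales (fact A A' \<beta> \<beta>\<beta>)+
  define W where "W = (\<lambda>e. (e, 0 :: 'b, e)) ` U"
  \<comment> \<open>The diagonal. Its middle entry can be zero because \<open>E\<close> and
    \<open>E'\<close> have the same linear part \<open>f1\<close>.\<close>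
  define f2 where "f2 n x = (x, 0 :: 'b, x)" for n :: int and x :: 'a
  have bN1: "bN [(n, x, h, y)] = (d n x, f1 n x - f1 n y - \<beta> [(n + 1, h)], d n y)" if "x \<in> piece P n" "y \<in> piece P n" for n x h y
    using that A A' by (simp add: bN_single)
  interpret T2: transfer P d U \<pi> co N bN W f2
  proof unfold_locales
    show "unital N W bN"
    proof (rule bN_unital[OF A(5) A'(5) V A(6) A'(6)])
      fix z assume "z \<in> W"
      then obtain e where e: "e \<in> U" "z = (e, 0, e)" by (auto simp: W_def)
      then show "fst z \<in> U \<and> fst (snd z) = 0 \<and> snd (snd z) \<in> U \<and> E [(1, fst z)] = E' [(1, snd (snd z))]"
        using A(4) A'(4) u(6) by simp
    qed
    show "graded_linear P N 0 f2"
      using gQ by (auto simp: graded_linear_def linear_on_def f2_def qmodule_simps)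
    show "f2 (n - 1) (d n x) = bN [(n, f2 n x)]" if "x \<in> piece P n" for n x
      using that d\<beta>_additive[of "n + 1"] additive_on_simps(1)[OF d\<beta>_additive, of "n + 1"] by (simp add: f2_def bN1)
    \<comment> \<open>In a cycle \<open>(y, x, h, x')\<close> both \<open>x\<close> and
      \<open>x'\<close> have boundary \<open>y\<close>, and \<open>h\<close> relates their images,
      so \<open>(x - x', h)\<close> is a cycle of the cone of \<open>f1\<close>. A primitive
      \<open>(y0, k0)\<close> of it yields the primitive \<open>(x, 0, - k0, y0)\<close>.\<close>
    show "acyclic_complex (cone P N) (dcone d f2 (\<lambda>n y. bN [(n, y)]))"
      unfolding acyclic_complex_def
    proof (intro allI ballI impI)
      fix n z assume z: "z \<in> piece (cone P N) n" "dcone d f2 (\<lambda>n y. bN [(n, y)]) n z = 0"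
      obtain y x h x' where zz: "z = (y, x, h, x')" by (cases z)
      have m: "y \<in> piece P n" "x \<in> piece P (n + 1)" "h \<in> piece Q (n + 1 + 1)" "x' \<in> piece P (n + 1)"
        using z(1) by (simp_all add: zz)
      have c: "d (n + 1) x = y" "f1 (n + 1) x - f1 (n + 1) x' = \<beta> [(n + 1 + 1, h)]" "d (n + 1) x' = y"
        using z(2) m by (auto simp: zz dcone_def f2_def bN1 zero_prod_def)
      have m2: "x - x' \<in> piece P (n + 1)" using m gP by simp
      have "dcone d f1 d\<beta> (n + 1) (x - x', h) = 0"
        using c additive_on_diff[OF graded_linear_additive[OF dP(2,1)] m(2,4)]
          additive_on_diff[OF graded_linear_additive[OF f1 dP(1)] m(2,4)]
        by (simp add: dcone_def zero_prod_def)
      then obtain w where w: "w \<in> piece (cone P Q) (n + 1 + 1)" "dcone d f1 d\<beta> (n + 1 + 1) w = (x - x', h)"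
        using acyclic m2 m(3) unfolding acyclic_complex_def by (metis cone_simps(2) mem_Sigma_iff)
      obtain y0 k0 where w': "w = (y0, k0)" by (cases w)
      have m3: "y0 \<in> piece P (n + 1 + 1)" "k0 \<in> piece Q (n + 1 + 1 + 1)" using w(1) by (simp_all add: w')
      have c3: "d (n + 1 + 1) y0 = x - x'" "f1 (n + 1 + 1) y0 - \<beta> [(n + 1 + 1 + 1, k0)] = h"
        using w(2) by (simp_all add: w' dcone_def)
      show "\<exists>y\<in>piece (cone P N) (n + 1). dcone d f2 (\<lambda>n y. bN [(n, y)]) (n + 1) y = z"
      proof
        show "(x, 0, - k0, y0) \<in> piece (cone P N) (n + 1)" using m m3 gP gQ by simp
        show "dcone d f2 (\<lambda>n y. bN [(n, y)]) (n + 1) (x, 0, - k0, y0) = z"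
          using c c3 bN1[OF gP(1) m3(1), of "- k0"] additive_on_simps(2)[OF d\<beta>_additive m3(2)]
            graded_linear_0[OF dP(2,1)] graded_linear_0[OF f1 dP(1)]
          by (simp add: dcone_def f2_def zz)
      qed
    qed
    show "\<And>e. e \<in> U \<Longrightarrow> f2 1 e \<in> W" by (simp add: f2_def W_def)
  qed (fact P U dU bN bN_bN)+
  obtain c G where cG: "\<And>k. T2.approx k (c, G)" using T2.transfer_exists by blast
  note C = T2.approxD[OF cG]
  note gNs = gfamD(4)[OF C(2)]
  have iso: "isotopy P U c b (\<lambda>xs. fst (G xs))" "isotopy P U c b' (\<lambda>xs. snd (snd (G xs)))"
  proof -
    have Gm: "fst (G xs) \<in> piece P (degree xs + 0)" "snd (snd (G xs)) \<in> piece P (degree xs + 0)" if "xs \<in> tlists P" "xs \<noteq> []" for xs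
      using gfamD(5)[OF C(2) that] by (auto simp: mem_Times_iff)
    have "unipotent P (\<lambda>xs. fst (G xs))" "unipotent P (\<lambda>xs. snd (snd (G xs)))"
      using C(4) Gm mlin_proj(1,3)[OF gNs gms] dP(1) by (auto simp: unipotent_def gfam_def f2_def)
    moreover have "unital_map P U U (\<lambda>xs. fst (G xs))" "unital_map P U U (\<lambda>xs. snd (snd (G xs)))"
      using C(6) by (auto simp: unital_map_def W_def)
    moreover have "mdef c b (\<lambda>xs. fst (G xs)) xs = 0 \<and> mdef c b' (\<lambda>xs. snd (snd (G xs))) xs = 0"
      if xs: "xs \<in> tlists P" "xs \<noteq> []" for xs
    proof -
      \<comment> \<open>The morphism equation of \<open>G\<close>, to be read in its outer
        components: as the projections of \<open>N\<close> are strict, these are the morphism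
        equations of the outer components of \<open>G\<close>.\<close>
      have 0: "cf G bN xs = cd c G xs" using C(8)[OF xs] by (simp add: mdef_def)
      have 1: "cf G bN xs = (cf G (\<lambda>zs. b (map p0 zs)) xs, cf G (\<lambda>zs. E (map p0 zs) - E' (map p2 zs) - cf \<Phi> (dl \<beta>) zs) xs,
          cf G (\<lambda>zs. b' (map p2 zs)) xs)"
        by (subst bN_def[abs_def]) (simp add: cf_pair)
      have 2: "cd c G xs = (cd c (\<lambda>zs. fst (G zs)) xs, cd c (\<lambda>zs. fst (snd (G zs))) xs, cd c (\<lambda>zs. snd (snd (G zs))) xs)"
        using cd_pair[of c "\<lambda>zs. fst (G zs)" "\<lambda>zs. snd (G zs)" xs]
          cd_pair[of c "\<lambda>zs. fst (snd (G zs))" "\<lambda>zs. snd (snd (G zs))" xs] by simp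
      have 3: "cf G (\<lambda>zs. b (map p0 zs)) xs = cf (\<lambda>xs. fst (G xs)) b (map id xs)"
        by (rule cf_map) (simp add: p_pair)
      have 4: "cf G (\<lambda>zs. b' (map p2 zs)) xs = cf (\<lambda>xs. snd (snd (G xs))) b' (map id xs)"
        by (rule cf_map) (simp add: p_pair)
      show ?thesis using 0 3 4 unfolding 1 2 by (simp add: mdef_def)
    qed
    ultimately show "isotopy P U c b (\<lambda>xs. fst (G xs))" "isotopy P U c b' (\<lambda>xs. snd (snd (G xs)))"
      by (auto simp: isotopy_def)
  qed
  have Us: "U \<subseteq> piece P 1" using u(6) by blast
  from isotopy_inverse[OF C(1) A(1) iso(1) Us] obtain K where "isotopy P U b c K" by blast
  from isotopy_comp[OF A(1) C(1) this iso(2) A'(1) Us] show ?thesis by blast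
qed

end

section \<open>The bar construction\<close>

definition susp :: "('q, 'a) graded \<Rightarrow> ('q, 'a) graded" where
  "susp A = \<lparr>smul = smul A, piece = (\<lambda>n. piece A (n - 1))\<rparr>"

definition sh :: "(int \<times> 'a) list \<Rightarrow> (int \<times> 'a) list" where
  "sh = map (\<lambda>z. (fst z + 1, snd z))"

definition unsh :: "(int \<times> 'a) list \<Rightarrow> (int \<times> 'a) list" where
  "unsh = map (\<lambda>z. (fst z - 1, snd z))"

text \<open>The \<open>k\<close>-th tensor power of the suspension sends \<open>x\<^sub>1 \<otimes> \<dots> \<otimes> x\<^sub>k\<close> to
  \<open>s x\<^sub>1 \<otimes> \<dots> \<otimes> s x\<^sub>k\<close> with sign exponent \<open>\<Sum>\<^sub>i (k - i) |x\<^sub>i|\<close>.\<close>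

primrec tw :: "(int \<times> 'a) list \<Rightarrow> int" where
  "tw [] = 0"
| "tw (x # xs) = int (length xs) * fst x + tw xs"

definition bar :: "('a, 'b::ab_group_add) family \<Rightarrow> (int \<times> 'a) list \<Rightarrow> 'b" where
  "bar f xs = sg (tw (unsh xs)) (f (length xs) (unsh xs))"

definition unbar :: "((int \<times> 'a) list \<Rightarrow> 'b::ab_group_add) \<Rightarrow> ('a, 'b) family" where
  "unbar g k xs = sg (tw xs) (g (sh xs))"

lemma susp_simps [simp]: "smul (susp A) = smul A" "piece (susp A) n = piece A (n - 1)"
  by (simp_all add: susp_def)

lemma sh_simps [simp]:
  "sh [] = []" "sh (x # xs) = (fst x + 1, snd x) # sh xs" "sh (xs @ ys) = sh xs @ sh ys" "length (sh xs) = length xs"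
  "unsh [] = []" "unsh (x # xs) = (fst x - 1, snd x) # unsh xs" "unsh (xs @ ys) = unsh xs @ unsh ys" "length (unsh xs) = length xs"
  "sh (unsh xs) = xs" "unsh (sh xs) = xs" "degree (sh xs) = degree xs + int (length xs)"
  "sh xs \<in> tlists (susp A) \<longleftrightarrow> xs \<in> tlists A" "unsh xs \<in> tlists A \<longleftrightarrow> xs \<in> tlists (susp A)"
  "sh xs = [] \<longleftrightarrow> xs = []" "unsh xs = [] \<longleftrightarrow> xs = []"
  by (simp_all add: sh_def unsh_def o_def) (induction xs; simp)+

lemma tw_append: "tw (us @ ws) = tw us + int (length ws) * degree us + tw ws"
  by (induction us) (simp_all add: algebra_simps)

lemma bar_unbar [simp]: "bar (unbar g) = g"
  by (simp add: bar_def unbar_def fun_eq_iff)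

lemma bar_sh: "f (length xs) xs = sg (tw xs) (bar f (sh xs))"
  by (simp add: bar_def)

lemma susp_graded [simp]: "graded_module (susp A) \<longleftrightarrow> graded_module A"
proof
  show "graded_module A" if "graded_module (susp A)"
    using that unfolding graded_module_def by (metis add_diff_cancel_right' susp_simps)
qed (simp add: graded_module_def)

text \<open>Suspension turns degree \<open>k - 1 + e\<close> on the \<open>k\<close>-th power into
  degree \<open>e\<close> for every \<open>k\<close>: \<open>e = -1\<close> gives structures and
  \<open>e = 0\<close> morphisms. The sign \<open>tw\<close> depends on degrees only, so it does not
  disturb multilinearity.\<close>

lemma gfam_bar:
  assumes "graded_module A" "graded_module B"
  shows "gfam (susp A) (susp B) e (bar f) \<longleftrightarrow> (\<forall>k\<ge>1. tensor_map A B k (int k - 1 + e) (f k))"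
proof
  note gA = graded_moduleD[OF assms(1)] and gB = graded_moduleD[OF assms(2)]
  note q = qmodule_simps[OF gB(4)] and qA = qmodule_simps[OF gA(4)]
  {
    assume t: "\<forall>k\<ge>1. tensor_map A B k (int k - 1 + e) (f k)"
    show "gfam (susp A) (susp B) e (bar f)"
      unfolding gfam_def mlin_def
    proof (intro conjI ballI allI impI)
      fix us ws n a x y
      assume *: "us \<in> tlists (susp A)" "ws \<in> tlists (susp A)" "x \<in> piece (susp A) n" "y \<in> piece (susp A) n"
      define k where "k = Suc (length us + length ws)"
      have tk: "tensor_map A B k (int k - 1 + e) (f k)"
      proof -
        have "1 \<le> k" by (simp add: k_def)
        then show ?thesis using t by blast
      qed
      have T: "unsh us @ (n - 1, z) # unsh ws \<in> tensors A k" if "z \<in> piece A (n - 1)" for z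
        using * that by (simp add: tensors_tlists k_def)
      have "f k (unsh us @ (n - 1, smul A a x + y) # unsh ws) =
        smul B a (f k (unsh us @ (n - 1, x) # unsh ws)) + f k (unsh us @ (n - 1, y) # unsh ws)"
        using tk T[of x] T[of "smul A a x"] * gA(3)[of x "n - 1" a] unfolding tensor_map_def by simp
      moreover have "tw (unsh us @ (n - 1, z) # unsh ws) = tw (unsh us @ (n - 1, x) # unsh ws)" for z
        by (simp add: tw_append)
      ultimately show "bar f (us @ (n, smul (susp A) a x + y) # ws) =
          smul (susp B) a (bar f (us @ (n, x) # ws)) + bar f (us @ (n, y) # ws)"
        by (simp add: bar_def k_def q sg_add tw_append)
    next
      fix xs assume xs: "xs \<in> tlists (susp A)" "xs \<noteq> []"
      then have "f (length xs) (unsh xs) \<in> piece B (degree (unsh xs) + (int (length xs) - 1 + e))"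
        using t[rule_format, of "length xs"] by (simp add: tensor_map_def tensors_tlists Suc_le_eq)
      moreover have "degree xs = degree (unsh xs) + int (length xs)" using sh_simps(11)[of "unsh xs"] by simp
      ultimately show "bar f xs \<in> piece (susp B) (degree xs + e)"
        using gB(7) by (simp add: bar_def add_diff_eq diff_add_eq ac_simps)
    qed (use assms gB in auto)
  }
  {
    assume g: "gfam (susp A) (susp B) e (bar f)"
    note l = gfamD(4)[OF g]
    show "\<forall>k\<ge>1. tensor_map A B k (int k - 1 + e) (f k)"
      unfolding tensor_map_def
    proof (intro allI impI conjI ballI)
      fix k :: nat assume k: "1 \<le> k"
      have fk: "f k xs = sg (tw xs) (bar f (sh xs))" if "xs \<in> tensors A k" for xs
        using bar_sh[of f xs] that by (simp add: tensors_tlists)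
      show "f k xs \<in> piece B (degree xs + (int k - 1 + e))" if xs: "xs \<in> tensors A k" for xs
      proof -
        have "xs \<noteq> []" using xs k by (auto simp: tensors_tlists)
        then have "bar f (sh xs) \<in> piece (susp B) (degree (sh xs) + e)"
          using xs by (intro gfamD(5)[OF g]) (auto simp: tensors_tlists)
        then show ?thesis using fk[OF xs] xs gB(7) by (simp add: tensors_tlists add_diff_eq diff_add_eq ac_simps)
      qed
      fix us n x ws assume T: "us @ (n, x) # ws \<in> tensors A k"
      have fz: "f k (us @ (n, z) # ws) = sg (tw (us @ (n, x) # ws)) (bar f (sh us @ (n + 1, z) # sh ws))" if "z \<in> piece A n" for z
        using fk[of "us @ (n, z) # ws"] T that by (simp add: tensors_tlists tw_append)
      have T': "sh us \<in> tlists (susp A)" "sh ws \<in> tlists (susp A)" "x \<in> piece A n" using T by (auto simp: tensors_tlists)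
      {
        fix y assume y: "y \<in> piece A n"
        have "additive_on (piece (susp A) (n + 1)) (\<lambda>z. bar f (sh us @ (n + 1, z) # sh ws))"
          by (rule mlin_additive[OF l T'(1,2)])
        then have "bar f (sh us @ (n + 1, x + y) # sh ws) = bar f (sh us @ (n + 1, x) # sh ws) + bar f (sh us @ (n + 1, y) # sh ws)"
          using T' y by (simp add: additive_on_def)
        then show "f k (us @ (n, x + y) # ws) = f k (us @ (n, x) # ws) + f k (us @ (n, y) # ws)"
          using T' y gA(2) by (simp add: fz sg_add)
      }
      fix a
      have "bar f (sh us @ (n + 1, smul A a x) # sh ws) = smul B a (bar f (sh us @ (n + 1, x) # sh ws))"
        using mlin_smul[OF l T'(1,2), of x "n + 1" a] T' by simp
      then show "f k (us @ (n, smul A a x) # ws) = smul B a (f k (us @ (n, x) # ws))"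
        using T' gA(3) by (simp add: fz q)
    qed
  }
qed

section \<open>Sums over splittings and over compositions\<close>

lemma dec_sum: "dec g xs = (\<Sum>i\<le>length xs. g (take i xs) (drop i xs))"
proof (induction xs arbitrary: g)
  case (Cons x xs)
  show ?case by (simp add: Cons.IH sum.atMost_Suc_shift del: sum.atMost_Suc)
qed simp

lemma splits_Suc: "splits (Suc k) = (\<lambda>i. (0, Suc i, k - i)) ` {..k} \<union> (\<lambda>(u, v, w). (Suc u, v, w)) ` splits k"
proof (intro set_eqI iffI)
  fix z assume "z \<in> splits (Suc k)"
  then obtain u v w where z: "z = (u, v, w)" "u + v + w = Suc k" "1 \<le> v" by (auto simp: splits_def)
  show "z \<in> (\<lambda>i. (0, Suc i, k - i)) ` {..k} \<union> (\<lambda>(u, v, w). (Suc u, v, w)) ` splits k"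
  proof (cases u)
    case 0
    then have "z = (0, Suc (v - 1), k - (v - 1))" "v - 1 \<le> k" using z by auto
    then show ?thesis by blast
  next
    case (Suc u')
    then have "(u', v, w) \<in> splits k" using z by (simp add: splits_def)
    then show ?thesis using z Suc by force
  qed
qed (auto simp: splits_def)

lemma finite_splits: "finite (splits k)"
  by (rule finite_subset[of _ "{..k} \<times> {..k} \<times> {..k}"]) (auto simp: splits_def)

text \<open>The recursion of \<open>cds\<close> unrolled: \<open>u\<close> letters are passed, which
  gives the sign, and the next \<open>v\<close> letters form the block.\<close>

lemma cd_sum:
  "cd b f xs = (\<Sum>(u, v, w)\<in>splits (length xs). sg (degree (take u xs))
     (f (take u xs @ (degree (take v (drop u xs)) - 1, b (take v (drop u xs))) # drop (u + v) xs)))"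
proof (induction xs arbitrary: f)
  case Nil
  have "splits 0 = {}" by (auto simp: splits_def)
  then show ?case by simp
next
  case (Cons x xs)
  let ?g = "\<lambda>(u, v, w). sg (degree (take u (x # xs)))
     (f (take u (x # xs) @ (degree (take v (drop u (x # xs))) - 1, b (take v (drop u (x # xs)))) # drop (u + v) (x # xs)))"
  have "(\<Sum>z\<in>splits (length (x # xs)). ?g z) =
     (\<Sum>z\<in>(\<lambda>i. (0, Suc i, length xs - i)) ` {..length xs}. ?g z) + (\<Sum>z\<in>(\<lambda>(u, v, w). (Suc u, v, w)) ` splits (length xs). ?g z)"
    unfolding length_Cons splits_Suc by (rule sum.union_disjoint) (auto simp: finite_splits)
  also have "(\<Sum>z\<in>(\<lambda>i. (0, Suc i, length xs - i)) ` {..length xs}. ?g z) =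
      dec (\<lambda>u w. f ((degree (x # u) - 1, b (x # u)) # w)) xs"
    by (subst sum.reindex) (auto simp: inj_on_def dec_sum)
  also have "(\<Sum>z\<in>(\<lambda>(u, v, w). (Suc u, v, w)) ` splits (length xs). ?g z) = sg (fst x) (cd b (\<lambda>ys. f (x # ys)) xs)"
  proof -
    have sgsum: "sg n (\<Sum>z\<in>S. h z) = (\<Sum>z\<in>S. sg n (h z))" for n S and h :: "_ \<Rightarrow> 'x::ab_group_add"
      by (simp add: sg_def sum_negf)
    show ?thesis unfolding Cons.IH sgsum
      by (subst sum.reindex) (auto simp: inj_on_def sg_plus_exp intro!: sum.cong)
  qed
  finally show ?case by (simp add: cd_Cons add.commute)
qed

definition comps :: "nat \<Rightarrow> nat list set" where
  "comps k = {\<alpha>. (\<forall>a\<in>set \<alpha>. 1 \<le> a) \<and> sum_list \<alpha> = k}"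

lemma comps_0: "comps 0 = {[]}"
proof (intro set_eqI iffI)
  fix \<alpha> :: "nat list" assume "\<alpha> \<in> comps 0"
  then show "\<alpha> \<in> {[]}" by (cases \<alpha>) (auto simp: comps_def)
qed (simp add: comps_def)

lemma comps_Suc: "comps (Suc k) = (\<Union>i\<in>{..k}. (#) (Suc i) ` comps (k - i))"
proof (intro set_eqI iffI)
  fix \<alpha> assume a: "\<alpha> \<in> comps (Suc k)"
  then obtain a \<alpha>' where \<alpha>: "\<alpha> = a # \<alpha>'" by (cases \<alpha>) (auto simp: comps_def)
  have "1 \<le> a" "a + sum_list \<alpha>' = Suc k" "\<forall>a\<in>set \<alpha>'. 1 \<le> a" using a by (auto simp: comps_def \<alpha>)
  then have "a = Suc (a - 1)" "a - 1 \<le> k" "\<alpha>' \<in> comps (k - (a - 1))" by (auto simp: comps_def)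
  then show "\<alpha> \<in> (\<Union>i\<in>{..k}. (#) (Suc i) ` comps (k - i))" unfolding \<alpha> by blast
qed (auto simp: comps_def)

lemma finite_comps: "finite (comps k)"
proof (induction k rule: less_induct)
  case (less k)
  then show ?case by (cases k) (auto simp: comps_0 comps_Suc)
qed

lemma sum_compositions:
  assumes "1 \<le> k"
  shows "(\<Sum>p=1..k. \<Sum>\<alpha>\<in>compositions p k. h \<alpha>) = (\<Sum>\<alpha>\<in>comps k. (h \<alpha> :: 'c::comm_monoid_add))"
proof -
  have len: "length \<alpha> \<le> sum_list \<alpha>" if "\<forall>a\<in>set \<alpha>. 1 \<le> a" for \<alpha> :: "nat list"
    using that by (induction \<alpha>) auto
  have *: "comps k = (\<Union>p\<in>{1..k}. compositions p k)"
  proof (intro set_eqI iffI)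
    fix \<alpha> assume a: "\<alpha> \<in> comps k"
    then have "\<alpha> \<in> compositions (length \<alpha>) k" "length \<alpha> \<in> {1..k}"
      using len[of \<alpha>] assms by (cases \<alpha>; auto simp: comps_def compositions_def)+
    then show "\<alpha> \<in> (\<Union>p\<in>{1..k}. compositions p k)" by blast
  qed (auto simp: comps_def compositions_def)
  have "finite (compositions p k)" for p
    by (rule finite_subset[OF _ finite_comps[of k]]) (auto simp: comps_def compositions_def)
  then show ?thesis unfolding *
    by (intro sum.UNION_disjoint[symmetric]) (auto simp: compositions_def)
qed

primrec bvals :: "((int \<times> 'a) list \<Rightarrow> 'b) \<Rightarrow> nat list \<Rightarrow> (int \<times> 'a) list \<Rightarrow> (int \<times> 'b) list" where
  "bvals F [] xs = []"
| "bvals F (a # \<alpha>) xs = (degree (take a xs), F (take a xs)) # bvals F \<alpha> (drop a xs)"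

lemma cf_sum: "cf F f xs = (\<Sum>\<alpha>\<in>comps (length xs). f (bvals F \<alpha> xs))"
proof (induction xs arbitrary: f rule: measure_induct_rule[where f = length])
  case (less xs)
  show ?case
  proof (cases xs)
    case (Cons x xs')
    have "(\<Sum>\<alpha>\<in>comps (length xs). f (bvals F \<alpha> xs)) =
      (\<Sum>i\<le>length xs'. \<Sum>\<alpha>\<in>(#) (Suc i) ` comps (length xs' - i). f (bvals F \<alpha> xs))"
      unfolding Cons length_Cons comps_Suc by (rule sum.UNION_disjoint) (auto simp: finite_comps)
    also have "\<dots> = (\<Sum>i\<le>length xs'. cf F (\<lambda>ys. f ((degree (x # take i xs'), F (x # take i xs')) # ys)) (drop i xs'))"
    proof (rule sum.cong[OF refl])
      fix i assume "i \<in> {..length xs'}"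
      then have "cf F (\<lambda>ys. f ((degree (x # take i xs'), F (x # take i xs')) # ys)) (drop i xs') =
        (\<Sum>\<alpha>\<in>comps (length xs' - i). f ((degree (x # take i xs'), F (x # take i xs')) # bvals F \<alpha> (drop i xs')))"
        by (subst less.IH) (auto simp: Cons)
      then show "(\<Sum>\<alpha>\<in>(#) (Suc i) ` comps (length xs' - i). f (bvals F \<alpha> xs)) =
        cf F (\<lambda>ys. f ((degree (x # take i xs'), F (x # take i xs')) # ys)) (drop i xs')"
        by (subst sum.reindex) (auto simp: Cons)
    qed
    finally show ?thesis by (simp add: Cons cf_Cons dec_sum)
  qed (simp add: comps_0)
qed

section \<open>Comparison of signs\<close>

lemma sg_cong: "even (m - n) \<Longrightarrow> sg m x = sg n x"
  by (auto simp: sg_def)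

lemma sg_sum: "sg n (\<Sum>z\<in>S. h z) = (\<Sum>z\<in>S. sg n (h z))"
  by (simp add: sg_def sum_negf)

lemma ids_append:
  "u \<le> length xs \<Longrightarrow> koszul_exponent (ids u @ fs) xs =
     sum_list (map (\<lambda>(k', e', f'). e') fs) * degree (take u xs) + koszul_exponent fs (drop u xs)"
  "u \<le> length xs \<Longrightarrow> tensor_values (ids u @ fs) xs = take u xs @ tensor_values fs (drop u xs)"
proof (induction u arbitrary: xs)
  case (Suc u)
  {
    case 1
    then obtain x xs' where x: "xs = x # xs'" "u \<le> length xs'" by (cases xs) auto
    have "sum_list (map (\<lambda>(k', e', f'). e') (replicate u (1, 0, \<lambda>xs. snd (hd xs)) @ fs)) = sum_list (map (\<lambda>(k', e', f'). e') fs)"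
      by (induction u) simp_all
    then show ?case using Suc(1)[OF x(2)] by (simp add: x ids_def algebra_simps)
  next
    case 2
    then obtain x xs' where x: "xs = x # xs'" "u \<le> length xs'" by (cases xs) auto
    then show ?case using Suc(2)[OF x(2)] by (simp add: x ids_def)
  }
qed (simp_all add: ids_def)

lemma split_three: "xs = take u xs @ take v (drop u xs) @ drop (u + v) xs"
proof -
  have "drop u xs = take v (drop u xs) @ drop v (drop u xs)" by (rule append_take_drop_id[symmetric])
  then have "drop u xs = take v (drop u xs) @ drop (u + v) xs" by (simp only: drop_drop add.commute)
  then show ?thesis by (metis append_take_drop_id)
qed

text \<open>The exponent \<open>u + v * w\<close>, the Koszul exponent and the suspension exponents
  of the inner and outer maps add up, modulo 2, to \<open>tw xs\<close> plus the exponent for moving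
  an odd map past the first \<open>u\<close> suspended letters.\<close>

lemma ainf_sum_bar:
  assumes \<phi>: "gfam (susp A) (susp B) e (bar \<phi>)" and \<mu>: "gfam (susp A) (susp A) (-1) (bar \<mu>)" and xs: "xs \<in> tlists A"
  shows "(\<Sum>(u, v, w)\<in>splits (length xs). sg (int (u + v * w))
     (comp_tensor (\<phi> (u + 1 + w)) (ids u @ [(v, int v - 2, \<mu> v)] @ ids w) xs)) = sg (tw xs) (cd (bar \<mu>) (bar \<phi>) (sh xs))"
  unfolding cd_sum sg_sum sh_simps(4)
proof (rule sum.cong[OF refl], clarify)
  fix u v w assume "(u, v, w) \<in> splits (length xs)"
  then have k: "length xs = u + v + w" "1 \<le> v" by (auto simp: splits_def)
  define us where "us = take u xs"
  define vs where "vs = take v (drop u xs)"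
  define ws where "ws = drop (u + v) xs"
  have xs': "xs = us @ vs @ ws" unfolding us_def vs_def ws_def by (rule split_three)
  have l: "length us = u" "length vs = v" "length ws = w" using k by (simp_all add: us_def vs_def ws_def)
  have T: "us \<in> tlists A" "vs \<in> tlists A" "ws \<in> tlists A" using xs unfolding xs' by auto
  have kos: "koszul_exponent (ids u @ [(v, int v - 2, \<mu> v)] @ ids w) xs = (int v - 2) * degree us"
    using ids_append(1)[of w ws "[]"] l k ids_append(1)[of u xs "[(v, int v - 2, \<mu> v)] @ ids w"]
    by (simp add: us_def[symmetric] vs_def[symmetric] ws_def ids_def add.commute sum_list_replicate)
  have val: "tensor_values (ids u @ [(v, int v - 2, \<mu> v)] @ ids w) xs = us @ (degree vs + (int v - 2), \<mu> v vs) # ws"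
    using ids_append(2)[of w ws "[]"] l k ids_append(2)[of u xs "[(v, int v - 2, \<mu> v)] @ ids w"]
    by (simp add: us_def[symmetric] vs_def[symmetric] ws_def add.commute)
  have \<mu>v: "\<mu> v vs = sg (tw vs) (bar \<mu> (sh vs))" using bar_sh[of \<mu> vs] l by simp
  have m: "bar \<mu> (sh vs) \<in> piece (susp A) (degree vs + int v - 1)"
    by (rule gfam_mem[OF \<mu>]) (use T l k in auto)
  have "\<phi> (u + 1 + w) (us @ (degree vs + (int v - 2), \<mu> v vs) # ws) =
     sg (tw (us @ (degree vs + (int v - 2), \<mu> v vs) # ws)) (bar \<phi> (sh us @ (degree vs + int v - 1, \<mu> v vs) # sh ws))"
    using bar_sh[of \<phi> "us @ (degree vs + (int v - 2), \<mu> v vs) # ws"] l by (simp add: add_diff_eq)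
  also have "bar \<phi> (sh us @ (degree vs + int v - 1, \<mu> v vs) # sh ws) =
     sg (tw vs) (bar \<phi> (sh us @ (degree vs + int v - 1, bar \<mu> (sh vs)) # sh ws))"
    unfolding \<mu>v using T m by (intro mlin_sg[OF gfamD(4)[OF \<phi>]]) auto
  finally have 1: "sg (int (u + v * w)) (comp_tensor (\<phi> (u + 1 + w)) (ids u @ [(v, int v - 2, \<mu> v)] @ ids w) xs) =
    sg (int (u + v * w) + (int v - 2) * degree us + tw (us @ (degree vs + (int v - 2), \<mu> v vs) # ws) + tw vs)
      (bar \<phi> (sh us @ (degree vs + int v - 1, bar \<mu> (sh vs)) # sh ws))"
    unfolding comp_tensor_def kos val by (simp add: sg_plus_exp)
  \<comment> \<open>Expanding both suspension exponents with \<open>tw_append\<close> leaves an even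
    difference.\<close>
  have 2: "int (u + v * w) + (int v - 2) * degree us + tw (us @ (degree vs + (int v - 2), \<mu> v vs) # ws) + tw vs
     - (tw xs + (degree us + int u)) = 2 * (int v * int w - degree us - int w)"
    unfolding xs' by (simp add: tw_append l algebra_simps)
  have ev: "even (int (u + v * w) + (int v - 2) * degree us + tw (us @ (degree vs + (int v - 2), \<mu> v vs) # ws) + tw vs
     - (tw xs + (degree us + int u)))" unfolding 2 by simp
  have "take u (sh xs) = sh us" "take v (drop u (sh xs)) = sh vs" "drop (u + v) (sh xs) = sh ws"
    by (simp_all add: sh_def us_def vs_def ws_def take_map drop_map)
  then show "sg (int (u + v * w)) (comp_tensor (\<phi> (u + 1 + w)) (ids u @ [(v, int v - 2, \<mu> v)] @ ids w) xs) =
    sg (tw xs) (sg (degree (take u (sh xs))) (bar \<phi> (take u (sh xs) @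
      (degree (take v (drop u (sh xs))) - 1, bar \<mu> (take v (drop u (sh xs)))) # drop (u + v) (sh xs))))"
    using sg_cong[OF ev] l unfolding 1 by (simp add: sg_plus_exp[of "tw xs"])
qed

lemma t1_Cons: "t1 (a # \<alpha>) = int (length \<alpha>) * (int a - 1) + t1 \<alpha>"
  unfolding t1_def by (simp add: sum.lessThan_Suc_shift del: sum.lessThan_Suc)

lemma tensor_family_vals:
  assumes \<phi>: "gfam (susp A) (susp B) 0 (bar \<phi>)"
  shows "xs \<in> tlists A \<Longrightarrow> \<alpha> \<in> comps (length xs) \<Longrightarrow>
    tensor_values (tensor_family \<phi> \<alpha>) xs \<in> tlists B \<and> length (tensor_values (tensor_family \<phi> \<alpha>) xs) = length \<alpha>"
proof (induction \<alpha> arbitrary: xs)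
  case (Cons a \<alpha>)
  define us where "us = take a xs"
  define ws where "ws = drop a xs"
  have xs: "xs = us @ ws" by (simp add: us_def ws_def)
  have a: "1 \<le> a" "length us = a" "\<alpha> \<in> comps (length ws)" using Cons.prems by (auto simp: comps_def us_def ws_def)
  have T: "us \<in> tlists A" "ws \<in> tlists A" using Cons.prems xs by auto
  have "bar \<phi> (sh us) \<in> piece (susp B) (degree us + int a)"
    by (rule gfam_mem[OF \<phi>]) (use T a in auto)
  then have "\<phi> a us \<in> piece B (degree us + (int a - 1))"
    using bar_sh[of \<phi> us] a graded_sg[OF gfamD(2)[OF \<phi>], of "bar \<phi> (sh us)" "degree us + int a" "tw us"]
    by (simp add: add_diff_eq)
  then show ?case using Cons.IH[OF T(2) a(3)] by (simp add: tensor_family_def us_def ws_def)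
qed (simp add: tensor_family_def)

text \<open>Induction on \<alpha> with the functional \<open>g\<close> generalised, so that a
  treated block can be absorbed into \<open>g\<close>. The exponent \<open>t1\<close> cancels the
  part of \<open>tw\<close> of the values that stems from the degrees \<open>a - 1\<close> of the
  maps, and the Koszul exponent accounts for the rest.\<close>

lemma tensor_family_sign:
  assumes \<phi>: "gfam (susp A) (susp B) 0 (bar \<phi>)"
  shows "mlin (susp B) s g \<Longrightarrow> xs \<in> tlists A \<Longrightarrow> \<alpha> \<in> comps (length xs) \<Longrightarrow>
    sg (t1 \<alpha> + koszul_exponent (tensor_family \<phi> \<alpha>) xs + tw (tensor_values (tensor_family \<phi> \<alpha>) xs))
      (g (sh (tensor_values (tensor_family \<phi> \<alpha>) xs))) = sg (tw xs) (g (bvals (bar \<phi>) \<alpha> (sh xs)))"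
proof (induction \<alpha> arbitrary: xs g)
  case Nil
  then show ?case by (simp add: comps_def tensor_family_def t1_def)
next
  case (Cons a \<alpha>)
  define us where "us = take a xs"
  define ws where "ws = drop a xs"
  define vals where "vals = tensor_values (tensor_family \<phi> \<alpha>) ws"
  define K where "K = koszul_exponent (tensor_family \<phi> \<alpha>) ws"
  have xs: "xs = us @ ws" by (simp add: us_def ws_def)
  have a: "1 \<le> a" "length us = a" "\<alpha> \<in> comps (length ws)" using Cons.prems by (auto simp: comps_def us_def ws_def)
  have T: "us \<in> tlists A" "ws \<in> tlists A" using Cons.prems xs by auto
  have \<phi>us: "\<phi> a us = sg (tw us) (bar \<phi> (sh us))" using bar_sh[of \<phi> us] a by simp
  have m: "bar \<phi> (sh us) \<in> piece (susp B) (degree us + int a)"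
    by (rule gfam_mem[OF \<phi>]) (use T a in auto)
  have vals: "vals \<in> tlists B" "length vals = length \<alpha>"
    using tensor_family_vals[OF \<phi> T(2) a(3)] by (auto simp: vals_def)
  have v: "tensor_values (tensor_family \<phi> (a # \<alpha>)) xs = (degree us + (int a - 1), \<phi> a us) # vals"
    by (simp add: tensor_family_def us_def ws_def vals_def)
  have es: "sum_list (map (\<lambda>(k', e', f'). e') (tensor_family \<phi> \<alpha>)) = int (length ws) - int (length \<alpha>)"
  proof -
    have "sum_list (map (\<lambda>(k', e', f'). e') (tensor_family \<phi> \<alpha>)) = int (sum_list \<alpha>) - int (length \<alpha>)"
      by (induction \<alpha>) (simp_all add: tensor_family_def)
    then show ?thesis using a(3) by (simp add: comps_def)
  qed
  have k: "koszul_exponent (tensor_family \<phi> (a # \<alpha>)) xs = (int (length ws) - int (length \<alpha>)) * degree us + K"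
    using es by (simp add: tensor_family_def us_def ws_def K_def)
  define g' where "g' zs = g ((degree us + int a, bar \<phi> (sh us)) # zs)" for zs
  have g': "mlin (susp B) s g'" unfolding g'_def[abs_def] using m by (intro mlin_Cons[OF Cons.prems(1)]) simp
  have "g (sh (tensor_values (tensor_family \<phi> (a # \<alpha>)) xs)) = sg (tw us) (g' (sh vals))"
    using mlin_sg[OF Cons.prems(1), of "[]" "sh vals" "bar \<phi> (sh us)" "degree us + int a" "tw us"] m vals
    by (simp add: v \<phi>us g'_def add_diff_eq)
  then have "sg (t1 (a # \<alpha>) + koszul_exponent (tensor_family \<phi> (a # \<alpha>)) xs + tw (tensor_values (tensor_family \<phi> (a # \<alpha>)) xs))
      (g (sh (tensor_values (tensor_family \<phi> (a # \<alpha>)) xs))) =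
     sg ((int (length \<alpha>) * (int a - 1) + t1 \<alpha>) + ((int (length ws) - int (length \<alpha>)) * degree us + K) +
        (int (length \<alpha>) * (degree us + (int a - 1)) + tw vals) + tw us) (g' (sh vals))"
    unfolding t1_Cons k v by (simp add: sg_plus_exp vals)
  also have "\<dots> = sg ((int (length ws) * degree us + tw us) + (t1 \<alpha> + K + tw vals)) (g' (sh vals))"
  proof (rule sg_cong)
    have "int (length \<alpha>) * (int a - 1) + t1 \<alpha> + ((int (length ws) - int (length \<alpha>)) * degree us + K) +
        (int (length \<alpha>) * (degree us + (int a - 1)) + tw vals) + tw us
        - ((int (length ws) * degree us + tw us) + (t1 \<alpha> + K + tw vals)) = 2 * (int (length \<alpha>) * (int a - 1))"
      by (simp add: algebra_simps)
    then show "even (int (length \<alpha>) * (int a - 1) + t1 \<alpha> + ((int (length ws) - int (length \<alpha>)) * degree us + K) +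
        (int (length \<alpha>) * (degree us + (int a - 1)) + tw vals) + tw us
        - ((int (length ws) * degree us + tw us) + (t1 \<alpha> + K + tw vals)))" by (metis dvd_triv_left)
  qed
  also have "\<dots> = sg (int (length ws) * degree us + tw us) (sg (tw ws) (g' (bvals (bar \<phi>) \<alpha> (sh ws))))"
    using Cons.IH[OF g' T(2) a(3)] by (simp add: sg_plus_exp[of "int (length ws) * degree us + tw us"] vals_def K_def)
  also have "\<dots> = sg (tw xs) (g (bvals (bar \<phi>) (a # \<alpha>) (sh xs)))"
  proof -
    have "take a (sh xs) = sh us" "drop a (sh xs) = sh ws" by (simp_all add: sh_def us_def ws_def take_map drop_map)
    moreover have "tw xs = (int (length ws) * degree us + tw us) + tw ws" unfolding xs by (simp add: tw_append)
    ultimately show ?thesis using a by (simp add: g'_def sg_plus_exp)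
  qed
  finally show ?case .
qed

lemma composite_sum_bar:
  assumes \<phi>: "gfam (susp A) (susp B) 0 (bar \<phi>)" and \<nu>: "mlin (susp B) s (bar \<nu>)" and xs: "xs \<in> tlists A" "xs \<noteq> []"
  shows "(\<Sum>p=1..length xs. \<Sum>\<alpha>\<in>compositions p (length xs). sg (t1 \<alpha>)
     (comp_tensor (\<nu> p) (tensor_family \<phi> \<alpha>) xs)) = sg (tw xs) (cf (bar \<phi>) (bar \<nu>) (sh xs))"
proof -
  have "(\<Sum>p=1..length xs. \<Sum>\<alpha>\<in>compositions p (length xs). sg (t1 \<alpha>) (comp_tensor (\<nu> p) (tensor_family \<phi> \<alpha>) xs)) =
    (\<Sum>p=1..length xs. \<Sum>\<alpha>\<in>compositions p (length xs). sg (t1 \<alpha>) (comp_tensor (\<nu> (length \<alpha>)) (tensor_family \<phi> \<alpha>) xs))"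
    by (intro sum.cong refl) (simp add: compositions_def)
  also have "\<dots> = (\<Sum>\<alpha>\<in>comps (length xs). sg (t1 \<alpha>) (comp_tensor (\<nu> (length \<alpha>)) (tensor_family \<phi> \<alpha>) xs))"
    using xs by (intro sum_compositions) (simp add: Suc_le_eq)
  also have "\<dots> = (\<Sum>\<alpha>\<in>comps (length xs). sg (tw xs) (bar \<nu> (bvals (bar \<phi>) \<alpha> (sh xs))))"
  proof (rule sum.cong[OF refl])
    fix \<alpha> assume \<alpha>: "\<alpha> \<in> comps (length xs)"
    have "\<nu> (length \<alpha>) (tensor_values (tensor_family \<phi> \<alpha>) xs) =
      sg (tw (tensor_values (tensor_family \<phi> \<alpha>) xs)) (bar \<nu> (sh (tensor_values (tensor_family \<phi> \<alpha>) xs)))"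
      using bar_sh[of \<nu> "tensor_values (tensor_family \<phi> \<alpha>) xs"] tensor_family_vals[OF \<phi> xs(1) \<alpha>] by simp
    then show "sg (t1 \<alpha>) (comp_tensor (\<nu> (length \<alpha>)) (tensor_family \<phi> \<alpha>) xs) = sg (tw xs) (bar \<nu> (bvals (bar \<phi>) \<alpha> (sh xs)))"
      using tensor_family_sign[OF \<phi> \<nu> xs(1) \<alpha>] by (simp add: comp_tensor_def sg_plus_exp)
  qed
  finally show ?thesis by (simp add: cf_sum sg_sum)
qed

section \<open>Structures, morphisms and units in the bar construction\<close>

lemma sg_eq_iff [simp]: "sg n x = sg n y \<longleftrightarrow> x = y" "sg n x = 0 \<longleftrightarrow> x = 0"
  by (auto simp: sg_def)

lemma ainf_algebra_bar:
  "ainf_algebra A \<mu> \<longleftrightarrow> gfam (susp A) (susp A) (-1) (bar \<mu>) \<and> (\<forall>ys\<in>tlists (susp A). cd (bar \<mu>) (bar \<mu>) ys = 0)"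
proof -
  have "(\<forall>k\<ge>1. tensor_map A A k (int k - 2) (\<mu> k)) \<longleftrightarrow> gfam (susp A) (susp A) (-1) (bar \<mu>)" if "graded_module A"
    unfolding gfam_bar[OF that that] by simp
  moreover have "(\<forall>k\<ge>1. \<forall>xs\<in>tensors A k.
        (\<Sum>(u, v, w)\<in>splits k. sg (int (u + v * w))
           (comp_tensor (\<mu> (u + 1 + w)) (ids u @ [(v, int v - 2, \<mu> v)] @ ids w) xs)) = 0) \<longleftrightarrow>
      (\<forall>ys\<in>tlists (susp A). cd (bar \<mu>) (bar \<mu>) ys = 0)" if g: "gfam (susp A) (susp A) (-1) (bar \<mu>)"
  proof (intro iffI ballI allI impI)
    fix ys assume *: "\<forall>k\<ge>1. \<forall>xs\<in>tensors A k.
        (\<Sum>(u, v, w)\<in>splits k. sg (int (u + v * w))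
           (comp_tensor (\<mu> (u + 1 + w)) (ids u @ [(v, int v - 2, \<mu> v)] @ ids w) xs)) = 0" and ys: "ys \<in> tlists (susp A)"
    show "cd (bar \<mu>) (bar \<mu>) ys = 0"
    proof (cases "ys = []")
      case False
      then show ?thesis using *[rule_format, of "length ys" "unsh ys"] ainf_sum_bar[OF g g, of "unsh ys"] ys
        by (simp add: tensors_tlists Suc_le_eq)
    qed simp
  next
    fix k :: nat and xs assume "\<forall>ys\<in>tlists (susp A). cd (bar \<mu>) (bar \<mu>) ys = 0" "1 \<le> k" "xs \<in> tensors A k"
    then show "(\<Sum>(u, v, w)\<in>splits k. sg (int (u + v * w))
           (comp_tensor (\<mu> (u + 1 + w)) (ids u @ [(v, int v - 2, \<mu> v)] @ ids w) xs)) = 0"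
      using ainf_sum_bar[OF g g, of xs] by (simp add: tensors_tlists)
  qed
  moreover have "graded_module A" if "gfam (susp A) (susp A) (-1) (bar \<mu>)" using gfamD(1)[OF that] by simp
  ultimately show ?thesis unfolding ainf_algebra_def by argo
qed

lemma ainf_morphism_bar:
  assumes \<mu>: "ainf_algebra A \<mu>" and \<nu>: "ainf_algebra B \<nu>"
  shows "ainf_morphism A \<mu> B \<nu> \<phi> \<longleftrightarrow> gfam (susp A) (susp B) 0 (bar \<phi>) \<and>
    (\<forall>ys\<in>tlists (susp A). ys \<noteq> [] \<longrightarrow> mdef (bar \<mu>) (bar \<nu>) (bar \<phi>) ys = 0)"
proof -
  have gA: "graded_module A" and gB: "graded_module B" using \<mu> \<nu> by (auto simp: ainf_algebra_def)
  have g: "gfam (susp A) (susp A) (-1) (bar \<mu>)" "gfam (susp B) (susp B) (-1) (bar \<nu>)" using \<mu> \<nu> by (auto simp: ainf_algebra_bar)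
  let ?eq = "\<lambda>k xs. (\<Sum>(u, v, w)\<in>splits k. sg (int (u + v * w))
           (comp_tensor (\<phi> (u + 1 + w)) (ids u @ [(v, int v - 2, \<mu> v)] @ ids w) xs)) =
        (\<Sum>p=1..k. \<Sum>\<alpha>\<in>compositions p k. sg (t1 \<alpha>) (comp_tensor (\<nu> p) (tensor_family \<phi> \<alpha>) xs))"
  have "(\<forall>k\<ge>1. \<forall>xs\<in>tensors A k. ?eq k xs) \<longleftrightarrow>
      (\<forall>ys\<in>tlists (susp A). ys \<noteq> [] \<longrightarrow> mdef (bar \<mu>) (bar \<nu>) (bar \<phi>) ys = 0)" if \<phi>: "gfam (susp A) (susp B) 0 (bar \<phi>)"
  proof -
    have key: "?eq (length xs) xs \<longleftrightarrow> mdef (bar \<mu>) (bar \<nu>) (bar \<phi>) (sh xs) = 0" if "xs \<in> tlists A" "xs \<noteq> []" for xs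
      using ainf_sum_bar[OF \<phi> g(1) that(1)] composite_sum_bar[OF \<phi> gfamD(4)[OF g(2)] that] by (auto simp: mdef_def)
    show ?thesis
    proof (intro iffI ballI allI impI)
      fix ys assume "\<forall>k\<ge>1. \<forall>xs\<in>tensors A k. ?eq k xs" "ys \<in> tlists (susp A)" "ys \<noteq> []"
      then show "mdef (bar \<mu>) (bar \<nu>) (bar \<phi>) ys = 0"
        using key[of "unsh ys"] by (simp add: tensors_tlists Suc_le_eq)
    next
      fix k :: nat and xs assume "\<forall>ys\<in>tlists (susp A). ys \<noteq> [] \<longrightarrow> mdef (bar \<mu>) (bar \<nu>) (bar \<phi>) ys = 0" "1 \<le> k" "xs \<in> tensors A k"
      moreover from this have "xs \<noteq> []" by (auto simp: tensors_tlists)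
      ultimately show "?eq k xs" using key[of xs] by (auto simp: tensors_tlists)
    qed
  qed
  moreover have "gfam (susp A) (susp B) 0 (bar \<phi>) \<longleftrightarrow> (\<forall>k\<ge>1. tensor_map A B k (int k - 1) (\<phi> k))"
    using gfam_bar[OF gA gB, of 0 \<phi>] by simp
  ultimately show ?thesis unfolding ainf_morphism_def by argo
qed

lemma ainf_comp_bar:
  assumes "gfam (susp A) (susp B) 0 (bar \<phi>)" "mlin (susp B) s (bar \<psi>)" "xs \<in> tlists A" "xs \<noteq> []"
  shows "ainf_comp \<psi> \<phi> (length xs) xs = sg (tw xs) (cf (bar \<phi>) (bar \<psi>) (sh xs))"
  unfolding ainf_comp_def by (rule composite_sum_bar[OF assms])

lemma ainf_id_bar: "bar ainf_id = idn"
proof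
  show "bar ainf_id ys = idn ys" for ys :: "(int \<times> 'x::ab_group_add) list"
    by (cases ys; cases "tl ys") (auto simp: bar_def ainf_id_def idn_def)
qed

text \<open>The sign in the right unit law of \<open>unital\<close> is
  \<open>tw [(n, x), (0, e)] = n\<close>, rewritten in the suspended degree \<open>n + 1\<close> of
  \<open>x\<close>.\<close>

lemma strict_unit_bar: "strict_unit A \<mu> e \<longleftrightarrow> unital (susp A) {e} (bar \<mu>)"
proof
  assume u: "strict_unit A \<mu> e"
  have van: "\<mu> (Suc (length us + length ws)) (us @ (0, e) # ws) = 0"
    if "us \<in> tlists A" "ws \<in> tlists A" "length us + length ws \<noteq> 1" for us ws
    using u that unfolding strict_unit_def vanishes_on_unit_def by (auto simp: tensors_tlists)
  show "unital (susp A) {e} (bar \<mu>)"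
    unfolding unital_def
  proof (intro ballI conjI allI impI)
    fix e' assume "e' \<in> {e}"
    then have e': "e' = e" by simp
    show "e' \<in> piece (susp A) 1" using u e' by (simp add: strict_unit_def)
    show "bar \<mu> [(1, e')] = 0" using van[of "[]" "[]"] by (simp add: bar_def e')
    show "bar \<mu> [(1, e'), (n, x)] = x" "bar \<mu> [(n, x), (1, e')] = sg (n - 1) x" if "x \<in> piece (susp A) n" for n x
      using u that by (auto simp: bar_def e' strict_unit_def numeral_2_eq_2)
    show "bar \<mu> (us @ (1, e') # ws) = 0" if "us \<in> tlists (susp A)" "ws \<in> tlists (susp A)" "2 \<le> length us + length ws" for us ws
      using van[of "unsh us" "unsh ws"] that by (simp add: bar_def e')
  qed
next
  assume u: "unital (susp A) {e} (bar \<mu>)"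
  note e = unitalD[OF u, of e]
  show "strict_unit A \<mu> e"
    unfolding strict_unit_def vanishes_on_unit_def
  proof (intro conjI allI ballI impI)
    show "e \<in> piece A 0" using e(1) by simp
    show "\<mu> 2 [(n, x), (0, e)] = x" "\<mu> 2 [(0, e), (n, x)] = x" if "x \<in> piece A n" for n x
      using bar_sh[of \<mu> "[(n, x), (0, e)]"] bar_sh[of \<mu> "[(0, e), (n, x)]"] e(3)[of x "n + 1"] e(4)[of x "n + 1"] that
      by (simp_all add: numeral_2_eq_2)
    fix k u w us ws assume k: "1 \<le> k" "k \<noteq> (2::nat)" "u + w + 1 = k" "us \<in> tensors A u" "ws \<in> tensors A w"
    have "bar \<mu> (sh us @ (1, e) # sh ws) = 0"
    proof (cases "u = 0 \<and> w = 0")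
      case True
      then show ?thesis using e(2) k by (simp add: tensors_tlists)
    next
      case False
      then have "2 \<le> u + w" using k by linarith
      then show ?thesis using e(5)[of "sh us" "sh ws"] k by (auto simp: tensors_tlists)
    qed
    then show "\<mu> k (us @ (0, e) # ws) = 0" using bar_sh[of \<mu> "us @ (0, e) # ws"] k by (auto simp: tensors_tlists)
  qed
qed

lemma unital_map_bar:
  "unital_map (susp A) {e} {e'} (bar \<phi>) \<longleftrightarrow> \<phi> 1 [(0, e)] = e' \<and> (\<forall>k\<ge>2. vanishes_on_unit A e k (\<phi> k))"
proof
  assume u: "unital_map (susp A) {e} {e'} (bar \<phi>)"
  show "\<phi> 1 [(0, e)] = e' \<and> (\<forall>k\<ge>2. vanishes_on_unit A e k (\<phi> k))"
    unfolding vanishes_on_unit_def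
  proof (intro conjI allI ballI impI)
    show "\<phi> 1 [(0, e)] = e'" using bar_sh[of \<phi> "[(0, e)]"] unital_mapD(1)[OF u] by simp
    fix k u' w us ws assume k: "(2::nat) \<le> k" "u' + w + 1 = k" "us \<in> tensors A u'" "ws \<in> tensors A w"
    then have "bar \<phi> (sh us @ (1, e) # sh ws) = 0"
      by (intro unital_mapD(2)[OF u]) (auto simp: tensors_tlists)
    then show "\<phi> k (us @ (0, e) # ws) = 0" using bar_sh[of \<phi> "us @ (0, e) # ws"] k by (auto simp: tensors_tlists)
  qed
next
  assume u: "\<phi> 1 [(0, e)] = e' \<and> (\<forall>k\<ge>2. vanishes_on_unit A e k (\<phi> k))"
  have van: "\<phi> (Suc (length us + length ws)) (us @ (0, e) # ws) = 0"
    if "us \<in> tlists A" "ws \<in> tlists A" "us @ ws \<noteq> []" for us ws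
  proof -
    have "2 \<le> Suc (length us + length ws)" using that(3) by (cases us; cases ws) auto
    then show ?thesis using u that unfolding vanishes_on_unit_def by (auto simp: tensors_tlists)
  qed
  show "unital_map (susp A) {e} {e'} (bar \<phi>)"
    unfolding unital_map_def using u van[of "unsh _" "unsh _"] by (auto simp: bar_def)
qed

lemma tensor_values_append:
  "tensor_values (fs @ gs) xs = tensor_values fs (take (sum_list (map fst fs)) xs) @ tensor_values gs (drop (sum_list (map fst fs)) xs)"
proof (induction fs arbitrary: xs)
  case (Cons f fs)
  obtain k e h where "f = (k, e, h)" by (cases f)
  then show ?case using Cons[of "drop k xs"] by (simp add: min_def drop_take add.commute)
qed simp

text \<open>With zero in place of \<sigma>, each summand of the second sum evaluates \<mu> on a
  tensor with a zero entry. Agreement of \<open>f\<close> and \<open>g\<close> is asked for on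
  actual tensors only, because families are unconstrained elsewhere.\<close>

lemma zero_homotopy:
  assumes \<mu>: "ainf_algebra A \<mu>" and f: "gfam (susp A) (susp A) 0 (bar f)" and g: "gfam (susp A) (susp A) 0 (bar g)"
    and eq: "\<And>k xs. 1 \<le> k \<Longrightarrow> xs \<in> tensors A k \<Longrightarrow> f k xs = g k xs"
  shows "ainf_homotopy A \<mu> A \<mu> f g (\<lambda>k xs. 0)"
proof -
  have gA: "graded_module A" using \<mu> by (simp add: ainf_algebra_def)
  note gr = graded_moduleD[OF gA]
  have m: "gfam (susp A) (susp A) (-1) (bar \<mu>)" using \<mu> by (simp add: ainf_algebra_bar)
  have 0: "comp_tensor (\<mu> (p + 1 + q)) (tensor_family f \<alpha> @ [(v, int v, \<lambda>xs. 0)] @ tensor_family g \<gamma>) xs = 0"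
    if "(u, v, w) \<in> splits k" "\<alpha> \<in> compositions p u" "\<gamma> \<in> compositions q w" "xs \<in> tensors A k" for u v w p q \<alpha> \<gamma> k xs
  proof -
    define us where "us = take u xs"
    define vs where "vs = take v (drop u xs)"
    define ws where "ws = drop (u + v) xs"
    have k: "length xs = u + v + w" using that by (auto simp: splits_def tensors_tlists)
    have xs': "xs = us @ vs @ ws" unfolding us_def vs_def ws_def by (rule split_three)
    have l: "length us = u" "length vs = v" "length ws = w" using k by (simp_all add: us_def vs_def ws_def)
    have T: "us \<in> tlists A" "vs \<in> tlists A" "ws \<in> tlists A" using that(4) unfolding xs' by (auto simp: tensors_tlists)
    have "sum_list (map fst (tensor_family f \<alpha>)) = u"
      using that(2) by (simp add: tensor_family_def o_def compositions_def)
    then have v: "tensor_values (tensor_family f \<alpha> @ [(v, int v, \<lambda>xs. 0)] @ tensor_family g \<gamma>) xs =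
      tensor_values (tensor_family f \<alpha>) us @ (degree vs + int v, 0) # tensor_values (tensor_family g \<gamma>) ws"
      by (simp only: tensor_values_append) (simp add: us_def vs_def ws_def add.commute)
    have A: "tensor_values (tensor_family f \<alpha>) us \<in> tlists A" "length (tensor_values (tensor_family f \<alpha>) us) = p"
      using tensor_family_vals[OF f T(1), of \<alpha>] that(2) l by (auto simp: compositions_def comps_def)
    have G: "tensor_values (tensor_family g \<gamma>) ws \<in> tlists A" "length (tensor_values (tensor_family g \<gamma>) ws) = q"
      using tensor_family_vals[OF g T(3), of \<gamma>] that(3) l by (auto simp: compositions_def comps_def)
    show ?thesis
      using bar_sh[of \<mu> "tensor_values (tensor_family f \<alpha>) us @ (degree vs + int v, 0) # tensor_values (tensor_family g \<gamma>) ws"]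
        mlin_0[OF gfamD(4)[OF m], of "sh (tensor_values (tensor_family f \<alpha>) us)" "sh (tensor_values (tensor_family g \<gamma>) ws)"] A G
      unfolding comp_tensor_def v by simp
  qed
  show ?thesis
    unfolding ainf_homotopy_def
  proof (intro conjI allI impI ballI)
    show "tensor_map A A k (int k) (\<lambda>xs. 0)" for k
      using gr by (simp add: tensor_map_def qmodule_simps)
    fix k :: nat and xs assume k: "1 \<le> k" "xs \<in> tensors A k"
    have "(\<Sum>(u, v, w)\<in>splits k. sg (int (u + v * w))
       (comp_tensor (\<lambda>xs. 0) (ids u @ [(v, int v - 2, \<mu> v)] @ ids w) xs)) = (0 :: 'b)"
      by (rule sum.neutral) (auto simp: comp_tensor_def)
    moreover have "(\<Sum>(u, v, w)\<in>splits k. \<Sum>p=0..u. \<Sum>\<alpha>\<in>compositions p u. \<Sum>q=0..w. \<Sum>\<gamma>\<in>compositions q w.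
        sg (int (u + v * q) + t2 \<alpha> \<gamma>) (comp_tensor (\<mu> (p + 1 + q)) (tensor_family f \<alpha> @ [(v, int v, \<lambda>xs. 0)] @ tensor_family g \<gamma>) xs)) = 0"
    proof (rule sum.neutral, clarify)
      fix u v w assume uvw: "(u, v, w) \<in> splits k"
      show "(\<Sum>p=0..u. \<Sum>\<alpha>\<in>compositions p u. \<Sum>q=0..w. \<Sum>\<gamma>\<in>compositions q w.
        sg (int (u + v * q) + t2 \<alpha> \<gamma>) (comp_tensor (\<mu> (p + 1 + q)) (tensor_family f \<alpha> @ [(v, int v, \<lambda>xs. 0)] @ tensor_family g \<gamma>) xs)) = 0"
      proof (intro sum.neutral ballI)
        fix p \<alpha> q \<gamma> assume "\<alpha> \<in> compositions p u" "\<gamma> \<in> compositions q w"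
        from 0[OF uvw this k(2)]
        show "sg (int (u + v * q) + t2 \<alpha> \<gamma>) (comp_tensor (\<mu> (p + 1 + q))
          (tensor_family f \<alpha> @ [(v, int v, \<lambda>xs. 0)] @ tensor_family g \<gamma>) xs) = 0"
          by (simp only: sg_simps)
      qed
    qed
    ultimately show "f k xs - g k xs = (\<Sum>(u, v, w)\<in>splits k. sg (int (u + v * w))
       (comp_tensor (\<lambda>xs. 0) (ids u @ [(v, int v - 2, \<mu> v)] @ ids w) xs)) +
       (\<Sum>(u, v, w)\<in>splits k. \<Sum>p=0..u. \<Sum>\<alpha>\<in>compositions p u. \<Sum>q=0..w. \<Sum>\<gamma>\<in>compositions q w.
        sg (int (u + v * q) + t2 \<alpha> \<gamma>) (comp_tensor (\<mu> (p + 1 + q)) (tensor_family f \<alpha> @ [(v, int v, \<lambda>xs. 0)] @ tensor_family g \<gamma>) xs))"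
      by (simp only: eq[OF k] diff_self add_0_left)
  qed
qed

section \<open>Quasi-isomorphisms have acyclic cones\<close>

lemma equiv_homologous:
  assumes "chain_complex A d"
  shows "equiv (cycles A d n) (homologous A d n)"
proof -
  note dA = chain_complexD[OF assms]
  note g = graded_moduleD[OF dA(1)] and add = graded_linear_additive[OF dA(2,1)]
  have cm: "x \<in> piece A n" if "x \<in> cycles A d n" for x using that by (simp add: cycles_def)
  show ?thesis
  proof (rule equivI)
    show "refl_on (cycles A d n) (homologous A d n)"
      using g(1) graded_linear_0[OF dA(2,1)] by (force simp: refl_on_def homologous_def boundaries_def image_iff)
    show "homologous A d n \<subseteq> cycles A d n \<times> cycles A d n" by (auto simp: homologous_def)
    show "sym (homologous A d n)"
    proof (rule symI)
      fix x y assume "(x, y) \<in> homologous A d n"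
      then obtain z where z: "x \<in> cycles A d n" "y \<in> cycles A d n" "z \<in> piece A (n + 1)" "x - y = d (n + 1) z"
        by (auto simp: homologous_def boundaries_def)
      have "y - x = d (n + 1) (- z)" using additive_on_simps(2)[OF add z(3)] by (simp flip: z(4))
      then show "(y, x) \<in> homologous A d n" using z g(5)[OF z(3)] by (auto simp: homologous_def boundaries_def)
    qed
    show "trans (homologous A d n)"
    proof (rule transI)
      fix x y w assume "(x, y) \<in> homologous A d n" "(y, w) \<in> homologous A d n"
      then obtain z z' where z: "x \<in> cycles A d n" "w \<in> cycles A d n" "z \<in> piece A (n + 1)" "x - y = d (n + 1) z"
        "z' \<in> piece A (n + 1)" "y - w = d (n + 1) z'"
        by (auto simp: homologous_def boundaries_def)
      have "x - w = d (n + 1) (z + z')" using graded_linearD(2)[OF dA(2) z(3,5)] by (simp flip: z(4,6))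
      then show "(x, w) \<in> homologous A d n" using z g(2)[OF z(3,5)] by (auto simp: homologous_def boundaries_def)
    qed
  qed
qed

text \<open>For a cycle \<open>(x, y)\<close> of the cone, injectivity on homology makes
  \<open>x\<close> a boundary, and surjectivity corrects the chosen primitive so that
  \<open>y\<close> is reached as well.\<close>

lemma quasi_iso_acyclic:
  assumes A: "chain_complex A dA" and B: "chain_complex B dB" and f: "quasi_iso A dA B dB f"
  shows "acyclic_complex (cone A B) (dcone dA f dB)"
proof -
  note dA = chain_complexD[OF A] and dB = chain_complexD[OF B]
  note gA = graded_moduleD[OF dA(1)] and gB = graded_moduleD[OF dB(1)]
  have fl: "graded_linear A B 0 f" and fd: "\<And>n x. x \<in> piece A n \<Longrightarrow> f (n - 1) (dA n x) = dB n (f n x)"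
    and bij: "\<And>n. bij_betw (homology_map B dB f n) (homology A dA n) (homology B dB n)"
    using f by (auto simp: quasi_iso_def chain_map_def)
  have fm: "f n x \<in> piece B n" if "x \<in> piece A n" for n x using graded_linearD(1)[OF fl that] by simp
  note fadd = graded_linear_additive[OF fl dA(1)]
  have fcyc: "f n x \<in> cycles B dB n" if "x \<in> cycles A dA n" for n x
    using that fm fd[of x n] graded_linear_0[OF fl dA(1)] by (auto simp: cycles_def)
  have fhom: "(f n x, f n y) \<in> homologous B dB n" if xy: "(x, y) \<in> homologous A dA n" for n x y
  proof -
    obtain z where z: "x \<in> cycles A dA n" "y \<in> cycles A dA n" "z \<in> piece A (n + 1)" "x - y = dA (n + 1) z"
      using xy by (auto simp: homologous_def boundaries_def)
    have "f n x - f n y = f n (x - y)"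
      by (rule additive_on_diff[OF fadd, symmetric]) (use z in \<open>simp_all add: cycles_def\<close>)
    also have "\<dots> = dB (n + 1) (f (n + 1) z)" using fd[OF z(3)] z(4) by simp
    finally show ?thesis using fcyc z(1,2) fm[OF z(3)] by (auto simp: homologous_def boundaries_def)
  qed
  have hm: "homology_map B dB f n (homologous A dA n `` {x}) = homologous B dB n `` {f n x}" if x: "x \<in> cycles A dA n" for n x
  proof -
    have "homologous B dB n `` {f n y} = homologous B dB n `` {f n x}" if "y \<in> homologous A dA n `` {x}" for y
      using equiv_class_eq[OF equiv_homologous[OF B] fhom[of x y n]] that by simp
    moreover have "x \<in> homologous A dA n `` {x}" by (rule equiv_class_self[OF equiv_homologous[OF A] x])
    ultimately show ?thesis unfolding homology_map_def by blast
  qed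
  show ?thesis
    unfolding acyclic_complex_def
  proof (intro allI ballI impI)
    fix n z assume z: "z \<in> piece (cone A B) n" "dcone dA f dB n z = 0"
    obtain x y where zz: "z = (x, y)" by (cases z)
    have xy: "x \<in> piece A n" "y \<in> piece B (n + 1)" "dA n x = 0" "f n x = dB (n + 1) y"
      using z by (auto simp: zz dcone_def zero_prod_def)
    have cyc: "x \<in> cycles A dA n" "0 \<in> cycles A dA n"
      using xy gA graded_linear_0[OF dA(2,1)] by (auto simp: cycles_def)
    have "(f n x, f n 0) \<in> homologous B dB n"
      using fcyc[OF cyc(1)] fcyc[OF cyc(2)] xy graded_linear_0[OF fl dA(1)]
      by (auto simp: homologous_def boundaries_def)
    then have "homology_map B dB f n (homologous A dA n `` {x}) = homology_map B dB f n (homologous A dA n `` {0})"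
      using hm cyc equiv_class_eq[OF equiv_homologous[OF B]] by simp
    then have "homologous A dA n `` {x} = homologous A dA n `` {0}"
      using bij[of n] cyc unfolding bij_betw_def inj_on_def homology_def by (meson quotientI)
    then have "(x, 0) \<in> homologous A dA n"
      using eq_equiv_class[OF _ equiv_homologous[OF A] cyc(2)] by simp
    then obtain x0 where x0: "x0 \<in> piece A (n + 1)" "x = dA (n + 1) x0"
      by (auto simp: homologous_def boundaries_def)
    \<comment> \<open>The error of the choice \<open>x0\<close> is a cycle of \<open>B\<close>. A
      cycle \<open>w\<close> of \<open>A\<close> that represents its class will be subtracted from
      \<open>x0\<close>.\<close>
    define c where "c = f (n + 1) x0 - y"
    have "dB (n + 1) c = dB (n + 1) (f (n + 1) x0) - dB (n + 1) y"
      unfolding c_def by (rule additive_on_diff[OF graded_linear_additive[OF dB(2,1)] fm[OF x0(1)] xy(2)])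
    then have cc: "c \<in> cycles B dB (n + 1)"
      using fd[OF x0(1)] x0 xy gB fm[OF x0(1)] by (simp add: cycles_def c_def)
    then have "homologous B dB (n + 1) `` {c} \<in> homology_map B dB f (n + 1) ` homology A dA (n + 1)"
      using bij[of "n + 1"] by (simp add: bij_betw_def homology_def quotientI)
    then obtain w where w: "w \<in> cycles A dA (n + 1)"
      "homologous B dB (n + 1) `` {c} = homology_map B dB f (n + 1) (homologous A dA (n + 1) `` {w})"
      by (auto simp: homology_def elim!: quotientE)
    have "(f (n + 1) w, c) \<in> homologous B dB (n + 1)"
      using eq_equiv_class[OF _ equiv_homologous[OF B] cc, of "f (n + 1) w"] w hm by simp
    then obtain v where v: "v \<in> piece B (n + 1 + 1)" "f (n + 1) w - c = dB (n + 1 + 1) v"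
      by (auto simp: homologous_def boundaries_def)
    have wm: "w \<in> piece A (n + 1)" "dA (n + 1) w = 0" using w(1) by (auto simp: cycles_def)
    have 1: "f (n + 1) (x0 - w) = f (n + 1) x0 - f (n + 1) w" by (rule additive_on_diff[OF fadd x0(1) wm(1)])
    have 2: "dA (n + 1) (x0 - w) = dA (n + 1) x0 - dA (n + 1) w"
      by (rule additive_on_diff[OF graded_linear_additive[OF dA(2,1)] x0(1) wm(1)])
    have 3: "f (n + 1) (x0 - w) + dB (n + 1 + 1) v = y" unfolding 1 v(2)[symmetric] c_def by simp
    show "\<exists>y\<in>piece (cone A B) (n + 1). dcone dA f dB (n + 1) y = z"
    proof
      show "(x0 - w, - v) \<in> piece (cone A B) (n + 1)" using x0 wm v gA gB by simp
      show "dcone dA f dB (n + 1) (x0 - w, - v) = z"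
        using 2 3 x0 wm additive_on_simps(2)[OF graded_linear_additive[OF dB(2,1)] v(1)]
        by (simp add: dcone_def zz)
    qed
  qed
qed

text \<open>A transferred structure agrees with the given differential and map only on the pieces of
  \<open>A\<close>, so the quasi-isomorphism has to be carried over to its linear parts.\<close>

lemma quasi_iso_cong:
  assumes A: "chain_complex A dA" and q: "quasi_iso A dA B dB f"
    and eq: "\<And>n x. x \<in> piece A n \<Longrightarrow> dA' n x = dA n x \<and> f' n x = f n x"
  shows "quasi_iso A dA' B dB f'"
proof -
  have cyc: "cycles A dA' n = cycles A dA n" for n using eq by (auto simp: cycles_def)
  have "boundaries A dA' n = boundaries A dA n" for n
    using eq by (auto simp: boundaries_def intro!: image_cong)
  then have hom: "homology A dA' n = homology A dA n" for n
    unfolding homology_def homologous_def cyc by simp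
  have map_eq: "homology_map B dB f' n C = homology_map B dB f n C" if "C \<in> homology A dA n" for C n
  proof -
    have "x \<in> piece A n" if "x \<in> C" for x
      using that \<open>C \<in> homology A dA n\<close> by (auto simp: homology_def quotient_def homologous_def cycles_def)
    then show ?thesis using eq by (simp add: homology_map_def)
  qed
  have "chain_map A dA' B dB f'"
    using q chain_complexD(4)[OF A] eq graded_moduleD(2,3)[OF chain_complexD(1)[OF A]]
    unfolding quasi_iso_def chain_map_def graded_linear_def linear_on_def by simp
  moreover have "bij_betw (homology_map B dB f' n) (homology A dA' n) (homology B dB n)" for n
    using q map_eq unfolding hom quasi_iso_def by (metis bij_betw_cong)
  ultimately show ?thesis by (simp add: quasi_iso_def)
qed


section \<open>Existence and uniqueness of the transferred structure\<close>

lemma unit_data_trivial: "graded_module P \<Longrightarrow> unit_data P {} (\<lambda>n x. x) (\<lambda>n x. 0)"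
  by (auto simp: unit_data_def graded_linear_def linear_on_def)

lemma unit_data_splits_off:
  assumes A: "graded_module A" and s: "splits_off A e"
  shows "\<exists>\<pi> co. unit_data (susp A) {e} \<pi> co"
proof -
  note g = graded_moduleD[OF A]
  note q = qmodule_simps[OF g(4)]
  from s obtain C where C: "submodule (smul A) (C 0)"
    and bij: "bij_betw (\<lambda>(a, c). smul A a e + c) (UNIV \<times> C (0::int)) (piece A 0)"
    unfolding splits_off_def by blast
  define h where "h = (\<lambda>(a, c). smul A a e + c)"
  define r where "r = inv_into (UNIV \<times> C 0) h"
  have bij: "bij_betw h (UNIV \<times> C 0) (piece A 0)" using bij by (simp add: h_def)
  have hm: "smul A a e + c \<in> piece A 0" if "c \<in> C 0" for a c
    using bij_betwE[OF bij] that by (auto simp: h_def)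
  have rh: "r (smul A a e + c) = (a, c)" if "c \<in> C 0" for a c
    using bij_betw_inv_into_left[OF bij, of "(a, c)"] that by (simp add: r_def h_def)
  have ex: "\<exists>a c. c \<in> C 0 \<and> x = smul A a e + c" if "x \<in> piece A 0" for x
  proof -
    have "x \<in> h ` (UNIV \<times> C 0)" using bij that by (simp add: bij_betw_def)
    then show ?thesis by (auto simp: h_def)
  qed
  have Cs: "0 \<in> C 0" "\<And>x y. x \<in> C 0 \<Longrightarrow> y \<in> C 0 \<Longrightarrow> x + y \<in> C 0" "\<And>a x. x \<in> C 0 \<Longrightarrow> smul A a x \<in> C 0"
    using C by (auto simp: submodule_def)
  have C0: "c \<in> piece A 0" "r c = (0, c)" if "c \<in> C 0" for c using hm[OF that, of 0] rh[OF that, of 0] q by auto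
  have e0: "e \<in> piece A 0" "r e = (1, 0)" using hm[OF Cs(1), of 1] rh[OF Cs(1), of 1] q by auto
  have rlin: "r (smul A a x + y) = (a * fst (r x) + fst (r y), smul A a (snd (r x)) + snd (r y))"
    "x = smul A (fst (r x)) e + snd (r x)" "snd (r x) \<in> C 0"
    if xy: "x \<in> piece A 0" "y \<in> piece A 0" for a x y
  proof -
    obtain a1 c1 where x: "c1 \<in> C 0" "x = smul A a1 e + c1" using ex[OF xy(1)] by blast
    obtain a2 c2 where y: "c2 \<in> C 0" "y = smul A a2 e + c2" using ex[OF xy(2)] by blast
    have "smul A a x + y = smul A (a * a1 + a2) e + (smul A a c1 + c2)" by (simp add: x y q ac_simps)
    then have "r (smul A a x + y) = (a * a1 + a2, smul A a c1 + c2)"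
      using rh[of "smul A a c1 + c2" "a * a1 + a2"] Cs x(1) y(1) by presburger
    then show "r (smul A a x + y) = (a * fst (r x) + fst (r y), smul A a (snd (r x)) + snd (r y))"
      "x = smul A (fst (r x)) e + snd (r x)" "snd (r x) \<in> C 0"
      using rh[OF x(1)] rh[OF y(1)] x y by auto
  qed
  \<comment> \<open>\<open>r\<close> inverts the bijection of the splitting, and its two coordinates
    give \<open>co\<close> and \<pi>. Degree 0 of \<open>A\<close> is degree 1 of the
    suspension.\<close>
  define co where "co n x = (if n = 1 then fst (r x) else 0)" for n :: int and x
  define \<pi> where "\<pi> n x = (if n = 1 then snd (r x) else x)" for n :: int and x
  have "unit_data (susp A) {e} \<pi> co"
    unfolding unit_data_def
  proof (intro conjI allI ballI impI)
    show "graded_linear (susp A) (susp A) 0 \<pi>"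
      unfolding graded_linear_def linear_on_def
    proof (intro conjI allI ballI)
      show "\<pi> n x \<in> piece (susp A) (n + 0)" if "x \<in> piece (susp A) n" for n x
        using that rlin(3)[of x x] C0 by (auto simp: \<pi>_def)
      show "\<pi> n (x + y) = \<pi> n x + \<pi> n y" if "x \<in> piece (susp A) n" "y \<in> piece (susp A) n" for n x y
        using that rlin(1)[of x y 1] q by (auto simp: \<pi>_def)
      show "\<pi> n (smul (susp A) a x) = smul (susp A) a (\<pi> n x)" if "x \<in> piece (susp A) n" for n x a
        using that rlin(1)[of x 0 a] g(1) C0(2)[OF Cs(1)] q by (auto simp: \<pi>_def)
    qed
    show "\<pi> n (\<pi> n x) = \<pi> n x" if "x \<in> piece (susp A) n" for n x
      using that rlin(3)[of x x] C0 by (auto simp: \<pi>_def)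
    show "co n (smul (susp A) a x + y) = a * co n x + co n y" if "x \<in> piece (susp A) n" "y \<in> piece (susp A) n" for n x y a
      using that rlin(1)[of x y a] by (auto simp: co_def)
    show "co n x = 0" if "n \<noteq> 1" for n x using that by (simp add: co_def)
    show "\<pi> n x = x" if "n \<noteq> 1 \<or> {e} = {}" for n x using that by (simp add: \<pi>_def)
    fix e' assume "e' \<in> {e}"
    then have e': "e' = e" by simp
    show "e' \<in> piece (susp A) 1" "\<pi> 1 e' = 0" "co 1 e' = 1" using e0 by (simp_all add: e' \<pi>_def co_def)
    show "x = smul (susp A) (co 1 x) e' + \<pi> 1 x" if "x \<in> piece (susp A) 1" for x
      using rlin(2)[of x x] that by (simp add: e' co_def \<pi>_def)
  qed
  then show ?thesis by blast
qed

lemma bar_single: "bar f [(n, x)] = linear_part f (n - 1) x"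
  by (simp add: bar_def linear_part_def)

lemma linear_part_unbar: "linear_part (unbar g) n x = g [(n + 1, x)]"
  by (simp add: linear_part_def unbar_def)

lemma transfer_susp:
  assumes \<nu>: "ainf_algebra B \<nu>" and A: "chain_complex A dA" "bounded_below A" "\<forall>n. projective (smul A) (piece A n)"
    and \<epsilon>: "quasi_iso A dA B (linear_part \<nu>) \<epsilon>\<^sub>1"
    and U: "unit_data (susp A) U \<pi> co" "\<And>e. e \<in> U \<Longrightarrow> dA 0 e = 0 \<and> \<epsilon>\<^sub>1 0 e \<in> V" "unital (susp B) V (bar \<nu>)"
  shows "transfer (susp A) (\<lambda>n. dA (n - 1)) U \<pi> co (susp B) (bar \<nu>) V (\<lambda>n. \<epsilon>\<^sub>1 (n - 1))"
proof -
  note dA = chain_complexD[OF A(1)]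
  have \<nu>': "gfam (susp B) (susp B) (-1) (bar \<nu>)" "\<And>ys. ys \<in> tlists (susp B) \<Longrightarrow> cd (bar \<nu>) (bar \<nu>) ys = 0"
    using \<nu> by (auto simp: ainf_algebra_bar)
  have sp: "sproj (susp A) (\<lambda>n. dA (n - 1))"
    unfolding sproj_def
  proof (intro conjI allI)
    show "chain_complex (susp A) (\<lambda>n. dA (n - 1))"
      unfolding chain_complex_def
    proof (intro conjI allI ballI)
      show "graded_module (susp A)" using dA(1) by simp
      show "graded_linear (susp A) (susp A) (- 1) (\<lambda>n. dA (n - 1))"
        unfolding graded_linear_def
      proof
        fix n
        have "linear_on (smul A) (piece A (n - 1)) (smul A) (piece A (n - 1 + - 1)) (dA (n - 1))"
          using dA(2) unfolding graded_linear_def by blast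
        then show "linear_on (smul (susp A)) (piece (susp A) n) (smul (susp A)) (piece (susp A) (n + - 1)) (dA (n - 1))"
          by simp
      qed
      show "dA (n - 1 - 1) (dA (n - 1) x) = 0" if "x \<in> piece (susp A) n" for n x
        using dA(3)[of x "n - 1"] that by simp
    qed
    obtain m where "\<forall>n<m. piece A n = {0}" using A(2) by (auto simp: bounded_below_def)
    then have "\<forall>n<m + 1. piece (susp A) n = {0}" by simp
    then show "bounded_below (susp A)" unfolding bounded_below_def by blast
  qed (use A(3) in simp)
  have \<epsilon>l: "graded_linear A B 0 \<epsilon>\<^sub>1" "\<And>n x. x \<in> piece A n \<Longrightarrow> \<epsilon>\<^sub>1 (n - 1) (dA n x) = linear_part \<nu> n (\<epsilon>\<^sub>1 n x)"
    using \<epsilon> by (auto simp: quasi_iso_def chain_map_def)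
  have Bc: "chain_complex B (linear_part \<nu>)"
    unfolding chain_complex_def
  proof (intro conjI allI ballI)
    show gB: "graded_module B" using \<nu> by (simp add: ainf_algebra_def)
    have add: "additive_on (piece B n) (linear_part \<nu> n)" for n
      using mlin_additive[OF gfamD(4)[OF \<nu>'(1)], of "[]" "[]" "n + 1"] by (simp add: bar_single)
    show "graded_linear B B (- 1) (linear_part \<nu>)"
      unfolding graded_linear_def linear_on_def
    proof (intro conjI allI ballI)
      show "linear_part \<nu> n x \<in> piece B (n + - 1)" if "x \<in> piece B n" for n x
        using gfamD(5)[OF \<nu>'(1), of "[(n + 1, x)]"] that by (simp add: bar_single)
      show "linear_part \<nu> n (x + y) = linear_part \<nu> n x + linear_part \<nu> n y" if "x \<in> piece B n" "y \<in> piece B n" for n x y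
        using add[of n] that by (simp add: additive_on_def)
      show "linear_part \<nu> n (smul B a x) = smul B a (linear_part \<nu> n x)" if "x \<in> piece B n" for n x a
        using mlin_smul[OF gfamD(4)[OF \<nu>'(1)], of "[]" "[]" x "n + 1" a] that by (simp add: bar_single)
    qed
    show "linear_part \<nu> (n - 1) (linear_part \<nu> n x) = 0" if "x \<in> piece B n" for n x
      using \<nu>'(2)[of "[(n + 1, x)]"] that by (simp add: cd_Cons bar_single)
  qed
  have ac: "acyclic_complex (cone A B) (dcone dA \<epsilon>\<^sub>1 (linear_part \<nu>))" by (rule quasi_iso_acyclic[OF A(1) Bc \<epsilon>])
  show ?thesis
  proof unfold_locales
    show "graded_linear (susp A) (susp B) 0 (\<lambda>n. \<epsilon>\<^sub>1 (n - 1))"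
      using \<epsilon>l(1) unfolding graded_linear_def by simp
    show "\<epsilon>\<^sub>1 (n - 1 - 1) (dA (n - 1) x) = bar \<nu> [(n, \<epsilon>\<^sub>1 (n - 1) x)]" if "x \<in> piece (susp A) n" for x n
      using \<epsilon>l(2)[of x "n - 1"] that by (simp add: bar_single)
    \<comment> \<open>The cone of the suspended data is the original cone with degrees shifted by
      one.\<close>
    show "acyclic_complex (cone (susp A) (susp B)) (dcone (\<lambda>n. dA (n - 1)) (\<lambda>n. \<epsilon>\<^sub>1 (n - 1)) (\<lambda>n y. bar \<nu> [(n, y)]))"
      unfolding acyclic_complex_def
    proof (intro allI ballI impI)
      fix n z assume "z \<in> piece (cone (susp A) (susp B)) n"
        "dcone (\<lambda>n. dA (n - 1)) (\<lambda>n. \<epsilon>\<^sub>1 (n - 1)) (\<lambda>n y. bar \<nu> [(n, y)]) n z = 0"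
      then have "z \<in> piece (cone A B) (n - 1)" "dcone dA \<epsilon>\<^sub>1 (linear_part \<nu>) (n - 1) z = 0"
        by (simp_all add: dcone_def bar_single)
      then obtain y where "y \<in> piece (cone A B) (n - 1 + 1)" "dcone dA \<epsilon>\<^sub>1 (linear_part \<nu>) (n - 1 + 1) y = z"
        using ac unfolding acyclic_complex_def by blast
      then show "\<exists>y\<in>piece (cone (susp A) (susp B)) (n + 1).
          dcone (\<lambda>n. dA (n - 1)) (\<lambda>n. \<epsilon>\<^sub>1 (n - 1)) (\<lambda>n y. bar \<nu> [(n, y)]) (n + 1) y = z"
        by (intro bexI[of _ y]) (simp_all add: dcone_def bar_single add.commute[of 1])
    qed
  qed (use sp U \<nu>' in simp_all)
qed

lemma gfam_cong:
  assumes f: "gfam A B e f" and eq: "\<And>xs. xs \<in> tlists A \<Longrightarrow> xs \<noteq> [] \<Longrightarrow> g xs = f xs"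
  shows "gfam A B e g"
  unfolding gfam_def mlin_def
proof (intro conjI ballI allI impI)
  note gA = graded_moduleD[OF gfamD(1)[OF f]]
  show "g (us @ (n, smul A a x + y) # ws) = smul B a (g (us @ (n, x) # ws)) + g (us @ (n, y) # ws)"
    if "us \<in> tlists A" "ws \<in> tlists A" "x \<in> piece A n" "y \<in> piece A n" for us ws n a x y
    using mlinD(3)[OF gfamD(4)[OF f] that] that gA(2,3) by (simp add: eq)
  show "g xs \<in> piece B (degree xs + e)" if "xs \<in> tlists A" "xs \<noteq> []" for xs
    using gfamD(5)[OF f that] eq[OF that] by simp
qed (use gfamD(1-3)[OF f] in auto)

text \<open>An isotopy and its inverse compose to the identity on tensors exactly, not just up to
  homotopy. The homotopy formula with its exponent \<open>t2\<close> is therefore needed for the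
  zero homotopy only, and its signs never have to be translated to the bar construction.\<close>

lemma isotopy_homotopy_equivalence:
  assumes \<mu>: "ainf_algebra A \<mu>" and \<mu>': "ainf_algebra A \<mu>'"
    and F: "isotopy (susp A) U (bar \<mu>) (bar \<mu>') F" and U: "U \<subseteq> piece A 0"
  shows "\<exists>\<phi> \<psi>. ainf_morphism A \<mu> A \<mu>' \<phi> \<and> ainf_morphism A \<mu>' A \<mu> \<psi> \<and>
    ainf_homotopy A \<mu> A \<mu> (ainf_comp \<psi> \<phi>) ainf_id (\<lambda>k xs. 0) \<and>
    ainf_homotopy A \<mu>' A \<mu>' (ainf_comp \<phi> \<psi>) ainf_id (\<lambda>k xs. 0) \<and>
    unital_map (susp A) U U (bar \<phi>) \<and> unital_map (susp A) U U (bar \<psi>) \<and>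
    (\<forall>n. \<forall>x\<in>piece A n. linear_part \<phi> n x = x \<and> linear_part \<psi> n x = x)"
proof -
  have g: "gfam (susp A) (susp A) (-1) (bar \<mu>)" "gfam (susp A) (susp A) (-1) (bar \<mu>')"
    using \<mu> \<mu>' by (auto simp: ainf_algebra_bar)
  have "U \<subseteq> piece (susp A) 1" using U by simp
  from isotopy_inverse[OF g F this] obtain G where G: "isotopy (susp A) U (bar \<mu>') (bar \<mu>) G"
    and inv: "\<And>xs. xs \<in> tlists (susp A) \<Longrightarrow> xs \<noteq> [] \<Longrightarrow> cf F G xs = idn xs \<and> cf G F xs = idn xs" by blast
  have gF: "gfam (susp A) (susp A) 0 F" "gfam (susp A) (susp A) 0 G"
    using F G by (auto simp: isotopy_def unipotent_def)
  have gm: "graded_module (susp A)" using \<mu> by (simp add: ainf_algebra_def)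
  note id = gfam_idn[OF gm]
  have comp: "ainf_homotopy A \<rho> A \<rho> (ainf_comp (unbar K) (unbar H)) ainf_id (\<lambda>k xs. 0)"
    if \<rho>: "ainf_algebra A \<rho>" and HK: "gfam (susp A) (susp A) 0 H" "gfam (susp A) (susp A) 0 K"
      "\<And>xs. xs \<in> tlists (susp A) \<Longrightarrow> xs \<noteq> [] \<Longrightarrow> cf H K xs = idn xs" for \<rho> H K
  proof -
    have c: "ainf_comp (unbar K) (unbar H) (length xs) xs = sg (tw xs) (idn (sh xs))" if "xs \<in> tlists A" "xs \<noteq> []" for xs
      using ainf_comp_bar[of A A "unbar H" "smul A" "unbar K" xs] that HK gfamD(4)[OF HK(2)] by simp
    have "bar (ainf_comp (unbar K) (unbar H)) ys = idn ys" if "ys \<in> tlists (susp A)" "ys \<noteq> []" for ys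
      using c[of "unsh ys"] that by (simp add: bar_def)
    then have "gfam (susp A) (susp A) 0 (bar (ainf_comp (unbar K) (unbar H)))"
      by (intro gfam_cong[OF id]) simp
    moreover have "ainf_comp (unbar K) (unbar H) k xs = ainf_id k xs" if "1 \<le> k" "xs \<in> tensors A k" for k xs
    proof -
      have "xs \<in> tlists A" "xs \<noteq> []" "length xs = k" using that by (auto simp: tensors_tlists)
      then show ?thesis using c[of xs] bar_sh[of ainf_id xs] by (simp add: ainf_id_bar)
    qed
    ultimately show ?thesis using id by (intro zero_homotopy \<rho>) (simp_all add: ainf_id_bar)
  qed
  show ?thesis
  proof (intro exI conjI)
    show "ainf_morphism A \<mu> A \<mu>' (unbar F)" "ainf_morphism A \<mu>' A \<mu> (unbar G)"
      using F G gF by (auto simp: ainf_morphism_bar[OF \<mu> \<mu>'] ainf_morphism_bar[OF \<mu>' \<mu>] isotopy_def)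
    show "ainf_homotopy A \<mu> A \<mu> (ainf_comp (unbar G) (unbar F)) ainf_id (\<lambda>k xs. 0)"
      "ainf_homotopy A \<mu>' A \<mu>' (ainf_comp (unbar F) (unbar G)) ainf_id (\<lambda>k xs. 0)"
      using inv by (blast intro: comp \<mu> \<mu>' gF)+
    show "unital_map (susp A) U U (bar (unbar F))" "unital_map (susp A) U U (bar (unbar G))"
      using F G by (auto simp: isotopy_def)
    show "\<forall>n. \<forall>x\<in>piece A n. linear_part (unbar F) n x = x \<and> linear_part (unbar G) n x = x"
      using F G by (auto simp: linear_part_unbar isotopy_def unipotent_def)
  qed
qed

lemma ainf_transfer_exists:
  assumes \<nu>: "ainf_algebra B \<nu>" and A: "chain_complex A dA" "bounded_below A" "\<forall>n. projective (smul A) (piece A n)"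
    and \<epsilon>: "quasi_iso A dA B (linear_part \<nu>) \<epsilon>\<^sub>1"
    and U: "unit_data (susp A) U \<pi> co" "\<And>e. e \<in> U \<Longrightarrow> dA 0 e = 0 \<and> \<epsilon>\<^sub>1 0 e \<in> V" "unital (susp B) V (bar \<nu>)"
  shows "\<exists>\<mu> \<epsilon>. ainf_algebra A \<mu> \<and> extends A \<mu> dA \<and> ainf_quasi_iso A \<mu> B \<nu> \<epsilon> \<and> extends A \<epsilon> \<epsilon>\<^sub>1 \<and>
    unital (susp A) U (bar \<mu>) \<and> unital_map (susp A) U V (bar \<epsilon>)"
proof -
  interpret transfer "susp A" "\<lambda>n. dA (n - 1)" U \<pi> co "susp B" "bar \<nu>" V "\<lambda>n. \<epsilon>\<^sub>1 (n - 1)"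
    by (rule transfer_susp[OF assms])
  obtain b F where "\<And>k. approx k (b, F)" using transfer_exists by blast
  note D = approxD[OF this]
  have alg: "ainf_algebra A (unbar b)" using D(1,7) by (simp add: ainf_algebra_bar)
  have lin: "linear_part (unbar b) n x = dA n x \<and> linear_part (unbar F) n x = \<epsilon>\<^sub>1 n x" if "x \<in> piece A n" for n x
    using D(3,4)[of x "n + 1"] that by (simp add: linear_part_unbar)
  show ?thesis
  proof (intro exI conjI)
    show "ainf_quasi_iso A (unbar b) B \<nu> (unbar F)"
      unfolding ainf_quasi_iso_def using D(2,8) quasi_iso_cong[OF A(1) \<epsilon> lin]
      by (simp add: ainf_morphism_bar[OF alg \<nu>])
  qed (use alg lin D(5,6) in \<open>auto simp: extends_def\<close>)
qed

lemma ainf_transfer_unique: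
  assumes \<nu>: "ainf_algebra B \<nu>" and A: "chain_complex A dA" "bounded_below A" "\<forall>n. projective (smul A) (piece A n)"
    and \<epsilon>: "quasi_iso A dA B (linear_part \<nu>) \<epsilon>\<^sub>1"
    and U: "unit_data (susp A) U \<pi> co" "\<And>e. e \<in> U \<Longrightarrow> dA 0 e = 0 \<and> \<epsilon>\<^sub>1 0 e \<in> V" "unital (susp B) V (bar \<nu>)"
    and \<mu>: "ainf_algebra A \<mu>" "extends A \<mu> dA" "ainf_quasi_iso A \<mu> B \<nu> \<phi>" "extends A \<phi> \<epsilon>\<^sub>1"
      "unital (susp A) U (bar \<mu>)" "unital_map (susp A) U V (bar \<phi>)"
    and \<mu>': "ainf_algebra A \<mu>'" "extends A \<mu>' dA" "ainf_quasi_iso A \<mu>' B \<nu> \<phi>'" "extends A \<phi>' \<epsilon>\<^sub>1"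
      "unital (susp A) U (bar \<mu>')" "unital_map (susp A) U V (bar \<phi>')"
  shows "\<exists>F. isotopy (susp A) U (bar \<mu>) (bar \<mu>') F"
proof -
  interpret transfer "susp A" "\<lambda>n. dA (n - 1)" U \<pi> co "susp B" "bar \<nu>" V "\<lambda>n. \<epsilon>\<^sub>1 (n - 1)"
    by (rule transfer_susp[OF \<nu> A \<epsilon> U])
  have "approx k (bar \<rho>, bar \<chi>)" if \<rho>: "ainf_algebra A \<rho>" "extends A \<rho> dA" "ainf_quasi_iso A \<rho> B \<nu> \<chi>" "extends A \<chi> \<epsilon>\<^sub>1"
      "unital (susp A) U (bar \<rho>)" "unital_map (susp A) U V (bar \<chi>)" for k \<rho> \<chi>
    using \<rho> unfolding approx_def ainf_quasi_iso_def ainf_morphism_bar[OF \<rho>(1) \<nu>] ainf_algebra_bar extends_def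
    by (simp add: bar_single)
  then show ?thesis using \<mu> \<mu>' by (intro transfer_unique[of "bar \<mu>" "bar \<phi>" "bar \<mu>'" "bar \<phi>'"]) blast+
qed

theorem theorem1:
  fixes A :: "('q::{comm_ring,monoid_mult}, 'a::ab_group_add) graded"
    and dA :: "int \<Rightarrow> 'a \<Rightarrow> 'a"
    and B :: "('q, 'b::ab_group_add) graded"
    and \<nu> :: "('b, 'b) family"
    and \<epsilon>\<^sub>1 :: "int \<Rightarrow> 'a \<Rightarrow> 'b"
  assumes "ainf_algebra B \<nu>"
    and "chain_complex A dA"
    and "bounded_below A"
    and "\<forall>n. projective (smul A) (piece A n)"
    and "quasi_iso A dA B (linear_part \<nu>) \<epsilon>\<^sub>1"
  shows
    "(\<exists>\<mu> \<epsilon>. ainf_algebra A \<mu> \<and> extends A \<mu> dA \<and>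
        ainf_quasi_iso A \<mu> B \<nu> \<epsilon> \<and> extends A \<epsilon> \<epsilon>\<^sub>1) \<and>
     (\<forall>eA eB. strict_unit B \<nu> eB \<longrightarrow> splits_off A eA \<longrightarrow> \<epsilon>\<^sub>1 0 eA = eB \<longrightarrow> dA 0 eA = 0 \<longrightarrow>
        (\<exists>\<mu> \<epsilon>. ainf_algebra A \<mu> \<and> extends A \<mu> dA \<and> strict_unit A \<mu> eA \<and>
           ainf_quasi_iso A \<mu> B \<nu> \<epsilon> \<and> extends A \<epsilon> \<epsilon>\<^sub>1 \<and>
           unital_morphism A \<mu> eA B \<nu> eB \<epsilon>)) \<and>
     (\<forall>\<mu> \<mu>' \<epsilon> \<epsilon>'.
        ainf_algebra A \<mu> \<longrightarrow> extends A \<mu> dA \<longrightarrow>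
        ainf_algebra A \<mu>' \<longrightarrow> extends A \<mu>' dA \<longrightarrow>
        ainf_quasi_iso A \<mu> B \<nu> \<epsilon> \<longrightarrow> extends A \<epsilon> \<epsilon>\<^sub>1 \<longrightarrow>
        ainf_quasi_iso A \<mu>' B \<nu> \<epsilon>' \<longrightarrow> extends A \<epsilon>' \<epsilon>\<^sub>1 \<longrightarrow>
        (\<exists>\<phi>. ainf_homotopy_equivalence A \<mu> A \<mu>' \<phi>)) \<and>
     (\<forall>eA eB \<mu> \<mu>' \<epsilon> \<epsilon>'.
        strict_unit B \<nu> eB \<longrightarrow> splits_off A eA \<longrightarrow> \<epsilon>\<^sub>1 0 eA = eB \<longrightarrow> dA 0 eA = 0 \<longrightarrow>
        ainf_algebra A \<mu> \<longrightarrow> extends A \<mu> dA \<longrightarrow> strict_unit A \<mu> eA \<longrightarrow>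
        ainf_algebra A \<mu>' \<longrightarrow> extends A \<mu>' dA \<longrightarrow> strict_unit A \<mu>' eA \<longrightarrow>
        ainf_quasi_iso A \<mu> B \<nu> \<epsilon> \<longrightarrow> extends A \<epsilon> \<epsilon>\<^sub>1 \<longrightarrow> unital_morphism A \<mu> eA B \<nu> eB \<epsilon> \<longrightarrow>
        ainf_quasi_iso A \<mu>' B \<nu> \<epsilon>' \<longrightarrow> extends A \<epsilon>' \<epsilon>\<^sub>1 \<longrightarrow> unital_morphism A \<mu>' eA B \<nu> eB \<epsilon>' \<longrightarrow>
        (\<exists>\<phi>. unital_homotopy_equivalence A \<mu> eA A \<mu>' eA \<phi>))"
proof -
  have gA: "graded_module A" using chain_complexD(1)[OF assms(2)] .
  note triv = unit_data_trivial[of "susp A", simplified, OF gA]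
  \<comment> \<open>The statements without units are the case of empty sets of units, in which all
    unit conditions are void.\<close>
  have uB: "unital (susp B) {} (bar \<nu>)" and u0: "unital (susp A) {} b" "unital_map (susp A) {} {} F" for b :: "_ \<Rightarrow> 'a" and F :: "_ \<Rightarrow> 'x::ab_group_add"
    by (simp_all add: unital_def unital_map_def)
  show ?thesis
  proof (intro conjI allI impI)
    show "\<exists>\<mu> \<epsilon>. ainf_algebra A \<mu> \<and> extends A \<mu> dA \<and> ainf_quasi_iso A \<mu> B \<nu> \<epsilon> \<and> extends A \<epsilon> \<epsilon>\<^sub>1"
      using ainf_transfer_exists[OF assms triv _ uB] by blast
  next
    fix eA eB assume u: "strict_unit B \<nu> eB" "splits_off A eA" "\<epsilon>\<^sub>1 0 eA = eB" "dA 0 eA = 0"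
    obtain \<pi> co where "unit_data (susp A) {eA} \<pi> co" using unit_data_splits_off[OF gA u(2)] by blast
    from ainf_transfer_exists[OF assms this, of "{eB}"] u
    obtain \<mu> \<epsilon> where "ainf_algebra A \<mu>" "extends A \<mu> dA" "ainf_quasi_iso A \<mu> B \<nu> \<epsilon>" "extends A \<epsilon> \<epsilon>\<^sub>1"
      "unital (susp A) {eA} (bar \<mu>)" "unital_map (susp A) {eA} {eB} (bar \<epsilon>)" by (auto simp: strict_unit_bar)
    then show "\<exists>\<mu> \<epsilon>. ainf_algebra A \<mu> \<and> extends A \<mu> dA \<and> strict_unit A \<mu> eA \<and>
           ainf_quasi_iso A \<mu> B \<nu> \<epsilon> \<and> extends A \<epsilon> \<epsilon>\<^sub>1 \<and> unital_morphism A \<mu> eA B \<nu> eB \<epsilon>"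
      unfolding strict_unit_bar unital_morphism_def unital_map_bar ainf_quasi_iso_def by blast
  next
    fix \<mu> \<mu>' \<epsilon> \<epsilon>'
    assume *: "ainf_algebra A \<mu>" "extends A \<mu> dA" "ainf_algebra A \<mu>'" "extends A \<mu>' dA"
      "ainf_quasi_iso A \<mu> B \<nu> \<epsilon>" "extends A \<epsilon> \<epsilon>\<^sub>1" "ainf_quasi_iso A \<mu>' B \<nu> \<epsilon>'" "extends A \<epsilon>' \<epsilon>\<^sub>1"
    obtain F where F: "isotopy (susp A) {} (bar \<mu>) (bar \<mu>') F"
      using ainf_transfer_unique[OF assms triv _ uB *(1,2,5,6) u0(1) _ *(3,4,7,8) u0(1)]
      by (auto simp: unital_map_def)
    from isotopy_homotopy_equivalence[OF *(1,3) F]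
    show "\<exists>\<phi>. ainf_homotopy_equivalence A \<mu> A \<mu>' \<phi>"
      unfolding ainf_homotopy_equivalence_def by blast
  next
    fix eA eB \<mu> \<mu>' \<epsilon> \<epsilon>'
    assume u: "strict_unit B \<nu> eB" "splits_off A eA" "\<epsilon>\<^sub>1 0 eA = eB" "dA 0 eA = 0"
      and *: "ainf_algebra A \<mu>" "extends A \<mu> dA" "strict_unit A \<mu> eA"
      "ainf_algebra A \<mu>'" "extends A \<mu>' dA" "strict_unit A \<mu>' eA"
      "ainf_quasi_iso A \<mu> B \<nu> \<epsilon>" "extends A \<epsilon> \<epsilon>\<^sub>1" "unital_morphism A \<mu> eA B \<nu> eB \<epsilon>"
      "ainf_quasi_iso A \<mu>' B \<nu> \<epsilon>'" "extends A \<epsilon>' \<epsilon>\<^sub>1" "unital_morphism A \<mu>' eA B \<nu> eB \<epsilon>'"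
    obtain \<pi> co where U: "unit_data (susp A) {eA} \<pi> co" using unit_data_splits_off[OF gA u(2)] by blast
    have "\<exists>F. isotopy (susp A) {eA} (bar \<mu>) (bar \<mu>') F"
      using u *(3,6,9,12)
      by (intro ainf_transfer_unique[OF assms U _ _ *(1,2,7,8) _ _ *(4,5,10,11)])
        (auto simp: strict_unit_bar unital_morphism_def unital_map_bar)
    then obtain F where F: "isotopy (susp A) {eA} (bar \<mu>) (bar \<mu>') F" ..
    have "{eA} \<subseteq> piece A 0" using *(3) by (simp add: strict_unit_def)
    from isotopy_homotopy_equivalence[OF *(1,4) F this]
    obtain \<phi> \<psi> where m: "ainf_morphism A \<mu> A \<mu>' \<phi>" "ainf_morphism A \<mu>' A \<mu> \<psi>"
      and h: "ainf_homotopy A \<mu> A \<mu> (ainf_comp \<psi> \<phi>) ainf_id (\<lambda>k xs. 0)"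
        "ainf_homotopy A \<mu>' A \<mu>' (ainf_comp \<phi> \<psi>) ainf_id (\<lambda>k xs. 0)"
      and v: "unital_map (susp A) {eA} {eA} (bar \<phi>)" "unital_map (susp A) {eA} {eA} (bar \<psi>)" by blast
    have "unital_homotopy A \<mu> eA A \<mu> (ainf_comp \<psi> \<phi>) ainf_id (\<lambda>k xs. 0)"
      "unital_homotopy A \<mu>' eA A \<mu>' (ainf_comp \<phi> \<psi>) ainf_id (\<lambda>k xs. 0)"
      using h by (simp_all add: unital_homotopy_def vanishes_on_unit_def)
    moreover have "unital_morphism A \<mu> eA A \<mu>' eA \<phi>" "unital_morphism A \<mu>' eA A \<mu> eA \<psi>"
      using m v by (simp_all add: unital_morphism_def unital_map_bar)
    ultimately show "\<exists>\<phi>. unital_homotopy_equivalence A \<mu> eA A \<mu>' eA \<phi>"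
      unfolding unital_homotopy_equivalence_def by blast
  qed
qed

end
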